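(* Let $T$ be a complete first-order theory, let $M\models T$ and let $M^{Sh}$ be the Shelah expansion of $M$. If $\hat M$ is an expansion of $M$ such that $M^{Sh}$ is an expansion of $\hat M$, and $Th(M^{Sh})$ is distal, then $Th(\hat M)$ is distal.
   Context: Structures may be many-sorted. Expansion. An expansion of a structure $M$ is a structure $N$ with the same underlying set (the same sorts, in the many-sorted setting) such that every $\emptyset$-definable set of $M$ is $\emptyset$-definable in $N$. Shelah expansion. Let $M$ be an $L$-structure and $M\prec M'$ a sufficiently saturated elementary extension ($(|M|+|L|)^+$-saturated suffices). An externally definable set of $M$ is a set of the form $X\cap M^{\bar x}$, where $\bar x$ is a finite tuple of variables, $M^{\bar x}$ is the corresponding finite cartesian power of sorts of $M$, and $X\subseteq M'^{\bar x}$ is definable in $M'$ with parameters from $M'$ (this does not depend on the choice of $M'$). The Shelah expansion $M^{Sh}$ is the structure with the same underlying set(s) as $M$ whose language $L(M^{Sh})$ has one predicate for each externally definable set of $M$, each predicate being interpreted as that set. Distality. Let $T$ be a complete theory and let $U$ be a sufficiently saturated (saturated and strongly homogeneous up to some large cardinal $\kappa$) model of $T$; small means of cardinality less than $\kappa$. $T$ is distal if it has NIP and, for any small indiscernible sequence in $U$ of the form $I+\{b\}+J$, where $\{b\}$ is a singleton and $I$ and $J$ are infinite without endpoints, and any small $D\subseteq U$, if $I+J$ is indiscernible over $D$ then $I+\{b\}+J$ is indiscernible over $D$. Elements of the sequences may be finite tuples of elements of $U$. Here $+$ denotes concatenation of disjoint ordered sets (everything in the left set placed below everything in the right set). *)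

theory Defs
  imports Main
begin

unbundle cardinal_syntax

text \<open>
  Many-sorted first-order logic. The sorts are the elements of the type \<open>'s\<close>; a language selects
  its function and relation symbols from the types \<open>'f\<close> and \<open>'r\<close>. Variables are de Bruijn
  indices, so a formula is read in a context \<open>\<Gamma> :: 's list\<close> listing the sorts of its free
  variables, and it is evaluated at a list of elements of the same length; a bound variable
  becomes the new head of the context.
\<close>

record ('s, 'f, 'r) lang =
  Funs :: "'f set"
  Rels :: "'r set"
  fdom :: "'f \<Rightarrow> 's list"
  fcod :: "'f \<Rightarrow> 's"
  rdom :: "'r \<Rightarrow> 's list"

record ('s, 'f, 'r, 'a) struct =
  carrier :: "'s \<Rightarrow> 'a set"
  fint :: "'f \<Rightarrow> 'a list \<Rightarrow> 'a"
  rint :: "'r \<Rightarrow> 'a list set"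

datatype 'f tm = Var nat | App 'f "'f tm list"

datatype ('s, 'f, 'r) fm =
    Eq "'f tm" "'f tm"
  | Rel 'r "'f tm list"
  | Neg "('s, 'f, 'r) fm"
  | Conj "('s, 'f, 'r) fm" "('s, 'f, 'r) fm"
  | Ex 's "('s, 'f, 'r) fm"

inductive has_sort :: "('s, 'f, 'r) lang \<Rightarrow> 's list \<Rightarrow> 'f tm \<Rightarrow> 's \<Rightarrow> bool"
  for L :: "('s, 'f, 'r) lang" and \<Gamma> :: "'s list" where
  "i < length \<Gamma> \<Longrightarrow> has_sort L \<Gamma> (Var i) (\<Gamma> ! i)"
| "f \<in> Funs L \<Longrightarrow> list_all2 (has_sort L \<Gamma>) ts (fdom L f) \<Longrightarrow> has_sort L \<Gamma> (App f ts) (fcod L f)"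

primrec wf_fm :: "('s, 'f, 'r) lang \<Rightarrow> 's list \<Rightarrow> ('s, 'f, 'r) fm \<Rightarrow> bool" where
  "wf_fm L \<Gamma> (Eq t u) \<longleftrightarrow> (\<exists>s. has_sort L \<Gamma> t s \<and> has_sort L \<Gamma> u s)"
| "wf_fm L \<Gamma> (Rel R ts) \<longleftrightarrow> R \<in> Rels L \<and> list_all2 (has_sort L \<Gamma>) ts (rdom L R)"
| "wf_fm L \<Gamma> (Neg \<phi>) \<longleftrightarrow> wf_fm L \<Gamma> \<phi>"
| "wf_fm L \<Gamma> (Conj \<phi> \<psi>) \<longleftrightarrow> wf_fm L \<Gamma> \<phi> \<and> wf_fm L \<Gamma> \<psi>"
| "wf_fm L \<Gamma> (Ex s \<phi>) \<longleftrightarrow> wf_fm L (s # \<Gamma>) \<phi>"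

primrec eval :: "('s, 'f, 'r, 'a) struct \<Rightarrow> 'a list \<Rightarrow> 'f tm \<Rightarrow> 'a" where
  "eval M as (Var i) = as ! i"
| "eval M as (App f ts) = fint M f (map (eval M as) ts)"

primrec sat :: "('s, 'f, 'r, 'a) struct \<Rightarrow> 'a list \<Rightarrow> ('s, 'f, 'r) fm \<Rightarrow> bool" where
  "sat M as (Eq t u) \<longleftrightarrow> eval M as t = eval M as u"
| "sat M as (Rel R ts) \<longleftrightarrow> map (eval M as) ts \<in> rint M R"
| "sat M as (Neg \<phi>) \<longleftrightarrow> \<not> sat M as \<phi>"
| "sat M as (Conj \<phi> \<psi>) \<longleftrightarrow> sat M as \<phi> \<and> sat M as \<psi>"
| "sat M as (Ex s \<phi>) \<longleftrightarrow> (\<exists>a\<in>carrier M s. sat M (a # as) \<phi>)"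

text \<open>
  The carriers of different sorts may overlap, so elements of a structure are tagged with
  their sort. Parameter sets are subsets of \<open>elems M\<close>, and \<open>tuples A ss\<close> is the set of
  tuples of sorts \<open>ss\<close> with entries in \<open>A\<close>; in particular \<open>tuples (elems M) ss\<close> is the
  cartesian product of the sorts \<open>ss\<close> of \<open>M\<close>.
\<close>

definition elems :: "('s, 'f, 'r, 'a) struct \<Rightarrow> ('s \<times> 'a) set" where
  "elems M = (SIGMA s:UNIV. carrier M s)"

definition tuples :: "('s \<times> 'a) set \<Rightarrow> 's list \<Rightarrow> 'a list set" where
  "tuples A ss = {as. list_all2 (\<lambda>s a. (s, a) \<in> A) ss as}"

definition is_struct :: "('s, 'f, 'r) lang \<Rightarrow> ('s, 'f, 'r, 'a) struct \<Rightarrow> bool" where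
  "is_struct L M \<longleftrightarrow>
     (\<forall>s. carrier M s \<noteq> {}) \<and>
     (\<forall>f\<in>Funs L. \<forall>as\<in>tuples (elems M) (fdom L f). fint M f as \<in> carrier M (fcod L f)) \<and>
     (\<forall>R\<in>Rels L. rint M R \<subseteq> tuples (elems M) (rdom L R))"

definition sentences :: "('s, 'f, 'r) lang \<Rightarrow> ('s, 'f, 'r) fm set" where
  "sentences L = {\<phi>. wf_fm L [] \<phi>}"

definition model :: "('s, 'f, 'r) lang \<Rightarrow> ('s, 'f, 'r) fm set \<Rightarrow> ('s, 'f, 'r, 'a) struct \<Rightarrow> bool" where
  "model L T M \<longleftrightarrow> is_struct L M \<and> (\<forall>\<phi>\<in>T. sat M [] \<phi>)"

definition Th :: "('s, 'f, 'r) lang \<Rightarrow> ('s, 'f, 'r, 'a) struct \<Rightarrow> ('s, 'f, 'r) fm set" where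
  "Th L M = {\<phi> \<in> sentences L. sat M [] \<phi>}"

text \<open>
  A complete theory is a consistent one that decides every sentence. The type of formulas is
  infinite and at least as large as the language, so by the downward Loewenheim-Skolem theorem
  it suffices to consider models with universe in that type.
\<close>

definition entails ::
  "('s, 'f, 'r) lang \<Rightarrow> ('s, 'f, 'r) fm set \<Rightarrow> ('s, 'f, 'r) fm \<Rightarrow> bool" where
  "entails L T \<phi> \<longleftrightarrow>
     (\<forall>N :: ('s, 'f, 'r, ('s, 'f, 'r) fm) struct. model L T N \<longrightarrow> sat N [] \<phi>)"

definition complete_theory :: "('s, 'f, 'r) lang \<Rightarrow> ('s, 'f, 'r) fm set \<Rightarrow> bool" where
  "complete_theory L T \<longleftrightarrow>
     T \<subseteq> sentences L \<and>
     (\<exists>N :: ('s, 'f, 'r, ('s, 'f, 'r) fm) struct. model L T N) \<and>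
     (\<forall>\<phi>\<in>sentences L. entails L T \<phi> \<or> entails L T (Neg \<phi>))"

definition elementary_extension ::
  "('s, 'f, 'r) lang \<Rightarrow> ('s, 'f, 'r, 'a) struct \<Rightarrow> ('s, 'f, 'r, 'a) struct \<Rightarrow> bool" where
  "elementary_extension L M M' \<longleftrightarrow>
     is_struct L M \<and> is_struct L M' \<and> (\<forall>s. carrier M s \<subseteq> carrier M' s) \<and>
     (\<forall>\<Gamma> \<phi>. \<forall>as\<in>tuples (elems M) \<Gamma>. wf_fm L \<Gamma> \<phi> \<longrightarrow> sat M as \<phi> = sat M' as \<phi>)"

text \<open>
  A definable set is recorded together with the sorts of its ambient product, because the
  underlying set of tuples need not determine them (e.g. when it is empty).
\<close>

definition definable_sets ::
  "('s, 'f, 'r) lang \<Rightarrow> ('s, 'f, 'r, 'a) struct \<Rightarrow> ('s list \<times> 'a list set) set" where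
  "definable_sets L M =
     {(ss, X). \<exists>\<phi>. wf_fm L ss \<phi> \<and> X = {as \<in> tuples (elems M) ss. sat M as \<phi>}}"

definition expansion ::
  "('s, 'f, 'r) lang \<Rightarrow> ('s, 'f, 'r, 'a) struct \<Rightarrow>
   ('s, 'g, 'q) lang \<Rightarrow> ('s, 'g, 'q, 'a) struct \<Rightarrow> bool" where
  "expansion L M L' N \<longleftrightarrow>
     is_struct L M \<and> is_struct L' N \<and>
     carrier N = carrier M \<and> definable_sets L M \<subseteq> definable_sets L' N"

text \<open>
  Cardinals are Isabelle/HOL cardinal orders \<open>\<kappa>\<close>. A formula with parameters is a triple
  \<open>(\<phi>, ts, ds)\<close>, the parameters \<open>ds\<close> of sorts \<open>ts\<close> being plugged in for the last variables.
\<close>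

definition saturated ::
  "'k rel \<Rightarrow> ('s, 'f, 'r) lang \<Rightarrow> ('s, 'f, 'r, 'a) struct \<Rightarrow> bool" where
  "saturated \<kappa> L M \<longleftrightarrow>
     (\<forall>A ss p. A \<subseteq> elems M \<longrightarrow> |A| <o \<kappa> \<longrightarrow>
        (\<forall>(\<phi>, ts, ds)\<in>p. wf_fm L (ss @ ts) \<phi> \<and> ds \<in> tuples A ts) \<longrightarrow>
        (\<forall>p0\<subseteq>p. finite p0 \<longrightarrow>
           (\<exists>as\<in>tuples (elems M) ss. \<forall>(\<phi>, ts, ds)\<in>p0. sat M (as @ ds) \<phi>)) \<longrightarrow>
        (\<exists>as\<in>tuples (elems M) ss. \<forall>(\<phi>, ts, ds)\<in>p. sat M (as @ ds) \<phi>))"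

definition elementary_map ::
  "('s, 'f, 'r) lang \<Rightarrow> ('s, 'f, 'r, 'a) struct \<Rightarrow> ('s \<times> 'a) set \<Rightarrow> ('s \<Rightarrow> 'a \<Rightarrow> 'a) \<Rightarrow> bool" where
  "elementary_map L M A h \<longleftrightarrow>
     A \<subseteq> elems M \<and> (\<forall>(s, a)\<in>A. h s a \<in> carrier M s) \<and>
     (\<forall>\<Gamma> \<phi>. \<forall>as\<in>tuples A \<Gamma>. wf_fm L \<Gamma> \<phi> \<longrightarrow> sat M as \<phi> = sat M (map2 h \<Gamma> as) \<phi>)"

definition automorphism ::
  "('s, 'f, 'r) lang \<Rightarrow> ('s, 'f, 'r, 'a) struct \<Rightarrow> ('s \<Rightarrow> 'a \<Rightarrow> 'a) \<Rightarrow> bool" where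
  "automorphism L M h \<longleftrightarrow>
     (\<forall>s. bij_betw (h s) (carrier M s) (carrier M s)) \<and>
     (\<forall>f\<in>Funs L. \<forall>as\<in>tuples (elems M) (fdom L f).
        h (fcod L f) (fint M f as) = fint M f (map2 h (fdom L f) as)) \<and>
     (\<forall>R\<in>Rels L. \<forall>as\<in>tuples (elems M) (rdom L R).
        as \<in> rint M R \<longleftrightarrow> map2 h (rdom L R) as \<in> rint M R)"

definition strongly_homogeneous ::
  "'k rel \<Rightarrow> ('s, 'f, 'r) lang \<Rightarrow> ('s, 'f, 'r, 'a) struct \<Rightarrow> bool" where
  "strongly_homogeneous \<kappa> L M \<longleftrightarrow>
     (\<forall>A h. |A| <o \<kappa> \<longrightarrow> elementary_map L M A h \<longrightarrow>
        (\<exists>g. automorphism L M g \<and> (\<forall>(s, a)\<in>A. g s a = h s a)))"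

text \<open>
  The ambient models in which distality is tested. Note that \<open>|sentences L|\<close> is the sum of
  \<open>\<aleph>\<^sub>0\<close>, the number of sorts and the number of symbols of \<open>L\<close>.
\<close>

definition monster ::
  "'k rel \<Rightarrow> ('s, 'f, 'r) lang \<Rightarrow> ('s, 'f, 'r) fm set \<Rightarrow> ('s, 'f, 'r, 'a) struct \<Rightarrow> bool" where
  "monster \<kappa> L T U \<longleftrightarrow>
     Card_order \<kappa> \<and> |sentences L| <o \<kappa> \<and>
     model L T U \<and> saturated \<kappa> L U \<and> strongly_homogeneous \<kappa> L U"

text \<open>
  The function-symbol type of the (relational) language of the Shelah expansion is the dummy
  type \<open>unit\<close>; the predicates are the externally definable sets themselves.
\<close>

definition externally_definable ::
  "('s, 'f, 'r) lang \<Rightarrow> ('s, 'f, 'r, 'a) struct \<Rightarrow> ('s, 'f, 'r, 'a) struct \<Rightarrow>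
   ('s list \<times> 'a list set) set" where
  "externally_definable L M M' =
     {(ss, X). \<exists>\<phi> ts ds. wf_fm L (ss @ ts) \<phi> \<and> ds \<in> tuples (elems M') ts \<and>
        X = {as \<in> tuples (elems M') ss. sat M' (as @ ds) \<phi>} \<inter> tuples (elems M) ss}"

definition shelah_lang ::
  "('s, 'f, 'r) lang \<Rightarrow> ('s, 'f, 'r, 'a) struct \<Rightarrow> ('s, 'f, 'r, 'a) struct \<Rightarrow>
   ('s, unit, 's list \<times> 'a list set) lang" where
  "shelah_lang L M M' =
     \<lparr>Funs = {}, Rels = externally_definable L M M',
      fdom = (\<lambda>_. []), fcod = (\<lambda>_. undefined), rdom = fst\<rparr>"

definition shelah_expansion ::
  "('s, 'f, 'r, 'a) struct \<Rightarrow> ('s, unit, 's list \<times> 'a list set, 'a) struct" where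
  "shelah_expansion M = \<lparr>carrier = carrier M, fint = (\<lambda>_ _. undefined), rint = snd\<rparr>"

definition nip :: "('s, 'f, 'r) lang \<Rightarrow> ('s, 'f, 'r, 'a) struct \<Rightarrow> bool" where
  "nip L U \<longleftrightarrow>
     \<not> (\<exists>ss ts \<phi> (a :: nat \<Rightarrow> 'a list) (b :: nat set \<Rightarrow> 'a list).
          wf_fm L (ss @ ts) \<phi> \<and>
          (\<forall>i. a i \<in> tuples (elems U) ss) \<and> (\<forall>S. b S \<in> tuples (elems U) ts) \<and>
          (\<forall>i S. sat U (a i @ b S) \<phi> \<longleftrightarrow> i \<in> S))"

text \<open>
  Sequences are sets with a strict linear order. Indexed families with repetitions add
  nothing for distality: an infinite indiscernible family is injective or constant.
\<close>

type_synonym 'x ordered_set = "'x set \<times> 'x rel"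

definition ordered_set :: "'x ordered_set \<Rightarrow> bool" where
  "ordered_set I \<longleftrightarrow> snd I \<subseteq> fst I \<times> fst I \<and> strict_linear_order_on (fst I) (snd I)"

definition concatenation :: "'x ordered_set \<Rightarrow> 'x ordered_set \<Rightarrow> 'x ordered_set"
    (infixl "\<oplus>" 65) where
  "I \<oplus> J = (fst I \<union> fst J, snd I \<union> snd J \<union> fst I \<times> fst J)"

definition singleton :: "'x \<Rightarrow> 'x ordered_set" where
  "singleton b = ({b}, {})"

definition no_endpoints :: "'x ordered_set \<Rightarrow> bool" where
  "no_endpoints I \<longleftrightarrow>
     (\<forall>x\<in>fst I. (\<exists>y\<in>fst I. (y, x) \<in> snd I) \<and> (\<exists>y\<in>fst I. (x, y) \<in> snd I))"

definition indiscernible ::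
  "('s, 'f, 'r) lang \<Rightarrow> ('s, 'f, 'r, 'a) struct \<Rightarrow> ('s \<times> 'a) set \<Rightarrow> 's list \<Rightarrow>
   'a list ordered_set \<Rightarrow> bool" where
  "indiscernible L U D ss I \<longleftrightarrow>
     ordered_set I \<and> fst I \<subseteq> tuples (elems U) ss \<and>
     (\<forall>xs ys \<phi> ts. \<forall>ds\<in>tuples D ts.
        set xs \<subseteq> fst I \<longrightarrow> sorted_wrt (\<lambda>x y. (x, y) \<in> snd I) xs \<longrightarrow>
        set ys \<subseteq> fst I \<longrightarrow> sorted_wrt (\<lambda>x y. (x, y) \<in> snd I) ys \<longrightarrow>
        length xs = length ys \<longrightarrow>
        wf_fm L (concat (replicate (length xs) ss) @ ts) \<phi> \<longrightarrow>
        sat U (concat xs @ ds) \<phi> = sat U (concat ys @ ds) \<phi>)"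

text \<open>
  Distality of a complete theory \<open>T\<close> is the following property of a monster model \<open>U\<close> of \<open>T\<close>,
  i.e. under the assumption \<open>monster \<kappa> L T U\<close>; it does not depend on the choice of \<open>\<kappa>\<close> and \<open>U\<close>.
\<close>

definition distal :: "'k rel \<Rightarrow> ('s, 'f, 'r) lang \<Rightarrow> ('s, 'f, 'r, 'a) struct \<Rightarrow> bool" where
  "distal \<kappa> L U \<longleftrightarrow>
     nip L U \<and>
     (\<forall>ss I b J D.
        ordered_set I \<longrightarrow> ordered_set J \<longrightarrow>
        fst I \<inter> fst J = {} \<longrightarrow> b \<notin> fst I \<union> fst J \<longrightarrow>
        infinite (fst I) \<longrightarrow> infinite (fst J) \<longrightarrow> no_endpoints I \<longrightarrow> no_endpoints J \<longrightarrow>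
        |fst (I \<oplus> singleton b \<oplus> J)| <o \<kappa> \<longrightarrow>
        indiscernible L U {} ss (I \<oplus> singleton b \<oplus> J) \<longrightarrow>
        D \<subseteq> elems U \<longrightarrow> |D| <o \<kappa> \<longrightarrow>
        indiscernible L U D ss (I \<oplus> J) \<longrightarrow>
        indiscernible L U D ss (I \<oplus> singleton b \<oplus> J))"

end

theory Submission
  imports Defs "HOL-Library.Ramsey" "HOL-Library.Countable_Set_Type"
begin

text \<open>
  Let \<open>U\<close> be the monster model of the theory of the Shelah expansion \<open>M\<^sup>S\<^sup>h\<close>, and call a formula of
  \<open>U\<close> small if in \<open>M\<close> it defines a definable set of the intermediate structure.

  A failure of distality of the intermediate theory can be expressed by finite approximations, which
  pass from its monster model to \<open>M\<close> and from there to \<open>U\<close>. By Ramsey's theorem and saturation, \<open>U\<close>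
  then contains an indiscernible sequence of pairs \<open>(u\<^sub>i, b\<^sub>i)\<close>, \<open>i \<in> \<rat>\<close>, and a tuple \<open>d\<close> with
  \<open>\<chi>(u\<^sub>i, d)\<close> and \<open>\<not> \<chi>(b\<^sub>i, d)\<close>, such that replacing one \<open>u\<^sub>i\<close> by \<open>b\<^sub>i\<close> does not change the small
  type of \<open>(u\<^sub>i)\<^sub>i\<close>.

  The main point is that no formula of \<open>U\<close>, small or not, alternates infinitely often on a sequence
  that is indiscernible for small formulas only. For an externally definable relation this is due to
  NIP and the elementarity of \<open>M\<close> in \<open>M'\<close>; an induction on formulas gives the general case. Hence if
  every replacement of some of the \<open>u\<^sub>i\<close> by the \<open>b\<^sub>i\<close> preserves the small type, then \<open>u\<^sub>i\<close> and \<open>b\<^sub>i\<close>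
  have the same type over the rest of the sequence, and replacing only \<open>u\<^sub>0\<close> contradicts distality
  over \<open>d\<close>. Otherwise choose a minimal finite set \<open>T\<close> of replacements that changes the small type,
  and \<open>t\<^sub>0 \<noteq> t\<^sub>1\<close> in \<open>T\<close>. Using non-alternation again, one finds \<open>p\<close> such that replacing \<open>u\<close> at \<open>t\<^sub>0\<close>
  by \<open>p\<close> preserves the type of the sequence away from \<open>t\<^sub>1\<close>, but not the type of the whole sequence.
  This contradicts distality over finitely many \<open>u\<^sub>i\<close> with \<open>i \<noteq> t\<^sub>0\<close>.
\<close>

section \<open>Formulas over labelled variables\<close>

text \<open>Two obstacles shape the argument. The two monster models live in unrelated languages,
  and the monster model of the intermediate theory is not a reduct of \<open>U\<close>; the only
  link is that both theories have models on the universe of \<open>M\<close>. So smallness of a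
  formula is decided in \<open>M\<close>, and only finite data, each coded by one formula, can be
  carried across.

  What arrives in \<open>U\<close> concerns small formulas only, whereas distality of
  \<open>U\<close> needs equality of full types. Non-alternation closes this gap: a formula
  separating two interchangeable tuples would alternate on a sequence made of both. Since Ramsey's
  theorem destroys any alternation between members of a sequence, the alternating members are always
  glued into pairs before a sequence is extracted.

  Only single replacements are controlled at first, because a failure of distality involves one
  element \<open>b\<close>: its copies for the various positions are found independently of each
  other, and nothing is known about using two of them at once. This is the origin of the case
  distinction and of the minimal set of replacements.\<close>

primrec rename_tm :: "(nat \<Rightarrow> nat) \<Rightarrow> 'f tm \<Rightarrow> 'f tm" where
  "rename_tm \<rho> (Var i) = Var (\<rho> i)"
| "rename_tm \<rho> (App f ts) = App f (map (rename_tm \<rho>) ts)"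

primrec rename :: "('s, 'f, 'r) fm \<Rightarrow> (nat \<Rightarrow> nat) \<Rightarrow> ('s, 'f, 'r) fm" where
  "rename (Eq t u) \<rho> = Eq (rename_tm \<rho> t) (rename_tm \<rho> u)"
| "rename (Rel R ts) \<rho> = Rel R (map (rename_tm \<rho>) ts)"
| "rename (Neg \<phi>) \<rho> = Neg (rename \<phi> \<rho>)"
| "rename (Conj \<phi> \<psi>) \<rho> = Conj (rename \<phi> \<rho>) (rename \<psi> \<rho>)"
| "rename (Ex s \<phi>) \<rho> = Ex s (rename \<phi> (case_nat 0 (\<lambda>i. Suc (\<rho> i))))"

lemma has_sort_rename_tm:
  assumes "has_sort L \<Gamma> t s" "\<And>i. i < length \<Gamma> \<Longrightarrow> \<rho> i < length \<Gamma>' \<and> \<Gamma>' ! \<rho> i = \<Gamma> ! i"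
  shows "has_sort L \<Gamma>' (rename_tm \<rho> t) s"
  using assms
proof (induction rule: has_sort.induct)
  case (1 i)
  then show ?case using has_sort.intros(1)[of "\<rho> i" \<Gamma>' L] by auto
next
  case (2 f ts)
  then show ?case
    by (auto intro!: has_sort.intros(2) simp: list_all2_map1 elim: list_all2_mono)
qed

lemma wf_rename:
  assumes "wf_fm L \<Gamma> \<phi>" "\<And>i. i < length \<Gamma> \<Longrightarrow> \<rho> i < length \<Gamma>' \<and> \<Gamma>' ! \<rho> i = \<Gamma> ! i"
  shows "wf_fm L \<Gamma>' (rename \<phi> \<rho>)"
  using assms
proof (induction \<phi> arbitrary: \<Gamma> \<Gamma>' \<rho>)
  case (Ex s \<phi>)
  have "wf_fm L (s # \<Gamma>') (rename \<phi> (case_nat 0 (\<lambda>i. Suc (\<rho> i))))"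
    by (rule Ex.IH[of "s # \<Gamma>"]) (use Ex.prems in \<open>auto split: nat.splits\<close>)
  then show ?case by simp
qed (auto simp: list_all2_map1 intro: has_sort_rename_tm elim!: list_all2_mono)

lemma eval_rename_tm:
  assumes "has_sort L \<Gamma> t s" "\<And>i. i < length \<Gamma> \<Longrightarrow> as ! \<rho> i = bs ! i"
  shows "eval M as (rename_tm \<rho> t) = eval M bs t"
  using assms
proof (induction rule: has_sort.induct)
  case (2 f ts)
  have "map (eval M as \<circ> rename_tm \<rho>) ts = map (eval M bs) ts"
    using 2 by (intro nth_equalityI) (auto simp: list_all2_conv_all_nth)
  then show ?case by (simp del: map_eq_conv)
qed auto

lemma eval_rename_tms:
  assumes "list_all2 (has_sort L \<Gamma>) ts ss" "\<And>i. i < length \<Gamma> \<Longrightarrow> as ! \<rho> i = bs ! i"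
  shows "map (eval M as \<circ> rename_tm \<rho>) ts = map (eval M bs) ts"
  using assms eval_rename_tm[of L \<Gamma> _ _ as \<rho> bs M]
  by (intro nth_equalityI) (auto simp: list_all2_conv_all_nth)

lemma sat_rename:
  assumes "wf_fm L \<Gamma> \<phi>" "\<And>i. i < length \<Gamma> \<Longrightarrow> as ! \<rho> i = bs ! i"
  shows "sat M as (rename \<phi> \<rho>) = sat M bs \<phi>"
  using assms
proof (induction \<phi> arbitrary: \<Gamma> as bs \<rho>)
  case (Eq t u)
  then show ?case using eval_rename_tm[of L \<Gamma> _ _ as \<rho> bs M] by (auto; metis)
next
  case (Rel R ts)
  then show ?case using eval_rename_tms[of L \<Gamma> ts _ as \<rho> bs M] by (auto simp del: map_eq_conv)
next
  case (Ex s \<phi>)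
  have "sat M (a # as) (rename \<phi> (case_nat 0 (\<lambda>i. Suc (\<rho> i)))) = sat M (a # bs) \<phi>" for a
    by (rule Ex.IH[of "s # \<Gamma>"]) (use Ex.prems in \<open>auto split: nat.splits\<close>)
  then show ?case by simp
next
  case (Neg \<phi>)
  show ?case using Neg.IH[of \<Gamma> as \<rho> bs] Neg.prems by simp
next
  case (Conj \<phi> \<psi>)
  show ?case using Conj.IH(1)[of \<Gamma> as \<rho> bs] Conj.IH(2)[of \<Gamma> as \<rho> bs] Conj.prems by simp
qed

text \<open>The properties shared by all formulas and by the small ones. Relation atoms are left out
  because an atom may define a set that is not definable in the intermediate structure.
  \<open>K_rename\<close> covers permuted, identified and dummy variables at once.\<close>

locale fm_class =
  fixes L :: "('s, 'f, 'r) lang" and K :: "'s list \<Rightarrow> ('s, 'f, 'r) fm \<Rightarrow> bool"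
  assumes K_wf: "K \<Gamma> \<phi> \<Longrightarrow> wf_fm L \<Gamma> \<phi>"
    and K_Eq: "\<lbrakk>i < length \<Gamma>; j < length \<Gamma>; \<Gamma> ! i = \<Gamma> ! j\<rbrakk> \<Longrightarrow> K \<Gamma> (Eq (Var i) (Var j))"
    and K_Neg: "K \<Gamma> \<phi> \<Longrightarrow> K \<Gamma> (Neg \<phi>)"
    and K_Conj: "K \<Gamma> \<phi> \<Longrightarrow> K \<Gamma> \<psi> \<Longrightarrow> K \<Gamma> (Conj \<phi> \<psi>)"
    and K_Ex: "K (s # \<Gamma>) \<phi> \<Longrightarrow> K \<Gamma> (Ex s \<phi>)"
    and K_rename: "K \<Gamma> \<phi> \<Longrightarrow> (\<And>i. i < length \<Gamma> \<Longrightarrow> \<rho> i < length \<Gamma>' \<and> \<Gamma>' ! \<rho> i = \<Gamma> ! i)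
      \<Longrightarrow> K \<Gamma>' (rename \<phi> \<rho>)"

lemma has_sort_Var: "i < length \<Gamma> \<Longrightarrow> \<Gamma> ! i = s \<Longrightarrow> has_sort L \<Gamma> (Var i) s"
  using has_sort.intros(1) by blast

lemma fm_class_wf: "fm_class L (wf_fm L)"
proof
  show "wf_fm L \<Gamma> (Eq (Var i) (Var j))"
    if "i < length \<Gamma>" "j < length \<Gamma>" "\<Gamma> ! i = \<Gamma> ! j" for i j \<Gamma>
    using that by (auto intro!: exI[of _ "\<Gamma> ! j"] has_sort_Var)
qed (auto intro: wf_rename)

section \<open>Predicates on environments given by one formula in two structures\<close>

definition typed :: "('s, 'f, 'r, 'a) struct \<Rightarrow> ('v \<Rightarrow> 's) \<Rightarrow> 'v set \<Rightarrow> ('v \<Rightarrow> 'a) \<Rightarrow> bool" where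
  "typed A \<sigma> W e \<longleftrightarrow> (\<forall>v\<in>W. e v \<in> carrier A (\<sigma> v))"

text \<open>
  Variables are named by labels in \<open>W\<close> and evaluated in environments, which hides the de Bruijn
  positions. The two predicates are related only by being defined by the same formula in \<open>A\<close> and \<open>B\<close>.
\<close>

definition codef ::
  "('s list \<Rightarrow> ('s, 'f, 'r) fm \<Rightarrow> bool) \<Rightarrow> ('s, 'f, 'r, 'a) struct \<Rightarrow> ('s, 'f, 'r, 'b) struct \<Rightarrow>
   ('v \<Rightarrow> 's) \<Rightarrow> 'v set \<Rightarrow> (('v \<Rightarrow> 'a) \<Rightarrow> bool) \<Rightarrow> (('v \<Rightarrow> 'b) \<Rightarrow> bool) \<Rightarrow> bool" where
  "codef K A B \<sigma> W P Q \<longleftrightarrow>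
     (\<exists>vs \<phi>. set vs \<subseteq> W \<and> K (map \<sigma> vs) \<phi> \<and>
        (\<forall>e. typed A \<sigma> W e \<longrightarrow> P e = sat A (map e vs) \<phi>) \<and>
        (\<forall>e. typed B \<sigma> W e \<longrightarrow> Q e = sat B (map e vs) \<phi>))"

abbreviation dfn where "dfn K A \<sigma> W P \<equiv> codef K A A \<sigma> W P P"

text \<open>Moves a formula from the context \<open>vs\<close> to a larger context. Labels may be
  repeated in \<open>us\<close>; every position with the right label carries the same value, so the
  choice is harmless.\<close>

definition relist :: "('s, 'f, 'r) fm \<Rightarrow> 'v list \<Rightarrow> 'v list \<Rightarrow> ('s, 'f, 'r) fm" where
  "relist \<phi> vs us = rename \<phi> (\<lambda>i. SOME j. j < length us \<and> us ! j = vs ! i)"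

lemma relist_index:
  assumes "set vs \<subseteq> set us" "i < length vs"
  shows "(SOME j. j < length us \<and> us ! j = vs ! i) < length us \<and>
         us ! (SOME j. j < length us \<and> us ! j = vs ! i) = vs ! i"
proof (rule someI_ex)
  show "\<exists>j. j < length us \<and> us ! j = vs ! i"
    using assms by (metis in_set_conv_nth nth_mem subsetD)
qed

lemma sat_relist:
  assumes "wf_fm L (map \<sigma> vs) \<phi>" "set vs \<subseteq> set us"
  shows "sat A (map e us) (relist \<phi> vs us) = sat A (map e vs) \<phi>"
  unfolding relist_def
  by (rule sat_rename[OF assms(1)]) (use relist_index[OF assms(2)] in auto)

lemma (in fm_class) K_relist:
  assumes "K (map \<sigma> vs) \<phi>" "set vs \<subseteq> set us"
  shows "K (map \<sigma> us) (relist \<phi> vs us)"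
  unfolding relist_def
  by (rule K_rename[OF assms(1)]) (use relist_index[OF assms(2)] in auto)

lemma typed_mono: "typed A \<sigma> W e \<Longrightarrow> V \<subseteq> W \<Longrightarrow> typed A \<sigma> V e"
  by (auto simp: typed_def)

lemma codef_dep:
  assumes "codef K A B \<sigma> W P Q" "typed A \<sigma> W e" "\<And>v. v \<in> W \<Longrightarrow> e v = e' v"
  shows "P e = P e'"
proof -
  obtain vs \<phi> where *: "set vs \<subseteq> W" "\<And>e. typed A \<sigma> W e \<Longrightarrow> P e = sat A (map e vs) \<phi>"
    using assms(1) unfolding codef_def by blast
  have "typed A \<sigma> W e'" using assms(2,3) by (auto simp: typed_def)
  moreover have "map e vs = map e' vs" using *(1) assms(3) by auto
  ultimately show ?thesis using *(2) assms(2) by metis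
qed

lemma codef_cong:
  assumes "codef K A B \<sigma> W P Q"
    and "\<And>e. typed A \<sigma> W e \<Longrightarrow> P' e = P e" "\<And>e. typed B \<sigma> W e \<Longrightarrow> Q' e = Q e"
  shows "codef K A B \<sigma> W P' Q'"
  using assms unfolding codef_def by (smt (verit))

lemma codef_flip: "codef K A B \<sigma> W P Q \<Longrightarrow> codef K B A \<sigma> W Q P"
  unfolding codef_def by blast

lemma codef_left: "codef K A B \<sigma> W P Q \<Longrightarrow> dfn K A \<sigma> W P"
  unfolding codef_def by blast

lemma codef_rename:
  assumes "codef K A B \<sigma> W P Q" "\<And>v. v \<in> W \<Longrightarrow> h v \<in> W' \<and> \<sigma>' (h v) = \<sigma> v"
  shows "codef K A B \<sigma>' W' (\<lambda>e. P (\<lambda>v. e (h v))) (\<lambda>e. Q (\<lambda>v. e (h v)))"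
proof -
  obtain vs \<phi> where *: "set vs \<subseteq> W" "K (map \<sigma> vs) \<phi>"
    "\<And>e. typed A \<sigma> W e \<Longrightarrow> P e = sat A (map e vs) \<phi>"
    "\<And>e. typed B \<sigma> W e \<Longrightarrow> Q e = sat B (map e vs) \<phi>"
    using assms(1) unfolding codef_def by blast
  have eq: "map \<sigma>' (map h vs) = map \<sigma> vs" using *(1) assms(2) by auto
  show ?thesis
    unfolding codef_def
  proof (intro exI[of _ "map h vs"] exI[of _ \<phi>] conjI allI impI)
    show "set (map h vs) \<subseteq> W'" using *(1) assms(2) by auto
    show "K (map \<sigma>' (map h vs)) \<phi>" using *(2) unfolding eq .
    show "P (\<lambda>v. e (h v)) = sat A (map e (map h vs)) \<phi>" if "typed A \<sigma>' W' e" for e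
    proof -
      have "typed A \<sigma> W (\<lambda>v. e (h v))" using that assms(2) unfolding typed_def by metis
      with *(3) show ?thesis by (simp add: comp_def)
    qed
    show "Q (\<lambda>v. e (h v)) = sat B (map e (map h vs)) \<phi>" if "typed B \<sigma>' W' e" for e
    proof -
      have "typed B \<sigma> W (\<lambda>v. e (h v))" using that assms(2) unfolding typed_def by metis
      with *(4) show ?thesis by (simp add: comp_def)
    qed
  qed
qed

lemma codef_mono: "codef K A B \<sigma> W P Q \<Longrightarrow> W \<subseteq> W' \<Longrightarrow> codef K A B \<sigma> W' P Q"
  using codef_rename[of K A B \<sigma> W P Q "\<lambda>v. v" W' \<sigma>] by auto

text \<open>Parameter sets such as all remaining indices of a sequence are infinite, but one formula
  mentions only finitely many labels. The new predicates are satisfaction itself, so they depend on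
  \<open>V\<close> alone, even for ill-typed environments.\<close>

lemma codef_finite:
  assumes "codef K A B \<sigma> W P Q"
  obtains V P' Q' where "finite V" "V \<subseteq> W" "codef K A B \<sigma> V P' Q'"
    "\<And>e. typed A \<sigma> W e \<Longrightarrow> P e = P' e" "\<And>e. typed B \<sigma> W e \<Longrightarrow> Q e = Q' e"
    "\<And>e e'. (\<And>v. v \<in> V \<Longrightarrow> e v = e' v) \<Longrightarrow> P' e = P' e'"
proof -
  obtain vs \<phi> where *: "set vs \<subseteq> W" "K (map \<sigma> vs) \<phi>"
    "\<And>e. typed A \<sigma> W e \<Longrightarrow> P e = sat A (map e vs) \<phi>"
    "\<And>e. typed B \<sigma> W e \<Longrightarrow> Q e = sat B (map e vs) \<phi>"
    using assms(1) unfolding codef_def by blast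
  show thesis
  proof (rule that[of "set vs" "\<lambda>e. sat A (map e vs) \<phi>" "\<lambda>e. sat B (map e vs) \<phi>"])
    show "codef K A B \<sigma> (set vs) (\<lambda>e. sat A (map e vs) \<phi>) (\<lambda>e. sat B (map e vs) \<phi>)"
      using *(2) unfolding codef_def by blast
    show "sat A (map e vs) \<phi> = sat A (map e' vs) \<phi>" if "\<And>v. v \<in> set vs \<Longrightarrow> e v = e' v" for e e'
      using that by (metis map_eq_conv)
  qed (use * in auto)
qed

context fm_class
begin

lemma codef_not: "codef K A B \<sigma> W P Q \<Longrightarrow> codef K A B \<sigma> W (\<lambda>e. \<not> P e) (\<lambda>e. \<not> Q e)"
  unfolding codef_def using K_Neg by (metis sat.simps(3))

lemma codef_conj:
  assumes "codef K A B \<sigma> W P Q" "codef K A B \<sigma> W P' Q'"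
  shows "codef K A B \<sigma> W (\<lambda>e. P e \<and> P' e) (\<lambda>e. Q e \<and> Q' e)"
proof -
  obtain vs \<phi> where *: "set vs \<subseteq> W" "K (map \<sigma> vs) \<phi>"
    "\<And>e. typed A \<sigma> W e \<Longrightarrow> P e = sat A (map e vs) \<phi>"
    "\<And>e. typed B \<sigma> W e \<Longrightarrow> Q e = sat B (map e vs) \<phi>"
    using assms(1) unfolding codef_def by blast
  obtain us \<psi> where **: "set us \<subseteq> W" "K (map \<sigma> us) \<psi>"
    "\<And>e. typed A \<sigma> W e \<Longrightarrow> P' e = sat A (map e us) \<psi>"
    "\<And>e. typed B \<sigma> W e \<Longrightarrow> Q' e = sat B (map e us) \<psi>"
    using assms(2) unfolding codef_def by blast
  let ?ws = "vs @ us"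
  have s: "set vs \<subseteq> set ?ws" "set us \<subseteq> set ?ws" by auto
  note r = sat_relist[OF K_wf[OF *(2)] s(1)] sat_relist[OF K_wf[OF **(2)] s(2)]
  show ?thesis
    unfolding codef_def
  proof (intro exI[of _ ?ws] exI[of _ "Conj (relist \<phi> vs ?ws) (relist \<psi> us ?ws)"] conjI allI impI)
    show "set ?ws \<subseteq> W" using *(1) **(1) by auto
    show "K (map \<sigma> ?ws) (Conj (relist \<phi> vs ?ws) (relist \<psi> us ?ws))"
      by (intro K_Conj K_relist * ** s)
  qed (simp_all only: sat.simps r * **)
qed

lemma codef_ex:
  fixes \<sigma> :: "'v \<Rightarrow> 's"
  assumes "codef K A B \<sigma> (insert v W) P Q"
  shows "codef K A B \<sigma> W (\<lambda>e. \<exists>a\<in>carrier A (\<sigma> v). P (e(v := a))) (\<lambda>e. \<exists>a\<in>carrier B (\<sigma> v). Q (e(v := a)))"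
proof -
  obtain vs \<phi> where *: "set vs \<subseteq> insert v W" "K (map \<sigma> vs) \<phi>"
    "\<And>e. typed A \<sigma> (insert v W) e \<Longrightarrow> P e = sat A (map e vs) \<phi>"
    "\<And>e. typed B \<sigma> (insert v W) e \<Longrightarrow> Q e = sat B (map e vs) \<phi>"
    using assms(1) unfolding codef_def by blast
  \<comment> \<open>The label \<open>v\<close> may occur several times in \<open>vs\<close> or not
    at all. Removing it everywhere and putting one copy at the head makes it the variable that
    \<open>Ex\<close> binds.\<close>
  let ?us = "filter (\<lambda>u. u \<noteq> v) vs"
  let ?\<psi> = "relist \<phi> vs (v # ?us)"
  have s: "set vs \<subseteq> set (v # ?us)" by auto
  note r = sat_relist[OF K_wf[OF *(2)] s]
  have k: "K (\<sigma> v # map \<sigma> ?us) ?\<psi>" using K_relist[OF *(2) s] by simp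
  have m: "map (e(v := a)) ?us = map e ?us" for e :: "'v \<Rightarrow> 'z" and a by auto
  have r': "sat A (a # map e ?us) ?\<psi> = sat A (map (e(v := a)) vs) \<phi>"
    for A :: "('s,'f,'r,'z) struct" and a e
    using r[of A "e(v := a)"] by (auto simp: m)
  have t: "typed A \<sigma> (insert v W) (e(v := a))" if "typed A \<sigma> W e" "a \<in> carrier A (\<sigma> v)"
    for A :: "('s,'f,'r,'z) struct" and a e using that by (auto simp: typed_def)
  show ?thesis
    unfolding codef_def
  proof (intro exI[of _ ?us] exI[of _ "Ex (\<sigma> v) ?\<psi>"] conjI allI impI)
    show "set ?us \<subseteq> W" using *(1) by auto
    show "K (map \<sigma> ?us) (Ex (\<sigma> v) ?\<psi>)" using K_Ex[OF k] .
    show "(\<exists>a\<in>carrier A (\<sigma> v). P (e(v := a))) = sat A (map e ?us) (Ex (\<sigma> v) ?\<psi>)"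
      if "typed A \<sigma> W e" for e
      using *(3) t[OF that] r' by (metis sat.simps(5))
    show "(\<exists>a\<in>carrier B (\<sigma> v). Q (e(v := a))) = sat B (map e ?us) (Ex (\<sigma> v) ?\<psi>)"
      if "typed B \<sigma> W e" for e
      using *(4) t[OF that] r' by (metis sat.simps(5))
  qed
qed

lemma codef_const:
  assumes "\<And>s. carrier A s \<noteq> {}" "\<And>s. carrier B s \<noteq> {}"
  shows "codef K A B \<sigma> W (\<lambda>_. b) (\<lambda>_. b)"
proof -
  \<comment> \<open>There is no constant for truth; this closed formula is true because no sort is
    empty, and it lies in every class \<open>K\<close>.\<close>
  let ?\<phi> = "Ex undefined (Eq (Var 0) (Var 0))"
  have k: "K [] ?\<phi>" by (intro K_Ex K_Eq) auto
  have "codef K A B \<sigma> W (\<lambda>_. True) (\<lambda>_. True)"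
    unfolding codef_def
    by (intro exI[of _ "[]"] exI[of _ ?\<phi>]) (use assms k in auto)
  with codef_not[OF this] show ?thesis by (cases b) auto
qed

lemma codef_imp:
  assumes "codef K A B \<sigma> W P Q" "codef K A B \<sigma> W P' Q'"
  shows "codef K A B \<sigma> W (\<lambda>e. P e \<longrightarrow> P' e) (\<lambda>e. Q e \<longrightarrow> Q' e)"
  using codef_not[OF codef_conj[OF assms(1) codef_not[OF assms(2)]]] by simp

lemma codef_iff:
  assumes "codef K A B \<sigma> W P Q" "codef K A B \<sigma> W P' Q'"
  shows "codef K A B \<sigma> W (\<lambda>e. P e = P' e) (\<lambda>e. Q e = Q' e)"
  by (rule codef_cong[OF codef_conj[OF codef_imp[OF assms] codef_imp[OF assms(2,1)]]]) auto

lemma codef_iff_const: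
  assumes "codef K A B \<sigma> W P Q"
  shows "codef K A B \<sigma> W (\<lambda>e. P e = b) (\<lambda>e. Q e = b)"
  using assms codef_not[OF assms] by (cases b) auto

lemma codef_ball:
  assumes "finite I" "\<And>s. carrier A s \<noteq> {}" "\<And>s. carrier B s \<noteq> {}"
    "\<And>i. i \<in> I \<Longrightarrow> codef K A B \<sigma> W (P i) (Q i)"
  shows "codef K A B \<sigma> W (\<lambda>e. \<forall>i\<in>I. P i e) (\<lambda>e. \<forall>i\<in>I. Q i e)"
  using assms(1,4)
proof (induction I)
  case empty
  then show ?case using codef_const[OF assms(2,3), of \<sigma> W True] by simp
next
  case (insert i I)
  then show ?case using codef_conj[of A B \<sigma> W "P i" "Q i"] by auto
qed

lemma codef_exs:
  fixes \<sigma> :: "'v \<Rightarrow> 's"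
  assumes "finite V" "codef K A B \<sigma> (W \<union> V) P Q"
  shows "codef K A B \<sigma> W (\<lambda>e. \<exists>f. typed A \<sigma> V f \<and> P (override_on e f V))
    (\<lambda>e. \<exists>f. typed B \<sigma> V f \<and> Q (override_on e f V))"
  using assms
proof (induction V arbitrary: P Q)
  case empty
  then show ?case by (simp add: typed_def)
next
  case (insert v V)
  have eq: "(\<exists>f. typed A \<sigma> V f \<and> (\<exists>a\<in>carrier A (\<sigma> v). P ((override_on e f V)(v := a))))
      = (\<exists>f. typed A \<sigma> (insert v V) f \<and> P (override_on e f (insert v V)))"
    for A :: "('s, 'f, 'r, 'z) struct" and e :: "'v \<Rightarrow> 'z" and P
  proof (intro iffI; elim exE conjE bexE)
    fix f a assume *: "typed A \<sigma> V f" "a \<in> carrier A (\<sigma> v)" "P ((override_on e f V)(v := a))"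
    have "(override_on e f V)(v := a) = override_on e (f(v := a)) (insert v V)"
      using insert.hyps by (auto simp: override_on_def fun_eq_iff)
    moreover have "typed A \<sigma> (insert v V) (f(v := a))"
      using * insert.hyps by (auto simp: typed_def)
    ultimately show "\<exists>f. typed A \<sigma> (insert v V) f \<and> P (override_on e f (insert v V))"
      using *(3) by metis
  next
    fix f assume *: "typed A \<sigma> (insert v V) f" "P (override_on e f (insert v V))"
    have "override_on e f (insert v V) = (override_on e f V)(v := f v)"
      by (auto simp: override_on_def fun_eq_iff)
    then show "\<exists>f. typed A \<sigma> V f \<and> (\<exists>a\<in>carrier A (\<sigma> v). P ((override_on e f V)(v := a)))"
      using * by (intro exI[of _ f]) (auto simp: typed_def)
  qed
  have "codef K A B \<sigma> (insert v (W \<union> V)) P Q" using insert.prems by simp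
  from insert.IH[OF codef_ex[OF this]] show ?case unfolding eq .
qed

lemma codef_alls:
  assumes "finite V" "codef K A B \<sigma> (W \<union> V) P Q"
  shows "codef K A B \<sigma> W (\<lambda>e. \<forall>f. typed A \<sigma> V f \<longrightarrow> P (override_on e f V))
    (\<lambda>e. \<forall>f. typed B \<sigma> V f \<longrightarrow> Q (override_on e f V))"
  by (rule codef_cong[OF codef_not[OF codef_exs[OF assms(1) codef_not[OF assms(2)]]]]) auto

lemma codef_eq:
  assumes "u \<in> W" "v \<in> W" "\<sigma> u = \<sigma> v"
  shows "codef K A B \<sigma> W (\<lambda>e. e u = e v) (\<lambda>e. e u = e v)"
proof -
  have "K (map \<sigma> [u, v]) (Eq (Var 0) (Var 1))" using assms by (intro K_Eq) auto
  then show ?thesis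
    unfolding codef_def
    by (intro exI[of _ "[u, v]"] exI[of _ "Eq (Var 0) (Var 1)"]) (use assms in auto)
qed

end

section \<open>Saturation and extraction of indiscernible sequences\<close>

locale saturated_struct =
  fixes L :: "('s, 'f, 'r) lang" and U :: "('s, 'f, 'r, 'a) struct" and \<kappa> :: "'k rel"
  assumes nonempty: "carrier U s \<noteq> {}"
    and saturated: "saturated \<kappa> L U"
    and uncountable: "natLeq <o \<kappa>"
begin

abbreviation Def where "Def \<equiv> dfn (wf_fm L) U"

sublocale fm_class L "wf_fm L" by (rule fm_class_wf)

lemma countable_less: "countable A \<Longrightarrow> |A| <o \<kappa>"
  using uncountable countable_card_le_natLeq ordLeq_ordLess_trans by blast

text \<open>Saturation for labelled predicates, with finitely many unknowns \<open>V\<close> and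
  countably many parameters \<open>W\<close>. Countable parameter sets are small for every
  uncountable \<kappa>, so nothing below depends on the size of \<kappa>.\<close>

lemma saturation:
  fixes \<sigma> :: "'v \<Rightarrow> 's"
  assumes V: "finite V" "V \<inter> W = {}" and W: "countable W" "typed U \<sigma> W e"
    and \<Sigma>: "\<And>P. P \<in> \<Sigma> \<Longrightarrow> Def \<sigma> (W \<union> V) P"
    and fin: "\<And>\<Sigma>0. finite \<Sigma>0 \<Longrightarrow> \<Sigma>0 \<subseteq> \<Sigma> \<Longrightarrow> \<exists>f. typed U \<sigma> V f \<and> (\<forall>P\<in>\<Sigma>0. P (override_on e f V))"
  shows "\<exists>f. typed U \<sigma> V f \<and> (\<forall>P\<in>\<Sigma>. P (override_on e f V))"
proof -
  obtain vl where vl: "set vl = V" "distinct vl" using finite_distinct_list[OF V(1)] by blast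
  have "\<exists>x. set (fst x) \<subseteq> W \<union> V \<and> wf_fm L (map \<sigma> (fst x)) (snd x) \<and>
     (\<forall>e. typed U \<sigma> (W \<union> V) e \<longrightarrow> P e = sat U (map e (fst x)) (snd x))" if "P \<in> \<Sigma>" for P
    using \<Sigma>[OF that] unfolding codef_def by (metis fst_conv snd_conv)
  then obtain F where F: "\<And>P. P \<in> \<Sigma> \<Longrightarrow> set (fst (F P)) \<subseteq> W \<union> V"
    "\<And>P. P \<in> \<Sigma> \<Longrightarrow> wf_fm L (map \<sigma> (fst (F P))) (snd (F P))"
    "\<And>P e. P \<in> \<Sigma> \<Longrightarrow> typed U \<sigma> (W \<union> V) e \<Longrightarrow> P e = sat U (map e (fst (F P))) (snd (F P))"
    by metis
  define ws where "ws P = filter (\<lambda>v. v \<notin> V) (fst (F P))" for P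
  \<comment> \<open>Unknowns come first and parameters last, the order demanded by
    \<open>saturated\<close>.\<close>
  define \<psi> where "\<psi> P = relist (snd (F P)) (fst (F P)) (vl @ ws P)" for P
  have sub: "set (fst (F P)) \<subseteq> set (vl @ ws P)" for P using vl by (auto simp: ws_def)
  have wsW: "set (ws P) \<subseteq> W" if "P \<in> \<Sigma>" for P using F(1)[OF that] by (auto simp: ws_def)
  have ty: "typed U \<sigma> (W \<union> V) (override_on e f V)" if "typed U \<sigma> V f" for f
    using that W(2) V(2) by (auto simp: typed_def override_on_def)
  have key: "sat U (map f vl @ map e (ws P)) (\<psi> P) = P (override_on e f V)"
    if "P \<in> \<Sigma>" "typed U \<sigma> V f" for P f
  proof -
    have "map f vl @ map e (ws P) = map (override_on e f V) (vl @ ws P)"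
      using vl wsW[OF that(1)] V(2) by (auto simp: override_on_def)
    then show ?thesis
      using F(3)[OF that(1) ty[OF that(2)]] sat_relist[OF F(2)[OF that(1)] sub]
      unfolding \<psi>_def by metis
  qed
  define p where "p = (\<lambda>P. (\<psi> P, map \<sigma> (ws P), map e (ws P))) ` \<Sigma>"
  let ?A = "(\<lambda>w. (\<sigma> w, e w)) ` W"
  have tup: "as \<in> tuples (elems U) (map \<sigma> vl) \<Longrightarrow> \<exists>f. typed U \<sigma> V f \<and> as = map f vl" for as
  proof -
    assume "as \<in> tuples (elems U) (map \<sigma> vl)"
    then have *: "length as = length vl" "\<And>i. i < length vl \<Longrightarrow> as ! i \<in> carrier U (\<sigma> (vl ! i))"
      by (auto simp: tuples_def elems_def list_all2_conv_all_nth)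
    define f where "f v = the (map_of (zip vl as) v)" for v
    have f: "f (vl ! i) = as ! i" if "i < length vl" for i
      using that *(1) vl(2) by (simp add: f_def map_of_zip_nth)
    show ?thesis
    proof (intro exI[of _ f] conjI)
      show "typed U \<sigma> V f" using * f vl(1) by (auto simp: typed_def in_set_conv_nth)
      show "as = map f vl" using * f by (auto intro: nth_equalityI)
    qed
  qed
  have tup': "map f vl \<in> tuples (elems U) (map \<sigma> vl)" if "typed U \<sigma> V f" for f
    using that vl(1) by (auto simp: tuples_def elems_def list_all2_conv_all_nth typed_def)
  have "\<exists>as\<in>tuples (elems U) (map \<sigma> vl). \<forall>(\<phi>, ts, ds)\<in>p. sat U (as @ ds) \<phi>"
  proof (rule saturated[unfolded saturated_def, rule_format])
    show "?A \<subseteq> elems U" using W(2) by (auto simp: elems_def typed_def)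
    show "|?A| <o \<kappa>" using W(1) by (intro countable_less) auto
    show "case x of (\<phi>, ts, ds) \<Rightarrow> wf_fm L (map \<sigma> vl @ ts) \<phi> \<and> ds \<in> tuples ?A ts" if "x \<in> p" for x
    proof -
      from that obtain P where P: "P \<in> \<Sigma>" "x = (\<psi> P, map \<sigma> (ws P), map e (ws P))"
        by (auto simp: p_def)
      have "wf_fm L (map \<sigma> (vl @ ws P)) (\<psi> P)"
        unfolding \<psi>_def by (rule K_relist[OF F(2)[OF P(1)] sub])
      moreover have "map e (ws P) \<in> tuples ?A (map \<sigma> (ws P))"
        using wsW[OF P(1)] nth_mem by (fastforce simp: tuples_def list_all2_conv_all_nth)
      ultimately show ?thesis using P(2) by simp
    qed
    show "\<exists>as\<in>tuples (elems U) (map \<sigma> vl). \<forall>(\<phi>, ts, ds)\<in>p0. sat U (as @ ds) \<phi>"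
      if p0: "p0 \<subseteq> p" "finite p0" for p0
    proof -
      obtain \<Sigma>0 where \<Sigma>0: "\<Sigma>0 \<subseteq> \<Sigma>" "finite \<Sigma>0" "p0 = (\<lambda>P. (\<psi> P, map \<sigma> (ws P), map e (ws P))) ` \<Sigma>0"
        using finite_subset_image[OF p0(2) p0(1)[unfolded p_def]] by blast
      obtain f where "typed U \<sigma> V f" "\<forall>P\<in>\<Sigma>0. P (override_on e f V)"
        using fin[OF \<Sigma>0(2,1)] by blast
      then show ?thesis using \<Sigma>0 key tup' by (intro bexI[of _ "map f vl"]) auto
    qed
  qed
  then obtain as where as: "as \<in> tuples (elems U) (map \<sigma> vl)"
    "\<forall>(\<phi>, ts, ds)\<in>p. sat U (as @ ds) \<phi>" by blast
  obtain f where f: "typed U \<sigma> V f" "as = map f vl" using tup[OF as(1)] by blast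
  show ?thesis using f as(2) key by (auto simp: p_def)
qed

end

section \<open>Extraction of indiscernible sequences by Ramsey's theorem and compactness\<close>

definition good ::
  "'i::linorder set \<Rightarrow> ('i \<Rightarrow> 'c \<Rightarrow> 'a) \<Rightarrow> (nat \<times> ((nat \<times> 'c \<Rightarrow> 'a) \<Rightarrow> bool)) set \<Rightarrow> bool" where
  "good X z Rq \<longleftrightarrow> (\<forall>(m, R)\<in>Rq. \<forall>g. strict_mono_on {..<m} g \<longrightarrow> g ` {..<m} \<subseteq> X \<longrightarrow>
      R (\<lambda>(k, c). z (g k) c))"

text \<open>A tuple is labelled by its own indices, so the same predicate can be compared at
  \<open>F\<close> and at its image under \<open>g\<close> without enumerating
  \<open>F\<close>.\<close>

definition ind ::
  "('s list \<Rightarrow> ('s, 'f, 'r) fm \<Rightarrow> bool) \<Rightarrow> ('s, 'f, 'r, 'a) struct \<Rightarrow> ('c \<Rightarrow> 's) \<Rightarrow> 'c set \<Rightarrow>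
   'i::linorder set \<Rightarrow> ('i \<Rightarrow> 'c \<Rightarrow> 'a) \<Rightarrow> bool" where
  "ind K U \<sigma> C X z \<longleftrightarrow> (\<forall>F Q g. finite F \<longrightarrow> F \<subseteq> X \<longrightarrow> strict_mono_on F g \<longrightarrow> g ` F \<subseteq> X \<longrightarrow>
      dfn K U (\<lambda>(i, c). \<sigma> c) (F \<times> C) Q \<longrightarrow> Q (\<lambda>(i, c). z i c) = Q (\<lambda>(i, c). z (g i) c))"

lemma enum_finite:
  fixes F :: "'i::linorder set"
  assumes "finite F"
  obtains h :: "nat \<Rightarrow> 'i" where "strict_mono_on {..<card F} h" "h ` {..<card F} = F"
proof
  let ?l = "sorted_list_of_set F"
  have len: "length ?l = card F" by simp
  show "strict_mono_on {..<card F} (\<lambda>k. ?l ! k)"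
    using strict_sorted_list_of_set[of F] len
    by (auto simp: strict_mono_on_def sorted_wrt_iff_nth_less)
  show "(\<lambda>k. ?l ! k) ` {..<card F} = F"
    using assms len by (metis lessThan_atLeast0 list.set_map map_nth set_sorted_list_of_set set_upt)
qed

lemma goodD:
  assumes "good X z Rq" "(m, R) \<in> Rq" "strict_mono_on {..<m} g" "g ` {..<m} \<subseteq> X"
  shows "R (\<lambda>(k, c). z (g k) c)"
  using assms unfolding good_def by blast

lemma goodI:
  assumes "\<And>m R g. (m, R) \<in> Rq \<Longrightarrow> strict_mono_on {..<m} g \<Longrightarrow> g ` {..<m} \<subseteq> X \<Longrightarrow> R (\<lambda>(k, c). z (g k) c)"
  shows "good X z Rq"
  using assms unfolding good_def by blast

lemma strict_mono_on_compose:
  "strict_mono_on A f \<Longrightarrow> strict_mono_on B g \<Longrightarrow> f ` A \<subseteq> B \<Longrightarrow> strict_mono_on A (\<lambda>x. g (f x))"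
  unfolding strict_mono_on_def by blast

lemma strict_mono_on_inverse:
  fixes h :: "'i::linorder \<Rightarrow> 'j::linorder"
  assumes "strict_mono_on A h"
  obtains h' where "strict_mono_on (h ` A) h'" "\<And>x. x \<in> A \<Longrightarrow> h' (h x) = x" "h' ` (h ` A) = A"
proof
  have inj: "inj_on h A" using assms by (rule strict_mono_on_imp_inj_on)
  let ?h = "inv_into A h"
  show "strict_mono_on (h ` A) ?h"
  proof (rule strict_mono_onI)
    fix r s assume *: "r \<in> h ` A" "s \<in> h ` A" "r < s"
    then obtain x y where "x \<in> A" "y \<in> A" "r = h x" "s = h y" by auto
    with * inj assms show "?h r < ?h s"
      by (metis inv_into_f_f not_less_iff_gr_or_eq order_less_trans strict_mono_onD)
  qed
  show "?h (h x) = x" if "x \<in> A" for x using inj that by simp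
  then show "?h ` (h ` A) = A" by (auto simp: image_image)
qed

lemma codef_reindex:
  assumes "codef K A B (\<lambda>(i, c). \<sigma> c) (F \<times> C) P Q" "\<And>i. i \<in> F \<Longrightarrow> h i \<in> G"
  shows "codef K A B (\<lambda>(i, c). \<sigma> c) (G \<times> C) (\<lambda>e. P (\<lambda>(i, c). e (h i, c))) (\<lambda>e. Q (\<lambda>(i, c). e (h i, c)))"
proof -
  have "codef K A B (\<lambda>(i, c). \<sigma> c) (G \<times> C) (\<lambda>e. P (\<lambda>v. e ((\<lambda>(i, c). (h i, c)) v)))
      (\<lambda>e. Q (\<lambda>v. e ((\<lambda>(i, c). (h i, c)) v)))"
    by (rule codef_rename[OF assms(1)]) (use assms(2) in auto)
  then show ?thesis by (simp add: case_prod_beta')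
qed

lemma strict_mono_on_unique:
  fixes g g' :: "nat \<Rightarrow> 'i::linorder"
  assumes "strict_mono_on {..<m} g" "strict_mono_on {..<m} g'" "g ` {..<m} = g' ` {..<m}" "k < m"
  shows "g k = g' k"
proof -
  have "sorted_wrt (<) (map g [0..<m])" "sorted_wrt (<) (map g' [0..<m])"
    using assms(1,2) by (auto simp: sorted_wrt_iff_nth_less strict_mono_on_def)
  moreover have "set (map g [0..<m]) = set (map g' [0..<m])"
    using assms(3) by (simp add: lessThan_atLeast0)
  ultimately have "map g [0..<m] = map g' [0..<m]" by (metis strict_sorted_equal)
  then show ?thesis using assms(4) by simp
qed

context saturated_struct
begin

abbreviation ftyped :: "('c \<Rightarrow> 's) \<Rightarrow> 'c set \<Rightarrow> ('i \<Rightarrow> 'c \<Rightarrow> 'a) \<Rightarrow> bool" where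
  "ftyped \<sigma> C z \<equiv> \<forall>i. typed U \<sigma> C (z i)"

definition reqs :: "('c \<Rightarrow> 's) \<Rightarrow> 'c set \<Rightarrow> (nat \<times> ((nat \<times> 'c \<Rightarrow> 'a) \<Rightarrow> bool)) set" where
  "reqs \<sigma> C = {(m, R). Def (\<lambda>(k, c). \<sigma> c) ({..<m} \<times> C) R}"

text \<open>Only finite sequences and finitely many requirements are involved. This makes
  consistency survive unions of chains, as Zorn's lemma needs, and accessible to the finite Ramsey
  theorem.\<close>

definition consistent ::
  "('c \<Rightarrow> 's) \<Rightarrow> 'c set \<Rightarrow> (nat \<times> ((nat \<times> 'c \<Rightarrow> 'a) \<Rightarrow> bool)) set \<Rightarrow> bool" where
  "consistent \<sigma> C Rq \<longleftrightarrow> (\<forall>n Rq0. finite Rq0 \<longrightarrow> Rq0 \<subseteq> Rq \<longrightarrow>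
     (\<exists>z::nat \<Rightarrow> 'c \<Rightarrow> 'a. ftyped \<sigma> C z \<and> good {..<n} z Rq0))"

lemma typed_seq: "ftyped \<sigma> C z \<Longrightarrow> typed U (\<lambda>(k, c). \<sigma> c) (K \<times> C) (\<lambda>(k, c). z (g k) c)"
  by (auto simp: typed_def)

lemma reqs_dep:
  assumes "(m, R) \<in> reqs \<sigma> C" "ftyped \<sigma> C z" "\<And>k c. k < m \<Longrightarrow> c \<in> C \<Longrightarrow> z (g k) c = z' (g' k) c"
  shows "R (\<lambda>(k, c). z (g k) c) = R (\<lambda>(k, c). z' (g' k) c)"
proof (rule codef_dep[where P = R and W = "{..<m} \<times> C"])
  show "Def (\<lambda>(k, c). \<sigma> c) ({..<m} \<times> C) R" using assms(1) by (simp add: reqs_def)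
  show "typed U (\<lambda>(k, c). \<sigma> c) ({..<m} \<times> C) (\<lambda>(k, c). z (g k) c)"
    by (rule typed_seq[OF assms(2)])
qed (use assms(3) in auto)

text \<open>If neither \<open>R\<close> nor its negation could be added, then \<open>n1\<close> and
  \<open>n2\<close> would be lengths at which the two extensions fail. On a sequence of the Ramsey
  length for these numbers, a subsequence homogeneous for \<open>R\<close> realises one of the
  extensions.\<close>

lemma consistent_maximal:
  fixes \<sigma> :: "'c \<Rightarrow> 's"
  assumes max: "\<And>Rq'. Rq \<subseteq> Rq' \<Longrightarrow> Rq' \<subseteq> reqs \<sigma> C \<Longrightarrow> consistent \<sigma> C Rq' \<Longrightarrow> Rq' = Rq"
    and Rq: "Rq \<subseteq> reqs \<sigma> C" "consistent \<sigma> C Rq"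
    and R: "(m, R) \<in> reqs \<sigma> C"
  shows "(m, R) \<in> Rq \<or> (m, \<lambda>e. \<not> R e) \<in> Rq"
proof (rule ccontr)
  assume no: "\<not> ?thesis"
  have R': "(m, \<lambda>e. \<not> R e) \<in> reqs \<sigma> C" using R codef_not by (auto simp: reqs_def)
  have "\<exists>n Rq0. finite Rq0 \<and> Rq0 \<subseteq> insert x Rq \<and>
      (\<forall>z::nat \<Rightarrow> 'c \<Rightarrow> 'a. ftyped \<sigma> C z \<longrightarrow> \<not> good {..<n} z Rq0)"
    if "x \<in> reqs \<sigma> C" "x \<notin> Rq" for x
  proof -
    have "\<not> consistent \<sigma> C (insert x Rq)" using max[of "insert x Rq"] that Rq(1) by auto
    then show ?thesis unfolding consistent_def not_all not_imp not_ex by blast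
  qed
  note inc = this
  obtain n1 R1 where
    1: "finite R1" "R1 \<subseteq> insert (m, R) Rq" "\<And>z::nat \<Rightarrow> 'c \<Rightarrow> 'a. ftyped \<sigma> C z \<Longrightarrow> \<not> good {..<n1} z R1"
    using inc[OF R] no by blast
  obtain n2 R2 where
    2: "finite R2" "R2 \<subseteq> insert (m, \<lambda>e. \<not> R e) Rq"
      "\<And>z::nat \<Rightarrow> 'c \<Rightarrow> 'a. ftyped \<sigma> C z \<Longrightarrow> \<not> good {..<n2} z R2"
    using inc[OF R'] no by blast
  obtain N :: nat where N: "partn_lst {..<N} [n1, n2] m" using ramsey_full by blast
  have "finite ((R1 \<union> R2) \<inter> Rq)" "(R1 \<union> R2) \<inter> Rq \<subseteq> Rq" using 1 2 by auto
  then obtain z :: "nat \<Rightarrow> 'c \<Rightarrow> 'a" where z: "ftyped \<sigma> C z" "good {..<N} z ((R1 \<union> R2) \<inter> Rq)"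
    using Rq(2) unfolding consistent_def by blast
  \<comment> \<open>A set of \<open>m\<close> indices has one increasing enumeration, so its colour
    is just the truth value of \<open>R\<close> there.\<close>
  define col :: "nat set \<Rightarrow> nat" where
    "col S = (if \<exists>g. strict_mono_on {..<m} g \<and> g ` {..<m} = S \<and> R (\<lambda>(k, c). z (g k) c) then 0 else 1)" for S
  have "col \<in> nsets {..<N} m \<rightarrow> {..<length [n1, n2]}" by (auto simp: col_def)
  then obtain \<xi> H where \<xi>: "\<xi> < 2" "H \<in> nsets {..<N} ([n1, n2] ! \<xi>)" "col ` nsets H m \<subseteq> {\<xi>}"
    using partn_lstE[OF N, of col 2] by (auto simp: numeral_2_eq_2)
  let ?n = "[n1, n2] ! \<xi>"
  have H: "H \<subseteq> {..<N}" "finite H" "card H = ?n" using \<xi>(2) by (auto simp: nsets_def)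
  obtain e :: "nat \<Rightarrow> nat" where e: "strict_mono_on {..<?n} e" "e ` {..<?n} = H"
    using enum_finite[OF H(2)] H(3) by metis
  have color: "R (\<lambda>(k, c). z (e (g k)) c) \<longleftrightarrow> \<xi> = 0"
    if g: "strict_mono_on {..<m} g" "g ` {..<m} \<subseteq> {..<?n}" for g
  proof -
    have eg: "strict_mono_on {..<m} (\<lambda>k. e (g k))" by (rule strict_mono_on_compose[OF g(1) e(1) g(2)])
    let ?S = "(\<lambda>k. e (g k)) ` {..<m}"
    have "card ?S = m" using card_image[OF strict_mono_on_imp_inj_on[OF eg]] by simp
    then have "?S \<in> nsets H m" using e(2) g(2) by (auto simp: nsets_def)
    then have c: "col ?S = \<xi>" using \<xi>(3) by blast
    have "R (\<lambda>(k, c). z (g' k) c) = R (\<lambda>(k, c). z (e (g k)) c)"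
      if "strict_mono_on {..<m} g'" "g' ` {..<m} = ?S" for g'
      using strict_mono_on_unique[OF that(1) eg that(2)]
      by (intro reqs_dep[OF R z(1), where g' = "\<lambda>k. e (g k)"]) simp
    then have "(\<exists>g'. strict_mono_on {..<m} g' \<and> g' ` {..<m} = ?S \<and> R (\<lambda>(k, c). z (g' k) c))
        = R (\<lambda>(k, c). z (e (g k)) c)" using eg by blast
    with c show ?thesis unfolding col_def by (simp split: if_splits)
  qed
  have old: "R' (\<lambda>(k, c). z (e (g k)) c)"
    if "(m', R') \<in> (R1 \<union> R2) \<inter> Rq" "strict_mono_on {..<m'} g" "g ` {..<m'} \<subseteq> {..<?n}" for m' R' g
  proof -
    have "strict_mono_on {..<m'} (\<lambda>k. e (g k))" by (rule strict_mono_on_compose[OF that(2) e(1) that(3)])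
    moreover have "(\<lambda>k. e (g k)) ` {..<m'} \<subseteq> {..<N}" using that(3) e(2) H(1) by auto
    ultimately show ?thesis by (rule goodD[OF z(2) that(1)])
  qed
  have t: "ftyped \<sigma> C (\<lambda>k. z (e k))" using z(1) by simp
  show False
  proof (cases "\<xi> = 0")
    case \<xi>eq: True
    have "good {..<n1} (\<lambda>k. z (e k)) R1"
    proof (rule goodI)
      fix m' R' g assume *: "(m', R') \<in> R1" "strict_mono_on {..<m'} g" "g ` {..<m'} \<subseteq> {..<n1}"
      show "R' (\<lambda>(k, c). z (e (g k)) c)"
      proof (cases "(m', R') \<in> Rq")
        case in_Rq: True
        show ?thesis by (rule old) (use in_Rq * \<xi>eq in auto)
      next
        case False
        then have "m' = m" "R' = (R)" using *(1) 1(2) by auto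
        then show ?thesis using color[of g] * \<xi>eq by (simp add: case_prod_beta')
      qed
    qed
    then show ?thesis using 1(3)[OF t] by simp
  next
    case False
    then have \<xi>eq: "\<xi> = 1" using \<xi>(1) by simp
    have "good {..<n2} (\<lambda>k. z (e k)) R2"
    proof (rule goodI)
      fix m' R' g assume *: "(m', R') \<in> R2" "strict_mono_on {..<m'} g" "g ` {..<m'} \<subseteq> {..<n2}"
      show "R' (\<lambda>(k, c). z (e (g k)) c)"
      proof (cases "(m', R') \<in> Rq")
        case in_Rq: True
        show ?thesis by (rule old) (use in_Rq * \<xi>eq in auto)
      next
        case False
        then have "m' = m" "R' = (\<lambda>e. \<not> R e)" using *(1) 2(2) by auto
        then show ?thesis using color[of g] * \<xi>eq by (simp add: case_prod_beta')
      qed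
    qed
    then show ?thesis using 2(3)[OF t] by simp
  qed
qed

text \<open>Saturation supplies finitely many elements at a time, so the sequence is built index by
  index. That the requirements on the next entry can be met is a statement about the old entries,
  hence itself decided by the complete set \<open>Rq\<close>.\<close>

lemma good_extend:
  fixes z :: "rat \<Rightarrow> 'c \<Rightarrow> 'a"
  assumes C: "finite C"
    and Rq: "Rq \<subseteq> reqs \<sigma> C" "consistent \<sigma> C Rq"
      "\<And>m R. (m, R) \<in> reqs \<sigma> C \<Longrightarrow> (m, R) \<in> Rq \<or> (m, \<lambda>e. \<not> R e) \<in> Rq"
    and F: "finite F" "q \<notin> F" and z: "ftyped \<sigma> C z" "good F z Rq"
  shows "\<exists>z'. ftyped \<sigma> C z' \<and> good (insert q F) z' Rq \<and> (\<forall>i\<in>F. z' i = z i)"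
proof -
  let ?\<sigma> = "\<lambda>(k, c). \<sigma> c"
  let ?V = "{q} \<times> C"
  define \<Sigma> where "\<Sigma> = {P. \<exists>m R g. (m, R) \<in> Rq \<and> strict_mono_on {..<m} g \<and> g ` {..<m} \<subseteq> insert q F
      \<and> P = (\<lambda>e. R (\<lambda>(k, c). e (g k, c)))}"
  have \<Sigma>Def: "Def ?\<sigma> (F \<times> C \<union> ?V) P" if P: "P \<in> \<Sigma>" for P
  proof -
    obtain m R g where *: "(m, R) \<in> Rq" "g ` {..<m} \<subseteq> insert q F" "P = (\<lambda>e. R (\<lambda>(k, c). e (g k, c)))"
      using P unfolding \<Sigma>_def by blast
    have "Def ?\<sigma> ({..<m} \<times> C) R" using *(1) Rq(1) by (auto simp: reqs_def)
    then have "Def ?\<sigma> (insert q F \<times> C) P"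
      unfolding *(3) by (rule codef_reindex) (use *(2) in auto)
    moreover have "insert q F \<times> C = F \<times> C \<union> ?V" by auto
    ultimately show ?thesis by simp
  qed
  have "\<exists>f. typed U ?\<sigma> ?V f \<and> (\<forall>P\<in>\<Sigma>. P (override_on (\<lambda>(i, c). z i c) f ?V))"
  proof (rule saturation[where W = "F \<times> C", OF _ _ _ _ \<Sigma>Def])
    show "finite ?V" "?V \<inter> F \<times> C = {}" using C F(2) by auto
    show "countable (F \<times> C)" using F(1) C by (simp add: countable_finite)
    show "typed U ?\<sigma> (F \<times> C) (\<lambda>(i, c). z i c)" using typed_seq[OF z(1), of F "\<lambda>i. i"] by simp
    fix \<Sigma>0 assume \<Sigma>0: "finite \<Sigma>0" "\<Sigma>0 \<subseteq> \<Sigma>"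
    \<comment> \<open>Solvability of \<open>\<Sigma>0\<close>, with the new entry quantified away;
      after renumbering \<open>F\<close> it becomes the requirement \<open>N\<close>.\<close>
    define \<Psi> where "\<Psi> e \<longleftrightarrow> (\<exists>f. typed U ?\<sigma> ?V f \<and> (\<forall>P\<in>\<Sigma>0. P (override_on e f ?V)))" for e
    have \<Psi>: "Def ?\<sigma> (F \<times> C) \<Psi>"
      unfolding \<Psi>_def
      by (intro codef_exs codef_ball \<Sigma>Def) (use C \<Sigma>0 nonempty in auto)
    obtain h :: "nat \<Rightarrow> rat" where h: "strict_mono_on {..<card F} h" "h ` {..<card F} = F"
      using enum_finite[OF F(1)] .
    obtain h' where h': "strict_mono_on F h'" "\<And>x. x < card F \<Longrightarrow> h' (h x) = x" "h' ` F = {..<card F}"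
      using strict_mono_on_inverse[OF h(1)] h(2) by (metis lessThan_iff)
    have hh': "h (h' i) = i" if "i \<in> F" for i using that h(2) h'(2) by (metis imageE lessThan_iff)
    define N where "N e = \<Psi> (\<lambda>(i, c). e (h' i, c))" for e
    have N: "(card F, N) \<in> reqs \<sigma> C"
      unfolding reqs_def N_def[abs_def] using h'(3) by (auto intro!: codef_reindex[OF \<Psi>])
    from Rq(3)[OF this] show "\<exists>f. typed U ?\<sigma> ?V f \<and> (\<forall>P\<in>\<Sigma>0. P (override_on (\<lambda>(i, c). z i c) f ?V))"
    proof
      assume "(card F, N) \<in> Rq"
      then have "N (\<lambda>(k, c). z (h k) c)" using goodD[OF z(2) _ h(1)] h(2) by auto
      then have "\<Psi> (\<lambda>(i, c). z (h (h' i)) c)" by (simp add: N_def case_prod_beta')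
      then have "\<Psi> (\<lambda>(i, c). z i c)"
        using codef_dep[OF \<Psi> typed_seq[OF z(1), of F "\<lambda>i. h (h' i)"], of "\<lambda>(i, c). z i c"] hh' by auto
      then show ?thesis by (simp add: \<Psi>_def)
    next
      \<comment> \<open>Impossible: a finite sequence meeting this requirement and those behind
        \<open>\<Sigma>0\<close>, spread over \<open>insert q F\<close>, solves
        \<open>\<Sigma>0\<close> by its own entry in the place of \<open>q\<close>.\<close>
      assume nN: "(card F, \<lambda>e. \<not> N e) \<in> Rq"
      define is_code where "is_code P x \<longleftrightarrow> (fst x, fst (snd x)) \<in> Rq \<and> strict_mono_on {..<fst x} (snd (snd x)) \<and>
          snd (snd x) ` {..<fst x} \<subseteq> insert q F \<and> P = (\<lambda>e. fst (snd x) (\<lambda>(k, c). e (snd (snd x) k, c)))"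
        for P and x :: "nat \<times> ((nat \<times> 'c \<Rightarrow> 'a) \<Rightarrow> bool) \<times> (nat \<Rightarrow> rat)"
      have "\<forall>P\<in>\<Sigma>0. \<exists>x. is_code P x"
        using \<Sigma>0(2) unfolding \<Sigma>_def is_code_def by fastforce
      from bchoice[OF this] obtain X where "\<And>P. P \<in> \<Sigma>0 \<Longrightarrow> is_code P (X P)" by blast
      note X = this[unfolded is_code_def]
      note X1 = X[THEN conjunct1] and X2 = X[THEN conjunct2, THEN conjunct1]
        and X3 = X[THEN conjunct2, THEN conjunct2, THEN conjunct1]
        and X4 = X[THEN conjunct2, THEN conjunct2, THEN conjunct2]
      let ?Rq = "insert (card F, \<lambda>e. \<not> N e) ((\<lambda>P. (fst (X P), fst (snd (X P)))) ` \<Sigma>0)"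
      have "finite ?Rq" "?Rq \<subseteq> Rq" using \<Sigma>0 X1 nN by auto
      then obtain y :: "nat \<Rightarrow> 'c \<Rightarrow> 'a" where y: "ftyped \<sigma> C y" "good {..<card (insert q F)} y ?Rq"
        using Rq(2) unfolding consistent_def by blast
      obtain j :: "nat \<Rightarrow> rat" where j: "strict_mono_on {..<card (insert q F)} j"
        "j ` {..<card (insert q F)} = insert q F" using enum_finite F(1) by (metis finite_insert)
      obtain j' where j': "strict_mono_on (insert q F) j'" "j' ` insert q F = {..<card (insert q F)}"
        using strict_mono_on_inverse[OF j(1)] j(2) by metis
      let ?e = "\<lambda>(i, c). y (j' i) c"
      have sm: "strict_mono_on {..<card F} (\<lambda>k. j' (h k))"
        by (rule strict_mono_on_compose[OF h(1) j'(1)]) (use h(2) in auto)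
      have im: "(\<lambda>k. j' (h k)) ` {..<card F} \<subseteq> {..<card (insert q F)}" using h(2) j'(2) by auto
      have "\<not> N (\<lambda>(k, c). y (j' (h k)) c)"
        using goodD[OF y(2) _ sm im] by blast
      then have "\<not> \<Psi> (\<lambda>(i, c). y (j' (h (h' i))) c)" by (simp add: N_def case_prod_beta')
      then have "\<not> \<Psi> ?e"
        using codef_dep[OF \<Psi> typed_seq[OF y(1), of F "\<lambda>i. j' (h (h' i))"], of ?e] hh' by auto
      moreover have "P (override_on ?e ?e ?V)" if "P \<in> \<Sigma>0" for P
      proof -
        have "strict_mono_on {..<fst (X P)} (\<lambda>k. j' (snd (snd (X P)) k))"
          by (rule strict_mono_on_compose[OF X2[OF that] j'(1) X3[OF that]])
        moreover have "(\<lambda>k. j' (snd (snd (X P)) k)) ` {..<fst (X P)} \<subseteq> {..<card (insert q F)}"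
          using X3[OF that] j'(2) by auto
        ultimately have "fst (snd (X P)) (\<lambda>(k, c). y (j' (snd (snd (X P)) k)) c)"
          using goodD[OF y(2)] that by blast
        then have "P ?e" by (subst X4[OF that]) (simp add: case_prod_beta')
        then show ?thesis by (simp add: override_on_def)
      qed
      ultimately have False
        unfolding \<Psi>_def using typed_seq[OF y(1), of "{q}" j'] by blast
      then show ?thesis ..
    qed
  qed
  then obtain f where f: "typed U ?\<sigma> ?V f" "\<And>P. P \<in> \<Sigma> \<Longrightarrow> P (override_on (\<lambda>(i, c). z i c) f ?V)" by blast
  let ?z = "z(q := \<lambda>c. f (q, c))"
  have "good (insert q F) ?z Rq"
    unfolding good_def
  proof (intro ballI, clarify)
    fix m R g assume *: "(m, R) \<in> Rq" "strict_mono_on {..<m} g" "g ` {..<m} \<subseteq> insert q F"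
    then have "(\<lambda>e. R (\<lambda>(k, c). e (g k, c))) \<in> \<Sigma>" by (auto simp: \<Sigma>_def)
    from f(2)[OF this] have "R (\<lambda>(k, c). override_on (\<lambda>(i, c). z i c) f ?V (g k, c))" .
    moreover have "R (\<lambda>(k, c). ?z (g k) c) = R (\<lambda>(k, c). (\<lambda>i c. override_on (\<lambda>(i, c). z i c) f ?V (i, c)) (g k) c)"
      by (rule reqs_dep[where \<sigma> = \<sigma> and C = C and m = m])
        (use * Rq(1) z(1) f(1) in \<open>auto simp: typed_def override_on_def\<close>)
    ultimately show "R (\<lambda>(k, c). ?z (g k) c)" by simp
  qed
  moreover have "ftyped \<sigma> C ?z" using z(1) f(1) by (auto simp: typed_def)
  ultimately show ?thesis using F(2) by (intro exI[of _ ?z]) auto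
qed

lemma good_total:
  assumes C: "finite C"
    and Rq: "Rq \<subseteq> reqs \<sigma> C" "consistent \<sigma> C Rq"
      "\<And>m R. (m, R) \<in> reqs \<sigma> C \<Longrightarrow> (m, R) \<in> Rq \<or> (m, \<lambda>e. \<not> R e) \<in> Rq"
  shows "\<exists>z::rat \<Rightarrow> 'c \<Rightarrow> 'a. ftyped \<sigma> C z \<and> good UNIV z Rq"
proof -
  let ?F = "\<lambda>n. from_nat ` {..<n} :: rat set"
  obtain y :: "nat \<Rightarrow> 'c \<Rightarrow> 'a" where y: "ftyped \<sigma> C y" 
    using Rq(2) unfolding consistent_def by (meson empty_subsetI finite.emptyI)
  have "\<exists>z. \<forall>n. (ftyped \<sigma> C (z n) \<and> good (?F n) (z n) Rq) \<and> (\<forall>i\<in>?F n. z (Suc n) i = z n i)"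
  proof (rule dependent_nat_choice)
    \<comment> \<open>Over the empty index set only requirements with \<open>m = 0\<close> apply.
      They are sentences, and consistency shows that each of them is true.\<close>
    have "good (?F 0) (\<lambda>_. y 0) Rq"
    proof (rule goodI)
      fix m R and g :: "nat \<Rightarrow> rat"
      assume *: "(m, R) \<in> Rq" "g ` {..<m} \<subseteq> ?F 0"
      then have m: "m = 0" by auto
      obtain x :: "nat \<Rightarrow> 'c \<Rightarrow> 'a" where x: "ftyped \<sigma> C x" "good {..<0} x {(m, R)}"
        using Rq(2) * unfolding consistent_def by (meson bot.extremum finite.simps insert_subset)
      have "R (\<lambda>(k, c). x ((\<lambda>k. k) k) c)" using goodD[OF x(2), of m R "\<lambda>k. k"] m by (simp add: strict_mono_on_def)
      moreover have "R (\<lambda>(k, c). x ((\<lambda>k. k) k) c) = R (\<lambda>(k, c). y 0 c)"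
        using reqs_dep[of m R \<sigma> C x "\<lambda>k. k" "\<lambda>_. y 0" "\<lambda>k. k"] * Rq(1) x(1) m by auto
      ultimately show "R (\<lambda>(k, c). y 0 c)" by simp
    qed
    then show "\<exists>z. ftyped \<sigma> C z \<and> good (?F 0) z Rq" using y by (intro exI[of _ "\<lambda>_. y 0"]) auto
    fix z :: "rat \<Rightarrow> 'c \<Rightarrow> 'a" and n
    assume z: "ftyped \<sigma> C z \<and> good (?F n) z Rq"
    have F: "?F (Suc n) = insert (from_nat n) (?F n)" by (simp add: lessThan_Suc)
    show "\<exists>z'. (ftyped \<sigma> C z' \<and> good (?F (Suc n)) z' Rq) \<and> (\<forall>i\<in>?F n. z' i = z i)"
    \<comment> \<open>\<open>from_nat\<close> need not be injective, so the index may have been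
      treated already.\<close>
    proof (cases "from_nat n \<in> ?F n")
      case True
      then have "?F (Suc n) = ?F n" using F by auto
      then show ?thesis using z by auto
    next
      case False
      then show ?thesis
        using good_extend[OF C Rq _ False] z unfolding F by auto
    qed
  qed
  then obtain z where z: "\<And>n. ftyped \<sigma> C (z n)" "\<And>n. good (?F n) (z n) Rq"
    "\<And>n i. i \<in> ?F n \<Longrightarrow> z (Suc n) i = z n i" by blast
  define zz where "zz i = z (Suc (to_nat i)) i" for i
  have zz: "z n i = zz i" if "to_nat i < n" for i n
    using that
  proof (induction n)
    case (Suc n)
    have "i \<in> ?F n" if "to_nat i < n" using that by (metis from_nat_to_nat imageI lessThan_iff)
    with Suc z(3) show ?case by (cases "to_nat i = n") (auto simp: zz_def)
  qed simp
  have "good UNIV zz Rq"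
  proof (rule goodI)
    fix m R and g :: "nat \<Rightarrow> rat"
    assume *: "(m, R) \<in> Rq" "strict_mono_on {..<m} g"
    define n where "n = Suc (\<Sum>k<m. to_nat (g k))"
    have n: "to_nat (g k) < n" if "k < m" for k
      using that member_le_sum[of k "{..<m}" "\<lambda>k. to_nat (g k)"] by (simp add: n_def)
    have "g k \<in> ?F n" if "k < m" for k
      using n[OF that] by (metis from_nat_to_nat imageI lessThan_iff)
    then have "g ` {..<m} \<subseteq> ?F n" by blast
    then have "R (\<lambda>(k, c). z n (g k) c)" by (rule goodD[OF z(2) *])
    moreover have "R (\<lambda>(k, c). z n (g k) c) = R (\<lambda>(k, c). zz (g k) c)"
      by (rule reqs_dep[OF _ z(1), where m = m]) (use * Rq(1) zz n in auto)
    ultimately show "R (\<lambda>(k, c). zz (g k) c)" by simp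
  qed
  then show ?thesis using z(1) by (intro exI[of _ zz]) (auto simp: zz_def)
qed

lemma complete_ind:
  assumes "good X z Rq" "ftyped \<sigma> C z"
    and "\<And>m R. (m, R) \<in> reqs \<sigma> C \<Longrightarrow> (m, R) \<in> Rq \<or> (m, \<lambda>e. \<not> R e) \<in> Rq"
  shows "ind (wf_fm L) U \<sigma> C X z"
  unfolding ind_def
proof (intro allI impI)
  fix F Q g
  assume F: "finite F" "F \<subseteq> X" "strict_mono_on F g" "g ` F \<subseteq> X" and Q: "Def (\<lambda>(i, c). \<sigma> c) (F \<times> C) Q"
  obtain h :: "nat \<Rightarrow> _" where h: "strict_mono_on {..<card F} h" "h ` {..<card F} = F"
    using enum_finite[OF F(1)] .
  obtain h' where h': "strict_mono_on F h'" "\<And>x. x < card F \<Longrightarrow> h' (h x) = x" "h' ` F = {..<card F}"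
    using strict_mono_on_inverse[OF h(1)] h(2) by (metis lessThan_iff)
  have hh': "h (h' i) = i" if "i \<in> F" for i using that h(2) h'(2) by (metis imageE lessThan_iff)
  define R where "R e = Q (\<lambda>(i, c). e (h' i, c))" for e
  have R: "(card F, R) \<in> reqs \<sigma> C"
    unfolding reqs_def R_def[abs_def] using h'(3) by (auto intro!: codef_reindex[OF Q])
  have gh: "strict_mono_on {..<card F} (\<lambda>k. g (h k))"
    by (rule strict_mono_on_compose[OF h(1) F(3)]) (use h(2) in auto)
  have "(\<lambda>k. g (h k)) ` {..<card F} \<subseteq> X" using h(2) F(4) by auto
  then have "R (\<lambda>(k, c). z (h k) c) = R (\<lambda>(k, c). z (g (h k)) c)"
    using assms(3)[OF R] goodD[OF assms(1) _ h(1)] goodD[OF assms(1) _ gh] h(2) F(2) by blast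
  moreover have "Q (\<lambda>(i, c). z (f i) c) = Q (\<lambda>(i, c). z (f (h (h' i))) c)" for f
    by (rule codef_dep[OF Q typed_seq[OF assms(2)]]) (use hh' in auto)
  from this[of "\<lambda>i. i"] this[of g]
  have "R (\<lambda>(k, c). z (h k) c) = Q (\<lambda>(i, c). z i c)" "R (\<lambda>(k, c). z (g (h k)) c) = Q (\<lambda>(i, c). z (g i) c)"
    by (simp_all add: R_def case_prod_beta')
  ultimately show "Q (\<lambda>(i, c). z i c) = Q (\<lambda>(i, c). z (g i) c)" by simp
qed

text \<open>A maximal consistent set of requirements plays the role of an Ehrenfeucht-Mostowski
  type: it decides every formula on increasing tuples, so any sequence meeting it is indiscernible.
  The given requirements \<open>Rq\<close> survive because they are the starting point of the
  maximisation.\<close>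

proposition indiscernible_extraction:
  assumes C: "finite C" and Rq: "Rq \<subseteq> reqs \<sigma> C" "consistent \<sigma> C Rq"
  obtains z :: "rat \<Rightarrow> 'c \<Rightarrow> 'a" where
    "ftyped \<sigma> C z" "good UNIV z Rq" "ind (wf_fm L) U \<sigma> C UNIV z"
proof -
  let ?A = "{Rq'. Rq \<subseteq> Rq' \<and> Rq' \<subseteq> reqs \<sigma> C \<and> consistent \<sigma> C Rq'}"
  have "\<exists>M\<in>?A. \<forall>X\<in>?A. M \<subseteq> X \<longrightarrow> X = M"
  proof (rule subset_Zorn_nonempty)
    show "?A \<noteq> {}" using Rq by auto
    fix \<C> assume \<C>: "\<C> \<noteq> {}" "subset.chain ?A \<C>"
    then have sub: "\<C> \<subseteq> ?A" by (auto simp: subset_chain_def)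
    have "consistent \<sigma> C (\<Union>\<C>)"
      unfolding consistent_def
    proof (intro allI impI)
      fix n Rq0 assume *: "finite Rq0" "Rq0 \<subseteq> \<Union>\<C>"
      obtain R where "R \<in> \<C>" "Rq0 \<subseteq> R"
        using finite_subset_Union_chain[OF * \<C>(1)] \<C>(2) by auto
      then show "\<exists>z::nat \<Rightarrow> _. ftyped \<sigma> C z \<and> good {..<n} z Rq0"
        using sub *(1) unfolding consistent_def by blast
    qed
    then show "\<Union>\<C> \<in> ?A" using sub \<C>(1) by blast
  qed
  then obtain M where M: "Rq \<subseteq> M" "M \<subseteq> reqs \<sigma> C" "consistent \<sigma> C M"
    "\<And>X. M \<subseteq> X \<Longrightarrow> X \<subseteq> reqs \<sigma> C \<Longrightarrow> consistent \<sigma> C X \<Longrightarrow> X = M" by auto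
  note compl = consistent_maximal[OF M(4) M(2,3)]
  obtain z :: "rat \<Rightarrow> _" where z: "ftyped \<sigma> C z" "good UNIV z M"
    using good_total[OF C M(2,3) compl] by blast
  show thesis
  proof (rule that[OF z(1)])
    show "good UNIV z Rq" using z(2) M(1) by (auto simp: good_def)
    show "ind (wf_fm L) U \<sigma> C UNIV z" by (rule complete_ind[OF z(2,1) compl])
  qed
qed

end

section \<open>NIP and alternation\<close>

lemma ind_eq:
  fixes z :: "'i::linorder \<Rightarrow> 'c \<Rightarrow> 'a" and a b :: "'j::linorder \<Rightarrow> 'i"
  assumes z: "ind K U \<sigma> C X z" "\<And>i. typed U \<sigma> C (z i)"
    and F: "finite F" "strict_mono_on F a" "strict_mono_on F b" "a ` F \<subseteq> X" "b ` F \<subseteq> X"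
    and Q: "dfn K U (\<lambda>(i, c). \<sigma> c) (F \<times> C) Q"
  shows "Q (\<lambda>(j, c). z (a j) c) = Q (\<lambda>(j, c). z (b j) c)"
proof -
  obtain a' where a': "strict_mono_on (a ` F) a'" "\<And>x. x \<in> F \<Longrightarrow> a' (a x) = x" "a' ` a ` F = F"
    using strict_mono_on_inverse[OF F(2)] by metis
  have Q': "dfn K U (\<lambda>(i, c). \<sigma> c) (a ` F \<times> C) (\<lambda>e. Q (\<lambda>(j, c). e (a j, c)))"
    by (rule codef_reindex[OF Q]) auto
  have "strict_mono_on (a ` F) (\<lambda>i. b (a' i))"
    by (rule strict_mono_on_compose[OF a'(1) F(3)]) (use a'(3) in auto)
  moreover have "(\<lambda>i. b (a' i)) ` a ` F \<subseteq> X" using a'(2) F(5) by auto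
  moreover have "finite (a ` F)" using F(1) by simp
  ultimately have "Q (\<lambda>(j, c). z (a j) c) = Q (\<lambda>(j, c). z (b (a' (a j))) c)"
    using z(1)[unfolded ind_def, rule_format, OF _ F(4) _ _ Q'] by (simp add: case_prod_beta')
  also have "\<dots> = Q (\<lambda>(j, c). z (b j) c)"
    by (rule codef_dep[OF Q]) (use z(2) a'(2) in \<open>auto simp: typed_def\<close>)
  finally show ?thesis .
qed

lemma ind_subseq:
  fixes z :: "'i::linorder \<Rightarrow> 'c \<Rightarrow> 'a" and a :: "'j::linorder \<Rightarrow> 'i"
  assumes z: "ind K U \<sigma> C X z" "\<And>i. typed U \<sigma> C (z i)"
    and a: "strict_mono_on Y a" "a ` Y \<subseteq> X"
  shows "ind K U \<sigma> C Y (\<lambda>j. z (a j))"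
  unfolding ind_def
proof (intro allI impI)
  fix F Q g assume F: "finite F" "F \<subseteq> Y" "strict_mono_on F g" "g ` F \<subseteq> Y"
    and Q: "dfn K U (\<lambda>(i, c). \<sigma> c) (F \<times> C) Q"
  have "strict_mono_on F a" using a(1) F(2) by (meson strict_mono_on_def subsetD)
  moreover have "strict_mono_on F (\<lambda>i. a (g i))" by (rule strict_mono_on_compose[OF F(3) a(1) F(4)])
  moreover have "a ` F \<subseteq> X" "(\<lambda>i. a (g i)) ` F \<subseteq> X" using a(2) F(2,4) by blast+
  ultimately show "Q (\<lambda>(i, c). z (a i) c) = Q (\<lambda>(i, c). z (a (g i)) c)"
    by (intro ind_eq[OF z F(1) _ _ _ _ Q])
qed

lemma (in fm_class) codef_pattern:
  fixes \<sigma> :: "'c \<Rightarrow> 's"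
  assumes "finite D" "C \<inter> D = {}" "codef K A B \<sigma> (C \<union> D) P Q"
    and ne: "\<And>s. carrier A s \<noteq> {}" "\<And>s. carrier B s \<noteq> {}"
  shows "codef K A B (\<lambda>(k, c). \<sigma> c) ({..<m::nat} \<times> C)
    (\<lambda>e. \<exists>f. typed A \<sigma> D f \<and> (\<forall>k<m. P (override_on (\<lambda>c. e (k, c)) f D) = (k \<in> S)))
    (\<lambda>e. \<exists>f. typed B \<sigma> D f \<and> (\<forall>k<m. Q (override_on (\<lambda>c. e (k, c)) f D) = (k \<in> S)))"
proof -
  \<comment> \<open>The tuples occupy the rows below \<open>m\<close>; row \<open>m\<close> is free
    and holds the parameters common to all of them.\<close>
  let ?V = "{m} \<times> D" and ?W = "{..<m} \<times> C" and ?\<sigma> = "\<lambda>(k, c). \<sigma> c"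
  let ?h = "\<lambda>k v. (if v \<in> D then m else k, v)"
  have "codef K A B ?\<sigma> (?W \<union> ?V) (\<lambda>e. P (\<lambda>v. e (?h k v))) (\<lambda>e. Q (\<lambda>v. e (?h k v)))"
    if "k < m" for k
    by (rule codef_rename[OF assms(3)]) (use that in auto)
  then have c: "codef K A B ?\<sigma> ?W
      (\<lambda>e. \<exists>f. typed A ?\<sigma> ?V f \<and> (\<forall>k\<in>{..<m}. P (\<lambda>v. override_on e f ?V (?h k v)) = (k \<in> S)))
      (\<lambda>e. \<exists>f. typed B ?\<sigma> ?V f \<and> (\<forall>k\<in>{..<m}. Q (\<lambda>v. override_on e f ?V (?h k v)) = (k \<in> S)))"
    by (intro codef_exs codef_ball codef_iff_const) (use assms(1) ne in auto)
  have eq: "(\<exists>f. typed A ?\<sigma> ?V f \<and> (\<forall>k\<in>{..<m}. P (\<lambda>v. override_on e f ?V (?h k v)) = (k \<in> S)))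
    = (\<exists>f. typed A \<sigma> D f \<and> (\<forall>k<m. P (override_on (\<lambda>c. e (k, c)) f D) = (k \<in> S)))"
    for P and A :: "('s, 'f, 'r, 'z) struct" and e :: "nat \<times> 'c \<Rightarrow> 'z"
  proof
    assume "\<exists>f. typed A ?\<sigma> ?V f \<and> (\<forall>k\<in>{..<m}. P (\<lambda>v. override_on e f ?V (?h k v)) = (k \<in> S))"
    then obtain f where f: "typed A ?\<sigma> ?V f"
      "\<forall>k\<in>{..<m}. P (\<lambda>v. override_on e f ?V (?h k v)) = (k \<in> S)" by blast
    have "(\<lambda>v. override_on e f ?V (?h k v)) = override_on (\<lambda>c. e (k, c)) (\<lambda>v. f (m, v)) D" if "k < m" for k
      using that by (auto simp: override_on_def fun_eq_iff)
    with f show "\<exists>f. typed A \<sigma> D f \<and> (\<forall>k<m. P (override_on (\<lambda>c. e (k, c)) f D) = (k \<in> S))"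
      by (intro exI[of _ "\<lambda>v. f (m, v)"]) (auto simp: typed_def)
  next
    assume "\<exists>f. typed A \<sigma> D f \<and> (\<forall>k<m. P (override_on (\<lambda>c. e (k, c)) f D) = (k \<in> S))"
    then obtain f where f: "typed A \<sigma> D f"
      "\<forall>k<m. P (override_on (\<lambda>c. e (k, c)) f D) = (k \<in> S)" by blast
    have "(\<lambda>v. override_on e (\<lambda>(k, v). f v) ?V (?h k v)) = override_on (\<lambda>c. e (k, c)) f D" if "k < m" for k
      using that by (auto simp: override_on_def fun_eq_iff)
    with f show "\<exists>f. typed A ?\<sigma> ?V f \<and> (\<forall>k\<in>{..<m}. P (\<lambda>v. override_on e f ?V (?h k v)) = (k \<in> S))"
      by (intro exI[of _ "\<lambda>(k, v). f v"]) (auto simp: typed_def)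
  qed
  show ?thesis using c unfolding eq .
qed

context saturated_struct
begin

text \<open>NIP forbids infinite shattered families, and compactness turns this into a uniform
  finite bound. Realising every finite pattern is a requirement in the sense of \<open>good\<close>,
  because it passes to subsequences.\<close>

lemma nip_bound:
  assumes nip: "nip L U" and C: "finite C" "finite D" "C \<inter> D = {}" and P: "Def \<sigma> (C \<union> D) P"
  shows "\<exists>n. \<forall>z. ftyped \<sigma> C z \<longrightarrow>
    (\<exists>S. \<not> (\<exists>f. typed U \<sigma> D f \<and> (\<forall>k<n::nat. P (override_on (z k) f D) = (k \<in> S))))"
proof (rule ccontr)
  let ?pat = "\<lambda>n S e. \<exists>f. typed U \<sigma> D f \<and> (\<forall>k<n::nat. P (override_on (\<lambda>c. e (k, c)) f D) = (k \<in> S))"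
  assume "\<not> ?thesis"
  then have sh: "\<exists>z. ftyped \<sigma> C z \<and> (\<forall>S. ?pat n S (\<lambda>(k, c). z k c))" for n by auto
  let ?Rq = "{(m, ?pat m S) | m S. True}"
  have "(m, ?pat m S) \<in> reqs \<sigma> C" for m S
    using codef_pattern[OF C(2,3) P nonempty nonempty] unfolding reqs_def by simp
  then have sub: "?Rq \<subseteq> reqs \<sigma> C" by blast
  have cons: "consistent \<sigma> C ?Rq"
    unfolding consistent_def
  proof (intro allI impI)
    fix n Rq0 assume Rq0: "finite Rq0" "Rq0 \<subseteq> ?Rq"
    obtain z where z: "ftyped \<sigma> C z" "\<And>S. ?pat n S (\<lambda>(k, c). z k c)" using sh by blast
    have "good {..<n} z Rq0"
    proof (rule goodI)
      fix m R g assume *: "(m, R) \<in> Rq0" "strict_mono_on {..<m} g" "g ` {..<m} \<subseteq> {..<n}"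
      then obtain S where R: "R = ?pat m S" using Rq0(2) by blast
      \<comment> \<open>Cutting \<open>S\<close> out of a subsequence means cutting the image of
        \<open>S\<close> out of the whole sequence.\<close>
      obtain f where f: "typed U \<sigma> D f"
        "\<forall>k<n. P (override_on (z k) f D) = (k \<in> g ` (S \<inter> {..<m}))"
        using z(2)[of "g ` (S \<inter> {..<m})"] by auto
      have "P (override_on (z (g k)) f D) = (k \<in> S)" if "k < m" for k
      proof -
        have "g k \<in> g ` (S \<inter> {..<m}) \<longleftrightarrow> k \<in> S"
          using that strict_mono_on_imp_inj_on[OF *(2)] by (auto dest: inj_onD)
        then show ?thesis using f(2) *(3) that by auto
      qed
      then show "R (\<lambda>(k, c). z (g k) c)" unfolding R using f(1) by auto
    qed
    then show "\<exists>z::nat \<Rightarrow> _. ftyped \<sigma> C z \<and> good {..<n} z Rq0" using z(1) by blast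
  qed
  obtain z :: "rat \<Rightarrow> _" where z: "ftyped \<sigma> C z" "good UNIV z ?Rq"
    using indiscernible_extraction[OF C(1) sub cons] by blast
  define a where "a k = z (of_nat k)" for k
  have pat: "?pat m S (\<lambda>(k, c). a k c)" for m S
    unfolding a_def by (rule goodD[OF z(2), of m _ of_nat]) (auto simp: strict_mono_on_def)
  have at: "ftyped \<sigma> C a" using z(1) by (simp add: a_def)
  \<comment> \<open>Saturation passes from the finite initial parts of a pattern to the whole
    infinite pattern, which is what \<open>nip\<close> excludes.\<close>
  have "\<exists>f. typed U \<sigma> D f \<and> (\<forall>k. P (override_on (a k) f D) = (k \<in> S))" for S
  proof -
    let ?V = "{0::nat} \<times> D" and ?W = "(UNIV :: nat set) \<times> C" and ?\<sigma> = "\<lambda>(k, c). \<sigma> c"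
    let ?h = "\<lambda>k v. (if v \<in> D then 0 else k, v)"
    let ?P = "\<lambda>k e. P (\<lambda>v. e (?h k v)) = (k \<in> S)"
    let ?e = "\<lambda>(k, c). a k c"
    have eq: "?P k (override_on ?e f ?V) = (P (override_on (a k) (\<lambda>v. f (0, v)) D) = (k \<in> S))" for k f
    proof -
      have "(\<lambda>v. override_on ?e f ?V (?h k v)) = override_on (a k) (\<lambda>v. f (0, v)) D"
        using C(3) by (auto simp: override_on_def fun_eq_iff)
      then show ?thesis by simp
    qed
    have "\<exists>f. typed U ?\<sigma> ?V f \<and> (\<forall>P\<in>range ?P. P (override_on ?e f ?V))"
    proof (rule saturation)
      show "finite ?V" "?V \<inter> ?W = {}" using C by auto
      show "countable ?W" using countable_SIGMA[of "UNIV :: nat set" "\<lambda>_. C"] countable_finite[OF C(1)] by simp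
      show "typed U ?\<sigma> ?W ?e" using at by (auto simp: typed_def)
      show "Def ?\<sigma> (?W \<union> ?V) Q" if "Q \<in> range ?P" for Q
      proof -
        obtain k where "Q = ?P k" using \<open>Q \<in> range ?P\<close> by blast
        then show ?thesis by (auto intro!: codef_iff_const codef_rename[OF P])
      qed
      fix \<Sigma>0 assume \<Sigma>0: "finite \<Sigma>0" "\<Sigma>0 \<subseteq> range ?P"
      obtain I where I: "finite I" "\<Sigma>0 = ?P ` I" using finite_subset_image[OF \<Sigma>0] by blast
      obtain m where m: "I \<subseteq> {..<m}" using I(1) finite_nat_iff_bounded by blast
      obtain f where f: "typed U \<sigma> D f" "\<forall>k<m. P (override_on (a k) f D) = (k \<in> S)"
        using pat[of m S] by auto
      show "\<exists>f. typed U ?\<sigma> ?V f \<and> (\<forall>P\<in>\<Sigma>0. P (override_on ?e f ?V))"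
      proof (intro exI conjI ballI)
        show "typed U ?\<sigma> ?V (\<lambda>(k, v). f v)" using f(1) by (auto simp: typed_def)
        fix Q assume "Q \<in> \<Sigma>0"
        then obtain k where "k \<in> I" "Q = ?P k" using I(2) by blast
        then show "Q (override_on ?e (\<lambda>(k, v). f v) ?V)" using eq f(2) m by auto
      qed
    qed
    then obtain f where "typed U ?\<sigma> ?V f" "\<forall>P\<in>range ?P. P (override_on ?e f ?V)" by blast
    then show ?thesis using eq by (intro exI[of _ "\<lambda>v. f (0, v)"]) (auto simp: typed_def)
  qed
  then obtain b where b: "\<And>S. typed U \<sigma> D (b S)" "\<And>S k. P (override_on (a k) (b S) D) = (k \<in> S)"
    by metis
  obtain vs \<phi> where vs: "set vs \<subseteq> C \<union> D" "wf_fm L (map \<sigma> vs) \<phi>"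
    "\<And>e. typed U \<sigma> (C \<union> D) e \<Longrightarrow> P e = sat U (map e vs) \<phi>"
    using P unfolding codef_def by blast
  obtain cl dl where cl: "set cl = C" "set dl = D" using C finite_list by metis
  have sub: "set vs \<subseteq> set (cl @ dl)" using vs(1) cl by simp
  let ?\<phi> = "relist \<phi> vs (cl @ dl)"
  have A1: "wf_fm L (map \<sigma> cl @ map \<sigma> dl) ?\<phi>" using K_relist[OF vs(2) sub] by simp
  have A2: "map (a i) cl \<in> tuples (elems U) (map \<sigma> cl)" for i
    using at cl by (auto simp: tuples_def elems_def typed_def list_all2_conv_all_nth)
  have A3: "map (b S) dl \<in> tuples (elems U) (map \<sigma> dl)" for S
    using b(1) cl by (auto simp: tuples_def elems_def typed_def list_all2_conv_all_nth)
  have A4: "sat U (map (a i) cl @ map (b S) dl) ?\<phi> = (i \<in> S)" for i S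
  proof -
    have "map (a i) cl @ map (b S) dl = map (override_on (a i) (b S) D) (cl @ dl)"
      using cl C(3) by (auto simp: override_on_def)
    moreover have "typed U \<sigma> (C \<union> D) (override_on (a i) (b S) D)"
      using at b(1) by (auto simp: typed_def override_on_def)
    ultimately show ?thesis
      using b(2)[of i S] vs(3) sat_relist[OF vs(2) sub] by metis
  qed
  have "\<exists>ss ts \<phi> (a :: nat \<Rightarrow> 'a list) (b :: nat set \<Rightarrow> 'a list). wf_fm L (ss @ ts) \<phi> \<and>
      (\<forall>i. a i \<in> tuples (elems U) ss) \<and> (\<forall>S. b S \<in> tuples (elems U) ts) \<and>
      (\<forall>i S. sat U (a i @ b S) \<phi> \<longleftrightarrow> i \<in> S)"
    by (rule exI[of _ "map \<sigma> cl"], rule exI[of _ "map \<sigma> dl"], rule exI[of _ ?\<phi>],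
        rule exI[of _ "\<lambda>i. map (a i) cl"], rule exI[of _ "\<lambda>S. map (b S) dl"])
      (intro conjI allI A1 A2 A3 A4)
  with nip show False unfolding nip_def by contradiction
qed

end

text \<open>
  The class \<open>K\<close> consists of the small formulas. In contrast to \<open>wf_fm L\<close>, it need not contain the
  atomic formulas.
\<close>

locale small_class = saturated_struct L U \<kappa> + small: fm_class L K
  for L :: "('s, 'f, 'r) lang" and U :: "('s, 'f, 'r, 'a) struct" and \<kappa> :: "'k rel"
    and K :: "'s list \<Rightarrow> ('s, 'f, 'r) fm \<Rightarrow> bool" +
  assumes nip: "nip L U"
begin

abbreviation SDef where "SDef \<equiv> dfn K U"

lemma SDef_Def: "SDef \<sigma> W P \<Longrightarrow> Def \<sigma> W P"
  unfolding codef_def using small.K_wf by blast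

definition smalls :: "('c \<Rightarrow> 's) \<Rightarrow> 'c set \<Rightarrow> (nat \<times> ((nat \<times> 'c \<Rightarrow> 'a) \<Rightarrow> bool)) set" where
  "smalls \<sigma> C = {(m, Q). SDef (\<lambda>(k, c). \<sigma> c) ({..<m} \<times> C) Q}"

text \<open>
  \<open>\<chi> n S\<close> is a necessary condition, expressed by a small formula, for \<open>P\<close> to cut out \<open>S\<close> from \<open>n\<close>
  tuples. The last clause bounds the sets shattered by the conditions and not only those shattered by \<open>P\<close>.
\<close>

definition tame :: "('c \<Rightarrow> 's) \<Rightarrow> 'c set \<Rightarrow> 'c set \<Rightarrow> (('c \<Rightarrow> 'a) \<Rightarrow> bool) \<Rightarrow> bool" where
  "tame \<sigma> C D P \<longleftrightarrow> (\<exists>\<chi>::nat \<Rightarrow> nat set \<Rightarrow> (nat \<times> 'c \<Rightarrow> 'a) \<Rightarrow> bool.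
     (\<forall>n S. (n, \<chi> n S) \<in> smalls \<sigma> C) \<and>
     (\<forall>n S z f. ftyped \<sigma> C z \<longrightarrow> typed U \<sigma> D f \<longrightarrow>
        (\<forall>k<n. P (override_on (z k) f D) = (k \<in> S)) \<longrightarrow> \<chi> n S (\<lambda>(k, c). z k c)) \<and>
     (\<exists>n. \<forall>z. ftyped \<sigma> C z \<longrightarrow> (\<exists>S. \<not> \<chi> n S (\<lambda>(k, c). z k c))))"

text \<open>The pattern formula of a small predicate is itself small and serves as its own necessary
  condition.\<close>

lemma tame_SDef:
  fixes \<sigma> :: "'c \<Rightarrow> 's"
  assumes "finite C" "finite D" "C \<inter> D = {}" "SDef \<sigma> (C \<union> D) P"
  shows "tame \<sigma> C D P"
  unfolding tame_def
proof -
  let ?pat = "\<lambda>n S e. \<exists>f. typed U \<sigma> D f \<and> (\<forall>k<n::nat. P (override_on (\<lambda>c. e (k, c)) f D) = (k \<in> S))"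
  have 1: "(n, ?pat n S) \<in> smalls \<sigma> C" for n S
    using small.codef_pattern[OF assms(2,3,4) nonempty nonempty] unfolding smalls_def by simp
  have 2: "\<exists>n. \<forall>z. ftyped \<sigma> C z \<longrightarrow> (\<exists>S. \<not> ?pat n S (\<lambda>(k, c). z k c))"
    using nip_bound[OF nip assms(1-3) SDef_Def[OF assms(4)]] by simp
  show "\<exists>\<chi>::nat \<Rightarrow> nat set \<Rightarrow> (nat \<times> 'c \<Rightarrow> 'a) \<Rightarrow> bool.
     (\<forall>n S. (n, \<chi> n S) \<in> smalls \<sigma> C) \<and>
     (\<forall>n S z f. ftyped \<sigma> C z \<longrightarrow> typed U \<sigma> D f \<longrightarrow>
        (\<forall>k<n. P (override_on (z k) f D) = (k \<in> S)) \<longrightarrow> \<chi> n S (\<lambda>(k, c). z k c)) \<and>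
     (\<exists>n. \<forall>z. ftyped \<sigma> C z \<longrightarrow> (\<exists>S. \<not> \<chi> n S (\<lambda>(k, c). z k c)))"
    by (rule exI[of _ ?pat]) (use 1 2 in auto)
qed

section \<open>Alternation along sequences indiscernible for small formulas\<close>

definition no_alt :: "('c \<Rightarrow> 's) \<Rightarrow> 'c set \<Rightarrow> 'c set \<Rightarrow> (('c \<Rightarrow> 'a) \<Rightarrow> bool) \<Rightarrow> bool" where
  "no_alt \<sigma> C D P \<longleftrightarrow> (\<forall>(z :: nat \<Rightarrow> 'c \<Rightarrow> 'a) f. ftyped \<sigma> C z \<longrightarrow> typed U \<sigma> D f \<longrightarrow>
     ind K U \<sigma> C UNIV z \<longrightarrow> \<not> (\<forall>k. P (override_on (z k) f D) = even k))"

text \<open>An alternating sequence contains, for every \<open>S\<close>, a subsequence from which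
  \<open>P\<close> cuts out \<open>S\<close>. The necessary conditions are small, so they do not
  notice the passage to the subsequence and hold for all \<open>S\<close> on the first
  \<open>n\<close> tuples, against the bound.\<close>

lemma tame_no_alt:
  fixes \<sigma> :: "'c \<Rightarrow> 's"
  assumes "tame \<sigma> C D P"
  shows "no_alt \<sigma> C D P"
  unfolding no_alt_def
proof (intro allI impI notI)
  fix z :: "nat \<Rightarrow> 'c \<Rightarrow> 'a" and f
  assume z: "ftyped \<sigma> C z" "typed U \<sigma> D f" "ind K U \<sigma> C UNIV z"
    "\<forall>k. P (override_on (z k) f D) = even k"
  from assms[unfolded tame_def] obtain \<chi> n where \<chi>': "\<forall>n S. (n, \<chi> n S) \<in> smalls \<sigma> C"
    "\<forall>n S z f. ftyped \<sigma> C z \<longrightarrow> typed U \<sigma> D f \<longrightarrow>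
        (\<forall>k<n. P (override_on (z k) f D) = (k \<in> S)) \<longrightarrow> \<chi> n S (\<lambda>(k, c). z k c)"
    and n: "\<forall>z. ftyped \<sigma> C z \<longrightarrow> (\<exists>S. \<not> \<chi> n S (\<lambda>(k, c). z k c))"
    by (elim exE conjE)
  note \<chi> = \<chi>'(1)[rule_format] \<chi>'(2)[rule_format]
  have "\<chi> n S (\<lambda>(k, c). z k c)" for S
  proof -
    \<comment> \<open>One index is taken from each pair \<open>2 * k\<close>,
      \<open>2 * k + 1\<close>: the even one, where \<open>P\<close> holds, exactly for
      \<open>k\<close> in \<open>S\<close>.\<close>
    let ?g = "\<lambda>k. 2 * k + (if k \<in> S then 0 else 1)"
    have "\<chi> n S (\<lambda>(k, c). z (?g k) c)"
      by (rule \<chi>(2)[OF _ z(2), of "\<lambda>k. z (?g k)"]) (use z in auto)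
    moreover have "\<chi> n S (\<lambda>(k, c). z (?g k) c) = \<chi> n S (\<lambda>(k, c). z k c)"
    proof (rule ind_eq[OF z(3), where F = "{..<n}" and a = ?g and b = "\<lambda>k. k" and Q = "\<chi> n S"])
      show "SDef (\<lambda>(k, c). \<sigma> c) ({..<n} \<times> C) (\<chi> n S)" using \<chi>(1)[of n S] by (simp add: smalls_def)
      show "strict_mono_on {..<n} ?g" by (rule strict_mono_onI) auto
      show "strict_mono_on {..<n} (\<lambda>k. k)" by (rule strict_mono_onI)
    qed (use z(1) in auto)
    ultimately show ?thesis by simp
  qed
  then show False using n z(1) by blast
qed

text \<open>
  In a sequence \<open>x\<close>, the families \<open>x i (False, _)\<close> and \<open>x i (True, _)\<close> are two tuples of the same
  sorts; \<open>\<epsilon>\<close> selects one of the two tuples at each index, and \<open>A m \<epsilon>\<close> says which selections at \<open>m\<close>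
  indices are required to realise the same small type.
\<close>

definition mix_ind ::
  "(nat \<Rightarrow> (nat \<Rightarrow> bool) \<Rightarrow> bool) \<Rightarrow> ('c \<Rightarrow> 's) \<Rightarrow> 'c set \<Rightarrow> ('i::linorder \<Rightarrow> bool \<times> 'c \<Rightarrow> 'a) \<Rightarrow> bool" where
  "mix_ind A \<sigma> C x \<longleftrightarrow> (\<forall>m Q g g' \<epsilon> \<epsilon>'. (m, Q) \<in> smalls \<sigma> C \<longrightarrow> A m \<epsilon> \<longrightarrow> A m \<epsilon>' \<longrightarrow>
     strict_mono_on {..<m} g \<longrightarrow> strict_mono_on {..<m} g' \<longrightarrow>
     Q (\<lambda>(k, c). x (g k) (\<epsilon> k, c)) = Q (\<lambda>(k, c). x (g' k) (\<epsilon>' k, c)))"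

abbreviation all_mixes :: "nat \<Rightarrow> (nat \<Rightarrow> bool) \<Rightarrow> bool" where
  "all_mixes \<equiv> \<lambda>_ _. True"

lemma mix_eq:
  fixes x :: "'i::linorder \<Rightarrow> bool \<times> 'c \<Rightarrow> 'a" and a b :: "'j::linorder \<Rightarrow> 'i"
  assumes x: "mix_ind A \<sigma> C x" "ftyped (\<lambda>(\<epsilon>, c). \<sigma> c) (UNIV \<times> C) x"
    and F: "finite F" "strict_mono_on F a" "strict_mono_on F b"
    and Q: "SDef (\<lambda>(i, c). \<sigma> c) (F \<times> C) Q"
    and A: "\<And>h. strict_mono_on {..<card F} h \<Longrightarrow> h ` {..<card F} = F \<Longrightarrow>
      A (card F) (\<lambda>k. \<epsilon> (h k)) \<and> A (card F) (\<lambda>k. \<epsilon>' (h k))"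
  shows "Q (\<lambda>(j, c). x (a j) (\<epsilon> j, c)) = Q (\<lambda>(j, c). x (b j) (\<epsilon>' j, c))"
proof -
  obtain h :: "nat \<Rightarrow> 'j" where h: "strict_mono_on {..<card F} h" "h ` {..<card F} = F"
    using enum_finite[OF F(1)] .
  obtain h' where h': "strict_mono_on F h'" "\<And>x. x < card F \<Longrightarrow> h' (h x) = x" "h' ` F = {..<card F}"
    using strict_mono_on_inverse[OF h(1)] h(2) by (metis lessThan_iff)
  have hh': "h (h' i) = i" if "i \<in> F" for i using that h(2) h'(2) by (metis imageE lessThan_iff)
  have Q': "(card F, \<lambda>e. Q (\<lambda>(i, c). e (h' i, c))) \<in> smalls \<sigma> C"
    unfolding smalls_def using h'(3) by (auto intro!: codef_reindex[OF Q])
  have ah: "strict_mono_on {..<card F} (\<lambda>k. a (h k))" "strict_mono_on {..<card F} (\<lambda>k. b (h k))"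
    using strict_mono_on_compose[OF h(1) F(2)] strict_mono_on_compose[OF h(1) F(3)] h(2) by auto
  have "Q (\<lambda>(i, c). x (a (h (h' i))) (\<epsilon> (h (h' i)), c)) = Q (\<lambda>(i, c). x (b (h (h' i))) (\<epsilon>' (h (h' i)), c))"
    using x(1)[unfolded mix_ind_def, rule_format, OF Q' _ _ ah, where \<epsilon> = "\<lambda>k. \<epsilon> (h k)" and \<epsilon>' = "\<lambda>k. \<epsilon>' (h k)"]
      A[OF h] by simp
  moreover have "Q (\<lambda>(i, c). x (a (h (h' i))) (\<epsilon> (h (h' i)), c)) = Q (\<lambda>(j, c). x (a j) (\<epsilon> j, c))" for a \<epsilon>
    by (rule codef_dep[OF Q]) (use x(2) hh' in \<open>auto simp: typed_def\<close>)
  ultimately show ?thesis by simp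
qed

lemma mix_ind_ind:
  fixes x :: "'i::linorder \<Rightarrow> bool \<times> 'c \<Rightarrow> 'a" and a :: "'j::linorder \<Rightarrow> 'i"
  assumes x: "mix_ind all_mixes \<sigma> C x" "ftyped (\<lambda>(\<epsilon>, c). \<sigma> c) (UNIV \<times> C) x" and a: "strict_mono_on X a"
  shows "ind K U \<sigma> C X (\<lambda>j c. x (a j) (\<epsilon> j, c))"
  unfolding ind_def
proof (intro allI impI)
  fix F Q g assume F: "finite F" "F \<subseteq> X" "strict_mono_on F g" "g ` F \<subseteq> X"
    and Q: "SDef (\<lambda>(i, c). \<sigma> c) (F \<times> C) Q"
  have "strict_mono_on F a" using a F(2) by (meson strict_mono_on_def subsetD)
  moreover have "strict_mono_on F (\<lambda>i. a (g i))" by (rule strict_mono_on_compose[OF F(3) a F(4)])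
  ultimately show "Q (\<lambda>(i, c). x (a i) (\<epsilon> i, c)) = Q (\<lambda>(i, c). x (a (g i)) (\<epsilon> (g i), c))"
    by (rule mix_eq[OF x F(1) _ _ Q]) auto
qed

end

section \<open>Sequences of pairs of tuples\<close>

text \<open>Supplies infinitely many substitutes for the index \<open>t\<close>, beginning with
  \<open>t\<close> itself, that lie in the same order relation to the other members of
  \<open>F\<close>. Indiscernibility then moves \<open>t\<close> along \<open>s\<close> while
  parameters indexed by \<open>F\<close> stay fixed.\<close>

lemma gap_seq:
  fixes t :: rat
  assumes "finite F"
  shows "\<exists>s :: nat \<Rightarrow> rat. strict_mono s \<and> s 0 = t \<and>
    (\<forall>i\<in>F. \<forall>k. (i < t \<longrightarrow> i < s k) \<and> (t < i \<longrightarrow> s k < i))"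
proof -
  define \<delta> where "\<delta> = Min (insert 1 ((\<lambda>i. i - t) ` {i \<in> F. t < i}))"
  have fin: "finite (insert 1 ((\<lambda>i. i - t) ` {i \<in> F. t < i}))" using assms by simp
  have \<delta>: "0 < \<delta>" unfolding \<delta>_def by (subst Min_gr_iff[OF fin]) auto
  have le: "\<delta> \<le> i - t" if "i \<in> F" "t < i" for i
    unfolding \<delta>_def by (rule Min_le[OF fin]) (use that in auto)
  \<comment> \<open>Increases from \<open>t\<close> towards \<open>t + \<delta>\<close> without
    reaching it, and \<delta> is at most the distance to the next member of
    \<open>F\<close>.\<close>
  define s where "s k = t + \<delta> * (1 - 1 / (of_nat k + 1))" for k :: nat
  have "strict_mono s"
  proof (rule strict_mono_Suc_iff[THEN iffD2, rule_format])
    fix k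
    have "1 / (of_nat (Suc k) + 1 :: rat) < 1 / (of_nat k + 1)"
      by (rule divide_strict_left_mono) auto
    then show "s k < s (Suc k)" using \<delta> unfolding s_def by simp
  qed
  moreover have "t \<le> s k" "s k < t + \<delta>" for k
    using \<delta> by (auto simp: s_def field_simps)
  moreover have "s 0 = t" by (simp add: s_def)
  moreover have "s k < i" if "i \<in> F" "t < i" for i k
    using le[OF that] \<open>s k < t + \<delta>\<close> by simp
  ultimately show ?thesis using less_le_trans by blast
qed

context small_class
begin

abbreviation pairs :: "'c set \<Rightarrow> 'c set \<Rightarrow> (bool \<times> 'c) set" where
  "pairs C D \<equiv> UNIV \<times> C \<union> {False} \<times> D"

text \<open>
  The components \<open>(False, d)\<close> with \<open>d \<in> D\<close> are parameters, not depending on the index; those with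
  \<open>d \<in> E\<close> are additional components of the first tuple.
\<close>

definition pair_approx ::
  "(nat \<Rightarrow> (nat \<Rightarrow> bool) \<Rightarrow> bool) \<Rightarrow> ('c \<Rightarrow> 's) \<Rightarrow> 'c set \<Rightarrow> 'c set \<Rightarrow> 'c set \<Rightarrow> (('c \<Rightarrow> 'a) \<Rightarrow> bool) \<Rightarrow> (('c \<Rightarrow> 'a) \<Rightarrow> bool) \<Rightarrow>
   nat \<Rightarrow> (nat \<times> ((nat \<times> 'c \<Rightarrow> 'a) \<Rightarrow> bool)) set \<Rightarrow> (nat \<Rightarrow> bool \<times> 'c \<Rightarrow> 'a) \<Rightarrow> bool" where
  "pair_approx A \<sigma> C D E P1 P2 n \<Delta> y \<longleftrightarrow>
     ftyped (\<lambda>(\<epsilon>, c). \<sigma> c) (pairs C (D \<union> E)) y \<and>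
     (\<forall>i<n. P1 (\<lambda>v. y i (False, v)) \<and> P2 (\<lambda>v. y i (v \<in> C, v))) \<and>
     (\<forall>d\<in>D. \<forall>i<n. \<forall>j<n. y i (False, d) = y j (False, d)) \<and>
     (\<forall>m Q g g' \<epsilon> \<epsilon>'. (m, Q) \<in> \<Delta> \<longrightarrow> A m \<epsilon> \<longrightarrow> A m \<epsilon>' \<longrightarrow>
        strict_mono_on {..<m} g \<longrightarrow> strict_mono_on {..<m} g' \<longrightarrow>
        g ` {..<m} \<subseteq> {..<n} \<longrightarrow> g' ` {..<m} \<subseteq> {..<n} \<longrightarrow>
        Q (\<lambda>(k, c). y (g k) (\<epsilon> k, c)) \<longrightarrow> Q (\<lambda>(k, c). y (g' k) (\<epsilon>' k, c)))"

text \<open>A requirement sees an increasing tuple of whole pairs. A property distinguishing the two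
  tuples at one index is therefore a legitimate requirement and survives the extraction.\<close>

lemma pair_extraction:
  fixes \<sigma> :: "'c \<Rightarrow> 's"
  assumes fin: "finite C" "finite D" "finite E" and disj: "C \<inter> (D \<union> E) = {}"
    and P1: "Def \<sigma> (C \<union> D \<union> E) P1" and P2: "Def \<sigma> (C \<union> D) P2"
    and ex: "\<And>n \<Delta>. finite \<Delta> \<Longrightarrow> \<Delta> \<subseteq> smalls \<sigma> C \<Longrightarrow> \<exists>y. pair_approx A \<sigma> C D E P1 P2 n \<Delta> y"
  obtains x :: "rat \<Rightarrow> bool \<times> 'c \<Rightarrow> 'a" where
    "ftyped (\<lambda>(\<epsilon>, c). \<sigma> c) (pairs C (D \<union> E)) x"
    "ind (wf_fm L) U (\<lambda>(\<epsilon>, c). \<sigma> c) (pairs C (D \<union> E)) UNIV x"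
    "\<And>i. P1 (\<lambda>v. x i (False, v))" "\<And>i. P2 (\<lambda>v. x i (v \<in> C, v))"
    "\<And>d i j. d \<in> D \<Longrightarrow> x i (False, d) = x j (False, d)"
    "mix_ind A \<sigma> C x"
proof -
  let ?\<sigma> = "\<lambda>(\<epsilon>::bool, c). \<sigma> c" and ?C = "pairs C (D \<union> E)"
  define R1 :: "(nat \<times> ((nat \<times> bool \<times> 'c \<Rightarrow> 'a) \<Rightarrow> bool)) set" where
    "R1 = {(1, \<lambda>e. P1 (\<lambda>v. e (0, False, v))), (1, \<lambda>e. P2 (\<lambda>v. e (0, v \<in> C, v)))}"
  define R2 :: "(nat \<times> ((nat \<times> bool \<times> 'c \<Rightarrow> 'a) \<Rightarrow> bool)) set" where
    "R2 = (\<lambda>d. (2, \<lambda>e. e (0, False, d) = e (1, False, d))) ` D"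
  define mixr :: "((nat \<times> 'c \<Rightarrow> 'a) \<Rightarrow> bool) \<Rightarrow> (nat \<Rightarrow> bool) \<Rightarrow> (nat \<Rightarrow> bool) \<Rightarrow> (nat \<times> bool \<times> 'c \<Rightarrow> 'a) \<Rightarrow> bool" where
    "mixr Q \<epsilon> \<epsilon>' e \<longleftrightarrow> (Q (\<lambda>(k, c). e (k, \<epsilon> k, c)) \<longrightarrow> Q (\<lambda>(k, c). e (k, \<epsilon>' k, c)))" for Q \<epsilon> \<epsilon>' e
  \<comment> \<open>A requirement sees a single tuple of indices, so only two selections at the same
    indices can be compared here. The comparison of different indices comes from the
    indiscernibility of the extracted sequence.\<close>
  define R3 where "R3 = {(m, mixr Q \<epsilon> \<epsilon>') | m Q \<epsilon> \<epsilon>'. (m, Q) \<in> smalls \<sigma> C \<and> A m \<epsilon> \<and> A m \<epsilon>'}"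
  let ?Rq = "R1 \<union> R2 \<union> R3"
  have r1: "R1 \<subseteq> reqs ?\<sigma> ?C"
  proof -
    have "Def (\<lambda>(k, c). ?\<sigma> c) ({..<1::nat} \<times> ?C) (\<lambda>e. P1 (\<lambda>v. e (0, False, v)))"
      by (rule codef_rename[OF P1, where h = "\<lambda>v. (0, False, v)"]) auto
    moreover have "Def (\<lambda>(k, c). ?\<sigma> c) ({..<1::nat} \<times> ?C) (\<lambda>e. P2 (\<lambda>v. e (0, v \<in> C, v)))"
      by (rule codef_rename[OF P2, where h = "\<lambda>v. (0, v \<in> C, v)"]) (use disj in auto)
    ultimately show ?thesis by (simp add: R1_def reqs_def)
  qed
  have r2: "R2 \<subseteq> reqs ?\<sigma> ?C"
  proof -
    have "Def (\<lambda>(k, c). ?\<sigma> c) ({..<2::nat} \<times> ?C) (\<lambda>e. e (0, False, d) = e (1, False, d))" if "d \<in> D" for d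
      by (rule codef_eq) (use that in auto)
    then show ?thesis by (auto simp: R2_def reqs_def)
  qed
  have r3: "R3 \<subseteq> reqs ?\<sigma> ?C"
  proof -
    have "Def (\<lambda>(k, c). ?\<sigma> c) ({..<m} \<times> ?C) (mixr Q \<epsilon> \<epsilon>')" if "(m, Q) \<in> smalls \<sigma> C" for m Q \<epsilon> \<epsilon>'
    proof -
      have Q: "Def (\<lambda>(k, c). \<sigma> c) ({..<m} \<times> C) Q" using that SDef_Def by (auto simp: smalls_def)
      have "Def (\<lambda>(k, c). ?\<sigma> c) ({..<m} \<times> ?C) (\<lambda>e. Q (\<lambda>v. e ((\<lambda>(k, c). (k, \<epsilon> k, c)) v)))" for \<epsilon>
        by (rule codef_rename[OF Q]) auto
      from codef_imp[OF this[of \<epsilon>] this[of \<epsilon>']] show ?thesis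
        unfolding mixr_def by (simp add: case_prod_beta')
    qed
    then show ?thesis by (auto simp: R3_def reqs_def)
  qed
  have cons: "consistent ?\<sigma> ?C ?Rq"
    unfolding consistent_def
  proof (intro allI impI)
    fix n Rq0 assume Rq0: "finite Rq0" "Rq0 \<subseteq> ?Rq"
    have "\<forall>r\<in>Rq0 \<inter> R3. \<exists>q. q \<in> smalls \<sigma> C \<and> (\<exists>\<epsilon> \<epsilon>'. A (fst q) \<epsilon> \<and> A (fst q) \<epsilon>' \<and> r = (fst q, mixr (snd q) \<epsilon> \<epsilon>'))"
      by (fastforce simp: R3_def)
    from bchoice[OF this] obtain q where q: "\<And>r. r \<in> Rq0 \<inter> R3 \<Longrightarrow>
        q r \<in> smalls \<sigma> C \<and> (\<exists>\<epsilon> \<epsilon>'. A (fst (q r)) \<epsilon> \<and> A (fst (q r)) \<epsilon>' \<and> r = (fst (q r), mixr (snd (q r)) \<epsilon> \<epsilon>'))" by blast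
    have "finite (q ` (Rq0 \<inter> R3))" "q ` (Rq0 \<inter> R3) \<subseteq> smalls \<sigma> C" using Rq0(1) q by auto
    from ex[OF this, of n] obtain y where "pair_approx A \<sigma> C D E P1 P2 n (q ` (Rq0 \<inter> R3)) y" by blast
    note * = this[unfolded pair_approx_def]
    note y1 = *[THEN conjunct1] and y2 = *[THEN conjunct2, THEN conjunct1]
      and y3 = *[THEN conjunct2, THEN conjunct2, THEN conjunct1]
      and y4 = *[THEN conjunct2, THEN conjunct2, THEN conjunct2, rule_format]
    have "good {..<n} y Rq0"
    proof (rule goodI)
      fix m R g assume R: "(m, R) \<in> Rq0" and g: "strict_mono_on {..<m} g" "g ` {..<m} \<subseteq> {..<n}"
      from R Rq0(2) consider "(m, R) \<in> R1" | "(m, R) \<in> R2" | "(m, R) \<in> R3" by blast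
      then show "R (\<lambda>(k, c). y (g k) c)"
      proof cases
        case 1
        then show ?thesis using y2 g(2) by (auto simp: R1_def)
      next
        case 2
        then obtain d where d: "d \<in> D" "m = 2" "R = (\<lambda>e. e (0, False, d) = e (1, False, d))"
          by (auto simp: R2_def)
        then have "g 0 < n" "g 1 < n" using g(2) by (auto simp: image_subset_iff)
        then have "y (g 0) (False, d) = y (g 1) (False, d)" using d(1) y3 by blast
        then show ?thesis unfolding d(3) by simp
      next
        case 3
        then obtain \<epsilon> \<epsilon>' where qe: "m = fst (q (m, R))" "R = mixr (snd (q (m, R))) \<epsilon> \<epsilon>'"
          and A: "A m \<epsilon>" "A m \<epsilon>'" using q[of "(m, R)"] R by auto
        have "(m, snd (q (m, R))) \<in> q ` (Rq0 \<inter> R3)"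
          using R 3 qe(1) by (metis IntI image_eqI prod.collapse)
        from y4[OF this A g(1) g(1) g(2) g(2)]
        show ?thesis by (subst qe(2)) (simp add: mixr_def)
      qed
    qed
    then show "\<exists>z::nat \<Rightarrow> _. ftyped ?\<sigma> ?C z \<and> good {..<n} z Rq0" using y1 by blast
  qed
  have finC: "finite ?C" using fin by auto
  have sub: "?Rq \<subseteq> reqs ?\<sigma> ?C" using r1 r2 r3 by simp
  obtain x :: "rat \<Rightarrow> _" where x: "ftyped ?\<sigma> ?C x" "good UNIV x ?Rq" "ind (wf_fm L) U ?\<sigma> ?C UNIV x"
    using indiscernible_extraction[OF finC sub cons] by blast
  have one: "strict_mono_on {..<1::nat} (\<lambda>_. i::rat)" for i by (auto simp: strict_mono_on_def)
  have D: "x i (False, d) = x j (False, d)" if "d \<in> D" "i < j" for d i j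
    using goodD[OF x(2), of 2 "\<lambda>e. e (0, False, d) = e (1, False, d)" "\<lambda>k. if k = 0 then i else j"] that
    by (auto simp: R2_def strict_mono_on_def)
  show thesis
  proof (rule that[OF x(1,3)])
    show "P1 (\<lambda>v. x i (False, v))" for i
      using goodD[OF x(2) _ one, of "\<lambda>e. P1 (\<lambda>v. e (0, False, v))" i] by (simp add: R1_def)
    show "P2 (\<lambda>v. x i (v \<in> C, v))" for i
      using goodD[OF x(2) _ one, of "\<lambda>e. P2 (\<lambda>v. e (0, v \<in> C, v))" i] by (simp add: R1_def)
    show "x i (False, d) = x j (False, d)" if "d \<in> D" for d i j
      using D[OF that, of i j] D[OF that, of j i] by (metis linorder_less_linear)
    have imp: "Q (\<lambda>(k, c). x (g' k) (\<epsilon>' k, c))"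
      if Q: "(m, Q) \<in> smalls \<sigma> C" and g: "strict_mono_on {..<m} g" "strict_mono_on {..<m} g'"
        and A: "A m \<epsilon>" "A m \<epsilon>'" and tr: "Q (\<lambda>(k, c). x (g k) (\<epsilon> k, c))" for m Q g g' \<epsilon> \<epsilon>'
    proof -
      have "(m, mixr Q \<epsilon> \<epsilon>') \<in> ?Rq" using Q A by (auto simp: R3_def)
      from goodD[OF x(2) this g(1)] tr have "Q (\<lambda>(k, c). x (g k) (\<epsilon>' k, c))" by (simp add: mixr_def)
      moreover have "(\<lambda>e. Q (\<lambda>(k, c). e (k, \<epsilon>' k, c))) (\<lambda>(k, c). x (g k) c)
          = (\<lambda>e. Q (\<lambda>(k, c). e (k, \<epsilon>' k, c))) (\<lambda>(k, c). x (g' k) c)"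
      proof (rule ind_eq[OF x(3), where F = "{..<m}" and a = g and b = g'
            and Q = "\<lambda>e. Q (\<lambda>(k, c). e (k, \<epsilon>' k, c))"])
        have "Def (\<lambda>(k, c). \<sigma> c) ({..<m} \<times> C) Q" using Q SDef_Def by (auto simp: smalls_def)
        then have "Def (\<lambda>(k, c). ?\<sigma> c) ({..<m} \<times> ?C) (\<lambda>e. Q (\<lambda>v. e ((\<lambda>(k, c). (k, \<epsilon>' k, c)) v)))"
          by (rule codef_rename) auto
        then show "Def (\<lambda>(k, c). ?\<sigma> c) ({..<m} \<times> ?C) (\<lambda>e. Q (\<lambda>(k, c). e (k, \<epsilon>' k, c)))"
          by (simp add: case_prod_beta')
      qed (use x(1) g in auto)
      ultimately show ?thesis by simp
    qed
    show "mix_ind A \<sigma> C x" unfolding mix_ind_def using imp by blast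
  qed
qed

definition finite_alt ::
  "('c \<Rightarrow> 's) \<Rightarrow> 'c set \<Rightarrow> 'c set \<Rightarrow> (('c \<Rightarrow> 'a) \<Rightarrow> bool) \<Rightarrow> nat \<Rightarrow>
   (nat \<times> ((nat \<times> 'c \<Rightarrow> 'a) \<Rightarrow> bool)) set \<Rightarrow> (nat \<Rightarrow> 'c \<Rightarrow> 'a) \<Rightarrow> ('c \<Rightarrow> 'a) \<Rightarrow> bool" where
  "finite_alt \<sigma> C D P n \<Delta> z f \<longleftrightarrow>
     ftyped \<sigma> C z \<and> typed U \<sigma> D f \<and> (\<forall>k<2 * n. P (override_on (z k) f D) = even k) \<and>
     (\<forall>m Q g g'. (m, Q) \<in> \<Delta> \<longrightarrow> strict_mono_on {..<m} g \<longrightarrow> strict_mono_on {..<m} g' \<longrightarrow>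
        g ` {..<m} \<subseteq> {..<2 * n} \<longrightarrow> g' ` {..<m} \<subseteq> {..<2 * n} \<longrightarrow>
        Q (\<lambda>(k, c). z (g k) c) \<longrightarrow> Q (\<lambda>(k, c). z (g' k) c))"

text \<open>Compactness for non-alternation: arbitrarily long finite alternations, indiscernible for
  finitely many small formulas at a time, would yield an infinite one. Consecutive entries are
  joined into pairs to protect the alternation from the extraction; a mixture of such pairs is again
  an increasing subsequence, so all mixtures have the same small type.\<close>

lemma no_alt_finite:
  fixes \<sigma> :: "'c \<Rightarrow> 's"
  assumes na: "no_alt \<sigma> C D P" and P: "Def \<sigma> (C \<union> D) P"
    and fin: "finite C" "finite D" and disj: "C \<inter> D = {}"
    and ex: "\<And>n \<Delta>. finite \<Delta> \<Longrightarrow> \<Delta> \<subseteq> smalls \<sigma> C \<Longrightarrow> \<exists>z f. finite_alt \<sigma> C D P n \<Delta> z f"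
  shows False
proof -
  let ?\<sigma> = "\<lambda>(\<epsilon>::bool, c). \<sigma> c"
  have "\<exists>y. pair_approx all_mixes \<sigma> C D {} P (\<lambda>e. \<not> P e) n \<Delta> y"
    if \<Delta>: "finite \<Delta>" "\<Delta> \<subseteq> smalls \<sigma> C" for n \<Delta>
  proof -
    obtain z f where "finite_alt \<sigma> C D P n \<Delta> z f" using ex[OF \<Delta>] by blast
    note * = this[unfolded finite_alt_def]
    note z1 = *[THEN conjunct1] and f = *[THEN conjunct2, THEN conjunct1]
      and z2 = *[THEN conjunct2, THEN conjunct2, THEN conjunct1]
      and z3 = *[THEN conjunct2, THEN conjunct2, THEN conjunct2, rule_format]
    define y where "y i = (\<lambda>(\<epsilon>, v). if v \<in> D then f v else z (2 * i + of_bool \<epsilon>) v)" for i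
    have ov: "typed U \<sigma> (C \<union> D) (override_on (z k) f D)" for k
      using z1 f by (auto simp: typed_def override_on_def)
    have "pair_approx all_mixes \<sigma> C D {} P (\<lambda>e. \<not> P e) n \<Delta> y"
      unfolding pair_approx_def
    proof (intro conjI allI impI ballI)
      show "typed U ?\<sigma> (pairs C (D \<union> {})) (y i)" for i
        using z1 f by (auto simp: typed_def y_def)
      have "(\<lambda>v. y i (False, v)) = override_on (z (2 * i)) f D" for i
        by (auto simp: y_def override_on_def fun_eq_iff)
      then show "P (\<lambda>v. y i (False, v))" if "i < n" for i using z2 that by auto
      have "P (\<lambda>v. y i (v \<in> C, v)) = P (override_on (z (2 * i + 1)) f D)" for i
        by (rule codef_dep[OF P ov, symmetric]) (use disj in \<open>auto simp: y_def override_on_def\<close>)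
      then show "\<not> P (\<lambda>v. y i (v \<in> C, v))" if "i < n" for i using z2 that by auto
      show "y i (False, d) = y j (False, d)" if "d \<in> D" for d i j using that by (simp add: y_def)
      fix m Q g g' \<epsilon> \<epsilon>'
      assume Q: "(m, Q) \<in> \<Delta>" and g: "strict_mono_on {..<m} g" "g ` {..<m} \<subseteq> {..<n}"
        and g': "strict_mono_on {..<m} g'" "g' ` {..<m} \<subseteq> {..<n}"
        and tr: "Q (\<lambda>(k, c). y (g k) (\<epsilon> k, c))"
      have Q': "SDef (\<lambda>(k, c). \<sigma> c) ({..<m} \<times> C) Q" using Q \<Delta>(2) by (auto simp: smalls_def)
      have eq: "Q (\<lambda>(k, c). z (2 * g k + of_bool (\<epsilon> k)) c) = Q (\<lambda>(k, c). y (g k) (\<epsilon> k, c))" for g \<epsilon>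
        by (rule codef_dep[OF Q']) (use z1 disj in \<open>auto simp: typed_def y_def\<close>)
      have sm: "strict_mono_on {..<m} (\<lambda>k. 2 * g k + of_bool (\<epsilon> k))"
        if "strict_mono_on {..<m} g" for g :: "nat \<Rightarrow> nat" and \<epsilon>
      proof (rule strict_mono_onI)
        fix r s assume "r \<in> {..<m}" "s \<in> {..<m}" "r < s"
        then have "g r < g s" using that by (auto simp: strict_mono_on_def)
        then show "2 * g r + of_bool (\<epsilon> r) < 2 * g s + of_bool (\<epsilon> s)" by auto
      qed
      have im: "(\<lambda>k. 2 * g k + of_bool (\<epsilon> k)) ` {..<m} \<subseteq> {..<2 * n}"
        if "g ` {..<m} \<subseteq> {..<n}" for g :: "nat \<Rightarrow> nat" and \<epsilon>
        using that by (force simp: of_bool_def)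
      show "Q (\<lambda>(k, c). y (g' k) (\<epsilon>' k, c))"
        using z3[OF Q sm[OF g(1)] sm[OF g'(1)] im[OF g(2)] im[OF g'(2)], of \<epsilon> \<epsilon>'] tr
        unfolding eq by simp
    qed
    then show ?thesis by blast
  qed
  note approx = this
  have disj': "C \<inter> (D \<union> {}) = {}" and P': "Def \<sigma> (C \<union> D \<union> {}) P" using disj P by auto
  obtain x :: "rat \<Rightarrow> _" where x0: "ftyped ?\<sigma> (pairs C (D \<union> {})) x"
    and x: "\<And>i. P (\<lambda>v. x i (False, v))" "\<And>i. \<not> P (\<lambda>v. x i (v \<in> C, v))"
    "\<And>d i j. d \<in> D \<Longrightarrow> x i (False, d) = x j (False, d)" "mix_ind all_mixes \<sigma> C x"
    by (rule pair_extraction[OF fin finite.emptyI disj' P' codef_not[OF P] approx]) (assumption+, rule that)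
  note x = x0[unfolded Un_empty_right] x
  have xC: "x i (\<epsilon>, v) \<in> carrier U (\<sigma> v)" if "v \<in> C" for i \<epsilon> v
    using x(1)[rule_format, of i] that unfolding typed_def by force
  have xD: "x i (False, v) \<in> carrier U (\<sigma> v)" if "v \<in> D" for i v
    using x(1)[rule_format, of i] that unfolding typed_def by force
  have nC: "v \<notin> C" if "v \<in> D" for v using that disj by blast
  \<comment> \<open>Undoes the pairing: first tuples at even and second tuples at odd indices. All
    mixtures being equivalent, this sequence is indiscernible for small formulas.\<close>
  define z where "z k v = x (of_nat k) (odd k, v)" for k :: nat and v
  define f where "f v = x 0 (False, v)" for v
  have "ind K U \<sigma> C UNIV z"
    unfolding z_def by (rule mix_ind_ind[OF x(5)]) (use x(1) in \<open>auto simp: typed_def strict_mono_on_def\<close>)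
  moreover have "P (override_on (z k) f D) = even k" for k
  proof (cases "even k")
    case True
    have "P (\<lambda>v. x (of_nat k) (False, v)) = P (override_on (z k) f D)"
      by (rule codef_dep[OF P]) (use True xC xD x(4) in \<open>auto simp: typed_def z_def f_def override_on_def\<close>)
    then show ?thesis using True x(2) by simp
  next
    case False
    have "P (\<lambda>v. x (of_nat k) (v \<in> C, v)) = P (override_on (z k) f D)"
      by (rule codef_dep[OF P]) (use False xC xD x(4) nC in \<open>auto simp: typed_def z_def f_def override_on_def\<close>)
    then show ?thesis using False x(3) by simp
  qed
  moreover have "ftyped \<sigma> C z" "typed U \<sigma> D f" using xC xD by (auto simp: typed_def z_def f_def)
  ultimately show False using na unfolding no_alt_def by blast
qed

text \<open>
  The two tuples at an index realise the same type over the rest of the sequence: otherwise a formula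
  would separate them at all indices of a small interval, hence alternate on a mixed sequence.
\<close>

lemma mix_types_equal:
  fixes \<sigma> :: "'c \<Rightarrow> 's" and x :: "rat \<Rightarrow> bool \<times> 'c \<Rightarrow> 'a"
  defines "\<tau> \<equiv> case_sum \<sigma> (\<lambda>(i::rat, \<epsilon>::bool, c). \<sigma> c)"
  assumes x: "ftyped (\<lambda>(\<epsilon>, c). \<sigma> c) (pairs C E) x"
      "ind (wf_fm L) U (\<lambda>(\<epsilon>, c). \<sigma> c) (pairs C E) UNIV x" "mix_ind all_mixes \<sigma> C x"
    and na: "\<And>D P. finite D \<Longrightarrow> Inl ` C \<inter> D = {} \<Longrightarrow> dfn K' U \<tau> (Inl ` C \<union> D) P \<Longrightarrow>
      no_alt \<tau> (Inl ` C) D P"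
    and K': "\<And>W P. dfn K' U \<tau> W P \<Longrightarrow> Def \<tau> W P" "fm_class L K'"
    and P: "dfn K' U \<tau> (Inl ` C \<union> Inr ` ((UNIV - {t}) \<times> pairs C E)) P"
    and C: "finite C"
  shows "P (case_sum (\<lambda>c. x t (False, c)) (\<lambda>(i, c). x i c)) = P (case_sum (\<lambda>c. x t (True, c)) (\<lambda>(i, c). x i c))"
proof -
  let ?\<sigma> = "\<lambda>(\<epsilon>::bool, c). \<sigma> c" and ?C = "pairs C E"
  \<comment> \<open>\<open>K'\<close> is the class for which non-alternation is already available:
    the small formulas while the existential quantifier is treated, and all formulas
    afterwards.\<close>
  interpret K': fm_class L K' by (rule K'(2))
  obtain V P' Q' where V: "finite V" "V \<subseteq> Inl ` C \<union> Inr ` ((UNIV - {t}) \<times> ?C)"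
    and VQ: "codef K' U U \<tau> V P' Q'"
    and PP': "\<And>e. typed U \<tau> (Inl ` C \<union> Inr ` ((UNIV - {t}) \<times> ?C)) e \<Longrightarrow> P e = P' e"
    by (rule codef_finite[OF P]) (rule that)
  define D where "D = V - Inl ` C"
  have D: "finite D" "Inl ` C \<inter> D = {}" "D \<subseteq> Inr ` ((UNIV - {t}) \<times> ?C)"
    using V(1,2) unfolding D_def by (simp, blast, blast)
  have P': "dfn K' U \<tau> (Inl ` C \<union> D) P'" by (rule codef_mono[OF codef_left[OF VQ]]) (auto simp: D_def)
  define F where "F = (\<lambda>v. fst (projr v)) ` D"
  have F: "finite F" "t \<notin> F" "D \<subseteq> Inr ` (F \<times> ?C)" using D by (force simp: F_def)+
  \<comment> \<open>The parameters left in \<open>D\<close> use the finitely many indices in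
    \<open>F\<close>, and moving \<open>t\<close> to any \<open>s k\<close> crosses none of
    them.\<close>
  obtain s :: "nat \<Rightarrow> rat" where s12: "strict_mono s" "s 0 = t"
    and sF: "\<forall>i\<in>F. \<forall>k. (i < t \<longrightarrow> i < s k) \<and> (t < i \<longrightarrow> s k < i)"
    using gap_seq[OF F(1)] by blast
  have s: "strict_mono s" "s 0 = t" "\<And>i k. i \<in> F \<Longrightarrow> i < t \<Longrightarrow> i < s k"
    "\<And>i k. i \<in> F \<Longrightarrow> t < i \<Longrightarrow> s k < i" using s12 sF by blast+
  let ?x = "\<lambda>(i, c). x i c"
  have xC: "x i (\<epsilon>, v) \<in> carrier U (\<sigma> v)" if "v \<in> C" for i \<epsilon> v
    using x(1)[rule_format, of i] that unfolding typed_def by force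
  have xE: "x i w \<in> carrier U (?\<sigma> w)" if "w \<in> ?C" for i w
    using x(1) that unfolding typed_def by blast
  have inD: "\<exists>i w. v = Inr (i, w) \<and> i \<in> F \<and> w \<in> ?C" if "v \<in> D" for v
    using F(3) that by blast
  have ct: "typed U \<tau> (Inl ` C \<union> D) (case_sum (\<lambda>c. x i (\<epsilon>, c)) ?x)" for i \<epsilon>
    using xC xE unfolding typed_def \<tau>_def by (auto dest!: inD)
  define B where "B \<epsilon> k = P' (case_sum (\<lambda>c. x (s k) (\<epsilon>, c)) ?x)" for \<epsilon> k
  \<comment> \<open>Full indiscernibility of the pairs: the truth value belongs to the choice
    \<epsilon> and not to the place in the gap.\<close>
  have const: "B \<epsilon> k = B \<epsilon> 0" for \<epsilon> k
  proof -
    let ?Q = "\<lambda>e. P' (\<lambda>w. e (case_sum (\<lambda>c. (t, \<epsilon>, c)) (\<lambda>v. v) w))"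
    let ?b = "\<lambda>i. if i = t then s k else i"
    have Q: "Def (\<lambda>(i, c). ?\<sigma> c) (insert t F \<times> ?C) ?Q"
      by (rule codef_rename[OF K'(1)[OF P']]) (use F(3) in \<open>auto simp: \<tau>_def\<close>)
    have "?Q (\<lambda>(i, c). x i c) = ?Q (\<lambda>(i, c). x (?b i) c)"
    proof (rule ind_eq[OF x(2), where F = "insert t F" and a = "\<lambda>i. i" and b = ?b and Q = ?Q])
      show "strict_mono_on (insert t F) ?b"
        using s(3,4) F(2) by (intro strict_mono_onI) (auto split: if_splits)
    qed (use x(1) F(1) Q in \<open>auto simp: strict_mono_on_def\<close>)
    moreover have "?Q (\<lambda>(i, c). x (?b i) c) = B \<epsilon> k"
      unfolding B_def
      by (rule codef_dep[OF P' ct, symmetric]) (use F(2) in \<open>auto dest!: inD\<close>)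
    moreover have "?Q (\<lambda>(i, c). x i c) = B \<epsilon> 0"
      unfolding B_def s(2)
      by (rule codef_dep[OF P' ct, symmetric]) (auto dest!: inD)
    ultimately show ?thesis by simp
  qed
  \<comment> \<open>If the two choices had different truth values, taking them in turn along
    \<open>s\<close> would make \<open>P'\<close> alternate on a mixture, which is indiscernible for
    small formulas.\<close>
  have no: False if b: "B b 0" "\<not> B (\<not> b) 0" for b
  proof -
    define z where "z k = case_sum (\<lambda>c. x (s k) (if even k then b else \<not> b, c)) (\<lambda>(i, c). x i c)" for k
    have z: "ftyped \<tau> (Inl ` C) z" using xC by (auto simp: typed_def z_def \<tau>_def)
    have "ind K U \<tau> (Inl ` C) UNIV z"
      unfolding ind_def
    proof (intro allI impI)
      fix F Q and g :: "nat \<Rightarrow> nat" assume F: "finite F" "strict_mono_on F g"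
        and Q: "SDef (\<lambda>(i, c). \<tau> c) (F \<times> Inl ` C) Q"
      have Q': "SDef (\<lambda>(i, c). \<sigma> c) (F \<times> C) (\<lambda>e. Q (\<lambda>v. e (apsnd projl v)))"
        by (rule codef_rename[OF Q]) (auto simp: \<tau>_def)
      have "Q (\<lambda>v. (\<lambda>(j, c). x (s j) (if even j then b else \<not> b, c)) (apsnd projl v))
          = Q (\<lambda>v. (\<lambda>(j, c). x (s (g j)) (if even (g j) then b else \<not> b, c)) (apsnd projl v))"
      proof (rule mix_eq[OF x(3) _ F(1) _ _ Q', where a = s and b = "\<lambda>j. s (g j)"
            and \<epsilon> = "\<lambda>j. if even j then b else \<not> b" and \<epsilon>' = "\<lambda>j. if even (g j) then b else \<not> b"])
        show "strict_mono_on F s" "strict_mono_on F (\<lambda>k. s (g k))"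
          using s(1) F(2) by (auto simp: strict_mono_on_def strict_mono_def)
      qed (use x(1) in \<open>auto simp: typed_def\<close>)
      moreover have "Q (\<lambda>(i, c). z i c) = Q (\<lambda>v. (\<lambda>(j, c). x (s j) (if even j then b else \<not> b, c)) (apsnd projl v))"
        by (rule codef_dep[OF Q]) (use z in \<open>auto simp: z_def typed_def\<close>)
      moreover have "Q (\<lambda>(i, c). z (g i) c) = Q (\<lambda>v. (\<lambda>(j, c). x (s (g j)) (if even (g j) then b else \<not> b, c)) (apsnd projl v))"
        by (rule codef_dep[OF Q]) (use z in \<open>auto simp: z_def typed_def\<close>)
      ultimately show "Q (\<lambda>(i, c). z i c) = Q (\<lambda>(i, c). z (g i) c)" by simp
    qed
    moreover have "typed U \<tau> D (case_sum (\<lambda>_. undefined) ?x)"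
      using xE unfolding typed_def \<tau>_def by (auto dest!: inD)
    moreover have "P' (override_on (z k) (case_sum (\<lambda>_. undefined) ?x) D) = even k" for k
    proof -
      have "override_on (z k) (case_sum (\<lambda>_. undefined) ?x) D = z k"
        by (auto simp: override_on_def z_def fun_eq_iff dest!: inD)
      then show ?thesis using b const unfolding B_def z_def by (cases "even k") auto
    qed
    ultimately show False using na[OF D(1,2) P'] z unfolding no_alt_def by blast
  qed
  have "P (case_sum (\<lambda>c. x t (\<epsilon>, c)) ?x) = B \<epsilon> 0" for \<epsilon>
    unfolding B_def s(2) by (rule PP') (use xC xE in \<open>auto simp: typed_def \<tau>_def\<close>)
  then show ?thesis using no[of True] no[of False] by auto
qed

end

section \<open>Closure of non-alternation under connectives and quantifiers\<close>

context small_class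
begin

lemma smallsD: "q \<in> smalls \<sigma> C \<Longrightarrow> SDef (\<lambda>(k, c). \<sigma> c) ({..<fst q} \<times> C) (snd q)"
  by (cases q) (simp add: smalls_def)

lemma no_altD:
  assumes "no_alt \<sigma> C D P" "ftyped \<sigma> C z" "typed U \<sigma> D f" "ind K U \<sigma> C (UNIV :: nat set) z"
    "\<And>k. P (override_on (z k) f D) = even k"
  shows False
proof -
  have "\<not> (\<forall>k. P (override_on (z k) f D) = even k)"
    by (rule assms(1)[unfolded no_alt_def, THEN spec, THEN spec, THEN mp, THEN mp, THEN mp]) (fact assms)+
  with assms(5) show False by simp
qed

lemma no_alt_not:
  assumes "no_alt \<sigma> C D P"
  shows "no_alt \<sigma> C D (\<lambda>e. \<not> P e)"
  unfolding no_alt_def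
proof (intro allI impI notI)
  fix z f assume *: "ftyped \<sigma> C z" "typed U \<sigma> D f" "ind K U \<sigma> C (UNIV :: nat set) z"
    "\<forall>k. (\<not> P (override_on (z k) f D)) = even k"
  have "ind K U \<sigma> C (UNIV :: nat set) (\<lambda>k. z (Suc k))"
    by (rule ind_subseq[OF *(3)]) (use *(1) in \<open>auto simp: strict_mono_on_def\<close>)
  moreover have "P (override_on (z (Suc k)) f D) = even k" for k using *(4) by (metis even_Suc)
  moreover have "ftyped \<sigma> C (\<lambda>k. z (Suc k))" using *(1) by simp
  ultimately show False by (intro no_altD[OF assms _ *(2), of "\<lambda>k. z (Suc k)"])
qed

text \<open>Infinitely many failures at odd places, interleaved with the even places just before
  them, would form a strictly alternating subsequence. The finiteness statement is what makes
  conjunctions tractable.\<close>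

lemma no_alt_sparse:
  fixes z :: "nat \<Rightarrow> 'c \<Rightarrow> 'a"
  assumes na: "no_alt \<sigma> C D P"
    and z: "ftyped \<sigma> C z" "typed U \<sigma> D f" "ind K U \<sigma> C UNIV z"
    and ev: "\<And>k. even k \<Longrightarrow> P (override_on (z k) f D)"
  shows "finite {k. odd k \<and> \<not> P (override_on (z k) f D)}"
proof (rule ccontr)
  let ?O = "{k. odd k \<and> \<not> P (override_on (z k) f D)}"
  assume inf: "infinite ?O"
  let ?e = "enumerate ?O"
  have e: "odd (?e j)" "\<not> P (override_on (z (?e j)) f D)" for j
    using enumerate_in_set[OF inf, of j] by auto
  \<comment> \<open>Each failing odd index is preceded by its even predecessor. Two odd numbers
    differ by at least two, so the result is strictly increasing.\<close>
  define w where "w j = (if even j then ?e (j div 2) - 1 else ?e (j div 2))" for j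
  have "strict_mono w"
  proof (rule strict_mono_Suc_iff[THEN iffD2, rule_format])
    fix j
    show "w j < w (Suc j)"
    proof (cases "even j")
      case True
      then show ?thesis using odd_pos[OF e(1)] by (simp add: w_def)
    next
      case False
      have "?e (j div 2) < ?e (Suc (j div 2))" by (rule enumerate_step[OF inf])
      moreover have "odd (?e (j div 2))" "odd (?e (Suc (j div 2)))" by (rule e(1))+
      moreover have "a < b - 1" if "a < b" "odd a" "odd b" for a b :: nat using that by presburger
      ultimately have "?e (j div 2) < ?e (Suc (j div 2)) - 1" by blast
      then show ?thesis using False by (simp add: w_def)
    qed
  qed
  then have "ind K U \<sigma> C UNIV (\<lambda>j. z (w j))"
    by (intro ind_subseq[OF z(3)]) (use z(1) in \<open>auto simp: strict_mono_def strict_mono_on_def\<close>)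
  moreover have "P (override_on (z (w j)) f D) = even j" for j
    using e ev[of "w j"] by (auto simp: w_def)
  moreover have "ftyped \<sigma> C (\<lambda>k. z (w k))" using z(1) by simp
  ultimately show False by (intro no_altD[OF na _ z(2), of "\<lambda>j. z (w j)"])
qed

text \<open>Both conjuncts hold at all even places. At every odd place one of them fails, although
  each fails at only finitely many.\<close>

lemma no_alt_conj:
  assumes "no_alt \<sigma> C D P" "no_alt \<sigma> C D P'"
  shows "no_alt \<sigma> C D (\<lambda>e. P e \<and> P' e)"
  unfolding no_alt_def
proof (intro allI impI notI)
  fix z f assume *: "ftyped \<sigma> C z" "typed U \<sigma> D f" "ind K U \<sigma> C (UNIV :: nat set) z"
    "\<forall>k. (P (override_on (z k) f D) \<and> P' (override_on (z k) f D)) = even k"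
  have "finite ({k. odd k \<and> \<not> P (override_on (z k) f D)} \<union> {k. odd k \<and> \<not> P' (override_on (z k) f D)})"
    using no_alt_sparse[OF assms(1) *(1-3)] no_alt_sparse[OF assms(2) *(1-3)] *(4) by auto
  moreover have "{k::nat. odd k} \<subseteq>
      {k. odd k \<and> \<not> P (override_on (z k) f D)} \<union> {k. odd k \<and> \<not> P' (override_on (z k) f D)}"
    using *(4) by auto
  moreover have "infinite {k::nat. odd k}"
    by (rule infinite_super[of "range (\<lambda>k. 2 * k + 1)"]) (auto intro!: range_inj_infinite injI)
  ultimately show False using finite_subset by blast
qed

text \<open>An alternation of the quantified predicate yields pairs whose first tuples have a
  witness for \<open>P\<close> and whose second tuples have none. The two tuples at an index have
  the same small type over the others, so second tuples can be substituted at odd places and given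
  values of \<open>v\<close> such that the enlarged tuples are still indiscernible for given small
  formulas. At these places \<open>P\<close> fails whatever the values are, so \<open>P\<close>
  itself alternates.\<close>

lemma no_alt_ex:
  fixes \<sigma> :: "'c \<Rightarrow> 's"
  assumes na: "no_alt \<sigma> (insert v C) D P" and P: "Def \<sigma> (insert v C \<union> D) P"
    and v: "v \<notin> C" "v \<notin> D" and fin: "finite C" "finite D" and disj: "C \<inter> D = {}"
  shows "no_alt \<sigma> C D (\<lambda>e. \<exists>a\<in>carrier U (\<sigma> v). P (e(v := a)))"
  unfolding no_alt_def
proof (intro allI impI notI)
  let ?P = "\<lambda>e. \<exists>a\<in>carrier U (\<sigma> v). P (e(v := a))"
  let ?\<sigma> = "\<lambda>(\<epsilon>::bool, c). \<sigma> c"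
  fix z f assume z: "ftyped \<sigma> C z" "typed U \<sigma> D f" "ind K U \<sigma> C (UNIV :: nat set) z"
    and alt: "\<forall>k. ?P (override_on (z k) f D) = even k"
  have "\<forall>k. \<exists>a. a \<in> carrier U (\<sigma> v) \<and> (even k \<longrightarrow> P ((override_on (z k) f D)(v := a)))"
    using alt nonempty by blast
  then obtain w where w: "\<And>k. w k \<in> carrier U (\<sigma> v)"
    "\<And>k. even k \<Longrightarrow> P ((override_on (z k) f D)(v := w k))" by metis
  have P2: "Def \<sigma> (C \<union> D) (\<lambda>e. \<not> ?P e)"
    by (intro codef_not codef_ex) (use P in simp)
  \<comment> \<open>Two consecutive entries form a pair, and the label \<open>v\<close> stores the
    witness belonging to the even one.\<close>
  define y where "y i = (\<lambda>(\<epsilon>, u). if u = v then w (2 * i) else if u \<in> D then f u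
      else z (2 * i + of_bool \<epsilon>) u)" for i
  have nC: "u \<notin> C" if "u \<in> D" for u using that disj by blast
  have "pair_approx all_mixes \<sigma> C D {v} P (\<lambda>e. \<not> ?P e) n \<Delta> y" if \<Delta>: "\<Delta> \<subseteq> smalls \<sigma> C" for n \<Delta>
    unfolding pair_approx_def
  proof (intro conjI allI impI ballI)
    show "typed U ?\<sigma> (pairs C (D \<union> {v})) (y i)" for i
      using z(1,2) w(1) v by (auto simp: typed_def y_def)
    have "(\<lambda>u. y i (False, u)) = (override_on (z (2 * i)) f D)(v := w (2 * i))" for i
      by (auto simp: y_def override_on_def fun_eq_iff)
    then show "P (\<lambda>u. y i (False, u))" for i using w(2) by simp
    have "(\<not> ?P (\<lambda>u. y i (u \<in> C, u))) = (\<not> ?P (override_on (z (2 * i + 1)) f D))" for i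
      by (rule codef_dep[OF P2, symmetric])
        (use z(1,2) v nC in \<open>auto simp: y_def override_on_def typed_def\<close>)
    then show "\<not> ?P (\<lambda>u. y i (u \<in> C, u))" for i using alt by simp
    show "y i (False, d) = y j (False, d)" if "d \<in> D" for d i j using that v by (auto simp: y_def)
    fix m Q and g g' :: "nat \<Rightarrow> nat" and \<epsilon> \<epsilon>'
    assume Q: "(m, Q) \<in> \<Delta>" and g: "strict_mono_on {..<m} g" and g': "strict_mono_on {..<m} g'"
      and tr: "Q (\<lambda>(k, c). y (g k) (\<epsilon> k, c))"
    have Q': "SDef (\<lambda>(k, c). \<sigma> c) ({..<m} \<times> C) Q" using Q \<Delta> by (auto simp: smalls_def)
    have eq: "Q (\<lambda>(k, c). z (2 * g k + of_bool (\<epsilon> k)) c) = Q (\<lambda>(k, c). y (g k) (\<epsilon> k, c))" for g \<epsilon>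
      by (rule codef_dep[OF Q']) (use z(1) v disj in \<open>auto simp: typed_def y_def\<close>)
    have sm: "strict_mono_on {..<m} (\<lambda>k. 2 * g k + of_bool (\<epsilon> k))"
      if "strict_mono_on {..<m} g" for g :: "nat \<Rightarrow> nat" and \<epsilon>
    proof (rule strict_mono_onI)
      fix r s assume "r \<in> {..<m}" "s \<in> {..<m}" "r < s"
      then have "g r < g s" using that by (auto simp: strict_mono_on_def)
      then show "2 * g r + of_bool (\<epsilon> r) < 2 * g s + of_bool (\<epsilon> s)" by auto
    qed
    have "Q (\<lambda>(k, c). z (2 * g k + of_bool (\<epsilon> k)) c) = Q (\<lambda>(k, c). z (2 * g' k + of_bool (\<epsilon>' k)) c)"
      by (rule ind_eq[OF z(3) _ _ sm[OF g] sm[OF g'] _ _ Q']) (use z(1) in auto)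
    then show "Q (\<lambda>(k, c). y (g' k) (\<epsilon>' k, c))" using tr unfolding eq by simp
  qed
  then have approx: "\<exists>y. pair_approx all_mixes \<sigma> C D {v} P (\<lambda>e. \<not> ?P e) n \<Delta> y"
    if "finite \<Delta>" "\<Delta> \<subseteq> smalls \<sigma> C" for n \<Delta> using that by blast
  have disj': "C \<inter> (D \<union> {v}) = {}" and fin': "finite {v}" using disj v by auto
  have P1: "Def \<sigma> (C \<union> D \<union> {v}) P" using P by (simp add: Un_commute)
  obtain x :: "rat \<Rightarrow> _" where x: "ftyped ?\<sigma> (pairs C (D \<union> {v})) x"
    "ind (wf_fm L) U ?\<sigma> (pairs C (D \<union> {v})) UNIV x"
    "\<And>i. P (\<lambda>v. x i (False, v))" "\<And>i. \<not> ?P (\<lambda>v. x i (v \<in> C, v))"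
    "\<And>d i j. d \<in> D \<Longrightarrow> x i (False, d) = x j (False, d)" "mix_ind all_mixes \<sigma> C x"
    by (rule pair_extraction[OF fin fin' disj' P1 P2 approx]) (assumption+, rule that)
  have xC: "x i (\<epsilon>, u) \<in> carrier U (\<sigma> u)" if "u \<in> C" for i \<epsilon> u
    using x(1)[rule_format, of i] that unfolding typed_def by force
  have xD: "x i (False, u) \<in> carrier U (\<sigma> u)" if "u \<in> D \<or> u = v" for i u
    using x(1)[rule_format, of i] that unfolding typed_def by force
  have "\<exists>z' f'. finite_alt \<sigma> (insert v C) D P n \<Delta> z' f'"
    if \<Delta>: "finite \<Delta>" "\<Delta> \<subseteq> smalls \<sigma> (insert v C)" for n \<Delta>
  proof -
    let ?\<sigma>k = "\<lambda>(k::nat, c). \<sigma> c"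
    define G where "G m = {g \<in> {..<m} \<rightarrow>\<^sub>E {..<2 * n}. strict_mono_on {..<m} g}" for m :: nat
    have finG: "finite (G m)" for m unfolding G_def by (simp add: finite_PiE)
    \<comment> \<open>Indiscernibility of the \<open>2 * n\<close> enlarged tuples for the formulas
      in \<Delta>. Index maps come from the finite sets \<open>G\<close>, so this is a single small
      formula.\<close>
    define \<Theta> where "\<Theta> e \<longleftrightarrow> (\<forall>q\<in>\<Delta>. \<forall>g\<in>G (fst q). \<forall>g'\<in>G (fst q).
        snd q (\<lambda>(k, c). e (g k, c)) \<longrightarrow> snd q (\<lambda>(k, c). e (g' k, c)))" for e
    have "SDef ?\<sigma>k ({..<2 * n} \<times> insert v C) (\<lambda>e. snd q (\<lambda>(k, c). e (g k, c)))"
      if "q \<in> \<Delta>" "g \<in> G (fst q)" for q g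
    proof (rule codef_reindex)
      show "SDef ?\<sigma>k ({..<fst q} \<times> insert v C) (snd q)" using that \<Delta>(2) smallsD by blast
    qed (use that in \<open>auto simp: G_def\<close>)
    then have \<Theta>: "SDef ?\<sigma>k ({..<2 * n} \<times> insert v C) \<Theta>"
      unfolding \<Theta>_def by (intro small.codef_ball small.codef_imp \<Delta>(1) finG nonempty)
    define Odd where "Odd = {k. k < 2 * n \<and> odd k}"
    let ?V = "Odd \<times> {v}" and ?W = "{..<2 * n} \<times> C \<union> {k. k < 2 * n \<and> even k} \<times> {v}"
    \<comment> \<open>Only the values of \<open>v\<close> at odd indices are quantified away; at
      even indices \<open>v\<close> must remain the witness for \<open>P\<close>.\<close>
    define \<Theta>' where "\<Theta>' e \<longleftrightarrow> (\<exists>h. typed U ?\<sigma>k ?V h \<and> \<Theta> (override_on e h ?V))" for e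
    have fV: "finite ?V" by (simp add: Odd_def)
    have "?W \<union> ?V = {..<2 * n} \<times> insert v C" by (auto simp: Odd_def)
    then have \<Theta>': "SDef ?\<sigma>k ?W \<Theta>'"
      unfolding \<Theta>'_def by (intro small.codef_exs fV) (simp add: \<Theta>)
    define eT where "eT T = (\<lambda>(k, c). if c = v then x (of_nat k) (False, v) else x (of_nat k) (k \<in> T, c))"
      for T :: "nat set"
    have eTt: "typed U ?\<sigma>k ?W (eT T)" for T using xC xD v by (auto simp: typed_def eT_def)
    \<comment> \<open>Second tuples are substituted one at a time. For empty \<open>T\<close> the
      values of \<open>v\<close> are those of the extracted sequence; the aim is
      \<open>T = Odd\<close>.\<close>
    have claim: "\<Theta>' (eT T)" if "finite T" "T \<subseteq> Odd" for T
      using that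
    proof (induction T)
      case empty
      have "\<Theta> (\<lambda>(k, c). x (of_nat k) (False, c))"
        unfolding \<Theta>_def
      proof (intro ballI)
        fix q g g' assume q: "q \<in> \<Delta>" "g \<in> G (fst q)" "g' \<in> G (fst q)"
        have Q: "Def ?\<sigma>k ({..<fst q} \<times> insert v C) (snd q)"
          using q(1) \<Delta>(2) SDef_Def smallsD by blast
        let ?Q = "\<lambda>e. snd q (\<lambda>w. e (case w of (k, c) \<Rightarrow> (k, False, c)))"
        have Q': "Def (\<lambda>(k, c). ?\<sigma> c) ({..<fst q} \<times> pairs C (D \<union> {v})) ?Q"
          by (rule codef_rename[OF Q]) auto
        have "?Q (\<lambda>(k, c). x (of_nat (g k)) c) = ?Q (\<lambda>(k, c). x (of_nat (g' k)) c)"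
          by (rule ind_eq[OF x(2), where F = "{..<fst q}" and Q = ?Q])
            (use x(1) q(2,3) Q' in \<open>auto simp: G_def strict_mono_on_def\<close>)
        then show "snd q (\<lambda>(k, c). case (g k, c) of (k, c) \<Rightarrow> x (of_nat k) (False, c)) \<longrightarrow>
          snd q (\<lambda>(k, c). case (g' k, c) of (k, c) \<Rightarrow> x (of_nat k) (False, c))"
          by (simp add: case_prod_beta')
      qed
      moreover have "override_on (eT {}) (\<lambda>(k, c). x (of_nat k) (False, c)) ?V
          = (\<lambda>(k, c). x (of_nat k) (False, c))"
        by (auto simp: override_on_def eT_def fun_eq_iff)
      moreover have "typed U ?\<sigma>k ?V (\<lambda>(k, c). x (of_nat k) (False, c))"
        using xD by (auto simp: typed_def)
      ultimately show ?case unfolding \<Theta>'_def by metis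
    next
      case (insert t T)
      then have t: "t \<in> Odd" "t \<notin> T" and IH: "\<Theta>' (eT T)" by auto
      let ?\<tau> = "case_sum \<sigma> (\<lambda>(i::rat, \<epsilon>::bool, c). \<sigma> c)"
      \<comment> \<open>The tuple at \<open>t\<close> is the one being exchanged, and the rest are
        parameters at other indices. Since \<open>t\<close> is odd, its component \<open>v\<close>
        is quantified, so only labels in \<open>C\<close> remain at \<open>t\<close>.\<close>
      let ?h = "\<lambda>(k, c). if k = t then Inl c else Inr (of_nat k :: rat, c \<in> C \<and> k \<in> T, c)"
      let ?P = "\<lambda>e. \<Theta>' (\<lambda>w. e (?h w))"
      let ?x = "\<lambda>(i, c). x i c"
      have "SDef ?\<tau> (Inl ` C \<union> Inr ` ((UNIV - {of_nat t}) \<times> pairs C (D \<union> {v}))) ?P"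
        by (rule codef_rename[OF \<Theta>']) (use t(1) v in \<open>auto simp: Odd_def\<close>)
      then have "?P (case_sum (\<lambda>c. x (of_nat t) (False, c)) ?x)
          = ?P (case_sum (\<lambda>c. x (of_nat t) (True, c)) ?x)"
        by (intro mix_types_equal[OF x(1,2,6), where K' = K])
          (auto intro!: tame_no_alt tame_SDef SDef_Def fin small.fm_class_axioms)
      moreover have "?P (case_sum (\<lambda>c. x (of_nat t) (False, c)) ?x) = \<Theta>' (eT T)"
        by (rule codef_dep[OF \<Theta>' eTt, symmetric]) (use t v in \<open>auto simp: eT_def Odd_def\<close>)
      moreover have "?P (case_sum (\<lambda>c. x (of_nat t) (True, c)) ?x) = \<Theta>' (eT (insert t T))"
        by (rule codef_dep[OF \<Theta>' eTt, symmetric]) (use t v in \<open>auto simp: eT_def Odd_def\<close>)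
      ultimately show ?case using IH by simp
    qed
    have "\<Theta>' (eT Odd)" by (rule claim) (auto simp: Odd_def)
    then obtain h where h: "typed U ?\<sigma>k ?V h" "\<Theta> (override_on (eT Odd) h ?V)"
      unfolding \<Theta>'_def by blast
    define z' where "z' k c = override_on (eT Odd) h ?V (k, c)" for k c
    define f' where "f' d = x 0 (False, d)" for d
    have z't: "ftyped \<sigma> (insert v C) z'"
      using xC xD h(1) v by (auto simp: typed_def z'_def eT_def override_on_def)
    have f't: "typed U \<sigma> D f'" using xD by (auto simp: typed_def f'_def)
    have ov: "typed U \<sigma> (insert v C \<union> D) (override_on (z' k) f' D)" for k
      using z't f't by (auto simp: typed_def override_on_def)
    have "finite_alt \<sigma> (insert v C) D P n \<Delta> z' f'"
      unfolding finite_alt_def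
    proof (intro conjI z't f't allI impI)
      fix k assume k: "k < 2 * n"
      show "P (override_on (z' k) f' D) = even k"
      proof (cases "even k")
        case True
        have "P (override_on (z' k) f' D) = P (\<lambda>u. x (of_nat k) (False, u))"
          by (rule codef_dep[OF P ov])
            (use True v nC x(5)[of _ 0 "of_nat k"] in \<open>auto simp: z'_def f'_def eT_def override_on_def Odd_def\<close>)
        then show ?thesis using True x(3) by simp
      next
        case False
        then have kO: "k \<in> Odd" using k by (simp add: Odd_def)
        have "P (override_on (z' k) f' D) = P ((\<lambda>u. x (of_nat k) (u \<in> C, u))(v := h (k, v)))"
          by (rule codef_dep[OF P ov])
            (use kO v nC x(5)[of _ 0 "of_nat k"] in \<open>auto simp: z'_def f'_def eT_def override_on_def\<close>)
        moreover have "h (k, v) \<in> carrier U (\<sigma> v)" using h(1) kO by (auto simp: typed_def)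
        ultimately show ?thesis using False x(4)[of "of_nat k"] by blast
      qed
    next
      fix m Q and g g' :: "nat \<Rightarrow> nat"
      assume Q: "(m, Q) \<in> \<Delta>" and g: "strict_mono_on {..<m} g" "g ` {..<m} \<subseteq> {..<2 * n}"
        and g': "strict_mono_on {..<m} g'" "g' ` {..<m} \<subseteq> {..<2 * n}"
        and tr: "Q (\<lambda>(k, c). z' (g k) c)"
      have Q': "SDef ?\<sigma>k ({..<m} \<times> insert v C) Q" using Q \<Delta>(2) by (auto simp: smalls_def)
      have r: "restrict g {..<m} \<in> G m" if "strict_mono_on {..<m} g" "g ` {..<m} \<subseteq> {..<2 * n}"
        for g :: "nat \<Rightarrow> nat"
        using that by (auto simp: G_def strict_mono_on_def)
      have eq: "Q (\<lambda>(k, c). z' (g k) c) = Q (\<lambda>(k, c). override_on (eT Odd) h ?V (restrict g {..<m} k, c))" for g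
        by (rule codef_dep[OF Q']) (use z't in \<open>auto simp: z'_def typed_def\<close>)
      show "Q (\<lambda>(k, c). z' (g' k) c)"
        using h(2)[unfolded \<Theta>_def, rule_format, OF Q, unfolded fst_conv snd_conv, OF r[OF g] r[OF g']] tr
        unfolding eq by simp
    qed
    then show ?thesis by blast
  qed
  from no_alt_finite[OF na P _ fin(2) _ this] show False using fin(1) v disj by simp
qed

lemma no_alt_pull:
  fixes \<sigma> :: "'c \<Rightarrow> 's" and \<tau> :: "'v \<Rightarrow> 's"
  assumes na: "no_alt \<sigma> C D P"
    and h: "\<And>c. c \<in> C \<Longrightarrow> h c \<in> C' \<and> \<tau> (h c) = \<sigma> c" "\<And>d. d \<in> D \<Longrightarrow> h d \<in> D' \<and> \<tau> (h d) = \<sigma> d"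
    and disj: "C' \<inter> D' = {}"
    and P: "\<And>e. typed U \<tau> (C' \<union> D') e \<Longrightarrow> P' e = P (\<lambda>c. e (h c))"
    and dep: "\<And>e e'. (\<And>c. c \<in> C \<union> D \<Longrightarrow> e c = e' c) \<Longrightarrow> P e = P e'"
  shows "no_alt \<tau> C' D' P'"
  unfolding no_alt_def
proof (intro allI impI notI)
  fix z f assume z: "ftyped \<tau> C' z" "typed U \<tau> D' f" "ind K U \<tau> C' (UNIV :: nat set) z"
    and alt: "\<forall>k. P' (override_on (z k) f D') = even k"
  let ?z = "\<lambda>k c. z k (h c)"
  have "ftyped \<sigma> C ?z" "typed U \<sigma> D (\<lambda>c. f (h c))"
    using z(1,2) h unfolding typed_def by metis+
  moreover have "ind K U \<sigma> C UNIV ?z"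
    unfolding ind_def
  proof (intro allI impI)
    fix F Q and g :: "nat \<Rightarrow> nat" assume F: "finite F" "strict_mono_on F g" and Q: "SDef (\<lambda>(i, c). \<sigma> c) (F \<times> C) Q"
    have "SDef (\<lambda>(i, c). \<tau> c) (F \<times> C') (\<lambda>e. Q (\<lambda>v. e (apsnd h v)))"
      by (rule codef_rename[OF Q]) (use h(1) in auto)
    from z(3)[unfolded ind_def, rule_format, OF F(1) _ F(2) _ this]
    show "Q (\<lambda>(i, c). ?z i c) = Q (\<lambda>(i, c). ?z (g i) c)" by (simp add: apsnd_def case_prod_beta')
  qed
  moreover have "P (override_on (?z k) (\<lambda>c. f (h c)) D) = even k" for k
  proof -
    have "typed U \<tau> (C' \<union> D') (override_on (z k) f D')"
      using z(1,2) by (auto simp: typed_def override_on_def)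
    from P[OF this] have "P (\<lambda>c. override_on (z k) f D' (h c)) = even k" using alt by simp
    moreover have "P (\<lambda>c. override_on (z k) f D' (h c)) = P (override_on (?z k) (\<lambda>c. f (h c)) D)"
      by (rule dep) (use h disj in \<open>auto simp: override_on_def\<close>)
    ultimately show ?thesis by simp
  qed
  ultimately show False by (intro no_altD[OF na, of ?z "\<lambda>c. f (h c)"])
qed

end

section \<open>Non-alternation of arbitrary formulas\<close>

locale tame_class = small_class L U \<kappa> K
  for L :: "('s, 'f, 'r) lang" and U :: "('s, 'f, 'r, 'a) struct" and \<kappa> :: "'k rel"
    and K :: "'s list \<Rightarrow> ('s, 'f, 'r) fm \<Rightarrow> bool" +
  assumes relational: "Funs L = {}"
    and tame_atom: "\<And>(\<sigma> :: nat \<Rightarrow> 's) vs R C D. R \<in> Rels L \<Longrightarrow> map \<sigma> vs = rdom L R \<Longrightarrow>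
      finite C \<Longrightarrow> finite D \<Longrightarrow> C \<inter> D = {} \<Longrightarrow> set vs \<subseteq> C \<union> D \<Longrightarrow>
      tame \<sigma> C D (\<lambda>e. map e vs \<in> rint U R)"
begin

lemma has_sort_relational: "has_sort L \<Gamma> t s \<longleftrightarrow> (\<exists>i<length \<Gamma>. t = Var i \<and> \<Gamma> ! i = s)"
  using relational by (auto elim!: has_sort.cases intro: has_sort_Var)

text \<open>
  Replaces quantifier elimination for the Shelah expansion: only the atomic formulas need to be
  analysed by hand.
\<close>

lemma no_alt_fm:
  fixes \<sigma> :: "nat \<Rightarrow> 's"
  assumes "wf_fm L (map \<sigma> vs) \<phi>" "set vs \<subseteq> C \<union> D" "finite C" "finite D" "C \<inter> D = {}"
  shows "no_alt \<sigma> C D (\<lambda>e. sat U (map e vs) \<phi>)"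
  using assms
proof (induction \<phi> arbitrary: \<sigma> vs C D)
  case (Eq t u)
  then obtain i j where ij: "t = Var i" "u = Var j" "i < length vs" "j < length vs" "\<sigma> (vs ! i) = \<sigma> (vs ! j)"
    by (auto simp: has_sort_relational)
  have "vs ! i \<in> C \<union> D" "vs ! j \<in> C \<union> D" using ij Eq.prems(2) by (meson nth_mem subsetD)+
  then have "tame \<sigma> C D (\<lambda>e. e (vs ! i) = e (vs ! j))"
    by (intro tame_SDef Eq.prems small.codef_eq ij(5))
  then show ?case using ij by (simp add: tame_no_alt)
next
  case (Rel R ts)
  then have R: "R \<in> Rels L" "list_all2 (has_sort L (map \<sigma> vs)) ts (rdom L R)" by auto
  define us where "us = map (\<lambda>t. case t of Var i \<Rightarrow> vs ! i) ts"
  have ts: "\<exists>i<length vs. ts ! k = Var i \<and> \<sigma> (vs ! i) = rdom L R ! k" if "k < length ts" for k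
    using R(2) that by (auto simp: list_all2_conv_all_nth has_sort_relational)
  have len: "length ts = length (rdom L R)" using R(2) by (rule list_all2_lengthD)
  have "map \<sigma> us = rdom L R"
    by (rule nth_equalityI) (use ts len in \<open>fastforce simp: us_def\<close>)+
  moreover have "set us \<subseteq> C \<union> D"
  proof
    fix v assume "v \<in> set us"
    then obtain k where k: "k < length ts" "v = us ! k" by (auto simp: in_set_conv_nth us_def)
    then show "v \<in> C \<union> D" using ts[OF k(1)] Rel.prems(2) nth_mem by (fastforce simp: us_def)
  qed
  ultimately have "tame \<sigma> C D (\<lambda>e. map e us \<in> rint U R)"
    using tame_atom[OF R(1)] Rel.prems by blast
  moreover have "map (eval U (map e vs)) ts = map e us" for e
    by (rule nth_equalityI) (use ts in \<open>fastforce simp: us_def\<close>)+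
  ultimately show ?case by (simp add: tame_no_alt)
next
  case (Neg \<phi>)
  then show ?case by (simp add: no_alt_not)
next
  case (Conj \<phi> \<psi>)
  then show ?case by (simp add: no_alt_conj)
next
  case (Ex s \<phi>)
  obtain v where v: "v \<notin> C \<union> D" using Ex.prems(3,4) by (meson ex_new_if_finite finite_UnI infinite_UNIV_nat)
  let ?\<sigma> = "\<sigma>(v := s)"
  let ?P = "\<lambda>e. sat U (map e (v # vs)) \<phi>"
  have m: "map ?\<sigma> (v # vs) = s # map \<sigma> vs" using v Ex.prems(2) by auto
  have wf: "wf_fm L (map ?\<sigma> (v # vs)) \<phi>" unfolding m using Ex.prems(1) by simp
  have sub: "set (v # vs) \<subseteq> insert v C \<union> D" using Ex.prems(2) by auto
  have na: "no_alt ?\<sigma> (insert v C) D ?P"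
    by (rule Ex.IH[OF wf sub]) (use Ex.prems v in auto)
  have "Def ?\<sigma> (insert v C \<union> D) ?P" using wf sub unfolding codef_def by blast
  from no_alt_ex[OF na this] have "no_alt ?\<sigma> C D (\<lambda>e. \<exists>a\<in>carrier U (?\<sigma> v). ?P (e(v := a)))"
    using v Ex.prems by blast
  moreover have eq: "(\<exists>a\<in>carrier U (?\<sigma> v). ?P (e(v := a))) = sat U (map e vs) (Ex s \<phi>)" for e
  proof -
    have "map (e(v := a)) vs = map e vs" for a using v Ex.prems(2) by auto
    then show ?thesis by (simp del: map_eq_conv)
  qed
  ultimately have na': "no_alt ?\<sigma> C D (\<lambda>e. sat U (map e vs) (Ex s \<phi>))" by simp
  show ?case
  proof (rule no_alt_pull[OF na', where h = "\<lambda>v. v"])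
    show "sat U (map e vs) (Ex s \<phi>) = sat U (map e' vs) (Ex s \<phi>)"
      if "\<And>c. c \<in> C \<union> D \<Longrightarrow> e c = e' c" for e e'
    proof -
      have "map e vs = map e' vs" using that Ex.prems(2) by auto
      then show ?thesis by (simp only:)
    qed
  qed (use v Ex.prems in auto)
qed

text \<open>The induction on formulas needs fresh labels for bound variables and is therefore
  carried out with natural numbers. Arbitrary labels are replaced by their positions in the context
  of the formula.\<close>

lemma no_alt_Def:
  fixes \<tau> :: "'v \<Rightarrow> 's"
  assumes P: "Def \<tau> (C \<union> D) P" and fin: "finite C" "finite D" and disj: "C \<inter> D = {}"
  shows "no_alt \<tau> C D P"
proof -
  obtain vs \<phi> where vs: "set vs \<subseteq> C \<union> D" "wf_fm L (map \<tau> vs) \<phi>"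
    "\<And>e. typed U \<tau> (C \<union> D) e \<Longrightarrow> P e = sat U (map e vs) \<phi>"
    using P unfolding codef_def by blast
  let ?\<sigma> = "\<lambda>i. \<tau> (vs ! i)" and ?is = "[0..<length vs]"
  let ?C = "{i. i < length vs \<and> vs ! i \<in> C}" and ?D = "{i. i < length vs \<and> vs ! i \<in> D}"
  have m: "map (\<lambda>i. f (vs ! i)) ?is = map f vs" for f :: "'v \<Rightarrow> 'z"
    by (rule nth_equalityI) auto
  have sub: "set ?is \<subseteq> ?C \<union> ?D" using vs(1) nth_mem by fastforce
  have "no_alt ?\<sigma> ?C ?D (\<lambda>e. sat U (map e ?is) \<phi>)"
    by (rule no_alt_fm) (use vs(2) sub disj in \<open>auto simp: m\<close>)
  then show ?thesis
  proof (rule no_alt_pull[where h = "\<lambda>i. vs ! i"])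
    show "P e = sat U (map (\<lambda>i. e (vs ! i)) ?is) \<phi>" if "typed U \<tau> (C \<union> D) e" for e
      using vs(3)[OF that] by (simp add: m)
    show "sat U (map e ?is) \<phi> = sat U (map e' ?is) \<phi>" if "\<And>c. c \<in> ?C \<union> ?D \<Longrightarrow> e c = e' c" for e e'
    proof -
      have "map e ?is = map e' ?is" using that sub by (meson map_eq_conv subsetD)
      then show ?thesis by (simp only:)
    qed
  qed (use disj in auto)
qed

lemma mix_types_equal_all:
  fixes \<sigma> :: "'c \<Rightarrow> 's" and x :: "rat \<Rightarrow> bool \<times> 'c \<Rightarrow> 'a"
  assumes x: "ftyped (\<lambda>(\<epsilon>, c). \<sigma> c) (pairs C E) x"
      "ind (wf_fm L) U (\<lambda>(\<epsilon>, c). \<sigma> c) (pairs C E) UNIV x" "mix_ind all_mixes \<sigma> C x"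
    and C: "finite C"
    and P: "Def (case_sum \<sigma> (\<lambda>(i::rat, \<epsilon>::bool, c). \<sigma> c)) (Inl ` C \<union> Inr ` ((UNIV - {t}) \<times> pairs C E)) P"
  shows "P (case_sum (\<lambda>c. x t (False, c)) (\<lambda>(i, c). x i c)) = P (case_sum (\<lambda>c. x t (True, c)) (\<lambda>(i, c). x i c))"
  by (rule mix_types_equal[OF x _ _ fm_class_wf P C]) (auto intro: no_alt_Def C)

end

section \<open>Distality for indexed families\<close>

text \<open>Distality is stated for linearly ordered sets of tuples, whereas the constructions
  produce families indexed by rationals. The two views agree for injective families.\<close>

definition family :: "('i::linorder \<Rightarrow> 'x) \<Rightarrow> 'i set \<Rightarrow> 'x ordered_set" where
  "family T X = (T ` X, {(T i, T j) | i j. i \<in> X \<and> j \<in> X \<and> i < j})"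

lemma family_less:
  assumes "inj_on T X" "i \<in> X" "j \<in> X"
  shows "(T i, T j) \<in> snd (family T X) \<longleftrightarrow> i < j"
  using assms by (auto simp: family_def dest: inj_onD)

lemma ordered_set_family:
  assumes inj: "inj_on T X"
  shows "ordered_set (family T X)"
proof -
  have "trans (snd (family T X))"
  proof (rule transI)
    fix x y z assume "(x, y) \<in> snd (family T X)" "(y, z) \<in> snd (family T X)"
    then obtain i j j' k where "x = T i" "y = T j" "y = T j'" "z = T k"
      "i \<in> X" "j \<in> X" "j' \<in> X" "k \<in> X" "i < j" "j' < k" by (auto simp: family_def)
    moreover from this have "j = j'" using inj by (auto dest: inj_onD)
    ultimately show "(x, z) \<in> snd (family T X)"
      using family_less[OF inj, of i k] by simp
  qed
  moreover have "irrefl (snd (family T X))"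
    using inj by (auto simp: irrefl_def family_def dest: inj_onD)
  moreover have "total_on (T ` X) (snd (family T X))"
    unfolding total_on_def family_def by auto (metis linorder_less_linear)
  moreover have "snd (family T X) \<subseteq> T ` X \<times> T ` X" by (auto simp: family_def)
  ultimately show ?thesis
    by (simp add: ordered_set_def strict_linear_order_on_def family_def)
qed

lemma family_concatenation:
  assumes "\<And>i j. i \<in> X \<Longrightarrow> j \<in> Y \<Longrightarrow> i < j"
  shows "family T X \<oplus> family T Y = family T (X \<union> Y)"
proof -
  have "\<not> j < i" if "i \<in> X" "j \<in> Y" for i j using assms[OF that] by simp
  then show ?thesis
    using assms unfolding family_def concatenation_def by (auto simp: image_Un) blast
qed

lemma family_singleton: "family T {i} = singleton (T i)"
  by (auto simp: family_def singleton_def)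

lemma family_sorted:
  assumes inj: "inj_on T X" and xs: "set xs \<subseteq> T ` X" "sorted_wrt (\<lambda>x y. (x, y) \<in> snd (family T X)) xs"
  obtains rs where "set rs \<subseteq> X" "sorted_wrt (<) rs" "xs = map T rs"
proof
  let ?rs = "map (inv_into X T) xs"
  show sub: "set ?rs \<subseteq> X" using xs(1) by (auto intro: inv_into_into)
  have TT: "T (inv_into X T x) = x" if "x \<in> set xs" for x using xs(1) that by (auto intro: f_inv_into_f)
  show "xs = map T ?rs" using TT by (simp add: map_idI)
  show "sorted_wrt (<) ?rs"
    unfolding sorted_wrt_iff_nth_less
  proof (intro allI impI)
    fix i j assume ij: "i < j" "j < length ?rs"
    then have "(xs ! i, xs ! j) \<in> snd (family T X)" using xs(2) by (simp add: sorted_wrt_iff_nth_less)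
    then have "(T (?rs ! i), T (?rs ! j)) \<in> snd (family T X)" using TT ij by simp
    then show "?rs ! i < ?rs ! j" using family_less[OF inj, of "?rs ! i" "?rs ! j"] sub ij
      by (meson nth_mem order.strict_trans subsetD)
  qed
qed

context saturated_struct
begin

lemma indiscernible_family:
  fixes u :: "'i::linorder \<Rightarrow> 'c \<Rightarrow> 'a" and \<sigma> :: "'c \<Rightarrow> 's" and \<tau> :: "'d \<Rightarrow> 's"
  defines "T \<equiv> \<lambda>cl i. map (u i) cl"
  assumes inj: "inj_on (T cl) X" and cl: "set cl = C" and u: "ftyped \<sigma> C u" and d: "typed U \<tau> E d"
    and H: "\<And>F g Q. finite F \<Longrightarrow> F \<subseteq> X \<Longrightarrow> strict_mono_on F g \<Longrightarrow> g ` F \<subseteq> X \<Longrightarrow>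
      Def (case_sum (\<lambda>(i, c). \<sigma> c) \<tau>) (Inl ` (F \<times> C) \<union> Inr ` E) Q \<Longrightarrow>
      Q (case_sum (\<lambda>(i, c). u i c) d) = Q (case_sum (\<lambda>(i, c). u (g i) c) d)"
  shows "indiscernible L U ((\<lambda>v. (\<tau> v, d v)) ` E) (map \<sigma> cl) (family (T cl) X)"
  unfolding indiscernible_def
proof (intro conjI allI ballI impI)
  show "ordered_set (family (T cl) X)" by (rule ordered_set_family[OF inj])
  show "fst (family (T cl) X) \<subseteq> tuples (elems U) (map \<sigma> cl)"
    using u cl by (auto simp: family_def T_def tuples_def elems_def list_all2_conv_all_nth typed_def)
  fix xs ys \<phi> ts ds
  assume ds: "ds \<in> tuples ((\<lambda>v. (\<tau> v, d v)) ` E) ts"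
    and xs: "set xs \<subseteq> fst (family (T cl) X)" "sorted_wrt (\<lambda>x y. (x, y) \<in> snd (family (T cl) X)) xs"
    and ys: "set ys \<subseteq> fst (family (T cl) X)" "sorted_wrt (\<lambda>x y. (x, y) \<in> snd (family (T cl) X)) ys"
    and len: "length xs = length ys"
    and wf: "wf_fm L (concat (replicate (length xs) (map \<sigma> cl)) @ ts) \<phi>"
  obtain rs where rs: "set rs \<subseteq> X" "sorted_wrt (<) rs" "xs = map (T cl) rs"
    using family_sorted[OF inj _ xs(2)] xs(1) by (auto simp: family_def)
  obtain rs' where rs': "set rs' \<subseteq> X" "sorted_wrt (<) rs'" "ys = map (T cl) rs'"
    using family_sorted[OF inj _ ys(2)] ys(1) by (auto simp: family_def)
  have sm: "strict_mono_on {..<length rs} (\<lambda>k. rs ! k)" "strict_mono_on {..<length rs} (\<lambda>k. rs' ! k)"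
    using rs(2) rs'(2) len rs(3) rs'(3) by (auto simp: strict_mono_on_def sorted_wrt_iff_nth_less)
  have im: "(\<lambda>k. rs ! k) ` {..<length rs} = set rs" by (auto simp: in_set_conv_nth)
  obtain h where h: "strict_mono_on (set rs) h" "\<And>k. k < length rs \<Longrightarrow> h (rs ! k) = k"
    "h ` set rs = {..<length rs}"
    using strict_mono_on_inverse[OF sm(1)] im by (metis lessThan_iff)
  define g where "g i = rs' ! h i" for i
  have g: "strict_mono_on (set rs) g"
    unfolding g_def by (rule strict_mono_on_compose[OF h(1) sm(2)]) (simp add: h(3))
  have grs: "map g rs = rs'"
    by (rule nth_equalityI) (use len rs(3) rs'(3) h(2) in \<open>auto simp: g_def\<close>)
  have "length ds = length ts" "\<forall>k<length ts. \<exists>v\<in>E. ts ! k = \<tau> v \<and> ds ! k = d v"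
    using ds by (auto simp: tuples_def list_all2_conv_all_nth)
  then obtain l where l: "\<And>k. k < length ts \<Longrightarrow> l k \<in> E \<and> ts ! k = \<tau> (l k) \<and> ds ! k = d (l k)" by metis
  define vl where "vl = map l [0..<length ts]"
  have vl: "set vl \<subseteq> E" "ts = map \<tau> vl" "ds = map d vl"
    using l \<open>length ds = length ts\<close> by (auto simp: vl_def intro!: nth_equalityI)
  define vs where "vs = concat (map (\<lambda>i. map (\<lambda>c. Inl (i, c)) cl) rs) @ map Inr vl"
  let ?\<tau> = "case_sum (\<lambda>(i, c). \<sigma> c) \<tau>"
  have vs_map: "map f vs = concat (map (\<lambda>i. map (\<lambda>c. f (Inl (i, c))) cl) rs) @ map (\<lambda>v. f (Inr v)) vl"
    for f :: "('i \<times> 'c) + 'd \<Rightarrow> 'z"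
    by (simp add: vs_def map_concat comp_def)
  have rep: "concat (map (\<lambda>i. x) rs) = concat (replicate (length rs) x)" for x :: "'z list"
    by (induction rs) auto
  have ctx: "map ?\<tau> vs = concat (replicate (length xs) (map \<sigma> cl)) @ ts"
    using rs(3) by (simp add: vs_map rep vl(2))
  have "Def ?\<tau> (Inl ` (set rs \<times> C) \<union> Inr ` E) (\<lambda>e. sat U (map e vs) \<phi>)"
    unfolding codef_def
  proof (intro exI[of _ vs] exI[of _ \<phi>] conjI)
    show "set vs \<subseteq> Inl ` (set rs \<times> C) \<union> Inr ` E" using vl(1) cl by (auto simp: vs_def)
    show "wf_fm L (map ?\<tau> vs) \<phi>" using wf by (simp only: ctx)
  qed auto
  from H[OF _ rs(1) g _ this]
  have "sat U (map (case_sum (\<lambda>(i, c). u i c) d) vs) \<phi> = sat U (map (case_sum (\<lambda>(i, c). u (g i) c) d) vs) \<phi>"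
    using rs'(1) grs by (metis List.finite_set list.set_map)
  moreover have "map (case_sum (\<lambda>(i, c). u i c) d) vs = concat xs @ ds"
    by (simp add: vs_map rs(3) T_def vl(3))
  moreover have "map (case_sum (\<lambda>(i, c). u (g i) c) d) vs = concat ys @ ds"
    by (simp add: vs_map rs'(3) T_def vl(3) grs[symmetric] comp_def)
  ultimately show "sat U (concat xs @ ds) \<phi> = sat U (concat ys @ ds) \<phi>" by simp
qed

text \<open>Distality with \<open>b\<close> the tuple \<open>p\<close> in the place of
  \<open>t\<close>, and \<open>I\<close>, \<open>J\<close> the parts of an open rational interval on
  the two sides of \<open>t\<close>. The predicate \<chi> refutes the conclusion of
  distality.\<close>

lemma distal_replace:
  fixes u :: "rat \<Rightarrow> 'c \<Rightarrow> 'a" and \<sigma> :: "'c \<Rightarrow> 's" and \<tau> :: "'d \<Rightarrow> 's"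
  assumes dist: "distal \<kappa> L U"
    and C: "finite C" "finite E" and u: "ftyped \<sigma> C u" "typed U \<sigma> C p" "typed U \<tau> E d"
    and X: "lo < t" "t < hi" "X = {lo<..<hi}"
    and 1: "\<And>F g Q. finite F \<Longrightarrow> F \<subseteq> X \<Longrightarrow> strict_mono_on F g \<Longrightarrow> g ` F \<subseteq> X \<Longrightarrow>
      Def (\<lambda>(i, c). \<sigma> c) (F \<times> C) Q \<Longrightarrow>
      Q (\<lambda>(i, c). (u(t := p)) i c) = Q (\<lambda>(i, c). (u(t := p)) (g i) c)"
    and 2: "\<And>F g Q. finite F \<Longrightarrow> F \<subseteq> X - {t} \<Longrightarrow> strict_mono_on F g \<Longrightarrow> g ` F \<subseteq> X - {t} \<Longrightarrow>
      Def (case_sum (\<lambda>(i, c). \<sigma> c) \<tau>) (Inl ` (F \<times> C) \<union> Inr ` E) Q \<Longrightarrow>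
      Q (case_sum (\<lambda>(i, c). u i c) d) = Q (case_sum (\<lambda>(i, c). u (g i) c) d)"
    and \<chi>: "Def (case_sum \<sigma> \<tau>) (Inl ` C \<union> Inr ` E) \<chi>"
      "\<And>i. i \<in> X \<Longrightarrow> i \<noteq> t \<Longrightarrow> \<chi> (case_sum (u i) d)" "\<not> \<chi> (case_sum p d)"
  shows False
proof -
  obtain cl el where cl: "set cl = C" "set el = E" using C finite_list by metis
  let ?u = "u(t := p)"
  define T where "T i = map (?u i) cl" for i
  let ?D = "(\<lambda>v. (\<tau> v, d v)) ` E"
  have ut: "ftyped \<sigma> C ?u" using u(1,2) by simp
  have ov: "typed U (case_sum \<sigma> \<tau>) (Inl ` C \<union> Inr ` E) (case_sum (?u i) d)" for i
    using u by (auto simp: typed_def)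
  \<comment> \<open>If two members coincided, indiscernibility would make the whole family constant,
    and \<chi> could not distinguish \<open>p\<close> from the other members.\<close>
  have inj: "inj_on T X"
  proof (rule ccontr)
    assume "\<not> inj_on T X"
    then obtain i j where ij: "i \<in> X" "j \<in> X" "i < j" "T i = T j"
      unfolding inj_on_def by (metis linorder_less_linear)
    have all: "T i' = T j'" if "i' \<in> X" "j' \<in> X" "i' < j'" for i' j'
    proof -
      let ?Q = "\<lambda>e. \<forall>c\<in>C. e (i, c) = e (j, c)"
      have "Def (\<lambda>(i, c). \<sigma> c) ({i, j} \<times> C) ?Q"
        by (intro codef_ball C nonempty codef_eq) auto
      then have "?Q (\<lambda>(i, c). ?u i c) = ?Q (\<lambda>(k, c). ?u (if k = i then i' else j') c)"
      proof (intro 1[of "{i, j}" _ ?Q])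
        show "strict_mono_on {i, j} (\<lambda>k. if k = i then i' else j')"
          using ij that by (intro strict_mono_onI) (auto split: if_splits)
      qed (use ij that in auto)
      then show ?thesis using ij(3,4) cl(1) by (auto simp: T_def)
    qed
    obtain j where j: "t < j" "j < hi" using X(2) dense by blast
    then have "T t = T j" using X by (intro all) auto
    then have "\<chi> (case_sum (?u t) d) = \<chi> (case_sum (?u j) d)"
      by (intro codef_dep[OF \<chi>(1) ov]) (use cl(1) in \<open>auto simp: T_def simp del: fun_upd_apply\<close>)
    then show False using \<chi>(2)[of j] \<chi>(3) j X by auto
  qed
  let ?I = "family T {lo<..<t}" and ?J = "family T {t<..<hi}"
  have subX: "{lo<..<t} \<subseteq> X" "{t<..<hi} \<subseteq> X" "t \<in> X" "X - {t} \<subseteq> X" using X by auto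
  have XI: "{lo<..<t} \<union> {t} \<union> {t<..<hi} = X" "{lo<..<t} \<union> {t<..<hi} = X - {t}" using X by auto
  have "?I \<oplus> singleton (T t) = family T ({lo<..<t} \<union> {t})"
    unfolding family_singleton[symmetric] by (rule family_concatenation) auto
  also have "\<dots> \<oplus> ?J = family T X"
    unfolding XI(1)[symmetric] by (rule family_concatenation) auto
  finally have IbJ: "?I \<oplus> singleton (T t) \<oplus> ?J = family T X" .
  have IJ: "?I \<oplus> ?J = family T (X - {t})"
    unfolding XI(2)[symmetric] by (rule family_concatenation) auto
  have noend: "no_endpoints (family T {a<..<b})" for a b :: rat
  proof -
    have "(\<exists>y\<in>T ` {a<..<b}. (y, T i) \<in> snd (family T {a<..<b})) \<and>
        (\<exists>y\<in>T ` {a<..<b}. (T i, y) \<in> snd (family T {a<..<b}))" if i: "i \<in> {a<..<b}" for i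
    proof -
      obtain j k where "a < j" "j < i" "i < k" "k < b" using i dense by (metis greaterThanLessThan_iff)
      with i have "T j \<in> T ` {a<..<b}" "T k \<in> T ` {a<..<b}" 
        "(T j, T i) \<in> snd (family T {a<..<b})" "(T i, T k) \<in> snd (family T {a<..<b})"
        unfolding family_def by fastforce+
      then show ?thesis by blast
    qed
    then show ?thesis by (auto simp: no_endpoints_def family_def)
  qed
  have infin: "infinite (T ` {a<..<b})" if "a < b" "{a<..<b} \<subseteq> X" for a b :: rat
    using that finite_imageD[OF _ inj_on_subset[OF inj that(2)]] infinite_Ioo by blast
  have Deq: "(\<lambda>i. map (?u i) cl) = T" by (simp add: T_def fun_eq_iff)
  have H1: "indiscernible L U ((\<lambda>v::unit. (undefined, undefined)) ` {}) (map \<sigma> cl) (family (\<lambda>i. map (?u i) cl) X)"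
  proof (rule indiscernible_family[where \<tau> = "\<lambda>_. undefined"])
    show "inj_on (\<lambda>i. map (?u i) cl) X" unfolding Deq by (rule inj)
    show "typed U (\<lambda>_::unit. undefined) {} (\<lambda>_. undefined)" by (simp add: typed_def)
    fix F and g :: "rat \<Rightarrow> rat" and Q
    assume F: "finite F" "F \<subseteq> X" "strict_mono_on F g" "g ` F \<subseteq> X"
      and Q: "Def (case_sum (\<lambda>(i, c). \<sigma> c) (\<lambda>_::unit. undefined)) (Inl ` (F \<times> C) \<union> Inr ` {}) Q"
    let ?r = "\<lambda>e. case_sum e (\<lambda>_::unit. undefined :: 'a)"
    have Q': "Def (\<lambda>(i, c). \<sigma> c) (F \<times> C) (\<lambda>e. Q (\<lambda>w. e (projl w)))"
      by (rule codef_rename[OF Q]) auto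
    have eq: "Q (\<lambda>w. (\<lambda>(i, c). ?u (g i) c) (projl w)) = Q (?r (\<lambda>(i, c). ?u (g i) c))" for g
      by (rule codef_dep[OF Q]) (use ut in \<open>auto simp: typed_def\<close>)
    show "Q (?r (\<lambda>(i, c). ?u i c)) = Q (?r (\<lambda>(i, c). ?u (g i) c))"
      using 1[OF F Q'] eq[of "\<lambda>i. i"] eq[of g] by simp
  qed (use cl ut in auto)
  have H2: "indiscernible L U ?D (map \<sigma> cl) (family (\<lambda>i. map (?u i) cl) (X - {t}))"
  proof (rule indiscernible_family[OF _ cl(1) ut u(3)])
    show "inj_on (\<lambda>i. map (?u i) cl) (X - {t})" unfolding Deq using inj subX(4) by (rule inj_on_subset)
    fix F and g :: "rat \<Rightarrow> rat" and Q
    assume F: "finite F" "F \<subseteq> X - {t}" "strict_mono_on F g" "g ` F \<subseteq> X - {t}"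
      and Q: "Def (case_sum (\<lambda>(i, c). \<sigma> c) \<tau>) (Inl ` (F \<times> C) \<union> Inr ` E) Q"
    have eq: "Q (case_sum (\<lambda>(i, c). u (g i) c) d) = Q (case_sum (\<lambda>(i, c). ?u (g i) c) d)"
      if "g ` F \<subseteq> X - {t}" for g
    proof (rule codef_dep[OF Q])
      have "g i \<noteq> t" if "i \<in> F" for i using that \<open>g ` F \<subseteq> X - {t}\<close> by blast
      then show "case_sum (\<lambda>(i, c). u (g i) c) d w = case_sum (\<lambda>(i, c). ?u (g i) c) d w"
        if "w \<in> Inl ` (F \<times> C) \<union> Inr ` E" for w
        using that by auto
    qed (use u(1,3) in \<open>auto simp: typed_def\<close>)
    show "Q (case_sum (\<lambda>(i, c). ?u i c) d) = Q (case_sum (\<lambda>(i, c). ?u (g i) c) d)"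
      using 2[OF F Q] eq[of "\<lambda>i. i"] eq[of g] F(2,4) by simp
  qed
  have card: "|fst (family T X)| <o \<kappa>" "|?D| <o \<kappa>"
    using C(2) by (auto intro!: countable_less simp: family_def countable_finite)
  have Dsub: "?D \<subseteq> elems U" using u(3) by (auto simp: elems_def typed_def)
  have disj: "T ` {lo<..<t} \<inter> T ` {t<..<hi} = {}" "T t \<notin> T ` {lo<..<t} \<union> T ` {t<..<hi}"
    using inj_onD[OF inj] subX by fastforce+
  have "indiscernible L U ?D (map \<sigma> cl) (?I \<oplus> singleton (T t) \<oplus> ?J)"
  proof (rule dist[unfolded distal_def, THEN conjunct2, rule_format])
    show "ordered_set ?I" "ordered_set ?J"
      using inj_on_subset[OF inj] subX by (auto intro: ordered_set_family)
    show "infinite (fst ?I)" "infinite (fst ?J)" using infin X subX by (auto simp: family_def)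
    show "no_endpoints ?I" "no_endpoints ?J" by (rule noend)+
    show "|fst (?I \<oplus> singleton (T t) \<oplus> ?J)| <o \<kappa>" unfolding IbJ by (rule card)
    show "indiscernible L U {} (map \<sigma> cl) (?I \<oplus> singleton (T t) \<oplus> ?J)"
      using H1 unfolding IbJ Deq by simp
    show "indiscernible L U ?D (map \<sigma> cl) (?I \<oplus> ?J)" using H2 unfolding IJ Deq .
    show "?D \<subseteq> elems U" "|?D| <o \<kappa>" by (rule Dsub card)+
  qed (use disj in \<open>auto simp: family_def\<close>)
  then have ind: "indiscernible L U ?D (map \<sigma> cl) (family T X)" unfolding IbJ .
  obtain j where j: "t < j" "j < hi" using X(2) dense by blast
  then have jX: "j \<in> X" "j \<noteq> t" using X by auto
  obtain vs \<phi> where vs: "set vs \<subseteq> Inl ` C \<union> Inr ` E" "wf_fm L (map (case_sum \<sigma> \<tau>) vs) \<phi>"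
    "\<And>e. typed U (case_sum \<sigma> \<tau>) (Inl ` C \<union> Inr ` E) e \<Longrightarrow> \<chi> e = sat U (map e vs) \<phi>"
    using \<chi>(1) unfolding codef_def by blast
  let ?us = "map Inl cl @ map Inr el"
  let ?\<phi> = "relist \<phi> vs ?us"
  have sub: "set vs \<subseteq> set ?us" using vs(1) cl by auto
  have sat: "sat U (concat [T i] @ map d el) ?\<phi> = \<chi> (case_sum (?u i) d)" for i
  proof -
    have "concat [T i] @ map d el = map (case_sum (?u i) d) ?us" by (simp add: T_def)
    then show ?thesis using sat_relist[OF vs(2) sub] vs(3)[OF ov] by metis
  qed
  have "sat U (concat [T j] @ map d el) ?\<phi> = sat U (concat [T t] @ map d el) ?\<phi>"
  proof (rule ind[unfolded indiscernible_def, THEN conjunct2, THEN conjunct2, rule_format])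
    show "map d el \<in> tuples ?D (map \<tau> el)"
      using cl(2) by (auto simp: tuples_def list_all2_conv_all_nth)
    show "wf_fm L (concat (replicate (length [T j]) (map \<sigma> cl)) @ map \<tau> el) ?\<phi>"
      using K_relist[OF vs(2) sub] by (simp add: comp_def)
  qed (use jX subX in \<open>auto simp: family_def\<close>)
  then show False using sat \<chi>(2)[OF jX] \<chi>(3) jX by simp
qed

end

lemma ind_pull:
  assumes z: "ind K U \<sigma> C X z" and h: "\<And>v. v \<in> V \<Longrightarrow> h v \<in> C \<and> \<sigma> (h v) = \<tau> v"
  shows "ind K U \<tau> V X (\<lambda>i v. z i (h v))"
  unfolding ind_def
proof (intro allI impI)
  fix F Q g assume F: "finite F" "F \<subseteq> X" "strict_mono_on F g" "g ` F \<subseteq> X"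
    and Q: "dfn K U (\<lambda>(i, c). \<tau> c) (F \<times> V) Q"
  have "dfn K U (\<lambda>(i, c). \<sigma> c) (F \<times> C) (\<lambda>e. Q (\<lambda>v. e (apsnd h v)))"
    by (rule codef_rename[OF Q]) (use h in auto)
  from z[unfolded ind_def, rule_format, OF F this]
  show "Q (\<lambda>(i, c). z i (h c)) = Q (\<lambda>(i, c). z (g i) (h c))" by (simp add: apsnd_def case_prod_beta')
qed

text \<open>At most one second tuple is used: exactly the replacements that a single element
  \<open>b\<close> can account for.\<close>

abbreviation single_mixes :: "nat \<Rightarrow> (nat \<Rightarrow> bool) \<Rightarrow> bool" where
  "single_mixes \<equiv> \<lambda>m \<epsilon>. card {k. k < m \<and> \<epsilon> k} \<le> 1"

context saturated_struct
begin

text \<open>The form in which distality is applied in both cases: if \<open>p\<close> has the same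
  type as \<open>u t\<close> over the rest of the sequence, then the sequence stays indiscernible
  after the replacement.\<close>

lemma distal_swap:
  fixes u :: "rat \<Rightarrow> 'c \<Rightarrow> 'a" and \<sigma> :: "'c \<Rightarrow> 's" and \<tau> :: "'d \<Rightarrow> 's"
  assumes dist: "distal \<kappa> L U"
    and C: "finite C" "finite E" and u: "ftyped \<sigma> C u" "typed U \<sigma> C p" "typed U \<tau> E d"
    and ind: "ind (wf_fm L) U \<sigma> C UNIV u"
    and X: "lo < t" "t < hi" "X = {lo<..<hi}"
    and 1: "\<And>P. Def (\<lambda>(i, c). \<sigma> c) (X \<times> C) P \<Longrightarrow>
      P (\<lambda>(i, c). (u(t := p)) i c) = P (\<lambda>(i, c). u i c)"
    and 2: "\<And>F g Q. finite F \<Longrightarrow> F \<subseteq> X - {t} \<Longrightarrow> strict_mono_on F g \<Longrightarrow> g ` F \<subseteq> X - {t} \<Longrightarrow>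
      Def (case_sum (\<lambda>(i, c). \<sigma> c) \<tau>) (Inl ` (F \<times> C) \<union> Inr ` E) Q \<Longrightarrow>
      Q (case_sum (\<lambda>(i, c). u i c) d) = Q (case_sum (\<lambda>(i, c). u (g i) c) d)"
    and \<chi>: "Def (case_sum \<sigma> \<tau>) (Inl ` C \<union> Inr ` E) \<chi>"
      "\<And>i. i \<in> X \<Longrightarrow> i \<noteq> t \<Longrightarrow> \<chi> (case_sum (u i) d)" "\<not> \<chi> (case_sum p d)"
  shows False
proof (rule distal_replace[OF dist C u X _ 2 \<chi>])
  fix F Q and g :: "rat \<Rightarrow> rat"
  assume F: "finite F" "F \<subseteq> X" "strict_mono_on F g" "g ` F \<subseteq> X"
    and Q: "Def (\<lambda>(i, c). \<sigma> c) (F \<times> C) Q"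
  have eq: "Q (\<lambda>(i, c). (u(t := p)) (g i) c) = Q (\<lambda>(i, c). u (g i) c)" if "g ` F \<subseteq> X" for g
  proof -
    have "Def (\<lambda>(i, c). \<sigma> c) (X \<times> C) (\<lambda>e. Q (\<lambda>(i, c). e (g i, c)))"
      by (rule codef_reindex[OF Q]) (use that in auto)
    from 1[OF this] have "Q (\<lambda>(i, c). case (g i, c) of (i, c) \<Rightarrow> (u(t := p)) i c)
        = Q (\<lambda>(i, c). case (g i, c) of (i, c) \<Rightarrow> u i c)" .
    then show ?thesis unfolding split .
  qed
  have "Q (\<lambda>(i, c). u i c) = Q (\<lambda>(i, c). u (g i) c)"
    using ind[unfolded ind_def, rule_format, OF F(1) _ F(3) _ Q] by simp
  then show "Q (\<lambda>(i, c). (u(t := p)) i c) = Q (\<lambda>(i, c). (u(t := p)) (g i) c)"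
    using eq[OF F(4)] eq[of "\<lambda>i. i"] F(2) by simp
qed auto

end

section \<open>The case that all mixtures have the same small type\<close>

context tame_class
begin

text \<open>Non-alternation upgrades equality of small types to equality of full types: the second
  tuple at index 0 cannot be told from the first over the other first tuples. Over the parameters in
  \<open>D\<close>, however, \<chi> tells them apart.\<close>

lemma all_mixes_contradiction:
  fixes \<sigma> :: "'c \<Rightarrow> 's" and x :: "rat \<Rightarrow> bool \<times> 'c \<Rightarrow> 'a"
  assumes dist: "distal \<kappa> L U" and fin: "finite C" "finite D" and disj: "C \<inter> D = {}"
    and x: "ftyped (\<lambda>(\<epsilon>, c). \<sigma> c) (pairs C D) x"
      "ind (wf_fm L) U (\<lambda>(\<epsilon>, c). \<sigma> c) (pairs C D) UNIV x"
      "\<And>d i j. d \<in> D \<Longrightarrow> x i (False, d) = x j (False, d)" "mix_ind all_mixes \<sigma> C x"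
    and \<chi>: "Def \<sigma> (C \<union> D) \<chi>" "\<And>i. \<chi> (\<lambda>v. x i (False, v))" "\<And>i. \<not> \<chi> (\<lambda>v. x i (v \<in> C, v))"
  shows False
proof -
  let ?\<sigma> = "\<lambda>(\<epsilon>::bool, c). \<sigma> c" and ?X = "{-1<..<1::rat}"
  let ?u = "\<lambda>i c. x i (False, c)" and ?p = "\<lambda>c. x 0 (True, c)" and ?d = "\<lambda>v. x 0 (False, v)"
  let ?\<chi> = "\<lambda>e. \<chi> (\<lambda>v. e (if v \<in> C then Inl v else Inr v))"
  have xC: "x i (\<epsilon>, u) \<in> carrier U (\<sigma> u)" if "u \<in> C" for i \<epsilon> u
    using x(1)[rule_format, of i] that unfolding typed_def by force
  have xD: "x i (False, u) \<in> carrier U (\<sigma> u)" if "u \<in> D" for i u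
    using x(1)[rule_format, of i] that unfolding typed_def by force
  have nC: "u \<notin> C" if "u \<in> D" for u using that disj by blast
  have \<chi>': "Def (case_sum \<sigma> \<sigma>) (Inl ` C \<union> Inr ` D) ?\<chi>"
    by (rule codef_rename[OF \<chi>(1)]) auto
  have u: "ftyped \<sigma> C ?u" "typed U \<sigma> C ?p" "typed U \<sigma> D ?d" using xC xD by (auto simp: typed_def)
  show False
  proof (rule distal_swap[OF dist fin u _ _ _ refl _ _ \<chi>', where lo = "-1" and t = 0 and hi = 1])
    show "ind (wf_fm L) U \<sigma> C UNIV ?u"
      by (rule ind_pull[OF x(2), where h = "\<lambda>c. (False, c)"]) auto
    show "?\<chi> (case_sum (?u i) ?d)" for i
    proof -
      have "\<chi> (\<lambda>v. x i (False, v)) = ?\<chi> (case_sum (?u i) ?d)"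
        by (rule codef_dep[OF \<chi>(1)]) (use xC xD x(3)[of _ i 0] nC in \<open>auto simp: typed_def\<close>)
      then show ?thesis using \<chi>(2) by simp
    qed
    have "\<chi> (\<lambda>v. x 0 (v \<in> C, v)) = ?\<chi> (case_sum ?p ?d)"
      by (rule codef_dep[OF \<chi>(1)]) (use xC xD nC in \<open>auto simp: typed_def\<close>)
    then show "\<not> ?\<chi> (case_sum ?p ?d)" using \<chi>(3) by simp
  next
    fix P assume P: "Def (\<lambda>(i, c). \<sigma> c) (?X \<times> C) P"
    let ?\<tau> = "case_sum \<sigma> (\<lambda>(i::rat, \<epsilon>::bool, c). \<sigma> c)"
    let ?h = "\<lambda>(i, c). if i = 0 then Inl c else Inr (i, False, c)"
    let ?P = "\<lambda>e. P (\<lambda>w. e (?h w))"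
    have "Def ?\<tau> (Inl ` C \<union> Inr ` ((UNIV - {0}) \<times> pairs C D)) ?P"
      by (rule codef_rename[OF P]) auto
    from mix_types_equal_all[OF x(1,2,4) fin(1) this]
    have "?P (case_sum (\<lambda>c. x 0 (False, c)) (\<lambda>(i, c). x i c)) = ?P (case_sum (\<lambda>c. x 0 (True, c)) (\<lambda>(i, c). x i c))" .
    moreover have "P (\<lambda>(i, c). ?u i c) = ?P (case_sum (\<lambda>c. x 0 (False, c)) (\<lambda>(i, c). x i c))"
      by (rule codef_dep[OF P]) (use xC in \<open>auto simp: typed_def\<close>)
    moreover have "P (\<lambda>(i, c). (?u(0 := ?p)) i c) = ?P (case_sum (\<lambda>c. x 0 (True, c)) (\<lambda>(i, c). x i c))"
      by (rule codef_dep[OF P]) (use xC in \<open>auto simp: typed_def\<close>)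
    ultimately show "P (\<lambda>(i, c). (?u(0 := ?p)) i c) = P (\<lambda>(i, c). ?u i c)" by simp
  next
    fix F Q and g :: "rat \<Rightarrow> rat"
    assume F: "finite F" "strict_mono_on F g"
      and Q: "Def (case_sum (\<lambda>(i, c). \<sigma> c) \<sigma>) (Inl ` (F \<times> C) \<union> Inr ` D) Q"
    have ty: "typed U (case_sum (\<lambda>(i, c). \<sigma> c) \<sigma>) (Inl ` (F \<times> C) \<union> Inr ` D) (case_sum (\<lambda>(i, c). ?u (g i) c) ?d)" for g
      using xC xD by (auto simp: typed_def)
    show "Q (case_sum (\<lambda>(i, c). ?u i c) ?d) = Q (case_sum (\<lambda>(i, c). ?u (g i) c) ?d)"
    proof (cases "F = {}")
      case True
      show ?thesis by (rule codef_dep[OF Q ty[of "\<lambda>i. i"]]) (use True in auto)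
    next
      case False
      then obtain i0 where i0: "i0 \<in> F" by blast
      \<comment> \<open>The parameters are constant components of every member of the sequence, so
        any index in \<open>F\<close> can host them. Plain indiscernibility of the enlarged tuples
        is thus indiscernibility over the parameters.\<close>
      let ?h = "case_sum (\<lambda>(i, c). (i, False, c)) (\<lambda>v. (i0, False, v))"
      let ?Q = "\<lambda>e. Q (\<lambda>w. e (?h w))"
      have Q': "Def (\<lambda>(i, c). ?\<sigma> c) (F \<times> pairs C D) ?Q"
        by (rule codef_rename[OF Q]) (use i0 in auto)
      have "?Q (\<lambda>(i, c). x i c) = ?Q (\<lambda>(i, c). x (g i) c)"
        using x(2)[unfolded ind_def, rule_format, OF F(1) _ F(2) _ Q'] by simp
      moreover have "Q (case_sum (\<lambda>(i, c). ?u (g i) c) ?d) = ?Q (\<lambda>(i, c). x (g i) c)" for g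
        by (rule codef_dep[OF Q ty]) (use x(3)[of _ 0 "g i0"] in auto)
      from this[of g] this[of "\<lambda>i. i"] calculation show ?thesis by simp
    qed
  qed auto
qed

section \<open>The case of a minimal mixture that changes the small type\<close>

definition mixed :: "('i \<Rightarrow> bool \<times> 'c \<Rightarrow> 'a) \<Rightarrow> 'i set \<Rightarrow> 'i \<times> 'c \<Rightarrow> 'a" where
  "mixed x T = (\<lambda>(i, c). x i (i \<in> T, c))"

text \<open>The number of replacements is minimised over all index sets and formulas at once, so the
  minimality still applies after indices have been moved. Equivalence of single replacements forces
  at least two, which provides \<open>t0\<close> and \<open>t1\<close>.\<close>

lemma minimal_bad_mix:
  fixes \<sigma> :: "'c \<Rightarrow> 's" and x :: "rat \<Rightarrow> bool \<times> 'c \<Rightarrow> 'a"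
  assumes x: "ftyped (\<lambda>(\<epsilon>, c). \<sigma> c) (UNIV \<times> C) x" "ind (wf_fm L) U (\<lambda>(\<epsilon>, c). \<sigma> c) (UNIV \<times> C) UNIV x"
    and single: "mix_ind single_mixes \<sigma> C x" and bad: "\<not> mix_ind all_mixes \<sigma> C x"
  obtains X T Q t0 t1 where "finite X" "T \<subseteq> X" "t0 \<in> T" "t1 \<in> T" "t0 \<noteq> t1"
    "SDef (\<lambda>(i, c). \<sigma> c) (X \<times> C) Q" "Q (mixed x {})" "\<not> Q (mixed x T)"
    "\<And>X' T' Q'. finite X' \<Longrightarrow> T' \<subseteq> X' \<Longrightarrow> card T' < card T \<Longrightarrow> SDef (\<lambda>(i, c). \<sigma> c) (X' \<times> C) Q' \<Longrightarrow>
      Q' (mixed x T') = Q' (mixed x {})"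
proof -
  let ?\<sigma> = "\<lambda>(i::rat, c). \<sigma> c"
  define isbad where "isbad N \<longleftrightarrow> (\<exists>X T Q. finite X \<and> T \<subseteq> X \<and> card T = N \<and> SDef ?\<sigma> (X \<times> C) Q \<and>
      Q (mixed x T) \<noteq> Q (mixed x {}))" for N
  have "\<exists>N. isbad N"
  proof (rule ccontr)
    assume no: "\<not> (\<exists>N. isbad N)"
    have sel: "Q (\<lambda>(k, c). x (g k) (\<epsilon> k, c)) = Q (\<lambda>(k, c). x (g k) (False, c))"
      if Q: "(m, Q) \<in> smalls \<sigma> C" and g: "strict_mono_on {..<m} g" for m Q \<epsilon> and g :: "nat \<Rightarrow> rat"
    proof -
      let ?X = "g ` {..<m}" and ?T = "g ` {k. k < m \<and> \<epsilon> k}" and ?Q = "\<lambda>e. Q (\<lambda>(k, c). e (g k, c))"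
      have Qd: "SDef (\<lambda>(k, c). \<sigma> c) ({..<m} \<times> C) Q" using smallsD[OF Q] by simp
      have "SDef ?\<sigma> (?X \<times> C) ?Q" by (rule codef_reindex[OF Qd]) auto
      moreover have "finite ?X" "?T \<subseteq> ?X" by auto
      ultimately have "?Q (mixed x ?T) = ?Q (mixed x {})" using no unfolding isbad_def by blast
      moreover have "g k \<in> ?T \<longleftrightarrow> \<epsilon> k" if "k < m" for k
        using strict_mono_on_imp_inj_on[OF g] that by (auto dest: inj_onD)
      then have "Q (\<lambda>(k, c). x (g k) (\<epsilon> k, c)) = ?Q (mixed x ?T)"
        by (intro codef_dep[OF Qd]) (use x(1) in \<open>auto simp: mixed_def typed_def\<close>)
      ultimately show ?thesis by (simp add: mixed_def case_prod_beta')
    qed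
    have "Q (\<lambda>(k, c). x (g k) (\<epsilon> k, c)) = Q (\<lambda>(k, c). x (g' k) (\<epsilon>' k, c))"
      if Q: "(m, Q) \<in> smalls \<sigma> C" and g: "strict_mono_on {..<m} g" "strict_mono_on {..<m} g'"
      for m Q \<epsilon> \<epsilon>' and g g' :: "nat \<Rightarrow> rat"
    proof -
      have Qd: "SDef (\<lambda>(k, c). \<sigma> c) ({..<m} \<times> C) Q" using smallsD[OF Q] by simp
      have "ind (wf_fm L) U \<sigma> C UNIV (\<lambda>i c. x i (False, c))"
        by (rule ind_pull[OF x(2), where h = "\<lambda>c. (False, c)"]) auto
      from ind_eq[OF this _ _ g _ _ SDef_Def[OF Qd]]
      have "Q (\<lambda>(k, c). x (g k) (False, c)) = Q (\<lambda>(k, c). x (g' k) (False, c))"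
        using x(1) by (auto simp: typed_def)
      then show ?thesis using sel[OF Q g(1), of \<epsilon>] sel[OF Q g(2), of \<epsilon>'] by simp
    qed
    then have "mix_ind all_mixes \<sigma> C x" unfolding mix_ind_def by blast
    then show False using bad by contradiction
  qed
  define N where "N = (LEAST N. isbad N)"
  have N: "isbad N" "\<And>N'. N' < N \<Longrightarrow> \<not> isbad N'"
    unfolding N_def using \<open>\<exists>N. isbad N\<close> by (auto intro: LeastI_ex dest: not_less_Least)
  obtain X T Q where XT: "finite X" "T \<subseteq> X" "card T = N" "SDef ?\<sigma> (X \<times> C) Q"
    "Q (mixed x T) \<noteq> Q (mixed x {})" using N(1) unfolding isbad_def by blast
  have finT: "finite T" using XT(1,2) finite_subset by blast
  have "\<not> card T \<le> 1"
  proof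
    assume T1: "card T \<le> 1"
    have "Q (\<lambda>(j, c). x j (j \<in> T, c)) = Q (\<lambda>(j, c). x j (False, c))"
    proof (rule mix_eq[OF single x(1) XT(1) _ _ XT(4), where \<epsilon> = "\<lambda>j. j \<in> T" and \<epsilon>' = "\<lambda>_. False" and a = "\<lambda>j. j" and b = "\<lambda>j. j"])
      fix h :: "nat \<Rightarrow> rat" assume h: "strict_mono_on {..<card X} h"
      have "card {k. k < card X \<and> h k \<in> T} \<le> card T"
        by (rule card_inj_on_le[OF _ _ finT, of h])
          (use strict_mono_on_imp_inj_on[OF h] in \<open>auto simp: inj_on_def\<close>)
      then show "single_mixes (card X) (\<lambda>k. h k \<in> T) \<and> single_mixes (card X) (\<lambda>k. False)"
        using T1 by simp
    qed (auto simp: strict_mono_on_def)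
    then show False using XT(5) by (simp add: mixed_def)
  qed
  then obtain t0 t1 where t: "t0 \<in> T" "t1 \<in> T" "t0 \<noteq> t1"
    using finT by (metis One_nat_def card_le_Suc0_iff_eq)
  have min: "Q' (mixed x T') = Q' (mixed x {})"
    if "finite X'" "T' \<subseteq> X'" "card T' < card T" "SDef ?\<sigma> (X' \<times> C) Q'" for X' T' Q'
    using N(2)[of "card T'"] that XT(3) unfolding isbad_def by blast
  show thesis
  proof (cases "Q (mixed x {})")
    case True
    then show ?thesis using that[OF XT(1,2) t XT(4)] XT(5) min by blast
  next
    case False
    then show ?thesis using that[OF XT(1,2) t small.codef_not[OF XT(4)]] XT(5) min by blast
  qed
qed

lemma insert_bad:
  fixes \<sigma> :: "'c \<Rightarrow> 's" and x :: "rat \<Rightarrow> bool \<times> 'c \<Rightarrow> 'a"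
  assumes C: "finite C"
    and x: "ftyped (\<lambda>(\<epsilon>, c). \<sigma> c) (UNIV \<times> C) x" "ind (wf_fm L) U (\<lambda>(\<epsilon>, c). \<sigma> c) (UNIV \<times> C) UNIV x"
    and X0: "finite X0" "T \<subseteq> X0" "t0 \<in> T" "t1 \<in> T" "t0 \<noteq> t1"
      "SDef (\<lambda>(i, c). \<sigma> c) (X0 \<times> C) Q0" "\<not> Q0 (mixed x T)"
    and min: "\<And>X' T' Q'. finite X' \<Longrightarrow> T' \<subseteq> X' \<Longrightarrow> card T' < card T \<Longrightarrow> SDef (\<lambda>(i, c). \<sigma> c) (X' \<times> C) Q' \<Longrightarrow>
      Q' (mixed x T') = Q' (mixed x {})"
    and y: "ftyped \<sigma> C y" "\<And>Q. SDef (\<lambda>(i, c). \<sigma> c) (X \<times> C) Q \<Longrightarrow> Q (\<lambda>(i, c). y i c) = Q (mixed x {})"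
    and X: "finite X" "strict_mono_on X0 g" "g ` X0 \<subseteq> X"
  shows "\<exists>p. typed U \<sigma> C p \<and> \<not> Q0 (\<lambda>(i, c). (y(g t0 := p)) (g i) c) \<and>
    (\<forall>Q. SDef (\<lambda>(i, c). \<sigma> c) ((X - {g t1}) \<times> C) Q \<longrightarrow>
      Q (\<lambda>(i, c). (y(g t0 := p)) i c) = Q (mixed x {}))"
proof -
  let ?\<sigma> = "\<lambda>(i::rat, c). \<sigma> c"
  let ?V = "{g t0} \<times> C" and ?W = "(X - {g t0}) \<times> C" and ?y = "\<lambda>(i, c). y i c"
  have tX: "g t0 \<in> X" "g t1 \<in> X" using X(3) X0(2-4) by blast+
  have ginj: "inj_on g X0" using X(2) by (rule strict_mono_on_imp_inj_on)
  have gT: "g i \<in> g ` T \<longleftrightarrow> i \<in> T" if "i \<in> X0" for i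
    using inj_on_image_mem_iff[OF ginj that X0(2)] .
  have finT: "finite T" using X0(1,2) finite_subset by blast
  have cT: "card (g ` T - {g t}) < card T" if "t \<in> T" for t
    using card_image[OF inj_on_subset[OF ginj X0(2)]] finT that
    by (metis card_Diff1_less finite_imageI imageI)
  have WV: "?W \<union> ?V = X \<times> C" using tX by auto
  have xC: "x i (\<epsilon>, c) \<in> carrier U (\<sigma> c)" if "c \<in> C" for i \<epsilon> c
    using x(1) that unfolding typed_def by fastforce
  define N where "N = (\<lambda>e. \<not> Q0 (\<lambda>(i, c). e (g i, c)))"
  define \<Sigma> where "\<Sigma> = insert N {\<lambda>e. Q e = Q (mixed x {}) | Q. SDef ?\<sigma> ((X - {g t1}) \<times> C) Q}"
  have \<Sigma>: "SDef ?\<sigma> (?W \<union> ?V) P" if P: "P \<in> \<Sigma>" for P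
    unfolding WV
  proof (cases "P = N")
    case True
    have "SDef ?\<sigma> (X \<times> C) (\<lambda>e. Q0 (\<lambda>(i, c). e (g i, c)))"
      by (rule codef_reindex[OF X0(6)]) (use X(3) in auto)
    then show "SDef ?\<sigma> (X \<times> C) P" unfolding True N_def by (rule small.codef_not)
  next
    case False
    then obtain Q where Q: "P = (\<lambda>e. Q e = Q (mixed x {}))" "SDef ?\<sigma> ((X - {g t1}) \<times> C) Q"
      using P by (auto simp: \<Sigma>_def)
    show "SDef ?\<sigma> (X \<times> C) P"
      unfolding Q(1) by (rule small.codef_iff_const[OF codef_mono[OF Q(2)]]) auto
  qed
  have "\<exists>f. typed U ?\<sigma> ?V f \<and> (\<forall>P\<in>\<Sigma>. P (override_on ?y f ?V))"
  proof (rule saturation[OF _ _ _ _ SDef_Def[OF \<Sigma>]])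
    show "finite ?V" "?V \<inter> ?W = {}" "countable ?W" using C X(1) by (auto simp: countable_finite)
    show "typed U ?\<sigma> ?W ?y" using y(1) by (auto simp: typed_def)
    fix \<Sigma>0 assume \<Sigma>0: "finite \<Sigma>0" "\<Sigma>0 \<subseteq> \<Sigma>"
    define \<Psi> where "\<Psi> e \<longleftrightarrow> (\<exists>f. typed U ?\<sigma> ?V f \<and> (\<forall>P\<in>\<Sigma>0. P (override_on e f ?V)))" for e
    have "SDef ?\<sigma> ?W \<Psi>"
      unfolding \<Psi>_def by (intro small.codef_exs small.codef_ball \<Sigma> nonempty) (use C \<Sigma>0 in auto)
    then have \<Psi>: "SDef ?\<sigma> (X \<times> C) \<Psi>" by (rule codef_mono) auto
    have gTX: "g ` T \<subseteq> X" using X0(2) X(3) by blast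
    \<comment> \<open>The solution is the second tuple at \<open>g t0\<close>. It completes the
      mixture to one on which \<open>Q0\<close> fails and which, away from \<open>g t1\<close>,
      agrees with a mixture having fewer replacements.\<close>
    have "\<Psi> (mixed x (g ` T - {g t0}))"
      unfolding \<Psi>_def
    proof (intro exI[of _ "\<lambda>(i, c). x i (True, c)"] conjI ballI)
      show "typed U ?\<sigma> ?V (\<lambda>(i, c). x i (True, c))" using xC by (auto simp: typed_def)
      fix P assume P: "P \<in> \<Sigma>0"
      have ov: "override_on (mixed x (g ` T - {g t0})) (\<lambda>(i, c). x i (True, c)) ?V (i, c) = mixed x (g ` T) (i, c)"
        if "c \<in> C" for i c
        using that X0(3) by (auto simp: override_on_def mixed_def)
      have ty: "typed U ?\<sigma> Y (mixed x S)" if "Y \<subseteq> UNIV \<times> C" for Y S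
        using xC that by (auto simp: typed_def mixed_def)
      have "P (override_on (mixed x (g ` T - {g t0})) (\<lambda>(i, c). x i (True, c)) ?V) = P (mixed x (g ` T))"
        by (rule codef_dep[OF \<Sigma>[of P, unfolded WV] ty, symmetric]) (use P \<Sigma>0(2) ov in auto)
      moreover have "P (mixed x (g ` T))"
      proof (cases "P = N")
        case True
        \<comment> \<open>\<open>Q0\<close> applied to the first or second tuple according to
          \<open>T\<close> is a formula about whole pairs, so their indiscernibility carries it from
          \<open>X0\<close> along \<open>g\<close>.\<close>
        let ?Q = "\<lambda>e. Q0 (\<lambda>w. e (case w of (i, c) \<Rightarrow> (i, i \<in> T, c)))"
        have Q: "SDef (\<lambda>(i, c). (\<lambda>(\<epsilon>, c). \<sigma> c) c) (X0 \<times> UNIV \<times> C) ?Q"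
          by (rule codef_rename[OF X0(6)]) auto
        have "?Q (\<lambda>(i, c). x i c) = ?Q (\<lambda>(i, c). x (g i) c)"
          using x(2)[unfolded ind_def, rule_format, OF X0(1) _ X(2) _ SDef_Def[OF Q]] by simp
        moreover have "?Q (\<lambda>(i, c). x i c) = Q0 (mixed x T)"
          by (rule codef_dep[OF X0(6)]) (use xC in \<open>auto simp: typed_def mixed_def\<close>)
        moreover have "?Q (\<lambda>(i, c). x (g i) c) = Q0 (\<lambda>(i, c). mixed x (g ` T) (g i, c))"
          by (rule codef_dep[OF X0(6)]) (use xC gT in \<open>auto simp: typed_def mixed_def\<close>)
        ultimately show ?thesis using X0(7) unfolding True N_def by simp
      next
        case False
        then obtain Q where Q: "P = (\<lambda>e. Q e = Q (mixed x {}))" "SDef ?\<sigma> ((X - {g t1}) \<times> C) Q"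
          using P \<Sigma>0(2) by (auto simp: \<Sigma>_def)
        have "Q (mixed x (g ` T)) = Q (mixed x (g ` T - {g t1}))"
        proof (rule codef_dep[OF Q(2) ty])
          show "mixed x (g ` T) w = mixed x (g ` T - {g t1}) w" if w: "w \<in> (X - {g t1}) \<times> C" for w
          proof -
            obtain i c where ic: "w = (i, c)" "i \<noteq> g t1" using w by auto
            then have "(i \<in> g ` T - {g t1}) = (i \<in> g ` T)" by simp
            then show ?thesis unfolding ic(1) mixed_def by (simp only: split)
          qed
        qed auto
        also have "\<dots> = Q (mixed x {})"
          by (rule min[OF _ _ cT[OF X0(4)] Q(2)]) (use X(1) gTX in auto)
        finally show ?thesis unfolding Q(1) .
      qed
      ultimately show "P (override_on (mixed x (g ` T - {g t0})) (\<lambda>(i, c). x i (True, c)) ?V)" by simp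
    qed
    moreover have "\<Psi> (mixed x (g ` T - {g t0})) = \<Psi> (mixed x {})"
      by (rule min[OF X(1) _ cT[OF X0(3)] \<Psi>]) (use gTX in auto)
    ultimately have "\<Psi> ?y" using y(2)[OF \<Psi>] by simp
    then show "\<exists>f. typed U ?\<sigma> ?V f \<and> (\<forall>P\<in>\<Sigma>0. P (override_on ?y f ?V))" unfolding \<Psi>_def .
  qed
  then obtain f where f: "typed U ?\<sigma> ?V f" "\<And>P. P \<in> \<Sigma> \<Longrightarrow> P (override_on ?y f ?V)" by blast
  define p where "p c = f (g t0, c)" for c
  have ov: "override_on ?y f ?V (i, c) = (y(g t0 := p)) i c" if "c \<in> C" for i c
    using that by (auto simp: override_on_def p_def)
  have ty: "typed U ?\<sigma> Y (override_on ?y f ?V)" if "Y \<subseteq> UNIV \<times> C" for Y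
    using f(1) y(1) that by (fastforce simp: typed_def override_on_def)
  have eq: "P (override_on ?y f ?V) = P (\<lambda>(i, c). (y(g t0 := p)) i c)"
    if "SDef ?\<sigma> (Y \<times> C) P" for P Y
    by (rule codef_dep[OF that ty]) (use ov in auto)
  have "N (\<lambda>(i, c). (y(g t0 := p)) i c)"
    using f(2)[of N] eq[OF \<Sigma>[of N, unfolded WV]] by (simp add: \<Sigma>_def)
  then have "\<not> Q0 (\<lambda>(i, c). (y(g t0 := p)) (g i) c)" unfolding N_def split .
  moreover have "Q (\<lambda>(i, c). (y(g t0 := p)) i c) = Q (mixed x {})"
    if "SDef ?\<sigma> ((X - {g t1}) \<times> C) Q" for Q
    using f(2)[of "\<lambda>e. Q e = Q (mixed x {})"] eq[OF that] that by (auto simp: \<Sigma>_def)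
  moreover have "typed U \<sigma> C p" using f(1) by (auto simp: typed_def p_def)
  ultimately show ?thesis by blast
qed

text \<open>
  If no such \<open>p\<close> existed, then some formula \<open>R\<close> true of \<open>u t0\<close> over the rest would exclude all \<open>p\<close> that
  are bad with \<open>u t1\<close>, and, by indiscernibility, all \<open>p\<close> that are bad with one of the \<open>u (j k)\<close>, where
  \<open>j k\<close> is close to \<open>t1\<close>. Inserting such bad elements one after the other close to \<open>t0\<close> (and
  giving up one \<open>u (j k)\<close> each time) makes \<open>R\<close> alternate.
\<close>

lemma bad_swap:
  fixes \<sigma> :: "'c \<Rightarrow> 's" and x :: "rat \<Rightarrow> bool \<times> 'c \<Rightarrow> 'a"
  defines "u \<equiv> \<lambda>i c. x i (False, c)"
  assumes C: "finite C"
    and x: "ftyped (\<lambda>(\<epsilon>, c). \<sigma> c) (UNIV \<times> C) x" "ind (wf_fm L) U (\<lambda>(\<epsilon>, c). \<sigma> c) (UNIV \<times> C) UNIV x"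
    and X0: "finite X0" "T \<subseteq> X0" "t0 \<in> T" "t1 \<in> T" "t0 \<noteq> t1"
      "SDef (\<lambda>(i, c). \<sigma> c) (X0 \<times> C) Q0" "Q0 (mixed x {})" "\<not> Q0 (mixed x T)"
    and min: "\<And>X' T' Q'. finite X' \<Longrightarrow> T' \<subseteq> X' \<Longrightarrow> card T' < card T \<Longrightarrow> SDef (\<lambda>(i, c). \<sigma> c) (X' \<times> C) Q' \<Longrightarrow>
      Q' (mixed x T') = Q' (mixed x {})"
  shows "\<exists>p. typed U \<sigma> C p \<and> \<not> Q0 (\<lambda>(i, c). (u(t0 := p)) i c) \<and>
    (\<forall>P. Def (\<lambda>(i, c). \<sigma> c) ((UNIV - {t1}) \<times> C) P \<longrightarrow>
      P (\<lambda>(i, c). (u(t0 := p)) i c) = P (\<lambda>(i, c). u i c))"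
proof -
  let ?\<sigma> = "\<lambda>(i::rat, c). \<sigma> c" and ?u = "\<lambda>(i, c). u i c"
  let ?V = "{t0} \<times> C" and ?W = "(UNIV - {t0}) \<times> C"
  have mu: "mixed x {} = ?u" by (simp add: mixed_def u_def)
  have ut: "ftyped \<sigma> C u" using x(1) by (fastforce simp: typed_def u_def)
  have uind: "ind (wf_fm L) U \<sigma> C UNIV u"
    unfolding u_def by (rule ind_pull[OF x(2), where h = "\<lambda>c. (False, c)"]) auto
  have tX0: "t0 \<in> X0" "t1 \<in> X0" using X0(2-4) by auto
  have Q0D: "Def ?\<sigma> (X0 \<times> C) Q0" by (rule SDef_Def[OF X0(6)])
  have uty: "typed U ?\<sigma> Y ?u" if "Y \<subseteq> UNIV \<times> C" for Y using ut that by (auto simp: typed_def)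
  define N where "N e \<longleftrightarrow> \<not> Q0 e" for e
  define \<Sigma> where "\<Sigma> = insert N {P. Def ?\<sigma> ((UNIV - {t1}) \<times> C) P \<and> P ?u}"
  have WV: "?W \<union> ?V = UNIV \<times> C" by auto
  have \<Sigma>: "Def ?\<sigma> (?W \<union> ?V) P" if "P \<in> \<Sigma>" for P
    unfolding WV
  proof (cases "P = N")
    case True
    show "Def ?\<sigma> (UNIV \<times> C) P" unfolding True N_def[abs_def] by (rule codef_mono[OF codef_not[OF Q0D]]) auto
  next
    case False
    then have "Def ?\<sigma> ((UNIV - {t1}) \<times> C) P" using that by (simp add: \<Sigma>_def)
    then show "Def ?\<sigma> (UNIV \<times> C) P" by (rule codef_mono) auto
  qed
  have "\<exists>f. typed U ?\<sigma> ?V f \<and> (\<forall>P\<in>\<Sigma>. P (override_on ?u f ?V))"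
  proof (rule saturation[OF _ _ _ _ \<Sigma>])
    show "finite ?V" "?V \<inter> ?W = {}" using C by auto
    show "countable ?W"
      using countable_SIGMA[of "UNIV - {t0}" "\<lambda>_. C"] countable_finite[OF C] by simp
    show "typed U ?\<sigma> ?W ?u" by (rule uty) auto
    fix \<Sigma>0 assume \<Sigma>0: "finite \<Sigma>0" "\<Sigma>0 \<subseteq> \<Sigma>"
    show "\<exists>f. typed U ?\<sigma> ?V f \<and> (\<forall>P\<in>\<Sigma>0. P (override_on ?u f ?V))"
    proof (rule ccontr)
      assume no: "\<not> ?thesis"
      define R where "R e \<longleftrightarrow> (\<forall>P\<in>\<Sigma>0 - {N}. P e)" for e
      have RD: "Def ?\<sigma> ((UNIV - {t1}) \<times> C) R"
        unfolding R_def by (rule codef_ball) (use \<Sigma>0 nonempty in \<open>auto simp: \<Sigma>_def\<close>)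
      obtain Vf R' R'' where Vf: "finite Vf" "Vf \<subseteq> (UNIV - {t1}) \<times> C"
        and R'D: "codef (wf_fm L) U U ?\<sigma> Vf R' R''"
        and RR': "\<And>e. typed U ?\<sigma> ((UNIV - {t1}) \<times> C) e \<Longrightarrow> R e = R' e"
        by (rule codef_finite[OF RD]) (rule that)
      define F where "F = insert t0 (fst ` Vf)"
      have F: "finite F" "t1 \<notin> F" "t0 \<in> F" "Vf \<subseteq> F \<times> C" using Vf X0(5) by (force simp: F_def)+
      have R': "Def ?\<sigma> (F \<times> C) R'" by (rule codef_mono[OF codef_left[OF R'D] F(4)])
      have Ru: "R' ?u"
        using RR'[OF uty] \<Sigma>0(2) by (auto simp: R_def \<Sigma>_def)
      have excl: "Q0 (override_on ?u f ?V)" if f: "typed U ?\<sigma> ?V f" "R' (override_on ?u f ?V)" for f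
      proof -
        have "typed U ?\<sigma> ((UNIV - {t1}) \<times> C) (override_on ?u f ?V)"
          using f(1) ut by (auto simp: typed_def override_on_def)
        then have R: "R (override_on ?u f ?V)" using RR' f(2) by simp
        show ?thesis
        proof (rule ccontr)
          assume "\<not> ?thesis"
          then have "N (override_on ?u f ?V)" by (simp add: N_def)
          then have "\<forall>P\<in>\<Sigma>0. P (override_on ?u f ?V)" using R unfolding R_def by blast
          then show False using no f(1) by blast
        qed
      qed
      \<comment> \<open>Quantifying over the entry at \<open>t0\<close> leaves a formula about
        \<open>u\<close> alone, which indiscernibility can move from \<open>t1\<close> to any
        \<open>j l\<close>.\<close>
      define \<Xi> where "\<Xi> e \<longleftrightarrow> (\<forall>f. typed U ?\<sigma> ?V f \<longrightarrow> R' (override_on e f ?V) \<longrightarrow> Q0 (override_on e f ?V))" for e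
      let ?F = "F \<union> X0 - {t0}"
      have FV: "?F \<times> C \<union> ?V = (F \<union> X0) \<times> C" using F(3) by auto
      have \<Xi>: "Def ?\<sigma> (?F \<times> C) \<Xi>"
        unfolding \<Xi>_def
      proof (intro codef_alls codef_imp)
        show "Def ?\<sigma> (?F \<times> C \<union> ?V) R'" "Def ?\<sigma> (?F \<times> C \<union> ?V) Q0"
          unfolding FV by (rule codef_mono[OF R'] codef_mono[OF Q0D]; auto)+
      qed (use C in auto)
      have \<Xi>u: "\<Xi> ?u" using excl by (simp add: \<Xi>_def)
      have finFX: "finite (F \<union> X0)" using F(1) X0(1) by simp
      \<comment> \<open>The \<open>s k\<close> are places next to \<open>t0\<close> where bad
        elements will be inserted. The \<open>j l\<close>, chosen below, are stand-ins for
        \<open>t1\<close>. Both stay within their gaps of \<open>F\<close> and \<open>X0\<close>, so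
        every order relation is preserved.\<close>
      obtain s :: "nat \<Rightarrow> rat" where s12: "strict_mono s" "s 0 = t0"
        and sF: "\<forall>i\<in>F \<union> X0. \<forall>k. (i < t0 \<longrightarrow> i < s k) \<and> (t0 < i \<longrightarrow> s k < i)"
        using gap_seq[OF finFX] by blast
      have s: "strict_mono s" "s 0 = t0" "\<And>i k. i \<in> F \<union> X0 \<Longrightarrow> i < t0 \<Longrightarrow> i < s k"
        "\<And>i k. i \<in> F \<union> X0 \<Longrightarrow> t0 < i \<Longrightarrow> s k < i" using s12 sF by blast+
      obtain j :: "nat \<Rightarrow> rat" where j12: "strict_mono j" "j 0 = t1"
        and jF: "\<forall>i\<in>F \<union> X0. \<forall>k. (i < t1 \<longrightarrow> i < j k) \<and> (t1 < i \<longrightarrow> j k < i)"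
        using gap_seq[OF finFX] by blast
      have j: "strict_mono j" "j 0 = t1" "\<And>i k. i \<in> F \<union> X0 \<Longrightarrow> i < t1 \<Longrightarrow> i < j k"
        "\<And>i k. i \<in> F \<union> X0 \<Longrightarrow> t1 < i \<Longrightarrow> j k < i" using j12 jF by blast+
      have s0: "t0 \<le> s k" and j0: "t1 \<le> j k" for k
        using s(1,2) j(1,2) by (metis strict_mono_less_eq zero_le)+
      have sx: "s k \<noteq> i" if "i \<in> F \<union> X0" "i \<noteq> t0" for i k
        using s(3,4)[OF that(1)] that(2) by (metis less_irrefl linorder_less_linear)
      have jx: "j k \<noteq> i" if "i \<in> F \<union> X0" "i \<noteq> t1" for i k
        using j(3,4)[OF that(1)] that(2) by (metis less_irrefl linorder_less_linear)
      have sj: "s k < j l" if "t0 < t1" for k l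
        using s(4)[of t1 k] j0[of l] tX0 that by simp
      have js: "j l < s k" if "t1 < t0" for k l
        using j(4)[of t0 l] s0[of k] tX0 that by simp
      have sjne: "s k \<noteq> j l" for k l
        using sj[of k l] js[of l k] X0(5) by (metis less_irrefl linorder_less_linear)
      have sinj: "s k = s l \<longleftrightarrow> k = l" and jinj: "j k = j l \<longleftrightarrow> k = l" for k l
        using s(1) j(1) strict_mono_eq by blast+
      \<comment> \<open>\<open>\<Xi>\<close> moved to \<open>j l\<close> says that \<open>R'\<close>
        implies \<open>Q0\<close> with \<open>u (j l)\<close> in place of \<open>u t1\<close>; hence
        an element violating this instance of \<open>Q0\<close> violates \<open>R'\<close>.\<close>
      have not\<Xi>: "\<not> R' (\<lambda>(i, c). (u(t0 := p)) i c)"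
        if p: "typed U \<sigma> C p" "\<not> Q0 (\<lambda>(i, c). (u(t0 := p, t1 := u (j l))) i c)" for p l
      proof
        assume Rp: "R' (\<lambda>(i, c). (u(t0 := p)) i c)"
        let ?b = "\<lambda>i. if i = t1 then j l else i"
        have "strict_mono_on ?F ?b"
          using j(3,4) by (intro strict_mono_onI) (auto split: if_splits)
        moreover have "finite ?F" using finFX by simp
        ultimately have "\<Xi> (\<lambda>(i, c). u (?b i) c)"
          using uind[unfolded ind_def, rule_format, OF _ _ _ _ \<Xi>, of ?b] \<Xi>u by simp
        moreover have eq: "override_on (\<lambda>(i, c). u (?b i) c) (\<lambda>(i, c). p c) ?V (i, c)
            = (u(t0 := p, t1 := u (j l))) i c" if "c \<in> C" for i c
          using X0(5) that by (auto simp: override_on_def)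
        have tp: "typed U ?\<sigma> Y (\<lambda>(i, c). (u(t0 := p, t1 := u (j l))) i c)" if "Y \<subseteq> UNIV \<times> C" for Y
          using ut p(1) that by (fastforce simp: typed_def)
        have "R' (\<lambda>(i, c). (u(t0 := p, t1 := u (j l))) i c) = R' (override_on (\<lambda>(i, c). u (?b i) c) (\<lambda>(i, c). p c) ?V)"
          by (rule codef_dep[OF R' tp]) (use eq in auto)
        moreover have "Q0 (\<lambda>(i, c). (u(t0 := p, t1 := u (j l))) i c) = Q0 (override_on (\<lambda>(i, c). u (?b i) c) (\<lambda>(i, c). p c) ?V)"
          by (rule codef_dep[OF Q0D tp]) (use eq in auto)
        moreover have "R' (\<lambda>(i, c). (u(t0 := p, t1 := u (j l))) i c) = R' (\<lambda>(i, c). (u(t0 := p)) i c)"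
          by (rule codef_dep[OF R' tp]) (use F(2) in auto)
        moreover have "typed U ?\<sigma> ?V (\<lambda>(i, c). p c)" using p(1) by (auto simp: typed_def)
        ultimately show False using Rp p(2) unfolding \<Xi>_def by blast
      qed
      have moved: "R' (\<lambda>(i, c). (u(t0 := u (s k))) i c)" for k
      proof -
        let ?b = "\<lambda>i. if i = t0 then s k else i"
        have "strict_mono_on F ?b"
          using s(3,4) by (intro strict_mono_onI) (auto split: if_splits)
        then have "R' (\<lambda>(i, c). u (?b i) c)"
          using uind[unfolded ind_def, rule_format, OF F(1) _ _ _ R', of ?b] Ru by simp
        moreover have "(\<lambda>(i, c). u (?b i) c) = (\<lambda>(i, c). (u(t0 := u (s k))) i c)"
          by (auto simp: fun_eq_iff)
        ultimately show ?thesis by simp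
      qed
      have "\<exists>z f. finite_alt ?\<sigma> ?V ((F - {t0}) \<times> C) R' n \<Delta> z f" if \<Delta>: "\<Delta> \<subseteq> smalls ?\<sigma> ?V" for n \<Delta>
      proof -
        define Xn where "Xn = s ` {..<2 * n} \<union> X0 \<union> j ` {..<n}"
        have finXn: "finite Xn" using X0(1) by (simp add: Xn_def)
        \<comment> \<open>After \<open>l\<close> steps bad elements stand at the first
          \<open>l\<close> odd places of \<open>s\<close>, and the small type of \<open>u\<close> is
          preserved off the first \<open>l\<close> stand-ins \<open>j\<close>. Each insertion may
          spoil the small type at the stand-in it uses, so every step consumes a new one.\<close>
        have "\<exists>y. ftyped \<sigma> C y \<and> (\<forall>i. (\<forall>k<l. i \<noteq> s (2 * k + 1)) \<longrightarrow> y i = u i) \<and>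
            (\<forall>Q. SDef ?\<sigma> ((Xn - j ` {..<l}) \<times> C) Q \<longrightarrow> Q (\<lambda>(i, c). y i c) = Q (mixed x {})) \<and>
            (\<forall>k<l. \<not> R' (\<lambda>(i, c). (u(t0 := y (s (2 * k + 1)))) i c))" if "l \<le> n" for l
          using that
        proof (induction l)
          case 0
          show ?case by (rule exI[of _ u]) (use ut mu in auto)
        next
          case (Suc l)
          then obtain y where y: "ftyped \<sigma> C y" "\<And>i. (\<forall>k<l. i \<noteq> s (2 * k + 1)) \<Longrightarrow> y i = u i"
            "\<And>Q. SDef ?\<sigma> ((Xn - j ` {..<l}) \<times> C) Q \<Longrightarrow> Q (\<lambda>(i, c). y i c) = Q (mixed x {})"
            "\<And>k. k < l \<Longrightarrow> \<not> R' (\<lambda>(i, c). (u(t0 := y (s (2 * k + 1)))) i c)" by auto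
          let ?s = "s (2 * l + 1)"
          let ?g = "\<lambda>i. if i = t0 then ?s else if i = t1 then j l else i"
          have "strict_mono_on X0 ?g"
          proof (rule strict_mono_onI)
            fix a b assume ab: "a \<in> X0" "b \<in> X0" "a < b"
            show "?g a < ?g b"
              using ab s(3)[of a "2 * l + 1"] s(4)[of b "2 * l + 1"] j(3)[of a l] j(4)[of b l] sj[of "2 * l + 1" l] js[of l "2 * l + 1"] X0(5)
              by (auto split: if_splits)
          qed
          moreover have "?g ` X0 \<subseteq> Xn - j ` {..<l}"
            using Suc.prems sjne jx jinj by (auto simp: Xn_def split: if_splits)
          moreover have "finite (Xn - j ` {..<l})" using finXn by simp
          ultimately have "\<exists>p. typed U \<sigma> C p \<and> \<not> Q0 (\<lambda>(i, c). (y(?g t0 := p)) (?g i) c) \<and>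
            (\<forall>Q. SDef ?\<sigma> ((Xn - j ` {..<l} - {?g t1}) \<times> C) Q \<longrightarrow>
              Q (\<lambda>(i, c). (y(?g t0 := p)) i c) = Q (mixed x {}))"
            by (intro insert_bad[OF C x X0(1-6,8)] min y(1,3))
          then obtain p where p: "typed U \<sigma> C p" "\<not> Q0 (\<lambda>(i, c). (y(?g t0 := p)) (?g i) c)"
            "\<And>Q. SDef ?\<sigma> ((Xn - j ` {..<l} - {?g t1}) \<times> C) Q \<Longrightarrow>
              Q (\<lambda>(i, c). (y(?g t0 := p)) i c) = Q (mixed x {})" by blast
          have yu: "y i = u i" if "i \<in> X0" "i \<noteq> t0" for i
            by (rule y(2)) (use sx[of i] that in auto)
          have yj: "y (j l) = u (j l)" by (rule y(2)) (use sjne in metis)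
          have g: "?g t0 = ?s" "?g t1 = j l" using X0(5) by auto
          have "Q0 (\<lambda>(i, c). (u(t0 := p, t1 := u (j l))) i c) = Q0 (\<lambda>(i, c). (y(?g t0 := p)) (?g i) c)"
          proof (rule codef_dep[OF Q0D])
            show "typed U ?\<sigma> (X0 \<times> C) (\<lambda>(i, c). (u(t0 := p, t1 := u (j l))) i c)"
              using ut p(1) by (auto simp: typed_def)
            have "(u(t0 := p, t1 := u (j l))) i = (y(?s := p)) (?g i)" if "i \<in> X0" for i
              using yu[OF that] yj X0(5) sx[of i "2 * l + 1"] sjne[of "2 * l + 1" l] that by auto
            then show "(\<lambda>(i, c). (u(t0 := p, t1 := u (j l))) i c) w = (\<lambda>(i, c). (y(?g t0 := p)) (?g i) c) w"
              if "w \<in> X0 \<times> C" for w using that unfolding g by (auto simp del: fun_upd_apply)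
          qed
          then have np: "\<not> R' (\<lambda>(i, c). (u(t0 := p)) i c)" using not\<Xi>[OF p(1)] p(2) by blast
          have "Xn - j ` {..<Suc l} = Xn - j ` {..<l} - {j l}" by (auto simp: lessThan_Suc)
          then have p3: "Q (\<lambda>(i, c). (y(?s := p)) i c) = Q (mixed x {})"
            if "SDef ?\<sigma> ((Xn - j ` {..<Suc l}) \<times> C) Q" for Q
            using p(3)[of Q] that unfolding g by simp
          show ?case
          proof (intro exI[of _ "y(?s := p)"] conjI allI impI)
            show "typed U \<sigma> C ((y(?s := p)) i)" for i using y(1) p(1) by simp
            show "(y(?s := p)) i = u i" if "\<forall>k<Suc l. i \<noteq> s (2 * k + 1)" for i
              using y(2)[of i] that by (auto simp: less_Suc_eq)
            show "\<not> R' (\<lambda>(i, c). (u(t0 := (y(?s := p)) (s (2 * k + 1)))) i c)" if "k < Suc l" for k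
              using np y(4)[of k] that sinj by (cases "k = l") (auto simp: less_Suc_eq)
          qed (use p3 in auto)
        qed
        from this[OF order.refl] obtain y where y: "ftyped \<sigma> C y" "\<And>i. (\<forall>k<n. i \<noteq> s (2 * k + 1)) \<Longrightarrow> y i = u i"
          "\<And>Q. SDef ?\<sigma> ((Xn - j ` {..<n}) \<times> C) Q \<Longrightarrow> Q (\<lambda>(i, c). y i c) = Q (mixed x {})"
          "\<And>k. k < n \<Longrightarrow> \<not> R' (\<lambda>(i, c). (u(t0 := y (s (2 * k + 1)))) i c)" by blast
        \<comment> \<open>The entries at all \<open>s k\<close> are put into the slot
          \<open>t0\<close> of \<open>R'\<close>. No stand-in is among these indices, so the small
          type is still that of a subsequence of \<open>u\<close>, while \<open>R'\<close>
          alternates.\<close>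
        define z where "z k = (\<lambda>(i::rat, c). y (s k) c)" for k
        have zt: "ftyped ?\<sigma> ?V z" using y(1) by (auto simp: typed_def z_def)
        have "finite_alt ?\<sigma> ?V ((F - {t0}) \<times> C) R' n \<Delta> z ?u"
          unfolding finite_alt_def
        proof (intro conjI allI impI zt[rule_format] uty)
          fix k assume k: "k < 2 * n"
          have "R' (\<lambda>(i, c). (u(t0 := y (s k))) i c) = R' (override_on (z k) ?u ((F - {t0}) \<times> C))"
            by (rule codef_dep[OF R'])
              (use y(1) ut in \<open>auto simp: typed_def z_def override_on_def split: if_splits\<close>)
          moreover have "R' (\<lambda>(i, c). (u(t0 := y (s k))) i c) = even k"
          proof (cases "even k")
            case True
            have "s k \<noteq> s (2 * l + 1)" for l using True by (simp add: sinj) presburger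
            then have "y (s k) = u (s k)" by (intro y(2)) blast
            then show ?thesis using moved[of k] True by simp
          next
            case False
            then obtain l where "k = 2 * l + 1" using oddE by blast
            then show ?thesis using y(4)[of l] k False by simp
          qed
          ultimately show "R' (override_on (z k) ?u ((F - {t0}) \<times> C)) = even k" by simp
        next
          fix m Q and g g' :: "nat \<Rightarrow> nat"
          assume Q: "(m, Q) \<in> \<Delta>" and g: "strict_mono_on {..<m} g" "g ` {..<m} \<subseteq> {..<2 * n}"
            and g': "strict_mono_on {..<m} g'" "g' ` {..<m} \<subseteq> {..<2 * n}"
            and tr: "Q (\<lambda>(k, c). z (g k) c)"
          have Qd: "SDef (\<lambda>(k, c). ?\<sigma> c) ({..<m} \<times> ?V) Q" using Q \<Delta> smallsD by fastforce
          have eq: "Q (\<lambda>(k, c). z (g k) c) = Q (\<lambda>(k, i, c). u (s (g k)) c)"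
            if "g ` {..<m} \<subseteq> {..<2 * n}" for g :: "nat \<Rightarrow> nat"
          proof -
            let ?Q = "\<lambda>e. Q (\<lambda>w. e (case w of (k, i, c) \<Rightarrow> (s (g k), c)))"
            have "SDef ?\<sigma> ((Xn - j ` {..<n}) \<times> C) ?Q"
              by (rule codef_rename[OF Qd]) (use that sjne in \<open>auto simp: Xn_def\<close>)
            from y(3)[OF this] show ?thesis by (simp add: z_def mu case_prod_beta')
          qed
          have gs: "strict_mono_on {..<m} (\<lambda>k. s (g k))" if "strict_mono_on {..<m} g" for g :: "nat \<Rightarrow> nat"
            using that s(1) by (auto simp: strict_mono_on_def strict_mono_def)
          let ?Q = "\<lambda>e. Q (\<lambda>w. e (case w of (k, i, c) \<Rightarrow> (k, c)))"
          have Qd': "Def (\<lambda>(k, c). \<sigma> c) ({..<m} \<times> C) ?Q"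
            by (rule codef_rename[OF SDef_Def[OF Qd]]) auto
          have "?Q (\<lambda>(k, c). u (s (g k)) c) = ?Q (\<lambda>(k, c). u (s (g' k)) c)"
            by (rule ind_eq[OF uind, where F = "{..<m}" and Q = ?Q]) (use ut gs g g' Qd' in auto)
          then have "Q (\<lambda>(k, i, c). u (s (g k)) c) = Q (\<lambda>(k, i, c). u (s (g' k)) c)"
            by (simp add: case_prod_beta')
          then show "Q (\<lambda>(k, c). z (g' k) c)" using tr eq[OF g(2)] eq[OF g'(2)] by simp
        qed auto
        then show ?thesis by blast
      qed
      moreover have FV': "?V \<union> (F - {t0}) \<times> C = F \<times> C" using F(3) by auto
      have R2: "Def ?\<sigma> (?V \<union> (F - {t0}) \<times> C) R'" unfolding FV' by (rule R')
      have fin2: "finite ?V" "finite ((F - {t0}) \<times> C)" "?V \<inter> (F - {t0}) \<times> C = {}" using C F(1) by auto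
      ultimately show False
        using no_alt_finite[OF no_alt_Def[OF R2 fin2] R2 fin2] by blast
    qed
  qed
  then obtain f where f: "typed U ?\<sigma> ?V f" "\<And>P. P \<in> \<Sigma> \<Longrightarrow> P (override_on ?u f ?V)" by blast
  define p where "p c = f (t0, c)" for c
  have ov: "override_on ?u f ?V (i, c) = (u(t0 := p)) i c" if "c \<in> C" for i c
    using that by (auto simp: override_on_def p_def)
  have pt: "typed U \<sigma> C p" using f(1) by (auto simp: typed_def p_def)
  have ty: "typed U ?\<sigma> Y (\<lambda>(i, c). (u(t0 := p)) i c)" if "Y \<subseteq> UNIV \<times> C" for Y
    using ut pt that by (fastforce simp: typed_def)
  have eq: "P (\<lambda>(i, c). (u(t0 := p)) i c) = P (override_on ?u f ?V)"
    if "Def ?\<sigma> (Y \<times> C) P" for P Y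
    by (rule codef_dep[OF that ty]) (use ov in auto)
  have "\<not> Q0 (\<lambda>(i, c). (u(t0 := p)) i c)"
    using f(2)[of N] eq[OF Q0D] by (simp add: \<Sigma>_def N_def)
  moreover have "P (\<lambda>(i, c). (u(t0 := p)) i c) = P ?u" if P: "Def ?\<sigma> ((UNIV - {t1}) \<times> C) P" for P
  proof (cases "P ?u")
    case True
    then show ?thesis using f(2)[of P] eq[OF P] P by (simp add: \<Sigma>_def)
  next
    case False
    then show ?thesis using f(2)[of "\<lambda>e. \<not> P e"] eq[OF P] codef_not[OF P] by (simp add: \<Sigma>_def)
  qed
  ultimately show ?thesis using pt by blast
qed

text \<open>On an interval around \<open>t0\<close> that avoids the rest of \<open>X0\<close>, and
  so avoids \<open>t1\<close>, replacing \<open>u t0\<close> by the tuple from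
  \<open>bad_swap\<close> is invisible to all formulas. Over the entries of \<open>u\<close> at the
  remaining indices of \<open>X0\<close>, including \<open>t1\<close>, it is detected by
  \<open>Q0\<close>.\<close>

lemma some_mix_contradiction:
  fixes \<sigma> :: "'c \<Rightarrow> 's" and x :: "rat \<Rightarrow> bool \<times> 'c \<Rightarrow> 'a"
  assumes dist: "distal \<kappa> L U" and C: "finite C"
    and x: "ftyped (\<lambda>(\<epsilon>, c). \<sigma> c) (UNIV \<times> C) x" "ind (wf_fm L) U (\<lambda>(\<epsilon>, c). \<sigma> c) (UNIV \<times> C) UNIV x"
    and single: "mix_ind single_mixes \<sigma> C x" and bad: "\<not> mix_ind all_mixes \<sigma> C x"
  shows False
proof -
  let ?\<sigma> = "\<lambda>(i::rat, c). \<sigma> c"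
  define u where "u i c = x i (False, c)" for i c
  have mu: "mixed x {} = (\<lambda>(i, c). u i c)" by (simp add: mixed_def u_def)
  have ut: "ftyped \<sigma> C u" using x(1) by (fastforce simp: typed_def u_def)
  have uind: "ind (wf_fm L) U \<sigma> C UNIV u"
    unfolding u_def by (rule ind_pull[OF x(2), where h = "\<lambda>c. (False, c)"]) auto
  obtain X0 T Q0 t0 t1 where X0: "finite X0" "T \<subseteq> X0" "t0 \<in> T" "t1 \<in> T" "t0 \<noteq> t1"
    "SDef ?\<sigma> (X0 \<times> C) Q0" "Q0 (mixed x {})" "\<not> Q0 (mixed x T)"
    and min: "\<And>X' T' Q'. finite X' \<Longrightarrow> T' \<subseteq> X' \<Longrightarrow> card T' < card T \<Longrightarrow> SDef ?\<sigma> (X' \<times> C) Q' \<Longrightarrow>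
      Q' (mixed x T') = Q' (mixed x {})"
    by (rule minimal_bad_mix[OF x single bad]) (rule that)
  have u: "u = (\<lambda>i c. x i (False, c))" by (simp add: u_def fun_eq_iff)
  have ex: "\<exists>p. typed U \<sigma> C p \<and> \<not> Q0 (\<lambda>(i, c). (u(t0 := p)) i c) \<and>
    (\<forall>P. Def ?\<sigma> ((UNIV - {t1}) \<times> C) P \<longrightarrow> P (\<lambda>(i, c). (u(t0 := p)) i c) = P (\<lambda>(i, c). u i c))"
    unfolding u by (intro bad_swap[OF C x X0] min)
  obtain p where p: "typed U \<sigma> C p" "\<not> Q0 (\<lambda>(i, c). (u(t0 := p)) i c)"
    "\<And>P. Def ?\<sigma> ((UNIV - {t1}) \<times> C) P \<Longrightarrow> P (\<lambda>(i, c). (u(t0 := p)) i c) = P (\<lambda>(i, c). u i c)"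
    using ex by blast
  \<comment> \<open>The interval reaches at most to the neighbours of \<open>t0\<close> in
    \<open>X0\<close>; the bounds at distance one serve when there are no such neighbours.\<close>
  define lo where "lo = Max (insert (t0 - 1) {i \<in> X0. i < t0})"
  define hi where "hi = Min (insert (t0 + 1) {i \<in> X0. t0 < i})"
  have lo: "lo < t0" "\<And>i. i \<in> X0 \<Longrightarrow> i < t0 \<Longrightarrow> i \<le> lo"
    using X0(1) by (auto simp: lo_def)
  have hi: "t0 < hi" "\<And>i. i \<in> X0 \<Longrightarrow> t0 < i \<Longrightarrow> hi \<le> i"
    using X0(1) by (auto simp: hi_def)
  define X where "X = {lo<..<hi}"
  have out: "i \<le> lo \<or> hi \<le> i" if "i \<in> X0" "i \<noteq> t0" for i
    using lo(2)[OF that(1)] hi(2)[OF that(1)] that(2) by (metis linorder_less_linear)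
  have t1: "t1 \<in> X0" "t1 \<notin> X" using X0(2,4,5) out[of t1] by (auto simp: X_def)
  let ?d = "\<lambda>(i, c). u i c" and ?E = "(X0 - {t0}) \<times> C"
  let ?\<chi> = "\<lambda>e. Q0 (\<lambda>w. e (case w of (i, c) \<Rightarrow> if i = t0 then Inl c else Inr (i, c)))"
  have Q0D: "Def ?\<sigma> (X0 \<times> C) Q0" by (rule SDef_Def[OF X0(6)])
  have \<chi>: "Def (case_sum \<sigma> ?\<sigma>) (Inl ` C \<union> Inr ` ?E) ?\<chi>"
    by (rule codef_rename[OF Q0D]) auto
  have \<chi>eq: "?\<chi> (case_sum q ?d) = Q0 (\<lambda>(i, c). (u(t0 := q)) i c)" if "typed U \<sigma> C q" for q
    by (rule codef_dep[OF Q0D]) (use ut that in \<open>auto simp: typed_def\<close>)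
  have finE: "finite ?E" using C X0(1) by simp
  have dt: "typed U ?\<sigma> ?E ?d" using ut by (auto simp: typed_def)
  show False
  proof (rule distal_swap[OF dist C finE ut p(1) dt uind lo(1) hi(1) X_def _ _ \<chi>])
    show "\<not> ?\<chi> (case_sum p ?d)" using \<chi>eq[OF p(1)] p(2) by simp
    fix i assume i: "i \<in> X"
    let ?b = "\<lambda>k. if k = t0 then i else k"
    have "strict_mono_on X0 ?b"
    proof (rule strict_mono_onI)
      fix a b assume "a \<in> X0" "b \<in> X0" "a < b"
      then show "?b a < ?b b" using i out[of a] out[of b] lo(1) hi(1) by (auto simp: X_def)
    qed
    then have "Q0 (\<lambda>(i, c). u (?b i) c)"
      using uind[unfolded ind_def, rule_format, OF X0(1) _ _ _ Q0D, of ?b] X0(7) mu by simp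
    moreover have "(\<lambda>(k, c). u (?b k) c) = (\<lambda>(k, c). (u(t0 := u i)) k c)" by (auto simp: fun_eq_iff)
    ultimately show "?\<chi> (case_sum (u i) ?d)" using \<chi>eq[of "u i"] ut by simp
  next
    fix P assume P: "Def ?\<sigma> (X \<times> C) P"
    show "P (\<lambda>(i, c). (u(t0 := p)) i c) = P (\<lambda>(i, c). u i c)"
      by (rule p(3)[OF codef_mono[OF P]]) (use t1(2) in auto)
  next
    fix F Q and g :: "rat \<Rightarrow> rat"
    assume F: "finite F" "F \<subseteq> X - {t0}" "strict_mono_on F g" "g ` F \<subseteq> X - {t0}"
      and Q: "Def (case_sum ?\<sigma> ?\<sigma>) (Inl ` (F \<times> C) \<union> Inr ` ?E) Q"
    \<comment> \<open>The parameters are entries of the same sequence outside the interval, so a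
      motion inside it extends to an increasing map fixing their indices.\<close>
    let ?F = "F \<union> (X0 - {t0})" and ?b = "\<lambda>i. if i \<in> F then g i else i"
    let ?Q = "\<lambda>e. Q (\<lambda>w. e (case_sum (\<lambda>v. v) (\<lambda>v. v) w))"
    have Q': "Def ?\<sigma> (?F \<times> C) ?Q" by (rule codef_rename[OF Q]) auto
    have sep: "i = t0" if "i \<in> X0" "i \<in> F" for i using F(2) out[of i] that by (auto simp: X_def)
    have "strict_mono_on ?F ?b"
    proof (rule strict_mono_onI)
      fix a b assume ab: "a \<in> ?F" "b \<in> ?F" "a < b"
      have in_X: "lo < k \<and> k < hi \<and> lo < g k \<and> g k < hi" if "k \<in> F" for k
        using F(2,4) that by (auto simp: X_def)
      show "?b a < ?b b"
        using ab F(3) in_X[of a] in_X[of b] out[of a] out[of b]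
        by (auto simp: strict_mono_on_def split: if_splits)
    qed
    then have "?Q (\<lambda>(i, c). u i c) = ?Q (\<lambda>(i, c). u (?b i) c)"
      using uind[unfolded ind_def, rule_format, OF _ _ _ _ Q', of ?b] F(1) X0(1) by simp
    moreover have "Q (case_sum (\<lambda>(i, c). u i c) ?d) = ?Q (\<lambda>(i, c). u i c)"
      by (rule codef_dep[OF Q]) (use ut in \<open>auto simp: typed_def\<close>)
    moreover have "Q (case_sum (\<lambda>(i, c). u (g i) c) ?d) = ?Q (\<lambda>(i, c). u (?b i) c)"
      by (rule codef_dep[OF Q]) (use ut in \<open>auto simp: typed_def split: if_splits dest: sep\<close>)
    ultimately show "Q (case_sum (\<lambda>(i, c). u i c) ?d) = Q (case_sum (\<lambda>(i, c). u (g i) c) ?d)" by simp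
  qed
qed

theorem no_nondistal_approximation:
  fixes \<sigma> :: "'c \<Rightarrow> 's"
  assumes dist: "distal \<kappa> L U" and fin: "finite C" "finite D" and disj: "C \<inter> D = {}"
    and \<chi>: "Def \<sigma> (C \<union> D) \<chi>"
    and approx: "\<And>n \<Delta>. finite \<Delta> \<Longrightarrow> \<Delta> \<subseteq> smalls \<sigma> C \<Longrightarrow>
      \<exists>y. pair_approx single_mixes \<sigma> C D {} \<chi> (\<lambda>e. \<not> \<chi> e) n \<Delta> y"
  shows False
proof -
  let ?\<sigma> = "\<lambda>(\<epsilon>::bool, c). \<sigma> c"
  have disj': "C \<inter> (D \<union> {}) = {}" and \<chi>': "Def \<sigma> (C \<union> D \<union> {}) \<chi>" using disj \<chi> by auto
  obtain x :: "rat \<Rightarrow> _" where x0: "ftyped ?\<sigma> (pairs C (D \<union> {})) x"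
    "ind (wf_fm L) U ?\<sigma> (pairs C (D \<union> {})) UNIV x"
    and x: "\<And>i. \<chi> (\<lambda>v. x i (False, v))" "\<And>i. \<not> \<chi> (\<lambda>v. x i (v \<in> C, v))"
    "\<And>d i j. d \<in> D \<Longrightarrow> x i (False, d) = x j (False, d)" "mix_ind single_mixes \<sigma> C x"
    by (rule pair_extraction[OF fin finite.emptyI disj' \<chi>' codef_not[OF \<chi>] approx]) (assumption+, rule that)
  note x0 = x0[unfolded Un_empty_right]
  show False
  proof (cases "mix_ind all_mixes \<sigma> C x")
    case True
    show ?thesis by (rule all_mixes_contradiction[OF dist fin disj x0 x(3) True \<chi> x(1,2)])
  next
    case False
    have "ftyped ?\<sigma> (UNIV \<times> C) x" using x0(1) by (auto simp: typed_def)
    moreover have "ind (wf_fm L) U ?\<sigma> (UNIV \<times> C) UNIV x"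
      using ind_pull[OF x0(2), where h = "\<lambda>v. v" and V = "UNIV \<times> C" and \<tau> = ?\<sigma>] by auto
    ultimately show ?thesis by (rule some_mix_contradiction[OF dist fin(1) _ _ x(4) False])
  qed
qed

end

section \<open>Finite approximations to a failure of distality\<close>

text \<open>Functions are extensional here so that the set is finite and a quantifier over it is a
  finite conjunction of formulas.\<close>

definition increasing :: "nat \<Rightarrow> nat \<Rightarrow> (nat \<Rightarrow> nat) set" where
  "increasing m n = {g \<in> {..<m} \<rightarrow>\<^sub>E {..<n}. strict_mono_on {..<m} g}"

definition selections :: "nat \<Rightarrow> (nat \<Rightarrow> bool) set" where
  "selections m = {\<epsilon> \<in> {..<m} \<rightarrow>\<^sub>E UNIV. card {k. k < m \<and> \<epsilon> k} \<le> 1}"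

lemma finite_increasing [simp]: "finite (increasing m n)"
  by (simp add: increasing_def finite_PiE)

lemma finite_selections [simp]: "finite (selections m)"
  by (simp add: selections_def finite_PiE)

text \<open>The version of \<open>pair_approx\<close> for single replacements that is visibly one
  formula. Members of \<Delta> are only names and \<open>Q\<close> interprets them, since the same
  formulas have to be read in several structures.\<close>

definition approx_pred ::
  "'c set \<Rightarrow> 'c set \<Rightarrow> (('c \<Rightarrow> 'a) \<Rightarrow> bool) \<Rightarrow> nat \<Rightarrow> (nat \<times> 'x) set \<Rightarrow>
   (nat \<times> 'x \<Rightarrow> (nat \<times> 'c \<Rightarrow> 'a) \<Rightarrow> bool) \<Rightarrow> (nat \<times> bool \<times> 'c \<Rightarrow> 'a) \<Rightarrow> bool" where
  "approx_pred C D \<chi> n \<Delta> Q h \<longleftrightarrow>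
     (\<forall>i\<in>{..<n}. \<chi> (\<lambda>v. h (i, False, v)) \<and> \<not> \<chi> (\<lambda>v. h (i, v \<in> C, v))) \<and>
     (\<forall>d\<in>D. \<forall>i\<in>{..<n}. \<forall>j\<in>{..<n}. h (i, False, d) = h (j, False, d)) \<and>
     (\<forall>q\<in>\<Delta>. \<forall>g\<in>increasing (fst q) n. \<forall>g'\<in>increasing (fst q) n.
        \<forall>\<epsilon>\<in>selections (fst q). \<forall>\<epsilon>'\<in>selections (fst q).
          Q q (\<lambda>(k, c). h (g k, \<epsilon> k, c)) \<longrightarrow> Q q (\<lambda>(k, c). h (g' k, \<epsilon>' k, c)))"

lemma (in fm_class) codef_approx_pred:
  assumes fin: "finite C" "finite D" "finite \<Delta>" and disj: "C \<inter> D = {}"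
    and ne: "\<And>s. carrier A s \<noteq> {}" "\<And>s. carrier B s \<noteq> {}"
    and \<chi>: "codef K A B \<sigma> (C \<union> D) \<chi> \<chi>'"
    and Q: "\<And>q. q \<in> \<Delta> \<Longrightarrow> codef K A B (\<lambda>(k, c). \<sigma> c) ({..<fst q} \<times> C) (Q q) (Q' q)"
  shows "codef K A B (\<lambda>(k, \<epsilon>, c). \<sigma> c) ({..<n} \<times> (UNIV \<times> C \<union> {False} \<times> D))
    (approx_pred C D \<chi> n \<Delta> Q) (approx_pred C D \<chi>' n \<Delta> Q')"
proof -
  let ?W = "{..<n} \<times> (UNIV \<times> C \<union> {False} \<times> D)" and ?\<sigma> = "\<lambda>(k::nat, \<epsilon>::bool, c). \<sigma> c"
  have 1: "codef K A B ?\<sigma> ?W (\<lambda>e. \<chi> (\<lambda>v. e (i, False, v))) (\<lambda>e. \<chi>' (\<lambda>v. e (i, False, v)))"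
    if "i \<in> {..<n}" for i
    by (rule codef_rename[OF \<chi>, where h = "\<lambda>v. (i, False, v)"]) (use that in auto)
  have 2: "codef K A B ?\<sigma> ?W (\<lambda>e. \<chi> (\<lambda>v. e (i, v \<in> C, v))) (\<lambda>e. \<chi>' (\<lambda>v. e (i, v \<in> C, v)))"
    if "i \<in> {..<n}" for i
    by (rule codef_rename[OF \<chi>, where h = "\<lambda>v. (i, v \<in> C, v)"]) (use that disj in auto)
  have 3: "codef K A B ?\<sigma> ?W (\<lambda>e. e (i, False, d) = e (j, False, d)) (\<lambda>e. e (i, False, d) = e (j, False, d))"
    if "d \<in> D" "i \<in> {..<n}" "j \<in> {..<n}" for d i j
    by (rule codef_eq) (use that in auto)
  have 4: "codef K A B ?\<sigma> ?W (\<lambda>e. Q q (\<lambda>(k, c). e (g k, \<epsilon> k, c))) (\<lambda>e. Q' q (\<lambda>(k, c). e (g k, \<epsilon> k, c)))"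
    if "q \<in> \<Delta>" "g \<in> increasing (fst q) n" for q g \<epsilon>
  proof -
    have "codef K A B ?\<sigma> ?W (\<lambda>e. Q q (\<lambda>v. e (case v of (k, c) \<Rightarrow> (g k, \<epsilon> k, c))))
        (\<lambda>e. Q' q (\<lambda>v. e (case v of (k, c) \<Rightarrow> (g k, \<epsilon> k, c))))"
      by (rule codef_rename[OF Q[OF that(1)]]) (use that(2) in \<open>auto simp: increasing_def\<close>)
    then show ?thesis by (simp add: case_prod_beta')
  qed
  show ?thesis
    unfolding approx_pred_def[abs_def]
    by (intro codef_conj codef_ball codef_imp codef_not 1 2 3 4 fin finite_increasing finite_selections
        finite_lessThan ne)
qed

section \<open>Increasing tuples in orders without endpoints\<close>

lemma above_finite:
  assumes I: "ordered_set I" "no_endpoints I" "fst I \<noteq> {}" and A: "finite A" "A \<subseteq> fst I"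
  shows "\<exists>z\<in>fst I. \<forall>a\<in>A. (a, z) \<in> snd I"
  using A
proof (induction A)
  case empty
  then show ?case using I(3) by auto
next
  case (insert a A)
  then obtain z where z: "z \<in> fst I" "\<forall>a\<in>A. (a, z) \<in> snd I" by auto
  have tr: "trans (snd I)" and tot: "total_on (fst I) (snd I)"
    using I(1) by (auto simp: ordered_set_def strict_linear_order_on_def)
  have a: "a \<in> fst I" using insert.prems by simp
  have up: "\<exists>y\<in>fst I. (x, y) \<in> snd I" if "x \<in> fst I" for x
    using I(2) that unfolding no_endpoints_def by blast
  obtain z' where z': "z' \<in> fst I" "(z, z') \<in> snd I" using up[OF z(1)] by blast
  consider "a = z" | "(a, z) \<in> snd I" | "(z, a) \<in> snd I"
    using tot z(1) a unfolding total_on_def by blast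
  then show ?case
  proof cases
    case 1
    have "\<forall>c\<in>insert a A. (c, z') \<in> snd I" using z(2) z'(2) transD[OF tr] 1 by blast
    then show ?thesis using z'(1) by blast
  next
    case 2
    then show ?thesis using z by blast
  next
    case 3
    obtain a' where a': "a' \<in> fst I" "(a, a') \<in> snd I" using up[OF a] by blast
    have "\<forall>c\<in>insert a A. (c, a') \<in> snd I" using z(2) a'(2) transD[OF tr] 3 by blast
    then show ?thesis using a'(1) by blast
  qed
qed

lemma increasing_list_above:
  assumes I: "ordered_set I" "no_endpoints I" "fst I \<noteq> {}" and A: "finite A" "A \<subseteq> fst I"
  shows "\<exists>zs. length zs = n \<and> set zs \<subseteq> fst I \<and> sorted_wrt (\<lambda>x y. (x, y) \<in> snd I) zs \<and>
    (\<forall>a\<in>A. \<forall>z\<in>set zs. (a, z) \<in> snd I)"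
proof (induction n)
  case 0
  show ?case by (rule exI[of _ "[]"]) auto
next
  case (Suc n)
  then obtain zs where zs: "length zs = n" "set zs \<subseteq> fst I" "sorted_wrt (\<lambda>x y. (x, y) \<in> snd I) zs"
    "\<forall>a\<in>A. \<forall>z\<in>set zs. (a, z) \<in> snd I" by blast
  obtain z where "z \<in> fst I" "\<forall>a\<in>A \<union> set zs. (a, z) \<in> snd I"
    using above_finite[OF I, of "A \<union> set zs"] A zs(2) by auto
  then show ?case using zs by (intro exI[of _ "zs @ [z]"]) (auto simp: sorted_wrt_append)
qed

lemma increasing_list_below:
  assumes J: "ordered_set J" "no_endpoints J" "fst J \<noteq> {}" and A: "finite A" "A \<subseteq> fst J"
  shows "\<exists>zs. length zs = n \<and> set zs \<subseteq> fst J \<and> sorted_wrt (\<lambda>x y. (x, y) \<in> snd J) zs \<and>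
    (\<forall>a\<in>A. \<forall>z\<in>set zs. (z, a) \<in> snd J)"
proof -
  let ?J = "(fst J, (snd J)\<inverse>)"
  have "ordered_set ?J"
    using J(1) by (auto simp: ordered_set_def strict_linear_order_on_def irrefl_def total_on_def)
  moreover have "no_endpoints ?J" using J(2) by (auto simp: no_endpoints_def)
  moreover have "fst ?J \<noteq> {}" "A \<subseteq> fst ?J" using J(3) A(2) by auto
  ultimately obtain zs where "length zs = n" "set zs \<subseteq> fst J"
    "sorted_wrt (\<lambda>x y. (x, y) \<in> (snd J)\<inverse>) zs" "\<forall>a\<in>A. \<forall>z\<in>set zs. (a, z) \<in> (snd J)\<inverse>"
    using increasing_list_above[of ?J A n] A(1) by auto
  then show ?thesis by (intro exI[of _ "rev zs"]) (auto simp: sorted_wrt_rev)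
qed

text \<open>
  Variables for \<open>m\<close> tuples of length \<open>l\<close> and \<open>r\<close> parameters: \<open>Inl (k, c)\<close> is the \<open>c\<close>-th entry of the
  \<open>k\<close>-th tuple.
\<close>

definition block_vars :: "nat \<Rightarrow> nat \<Rightarrow> nat \<Rightarrow> ((nat \<times> nat) + nat) list" where
  "block_vars m l r = concat (map (\<lambda>k. map (\<lambda>c. Inl (k, c)) [0..<l]) [0..<m]) @ map Inr [0..<r]"

abbreviation block_set :: "nat \<Rightarrow> nat \<Rightarrow> nat \<Rightarrow> ((nat \<times> nat) + nat) set" where
  "block_set m l r \<equiv> Inl ` ({..<m} \<times> {..<l}) \<union> Inr ` {..<r}"

abbreviation block_sort :: "'s list \<Rightarrow> 's list \<Rightarrow> (nat \<times> nat) + nat \<Rightarrow> 's" where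
  "block_sort ss ts \<equiv> case_sum (\<lambda>(k, c). ss ! c) ((!) ts)"

definition blocks :: "'a list list \<Rightarrow> 'a list \<Rightarrow> (nat \<times> nat) + nat \<Rightarrow> 'a" where
  "blocks xs ds = case_sum (\<lambda>(k, c). xs ! k ! c) (\<lambda>d. ds ! d)"

lemma set_block_vars: "set (block_vars m l r) = block_set m l r"
  by (force simp: block_vars_def)

lemma map_block_vars: "map f (block_vars m l r) =
    concat (map (\<lambda>k. map (\<lambda>c. f (Inl (k, c))) [0..<l]) [0..<m]) @ map (\<lambda>d. f (Inr d)) [0..<r]"
  by (simp add: block_vars_def map_concat comp_def)

lemma map_blocks:
  assumes "\<And>z. z \<in> set zs \<Longrightarrow> length z = l"
  shows "map (blocks zs ds) (block_vars (length zs) l (length ds)) = concat zs @ ds"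
proof -
  have "map (\<lambda>k. map (\<lambda>c. zs ! k ! c) [0..<l]) [0..<length zs] = zs"
    using assms by (auto intro!: nth_equalityI)
  moreover have "map (\<lambda>d. ds ! d) [0..<length ds] = ds" by (rule map_nth)
  ultimately show ?thesis by (simp add: map_block_vars blocks_def)
qed

lemma map_block_sort:
  "map (block_sort ss ts) (block_vars m (length ss) (length ts)) = concat (replicate m ss) @ ts"
proof -
  have "map (\<lambda>k. map (\<lambda>c. ss ! c) [0..<length ss]) [0..<m] = replicate m ss"
    by (auto simp: map_nth intro: nth_equalityI)
  then show ?thesis by (simp add: map_block_vars map_nth)
qed

lemma typed_blocks:
  assumes "set zs \<subseteq> tuples (elems U) ss" "ds \<in> tuples (elems U) ts"
  shows "typed U (block_sort ss ts) (block_set (length zs) (length ss) (length ts)) (blocks zs ds)"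
proof -
  have "zs ! k ! c \<in> carrier U (ss ! c)" if "k < length zs" "c < length ss" for k c
  proof -
    have "zs ! k \<in> tuples (elems U) ss" using assms(1) that(1) nth_mem by blast
    then show ?thesis using that(2) by (auto simp: tuples_def elems_def list_all2_conv_all_nth)
  qed
  moreover have "ds ! k \<in> carrier U (ts ! k)" if "k < length ts" for k
    using assms(2) that by (auto simp: tuples_def elems_def list_all2_conv_all_nth)
  ultimately show ?thesis by (auto simp: typed_def blocks_def)
qed

lemma tuples_mono: "A \<subseteq> B \<Longrightarrow> tuples A ts \<subseteq> tuples B ts"
  by (auto simp: tuples_def elim: list_all2_mono)

lemma tuples_length: "as \<in> tuples A ts \<Longrightarrow> length as = length ts"
  by (auto simp: tuples_def list_all2_lengthD)

lemma indiscernible_blocks: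
  assumes ind: "indiscernible L U D ss I" and ds: "ds \<in> tuples D ts"
    and xs: "set xs \<subseteq> fst I" "sorted_wrt (\<lambda>x y. (x, y) \<in> snd I) xs"
    and ys: "set ys \<subseteq> fst I" "sorted_wrt (\<lambda>x y. (x, y) \<in> snd I) ys" "length xs = length ys"
    and D: "D \<subseteq> elems U"
    and P: "dfn (wf_fm L) U (block_sort ss ts) (block_set (length xs) (length ss) (length ts)) P"
  shows "P (blocks xs ds) = P (blocks ys ds)"
proof -
  interpret fm_class L "wf_fm L" by (rule fm_class_wf)
  let ?W = "block_set (length xs) (length ss) (length ts)"
  obtain vs \<phi> where vs: "set vs \<subseteq> ?W" "wf_fm L (map (block_sort ss ts) vs) \<phi>"
    "\<And>e. typed U (block_sort ss ts) ?W e \<Longrightarrow> P e = sat U (map e vs) \<phi>"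
    using P unfolding codef_def by blast
  let ?us = "block_vars (length xs) (length ss) (length ts)"
  let ?\<phi> = "relist \<phi> vs ?us"
  have sub: "set vs \<subseteq> set ?us" using vs(1) by (simp add: set_block_vars)
  have I: "fst I \<subseteq> tuples (elems U) ss" using ind by (simp add: indiscernible_def)
  have "wf_fm L (concat (replicate (length xs) ss) @ ts) ?\<phi>"
    using K_relist[OF vs(2) sub] by (simp only: map_block_sort)
  then have "sat U (concat xs @ ds) ?\<phi> = sat U (concat ys @ ds) ?\<phi>"
    using ind ds xs ys unfolding indiscernible_def by blast
  moreover have "P (blocks zs ds) = sat U (concat zs @ ds) ?\<phi>"
    if "set zs \<subseteq> fst I" "length zs = length xs" for zs
  proof -
    have "typed U (block_sort ss ts) ?W (blocks zs ds)"
      using typed_blocks[of zs U ss ds ts] that I ds tuples_mono[OF D] by auto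
    moreover have "map (blocks zs ds) ?us = concat zs @ ds"
      using map_blocks[of zs "length ss" ds] that I tuples_length[OF ds] tuples_length by fastforce
    ultimately show ?thesis using vs(3) sat_relist[OF vs(2) sub] by metis
  qed
  ultimately show ?thesis using xs ys by simp
qed

text \<open>One element \<open>b\<close> has to serve every position of a fixed sequence. For each
  position \<open>t\<close> there are \<open>n\<close> members of \<open>I\<close> and
  \<open>J\<close> with \<open>b\<close> fitting at \<open>t\<close>. That some element behaves
  there as \<open>b\<close> does is a formula over the parameters, so indiscernibility over
  \<open>D\<close> transfers it to one sequence common to all \<open>t\<close>. The solutions for
  different \<open>t\<close> are unrelated, which is why selections allow a single replacement
  only.\<close>

lemma nondistal_approx:
  fixes L :: "('s, 'f, 'r) lang" and U :: "('s, 'f, 'r, 'a) struct" and I J :: "'a list ordered_set" and b :: "'a list"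
  defines "B \<equiv> I \<oplus> singleton b \<oplus> J"
  assumes ne: "\<And>s. carrier U s \<noteq> {}"
    and I: "ordered_set I" "no_endpoints I" "infinite (fst I)"
    and J: "ordered_set J" "no_endpoints J" "infinite (fst J)"
    and disj: "fst I \<inter> fst J = {}" "b \<notin> fst I \<union> fst J"
    and ind0: "indiscernible L U {} ss B"
    and D: "D \<subseteq> elems U" and indD: "indiscernible L U D ss (I \<oplus> J)"
    and not_ind: "\<not> indiscernible L U D ss B"
  obtains \<sigma> :: "nat + (nat \<times> nat) + nat \<Rightarrow> 's" and C E \<chi> where
    "finite C" "finite E" "C \<inter> E = {}" "dfn (wf_fm L) U \<sigma> (C \<union> E) \<chi>"
    "\<And>n (\<Delta> :: (nat \<times> 'x) set) Q. finite \<Delta> \<Longrightarrow>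
      (\<And>q. q \<in> \<Delta> \<Longrightarrow> dfn (wf_fm L) U (\<lambda>(k, c). \<sigma> c) ({..<fst q} \<times> C) (Q q)) \<Longrightarrow>
      \<exists>h. typed U (\<lambda>(k, \<epsilon>, c). \<sigma> c) ({..<n} \<times> (UNIV \<times> C \<union> {False} \<times> E)) h \<and> approx_pred C E \<chi> n \<Delta> Q h"
proof -
  interpret fm_class L "wf_fm L" by (rule fm_class_wf)
  let ?less = "\<lambda>x y. (x, y) \<in> snd B" and ?lessD = "\<lambda>x y. (x, y) \<in> snd (I \<oplus> J)"
  define l where "l = length ss"
  have fstB: "fst B = insert b (fst I \<union> fst J)" by (auto simp: B_def concatenation_def singleton_def)
  have fstIJ: "fst (I \<oplus> J) = fst I \<union> fst J" by (simp add: concatenation_def)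
  have sndB: "snd B = snd I \<union> snd J \<union> fst I \<times> {b} \<union> (fst I \<union> {b}) \<times> fst J"
    by (auto simp: B_def concatenation_def singleton_def)
  have sndIJ: "snd (I \<oplus> J) = snd I \<union> snd J \<union> fst I \<times> fst J" by (simp add: concatenation_def)
  have rel: "snd I \<subseteq> fst I \<times> fst I" "snd J \<subseteq> fst J \<times> fst J" using I(1) J(1) by (auto simp: ordered_set_def)
  have lessD: "?less x y \<longleftrightarrow> ?lessD x y" if "x \<noteq> b" "y \<noteq> b" for x y
    using that unfolding sndB sndIJ by auto
  have sortedD: "sorted_wrt ?less zs \<longleftrightarrow> sorted_wrt ?lessD zs" if "set zs \<subseteq> fst I \<union> fst J" for zs
  proof -
    have "z \<noteq> b" if "z \<in> set zs" for z using that \<open>set zs \<subseteq> _\<close> disj(2) by blast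
    then show ?thesis using lessD by (auto simp: sorted_wrt_iff_nth_less)
  qed
  have nonempty: "fst I \<noteq> {}" "fst J \<noteq> {}" using I(3) J(3) by auto
  have tup: "fst B \<subseteq> tuples (elems U) ss" using ind0 by (simp add: indiscernible_def)
  have lenB: "length z = l" if "z \<in> fst B" for z using tup that tuples_length unfolding l_def by blast
  have "ordered_set B" using ind0 by (simp add: indiscernible_def)
  then obtain xs ys \<phi> ts ds where ds: "ds \<in> tuples D ts" and xs: "set xs \<subseteq> fst B" "sorted_wrt ?less xs"
    and ys: "set ys \<subseteq> fst B" "sorted_wrt ?less ys" "length xs = length ys"
    and wf: "wf_fm L (concat (replicate (length xs) ss) @ ts) \<phi>"
    and ne_sat: "sat U (concat xs @ ds) \<phi> \<noteq> sat U (concat ys @ ds) \<phi>"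
    using not_ind tup unfolding indiscernible_def by blast
  define m where "m = length xs"
  define r where "r = length ts"
  obtain zs0 where zs0: "length zs0 = m" "set zs0 \<subseteq> fst I" "sorted_wrt (\<lambda>x y. (x, y) \<in> snd I) zs0"
    using increasing_list_above[OF I(1,2) nonempty(1), of "{}" m] by auto
  \<comment> \<open>The truth value of \<phi> on all increasing tuples avoiding \<open>b\<close>, by
    indiscernibility over \<open>D\<close>. A tuple with the other value must contain
    \<open>b\<close>.\<close>
  define v where "v = sat U (concat zs0 @ ds) \<phi>"
  have v: "sat U (concat zs @ ds) \<phi> = v"
    if "set zs \<subseteq> fst I \<union> fst J" "sorted_wrt ?less zs" "length zs = m" for zs
  proof -
    have "set zs \<subseteq> fst (I \<oplus> J)" "sorted_wrt ?lessD zs" using that sortedD fstIJ by auto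
    moreover have "set zs0 \<subseteq> fst (I \<oplus> J)" "sorted_wrt ?lessD zs0"
      using zs0 fstIJ sndIJ by (auto elim: sorted_wrt_mono_rel[rotated])
    ultimately show ?thesis
      using indD ds wf that(3) zs0(1) unfolding indiscernible_def v_def m_def by metis
  qed
  obtain xs0 where xs0: "set xs0 \<subseteq> fst B" "sorted_wrt ?less xs0" "length xs0 = m"
    "sat U (concat xs0 @ ds) \<phi> \<noteq> v" using xs ys ne_sat unfolding m_def by metis
  have "b \<in> set xs0"
  proof (rule ccontr)
    assume "b \<notin> set xs0"
    then have "set xs0 \<subseteq> fst I \<union> fst J" using xs0(1) unfolding fstB by blast
    from v[OF this xs0(2,3)] xs0(4) show False by contradiction
  qed
  then obtain ls rs where xs0_eq: "xs0 = ls @ b # rs" by (meson split_list)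
  define p where "p = length ls"
  have m_eq: "m = Suc (p + length rs)" using xs0(3) by (simp add: xs0_eq p_def)
  have lsI: "set ls \<subseteq> fst I" and rsJ: "set rs \<subseteq> fst J"
    using xs0(2) disj(2) rel unfolding xs0_eq by (auto simp: sorted_wrt_append sndB)
  have sls: "sorted_wrt ?less ls" and srs: "sorted_wrt ?less rs"
    using xs0(2) unfolding xs0_eq by (auto simp: sorted_wrt_append)
  let ?us = "block_vars m l r"
  define P0 where "P0 e = sat U (map e ?us) \<phi>" for e
  have P0: "dfn (wf_fm L) U (block_sort ss ts) (block_set m l r) P0"
    unfolding codef_def P0_def
  proof (intro exI[of _ ?us] exI[of _ \<phi>] conjI)
    show "set ?us \<subseteq> block_set m l r" by (simp add: set_block_vars)
    show "wf_fm L (map (block_sort ss ts) ?us) \<phi>"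
      using wf by (simp only: m_def l_def r_def map_block_sort)
  qed auto
  have P0_blocks: "P0 (blocks zs ds) = sat U (concat zs @ ds) \<phi>"
    if "set zs \<subseteq> fst B" "length zs = m" for zs
    using map_blocks[of zs l ds] that lenB tuples_length[OF ds] unfolding P0_def r_def by fastforce
  \<comment> \<open>\<open>C\<close> labels the tuple in place \<open>p\<close>, where
    \<open>b\<close> stood; \<open>E\<close> labels the other tuples of \<open>xs0\<close> and the
    parameters \<open>ds\<close>.\<close>
  define C :: "(nat + (nat \<times> nat) + nat) set" where "C = Inl ` {..<l}"
  define E :: "(nat + (nat \<times> nat) + nat) set" where
    "E = Inr ` (Inl ` (({..<m} - {p}) \<times> {..<l}) \<union> Inr ` {..<r})"
  define \<sigma> where "\<sigma> = case_sum ((!) ss) (block_sort ss ts)"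
  define h\<chi> :: "(nat \<times> nat) + nat \<Rightarrow> nat + (nat \<times> nat) + nat" where
    "h\<chi> = case_sum (\<lambda>(k, c). if k = p then Inl c else Inr (Inl (k, c))) (\<lambda>d. Inr (Inr d))"
  define \<chi> where "\<chi> e \<longleftrightarrow> P0 (\<lambda>w. e (h\<chi> w)) = v" for e
  have fin: "finite C" "finite E" and CE: "C \<inter> E = {}" by (auto simp: C_def E_def)
  have \<chi>: "dfn (wf_fm L) U \<sigma> (C \<union> E) \<chi>"
    unfolding \<chi>_def
    by (intro codef_iff_const codef_rename[OF P0]) (auto simp: C_def E_def h\<chi>_def \<sigma>_def)
  have ds': "ds \<in> tuples (elems U) ts" using ds tuples_mono[OF D] by blast
  have "\<exists>h. typed U (\<lambda>(k, \<epsilon>, c). \<sigma> c) ({..<n} \<times> (UNIV \<times> C \<union> {False} \<times> E)) h \<and> approx_pred C E \<chi> n \<Delta> Q h"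
    if fin\<Delta>: "finite \<Delta>" and Q: "\<And>q. q \<in> \<Delta> \<Longrightarrow> dfn (wf_fm L) U (\<lambda>(k, c). \<sigma> c) ({..<fst q} \<times> C) (Q q)"
    for n and \<Delta> :: "(nat \<times> 'x) set" and Q
  proof -
    obtain iI where iI: "length iI = n" "set iI \<subseteq> fst I" "sorted_wrt (\<lambda>x y. (x, y) \<in> snd I) iI"
      "\<And>a z. a \<in> set ls \<Longrightarrow> z \<in> set iI \<Longrightarrow> (a, z) \<in> snd I"
      using increasing_list_above[OF I(1,2) nonempty(1), of "set ls" n] lsI by auto
    obtain jJ where jJ: "length jJ = n" "set jJ \<subseteq> fst J" "sorted_wrt (\<lambda>x y. (x, y) \<in> snd J) jJ"
      "\<And>a z. a \<in> set rs \<Longrightarrow> z \<in> set jJ \<Longrightarrow> (z, a) \<in> snd J"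
      using increasing_list_below[OF J(1,2) nonempty(2), of "set rs" n] rsJ by auto
    have siI: "sorted_wrt ?less iI" "sorted_wrt ?less jJ"
      using iI(3) jJ(3) by (auto simp: sndB elim: sorted_wrt_mono_rel[rotated])
    \<comment> \<open>With \<open>t\<close> members in \<open>I\<close> and the others in
      \<open>J\<close>, the member at position \<open>t\<close> is the first one beyond
      \<open>b\<close>. Replacing it by \<open>b\<close> keeps the order.\<close>
    define w where "w t = take t iI @ take (n - t) jJ" for t
    have setw: "set (w t) \<subseteq> fst I \<union> fst J" for t
      using iI(2) jJ(2) by (auto simp: w_def dest: in_set_takeD)
    have lenw: "length (w t) = n" if "t \<le> n" for t using that iI(1) jJ(1) by (simp add: w_def)
    have sort_w: "sorted_wrt ?less (ls @ w t @ rs)" for t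
      using sls srs siI iI(2,4) jJ(2,4) lsI rsJ
      by (auto simp: w_def sorted_wrt_append sndB sorted_wrt_take dest!: in_set_takeD)
    have sort_wb: "sorted_wrt ?less (ls @ (w t)[t := b] @ rs)" if t: "t < n" for t
    proof -
      obtain z zs where zs: "take (n - t) jJ = z # zs" using t jJ(1) by (cases "take (n - t) jJ") auto
      have "sorted_wrt ?less (z # zs)" unfolding zs[symmetric] by (intro sorted_wrt_take siI)
      moreover have "set (z # zs) \<subseteq> set jJ" unfolding zs[symmetric] by (rule set_take_subset)
      moreover have "(w t)[t := b] = take t iI @ b # zs"
        using t iI(1) by (simp add: w_def zs list_update_append)
      ultimately show ?thesis
        using sls srs siI(1) iI(2,4) jJ(2,4) lsI rsJ
        by (auto simp: sorted_wrt_append sndB sorted_wrt_take dest!: in_set_takeD)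
    qed
    have sel: "sorted_wrt ?less (map (\<lambda>k. zs ! g k) [0..<k])"
      if "sorted_wrt ?less zs" "g \<in> increasing k (length zs)" for zs g k
    proof -
      show ?thesis
        unfolding sorted_wrt_iff_nth_less
      proof (intro allI impI)
        fix i j assume ij: "i < j" "j < length (map (\<lambda>k. zs ! g k) [0..<k])"
        then have "g i < g j" "g j < length zs" using that(2) by (auto simp: increasing_def strict_mono_on_def)
        then show "?less (map (\<lambda>k. zs ! g k) [0..<k] ! i) (map (\<lambda>k. zs ! g k) [0..<k] ! j)"
          using that(1) ij by (simp add: sorted_wrt_iff_nth_less)
      qed
    qed
    define S where "S q g zs \<longleftrightarrow> Q q (\<lambda>(k, c). zs ! g k ! projl c)" for q and g :: "nat \<Rightarrow> nat" and zs
    have Qd: "dfn (wf_fm L) U (block_sort ss []) (block_set (fst q) l 0) (\<lambda>e. Q q (\<lambda>(k, c). e (Inl (k, projl c))))"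
      if "q \<in> \<Delta>" for q
    proof -
      have "dfn (wf_fm L) U (block_sort ss []) (block_set (fst q) l 0)
          (\<lambda>e. Q q (\<lambda>w. e (case w of (k, c) \<Rightarrow> Inl (k, projl c))))"
        by (rule codef_rename[OF Q[OF that]]) (auto simp: C_def \<sigma>_def)
      then show ?thesis by (simp add: case_prod_beta')
    qed
    have S_eq: "S q g zs = S q g' zs'"
      if "q \<in> \<Delta>" "g \<in> increasing (fst q) n" "g' \<in> increasing (fst q) n"
        "set zs \<subseteq> fst B" "sorted_wrt ?less zs" "length zs = n"
        "set zs' \<subseteq> fst B" "sorted_wrt ?less zs'" "length zs' = n" for q g g' zs zs'
    proof -
      let ?sub = "\<lambda>g zs. map (\<lambda>k. zs ! g k) [0..<fst q]"
      let ?Q = "\<lambda>e. Q q (\<lambda>(k, c). e (Inl (k, projl c)))"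
      have sub: "set (?sub g zs) \<subseteq> fst B" if zs: "set zs \<subseteq> fst B" "length zs = n" "g \<in> increasing (fst q) n" for g zs
      proof -
        have "g k < length zs" if "k < fst q" for k using zs(2,3) that by (auto simp: increasing_def)
        then have "zs ! g k \<in> fst B" if "k < fst q" for k using zs(1) that nth_mem by blast
        then show ?thesis by auto
      qed
      have Sb: "S q g zs = ?Q (blocks (?sub g zs) [])"
        if "set zs \<subseteq> fst B" "length zs = n" "g \<in> increasing (fst q) n" for g zs
        unfolding S_def
      proof (rule codef_dep[OF Q[OF \<open>q \<in> \<Delta>\<close>], symmetric])
        have "zs ! g k ! c \<in> carrier U (ss ! c)" if "k < fst q" "c < l" for k c
        proof -
          have "g k < length zs"
            using \<open>length zs = n\<close> \<open>g \<in> increasing (fst q) n\<close> \<open>k < fst q\<close> by (auto simp: increasing_def)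
          then have "zs ! g k \<in> tuples (elems U) ss" using \<open>set zs \<subseteq> fst B\<close> tup nth_mem by blast
          then show ?thesis using that(2) by (auto simp: l_def tuples_def elems_def list_all2_conv_all_nth)
        qed
        then show "typed U (\<lambda>(k, c). \<sigma> c) ({..<fst q} \<times> C) (\<lambda>(k, c). blocks (?sub g zs) [] (Inl (k, projl c)))"
          by (auto simp: typed_def C_def \<sigma>_def blocks_def)
      qed (auto simp: blocks_def)
      have "?Q (blocks (?sub g zs) []) = ?Q (blocks (?sub g' zs') [])"
      proof (rule indiscernible_blocks[OF ind0, where ts = "[]"])
        show "sorted_wrt ?less (?sub g zs)" "sorted_wrt ?less (?sub g' zs')"
          using sel that by auto
        show "dfn (wf_fm L) U (block_sort ss []) (block_set (length (?sub g zs)) (length ss) (length [])) ?Q"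
          using Qd[OF that(1)] by (simp add: l_def)
        show "set (?sub g zs) \<subseteq> fst B" "set (?sub g' zs') \<subseteq> fst B" by (rule sub; fact that)+
      qed (auto simp: tuples_def)
      then show ?thesis using Sb[OF that(4,6,2)] Sb[OF that(7,9,3)] by simp
    qed
    \<comment> \<open>The length of \<open>ls @ w t @ rs\<close>; the row \<open>N\<close> just
      beyond it holds the element to be quantified.\<close>
    define N where "N = n + p + length rs"
    let ?V = "Inl ` ({N} \<times> {..<l}) :: ((nat \<times> nat) + nat) set" and ?W = "block_set N l r"
    let ?\<tau> = "block_sort ss ts"
    \<comment> \<open>Row \<open>p\<close> of \<open>xs0\<close> goes to the new row
      \<open>N\<close>. The rows of \<open>rs\<close> shift by \<open>n - 1\<close>, because
      \<open>n\<close> members of \<open>w t\<close> stand where the single \<open>b\<close>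
      stood.\<close>
    define h\<Theta> :: "(nat \<times> nat) + nat \<Rightarrow> (nat \<times> nat) + nat" where
      "h\<Theta> = case_sum (\<lambda>(k, c). Inl (if k < p then k else if k = p then N else k + n - 1, c)) Inr"
    define Qt where "Qt q g t e \<longleftrightarrow> Q q (\<lambda>(k, c). e (Inl (if g k = t then N else p + g k, projl c)))"
      for q t and g :: "nat \<Rightarrow> nat" and e :: "(nat \<times> nat) + nat \<Rightarrow> 'a"
    define Qn where "Qn q g e \<longleftrightarrow> Q q (\<lambda>(k, c). e (Inl (p + g k, projl c)))"
      for q and g :: "nat \<Rightarrow> nat" and e :: "(nat \<times> nat) + nat \<Rightarrow> 'a"
    \<comment> \<open>Some element gives \<phi> the wrong truth value in place \<open>p\<close>, yet
      may replace member \<open>t\<close> without affecting any formula in \<Delta> on increasing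
      tuples. On \<open>w t\<close> this is witnessed by \<open>b\<close>.\<close>
    define \<Theta> where "\<Theta> t e \<longleftrightarrow> (\<exists>f. typed U ?\<tau> ?V f \<and> P0 (\<lambda>w. override_on e f ?V (h\<Theta> w)) \<noteq> v \<and>
        (\<forall>q\<in>\<Delta>. \<forall>g\<in>increasing (fst q) n. Qt q g t (override_on e f ?V) = Qn q g (override_on e f ?V)))" for t e
    have Qt: "dfn (wf_fm L) U ?\<tau> (?W \<union> ?V) (Qt q g t)" if "q \<in> \<Delta>" "g \<in> increasing (fst q) n" for q g t
    proof -
      have "dfn (wf_fm L) U ?\<tau> (?W \<union> ?V)
          (\<lambda>e. Q q (\<lambda>w. e (case w of (k, c) \<Rightarrow> Inl (if g k = t then N else p + g k, projl c))))"
      proof (rule codef_rename[OF Q[OF that(1)]])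
        fix x assume "x \<in> {..<fst q} \<times> C"
        then obtain k c where x: "x = (k, Inl c)" "k < fst q" "c < l" by (auto simp: C_def)
        then have "g k < n" using that(2) by (auto simp: increasing_def)
        then show "(case x of (k, c) \<Rightarrow> Inl (if g k = t then N else p + g k, projl c)) \<in> ?W \<union> ?V \<and>
            ?\<tau> (case x of (k, c) \<Rightarrow> Inl (if g k = t then N else p + g k, projl c)) = (\<lambda>(k, c). \<sigma> c) x"
          using x by (simp add: \<sigma>_def N_def image_iff)
      qed
      then show ?thesis unfolding Qt_def[abs_def] by (simp add: case_prod_beta')
    qed
    have Qn: "dfn (wf_fm L) U ?\<tau> (?W \<union> ?V) (Qn q g)" if "q \<in> \<Delta>" "g \<in> increasing (fst q) n" for q g
    proof -
      have "dfn (wf_fm L) U ?\<tau> (?W \<union> ?V) (\<lambda>e. Q q (\<lambda>w. e (case w of (k, c) \<Rightarrow> Inl (p + g k, projl c))))"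
      proof (rule codef_rename[OF Q[OF that(1)]])
        fix x assume "x \<in> {..<fst q} \<times> C"
        then obtain k c where x: "x = (k, Inl c)" "k < fst q" "c < l" by (auto simp: C_def)
        then have "g k < n" using that(2) by (auto simp: increasing_def)
        then show "(case x of (k, c) \<Rightarrow> Inl (p + g k, projl c)) \<in> ?W \<union> ?V \<and>
            ?\<tau> (case x of (k, c) \<Rightarrow> Inl (p + g k, projl c)) = (\<lambda>(k, c). \<sigma> c) x"
          using x by (simp add: \<sigma>_def N_def image_iff)
      qed
      then show ?thesis unfolding Qn_def[abs_def] by (simp add: case_prod_beta')
    qed
    have P\<Theta>: "dfn (wf_fm L) U ?\<tau> (?W \<union> ?V) (\<lambda>e. P0 (\<lambda>w. e (h\<Theta> w)) \<noteq> v)"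
      by (intro codef_not codef_iff_const codef_rename[OF P0])
        (auto simp: h\<Theta>_def N_def m_eq)
    have \<Theta>: "dfn (wf_fm L) U ?\<tau> ?W (\<Theta> t)" for t
      unfolding \<Theta>_def[abs_def]
      by (intro codef_exs codef_conj codef_ball codef_iff P\<Theta> Qt Qn fin\<Delta> finite_increasing ne) simp_all
    have \<Theta>_wt: "\<Theta> t (blocks (ls @ w t @ rs) ds)" if t: "t < n" for t
      unfolding \<Theta>_def
    proof (intro exI conjI ballI)
      let ?zs = "ls @ w t @ rs"
      let ?f = "blocks (?zs @ [b]) ds"
      let ?e = "override_on (blocks ?zs ds) ?f ?V"
      have len: "length ?zs = N" using t by (simp add: lenw N_def p_def)
      have zsb: "set (?zs @ [b]) \<subseteq> tuples (elems U) ss"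
        using lsI rsJ setw[of t] fstB tup by auto
      have fty: "typed U ?\<tau> (block_set (Suc N) l r) ?f"
        using typed_blocks[OF zsb ds'] len by (simp add: l_def r_def)
      show "typed U ?\<tau> ?V ?f" by (rule typed_mono[OF fty]) auto
      have ef: "?e x = ?f x" if "x \<in> block_set (Suc N) l r" for x
        using that len by (auto simp: override_on_def blocks_def nth_append less_Suc_eq)
      have "P0 (blocks xs0 ds) = P0 (\<lambda>w. ?e (h\<Theta> w))"
      proof (rule codef_dep[OF P0])
        show "typed U ?\<tau> (block_set m l r) (blocks xs0 ds)"
          using typed_blocks[of xs0 U ss ds ts] xs0(1,3) tup ds' by (auto simp: l_def r_def)
        fix x assume x: "x \<in> block_set m l r"
        have "h\<Theta> x \<in> block_set (Suc N) l r" using x by (auto simp: h\<Theta>_def N_def m_eq)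
        then have "?e (h\<Theta> x) = ?f (h\<Theta> x)" by (rule ef)
        also have "\<dots> = blocks xs0 ds x"
          using x len lenw[of t] t unfolding xs0_eq h\<Theta>_def blocks_def N_def
          by (auto simp: nth_append nth_Cons' p_def m_eq)
        finally show "blocks xs0 ds x = ?e (h\<Theta> x)" by simp
      qed
      then show "P0 (\<lambda>w. ?e (h\<Theta> w)) \<noteq> v" using P0_blocks[OF xs0(1,3)] xs0(4) by simp
      fix q g assume q: "q \<in> \<Delta>" and g: "g \<in> increasing (fst q) n"
      have gn: "g k < n" if "k < fst q" for k using g that by (auto simp: increasing_def)
      have et: "typed U ?\<tau> (block_set (Suc N) l r) ?e" using fty ef by (auto simp: typed_def)
      have eI: "?e (Inl (k, c)) \<in> carrier U (ss ! c)" if "k < Suc N" "c < l" for k c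
        using et[unfolded typed_def, rule_format, of "Inl (k, c)"] that by simp
      have gN: "p + g k < Suc N" if "k < fst q" for k using gn[OF that] by (simp add: N_def)
      have tyt: "typed U (\<lambda>(k, c). \<sigma> c) ({..<fst q} \<times> C) (\<lambda>(k, c). ?e (Inl (if g k = t then N else p + g k, projl c)))"
        unfolding typed_def
      proof
        fix x assume "x \<in> {..<fst q} \<times> C"
        then obtain k c where x: "x = (k, Inl c)" "k < fst q" "c < l" by (auto simp: C_def)
        have "?e (Inl (if g k = t then N else p + g k, c)) \<in> carrier U (ss ! c)" by (rule eI) (use gN x in auto)
        then show "(case x of (k, c) \<Rightarrow> ?e (Inl (if g k = t then N else p + g k, projl c))) \<in> carrier U (case x of (k, c) \<Rightarrow> \<sigma> c)"
          unfolding x(1) by (simp only: split sum.sel \<sigma>_def sum.case)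
      qed
      have tyn: "typed U (\<lambda>(k, c). \<sigma> c) ({..<fst q} \<times> C) (\<lambda>(k, c). ?e (Inl (p + g k, projl c)))"
        unfolding typed_def
      proof
        fix x assume "x \<in> {..<fst q} \<times> C"
        then obtain k c where x: "x = (k, Inl c)" "k < fst q" "c < l" by (auto simp: C_def)
        have "?e (Inl (p + g k, c)) \<in> carrier U (ss ! c)" by (rule eI) (use gN x in auto)
        then show "(case x of (k, c) \<Rightarrow> ?e (Inl (p + g k, projl c))) \<in> carrier U (case x of (k, c) \<Rightarrow> \<sigma> c)"
          unfolding x(1) by (simp only: split sum.sel \<sigma>_def sum.case)
      qed
      have wN: "(?zs @ [b]) ! N = b" "\<And>i. i < n \<Longrightarrow> (?zs @ [b]) ! (p + i) = w t ! i"
        using len lenw[of t] t by (auto simp: nth_append p_def)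
      have wb: "(w t)[t := b] ! i = (if i = t then b else w t ! i)" if "i < n" for i
        using that lenw[of t] t by (simp add: nth_list_update)
      have "Qt q g t ?e = S q g ((w t)[t := b])"
        unfolding Qt_def S_def
      proof (rule codef_dep[OF Q[OF q] tyt])
        fix x assume "x \<in> {..<fst q} \<times> C"
        then obtain k c where x: "x = (k, Inl c)" "k < fst q" "c < l" by (auto simp: C_def)
        have "?e (Inl (if g k = t then N else p + g k, c)) = ?f (Inl (if g k = t then N else p + g k, c))"
          by (rule ef) (use x gn[OF x(2)] in \<open>auto simp: N_def\<close>)
        then show "(\<lambda>(k, c). ?e (Inl (if g k = t then N else p + g k, projl c))) x
            = (\<lambda>(k, c). (w t)[t := b] ! g k ! projl c) x"
          using wN wb[OF gn[OF x(2)]] gn[OF x(2)] by (simp add: x(1) blocks_def)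
      qed
      moreover have "Qn q g ?e = S q g (w t)"
        unfolding Qn_def S_def
      proof (rule codef_dep[OF Q[OF q] tyn])
        fix x assume "x \<in> {..<fst q} \<times> C"
        then obtain k c where x: "x = (k, Inl c)" "k < fst q" "c < l" by (auto simp: C_def)
        have "?e (Inl (p + g k, c)) = ?f (Inl (p + g k, c))"
          by (rule ef) (use x gn[OF x(2)] in \<open>auto simp: N_def\<close>)
        then show "(\<lambda>(k, c). ?e (Inl (p + g k, projl c))) x = (\<lambda>(k, c). w t ! g k ! projl c) x"
          using wN gn[OF x(2)] by (simp add: x(1) blocks_def)
      qed
      moreover have "S q g ((w t)[t := b]) = S q g (w t)"
      proof (rule S_eq[OF q g g])
        show "set ((w t)[t := b]) \<subseteq> fst B" using set_update_subset_insert[of "w t" t b] setw[of t] fstB by blast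
        show "set (w t) \<subseteq> fst B" using setw[of t] fstB by blast
        show "sorted_wrt ?less ((w t)[t := b])" "sorted_wrt ?less (w t)"
          using sort_w[of t] sort_wb[OF t] by (auto simp: sorted_wrt_append)
      qed (use lenw[of t] t in auto)
      ultimately show "Qt q g t ?e = Qn q g ?e" by simp
    qed
    let ?z0 = "ls @ w 0 @ rs"
    \<comment> \<open>The sequence \<open>w t\<close> varies with \<open>t\<close>; only after this
      transfer do all positions refer to the same members, those of \<open>w 0\<close>.\<close>
    have "\<Theta> t (blocks ?z0 ds)" if t: "t < n" for t
    proof -
      have IJ: "set (ls @ w t @ rs) \<subseteq> fst I \<union> fst J" for t using lsI rsJ setw[of t] by auto
      have "\<Theta> t (blocks (ls @ w t @ rs) ds) = \<Theta> t (blocks ?z0 ds)"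
      proof (rule indiscernible_blocks[OF indD ds _ _ _ _ _ D])
        show "sorted_wrt ?lessD (ls @ w t @ rs)" "sorted_wrt ?lessD ?z0"
          using sort_w sortedD[OF IJ] by blast+
        show "set (ls @ w t @ rs) \<subseteq> fst (I \<oplus> J)" "set ?z0 \<subseteq> fst (I \<oplus> J)" using IJ fstIJ by auto
        show "dfn (wf_fm L) U ?\<tau> (block_set (length (ls @ w t @ rs)) (length ss) (length ts)) (\<Theta> t)"
          using \<Theta>[of t] lenw[of t] t by (simp add: N_def p_def l_def r_def add.commute add.left_commute)
      qed (use lenw[of t] lenw[of 0] t in auto)
      then show ?thesis using \<Theta>_wt[OF t] by simp
    qed
    then have "\<forall>t. \<exists>f. t < n \<longrightarrow> typed U ?\<tau> ?V f \<and> P0 (\<lambda>w. override_on (blocks ?z0 ds) f ?V (h\<Theta> w)) \<noteq> v \<and>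
        (\<forall>q\<in>\<Delta>. \<forall>g\<in>increasing (fst q) n.
          Qt q g t (override_on (blocks ?z0 ds) f ?V) = Qn q g (override_on (blocks ?z0 ds) f ?V))"
      unfolding \<Theta>_def by blast
    then obtain F where F: "\<And>t. t < n \<Longrightarrow> typed U ?\<tau> ?V (F t)"
      "\<And>t. t < n \<Longrightarrow> P0 (\<lambda>w. override_on (blocks ?z0 ds) (F t) ?V (h\<Theta> w)) \<noteq> v"
      "\<And>t q g. t < n \<Longrightarrow> q \<in> \<Delta> \<Longrightarrow> g \<in> increasing (fst q) n \<Longrightarrow>
          Qt q g t (override_on (blocks ?z0 ds) (F t) ?V) = Qn q g (override_on (blocks ?z0 ds) (F t) ?V)"
      by metis
    define par where "par = case_sum (\<lambda>(k, c). xs0 ! k ! c) (\<lambda>d. ds ! d)"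
    \<comment> \<open>First tuples are the members of \<open>w 0\<close>, second tuples the
      solutions found for each position; the labels in \<open>E\<close> keep the values of
      \<open>ls\<close>, \<open>rs\<close> and \<open>ds\<close>.\<close>
    define h where "h = (\<lambda>(i, \<epsilon>, u). case_sum (\<lambda>c. if \<epsilon> then F i (Inl (N, c)) else w 0 ! i ! c) par u)"
    have w0B: "w 0 ! i \<in> fst B" if "i < n" for i
    proof -
      have "w 0 ! i \<in> set (w 0)" using lenw[of 0] that by simp
      then show ?thesis using setw[of 0] unfolding fstB by blast
    qed
    have w0: "w 0 ! i ! c \<in> carrier U (ss ! c)" if "i < n" "c < l" for i c
    proof -
      have "w 0 ! i \<in> tuples (elems U) ss" using w0B[OF that(1)] tup by blast
      then show ?thesis using that(2) by (auto simp: l_def tuples_def elems_def list_all2_conv_all_nth)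
    qed
    have Ft: "F i (Inl (N, c)) \<in> carrier U (ss ! c)" if "i < n" "c < l" for i c
      using F(1)[OF that(1)] that(2) by (auto simp: typed_def)
    have par: "typed U ?\<tau> (block_set m l r) par"
      using typed_blocks[of xs0 U ss ds ts] xs0(1,3) tup ds' by (auto simp: l_def r_def par_def blocks_def)
    have hCE: "h (i, \<epsilon>, c) \<in> carrier U (\<sigma> c)" if "i < n" "c \<in> C \<or> c \<in> E" for i \<epsilon> c
    proof -
      have "par (Inl (k, d)) \<in> carrier U (ss ! d)" if "k < m" "d < l" for k d
        using par[unfolded typed_def, rule_format, of "Inl (k, d)"] that by simp
      moreover have "par (Inr d) \<in> carrier U (ts ! d)" if "d < r" for d
        using par[unfolded typed_def, rule_format, of "Inr d"] that by simp
      ultimately show ?thesis using that w0 Ft by (auto simp: h_def C_def E_def \<sigma>_def)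
    qed
    have ht: "typed U (\<lambda>(k, \<epsilon>, c). \<sigma> c) ({..<n} \<times> (UNIV \<times> C \<union> {False} \<times> E)) h"
      using hCE by (auto simp: typed_def)
    have z0B: "set ?z0 \<subseteq> tuples (elems U) ss" using lsI rsJ setw[of 0] fstB tup by auto
    have lenz0: "length ?z0 = N" by (simp add: lenw N_def p_def)
    have bt: "typed U ?\<tau> ?W (blocks ?z0 ds)"
      using typed_blocks[OF z0B ds'] lenz0 by (simp add: l_def r_def)
    have ovt: "typed U ?\<tau> (?W \<union> ?V) (override_on (blocks ?z0 ds) (F t) ?V)" if "t < n" for t
      using bt F(1)[OF that] by (auto simp: typed_def override_on_def)
    have z0_nth: "?z0 ! (p + i) = w 0 ! i" if "i < n" for i
      using that lenw[of 0] by (simp add: nth_append p_def)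
    have "approx_pred C E \<chi> n \<Delta> Q h"
      unfolding approx_pred_def
    proof (intro conjI ballI impI)
      fix i assume "i \<in> {..<n}"
      then have i: "i < n" by simp
      have "P0 (blocks (ls @ [w 0 ! i] @ rs) ds) = P0 (\<lambda>x. h (i, False, h\<chi> x))"
      proof (rule codef_dep[OF P0])
        have wi: "w 0 ! i \<in> fst B" by (rule w0B[OF i])
        show "typed U ?\<tau> (block_set m l r) (blocks (ls @ [w 0 ! i] @ rs) ds)"
          using typed_blocks[of "ls @ [w 0 ! i] @ rs" U ss ds ts] ds' z0B wi tup
          by (auto simp: l_def r_def m_eq p_def)
        show "blocks (ls @ [w 0 ! i] @ rs) ds x = h (i, False, h\<chi> x)" if "x \<in> block_set m l r" for x
          using that by (auto simp: blocks_def h_def h\<chi>_def par_def xs0_eq nth_append nth_Cons' p_def)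
      qed
      moreover have "P0 (blocks (ls @ [w 0 ! i] @ rs) ds) = v"
      proof -
        have wi: "w 0 ! i \<in> set (w 0)" using i lenw[of 0] by simp
        have "sorted_wrt ?less (ls @ [w 0 ! i] @ rs)"
          using sort_w[of 0] wi by (auto simp: sorted_wrt_append)
        moreover have "set (ls @ [w 0 ! i] @ rs) \<subseteq> fst I \<union> fst J" using lsI rsJ setw[of 0] wi by auto
        moreover have "length (ls @ [w 0 ! i] @ rs) = m" by (simp add: m_eq p_def)
        ultimately show ?thesis using v P0_blocks[of "ls @ [w 0 ! i] @ rs"] fstB by blast
      qed
      ultimately show "\<chi> (\<lambda>v. h (i, False, v))" unfolding \<chi>_def by simp
      have "P0 (\<lambda>x. override_on (blocks ?z0 ds) (F i) ?V (h\<Theta> x)) = P0 (\<lambda>x. h (i, h\<chi> x \<in> C, h\<chi> x))"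
      proof (rule codef_dep[OF P0])
        have h\<Theta>W: "h\<Theta> x \<in> ?W \<union> ?V" "?\<tau> (h\<Theta> x) = ?\<tau> x" if "x \<in> block_set m l r" for x
          using that by (auto simp: h\<Theta>_def N_def m_eq)
        show "typed U ?\<tau> (block_set m l r) (\<lambda>x. override_on (blocks ?z0 ds) (F i) ?V (h\<Theta> x))"
          using ovt[OF i] h\<Theta>W unfolding typed_def by metis
        show "override_on (blocks ?z0 ds) (F i) ?V (h\<Theta> x) = h (i, h\<chi> x \<in> C, h\<chi> x)"
          if "x \<in> block_set m l r" for x
          using that lenw[of 0]
          by (auto simp: override_on_def blocks_def h_def h\<chi>_def h\<Theta>_def par_def xs0_eq nth_append nth_Cons'
              p_def C_def N_def m_eq)
      qed
      then show "\<not> \<chi> (\<lambda>v. h (i, v \<in> C, v))" unfolding \<chi>_def using F(2)[OF i] by simp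
    next
      show "h (i, False, d) = h (j, False, d)" if "d \<in> E" for d i j
        using that by (auto simp: h_def E_def)
    next
      fix q g g' \<epsilon> \<epsilon>'
      assume q: "q \<in> \<Delta>" and g: "g \<in> increasing (fst q) n" and g': "g' \<in> increasing (fst q) n"
        and \<epsilon>: "\<epsilon> \<in> selections (fst q)" "\<epsilon>' \<in> selections (fst q)"
        and tr: "Q q (\<lambda>(k, c). h (g k, \<epsilon> k, c))"
      \<comment> \<open>A selection uses a second tuple at no more than one position
        \<open>k0\<close>, and the choice of \<open>F (g k0)\<close> allows it to be exchanged for
        the first tuple.\<close>
      have eq: "Q q (\<lambda>(k, c). h (g k, \<epsilon> k, c)) = S q g (w 0)"
        if g: "g \<in> increasing (fst q) n" and \<epsilon>: "\<epsilon> \<in> selections (fst q)" for g \<epsilon>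
      proof -
        have gn: "g k < n" if "k < fst q" for k using g that by (auto simp: increasing_def)
        have ginj: "inj_on g {..<fst q}" using g by (auto simp: increasing_def intro: strict_mono_on_imp_inj_on)
        have hty: "typed U (\<lambda>(k, c). \<sigma> c) ({..<fst q} \<times> C) (\<lambda>(k, c). h (g k, \<epsilon> k, c))" for \<epsilon>
          using hCE gn by (auto simp: typed_def)
        show ?thesis
        proof (cases "\<exists>k<fst q. \<epsilon> k")
          case False
          then show ?thesis
            unfolding S_def by (intro codef_dep[OF Q[OF q] hty]) (auto simp: h_def C_def)
        next
          case True
          then obtain k0 where k0: "k0 < fst q" "\<epsilon> k0" by blast
          have uniq: "k = k0" if "k < fst q" "\<epsilon> k" for k
          proof -
            have "card {k. k < fst q \<and> \<epsilon> k} \<le> Suc 0" "finite {k. k < fst q \<and> \<epsilon> k}"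
              using \<epsilon> by (auto simp: selections_def)
            then show ?thesis using k0 that by (auto simp: card_le_Suc0_iff_eq)
          qed
          have sel_iff: "\<epsilon> k \<longleftrightarrow> g k = g k0" if "k < fst q" for k
            using uniq[OF that] k0 ginj that by (auto dest: inj_onD)
          let ?t = "g k0"
          let ?e = "override_on (blocks ?z0 ds) (F ?t) ?V"
          have t: "?t < n" by (rule gn[OF k0(1)])
          have "Q q (\<lambda>(k, c). h (g k, \<epsilon> k, c)) = Qt q g ?t ?e"
            unfolding Qt_def
          proof (rule codef_dep[OF Q[OF q] hty])
            fix x assume "x \<in> {..<fst q} \<times> C"
            then obtain k c where x: "x = (k, Inl c)" "k < fst q" "c < l" by (auto simp: C_def)
            have "p + g k \<noteq> N" using gn[OF x(2)] by (simp add: N_def)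
            then show "(\<lambda>(k, c). h (g k, \<epsilon> k, c)) x = (\<lambda>(k, c). ?e (Inl (if g k = ?t then N else p + g k, projl c))) x"
              using sel_iff[OF x(2)] z0_nth[OF gn[OF x(2)]] x(3)
              by (simp add: x(1) h_def override_on_def blocks_def image_iff)
          qed
          also have "\<dots> = Qn q g ?e" by (rule F(3)[OF t q g])
          also have "\<dots> = S q g (w 0)"
            unfolding Qn_def S_def
          proof (rule codef_dep[OF Q[OF q], symmetric])
            show "typed U (\<lambda>(k, c). \<sigma> c) ({..<fst q} \<times> C) (\<lambda>(k, c). w 0 ! g k ! projl c)"
              using w0 gn by (auto simp: typed_def C_def \<sigma>_def)
            fix x assume "x \<in> {..<fst q} \<times> C"
            then obtain k c where x: "x = (k, Inl c)" "k < fst q" "c < l" by (auto simp: C_def)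
            have "p + g k \<noteq> N" using gn[OF x(2)] by (simp add: N_def)
            then show "(\<lambda>(k, c). w 0 ! g k ! projl c) x = (\<lambda>(k, c). ?e (Inl (p + g k, projl c))) x"
              using z0_nth[OF gn[OF x(2)]] by (simp add: x(1) override_on_def blocks_def image_iff)
          qed
          finally show ?thesis .
        qed
      qed
      have "S q g (w 0) = S q g' (w 0)"
        by (rule S_eq[OF q g g'])
          (use sort_w[of 0] setw[of 0] lenw[of 0] fstB in \<open>auto simp: sorted_wrt_append\<close>)
      then show "Q q (\<lambda>(k, c). h (g' k, \<epsilon>' k, c))" using tr eq[OF g \<epsilon>(1)] eq[OF g' \<epsilon>(2)] by simp
    qed
    then show ?thesis using ht by blast
  qed
  then show thesis using that[OF fin CE \<chi>] by blast
qed

section \<open>Expansions and elementary equivalence\<close>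

lemma typed_carrier: "carrier A = carrier B \<Longrightarrow> typed A = typed B"
  by (intro ext) (simp add: typed_def)

lemma elems_carrier: "carrier A = carrier B \<Longrightarrow> elems A = elems B"
  by (simp add: elems_def)

lemma typed_tuples: "typed A \<sigma> W e \<Longrightarrow> set vs \<subseteq> W \<Longrightarrow> map e vs \<in> tuples (elems A) (map \<sigma> vs)"
  using nth_mem by (fastforce simp: tuples_def elems_def typed_def list_all2_conv_all_nth)

lemma codef_other:
  assumes "dfn K A \<sigma> W P"
  shows "\<exists>Q. codef K A B \<sigma> W P Q"
proof -
  obtain vs \<phi> where "set vs \<subseteq> W" "K (map \<sigma> vs) \<phi>" "\<forall>e. typed A \<sigma> W e \<longrightarrow> P e = sat A (map e vs) \<phi>"
    using assms unfolding codef_def by blast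
  then have "codef K A B \<sigma> W P (\<lambda>e. sat B (map e vs) \<phi>)" unfolding codef_def by blast
  then show ?thesis by blast
qed

lemma codef_weaken: "codef K A B \<sigma> W P Q \<Longrightarrow> (\<And>\<Gamma> \<phi>. K \<Gamma> \<phi> \<Longrightarrow> K' \<Gamma> \<phi>) \<Longrightarrow> codef K' A B \<sigma> W P Q"
  unfolding codef_def by blast

lemma definable_setsE:
  assumes "(ss, X) \<in> definable_sets L M"
  obtains \<phi> where "wf_fm L ss \<phi>" "X = {as \<in> tuples (elems M) ss. sat M as \<phi>}"
  using assms by (auto simp: definable_sets_def)

lemma Collect_conj_eqD: "{x \<in> X. P x} = {x \<in> X. Q x} \<Longrightarrow> x \<in> X \<Longrightarrow> P x = Q x"
  by blast

lemma dfn_expansion: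
  assumes "carrier B = carrier A" "definable_sets L1 A \<subseteq> definable_sets L2 B" "dfn (wf_fm L1) A \<sigma> W P"
  shows "dfn (wf_fm L2) B \<sigma> W P"
proof -
  obtain vs \<phi> where vs: "set vs \<subseteq> W" "wf_fm L1 (map \<sigma> vs) \<phi>"
    "\<And>e. typed A \<sigma> W e \<Longrightarrow> P e = sat A (map e vs) \<phi>"
    using assms(3) unfolding codef_def by blast
  have "(map \<sigma> vs, {as \<in> tuples (elems A) (map \<sigma> vs). sat A as \<phi>}) \<in> definable_sets L1 A"
    using vs(2) by (auto simp: definable_sets_def)
  then obtain \<psi> where \<psi>: "wf_fm L2 (map \<sigma> vs) \<psi>"
    "{as \<in> tuples (elems A) (map \<sigma> vs). sat A as \<phi>} = {as \<in> tuples (elems B) (map \<sigma> vs). sat B as \<psi>}"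
    by (rule definable_setsE[OF subsetD[OF assms(2)]])
  have "sat A (map e vs) \<phi> = sat B (map e vs) \<psi>" if "typed A \<sigma> W e" for e
    using typed_tuples[OF that vs(1)] elems_carrier[OF assms(1)]
    by (intro Collect_conj_eqD[OF \<psi>(2)[unfolded elems_carrier[OF assms(1)]]]) simp
  then show ?thesis
    using vs \<psi>(1) typed_carrier[OF assms(1)] unfolding codef_def by metis
qed

text \<open>This is the class of small formulas. Membership is tested in \<open>A\<close>, which
  will be the Shelah expansion of \<open>M\<close>, so the class can be used in every structure for
  \<open>L1\<close>, although such a structure carries no interpretation of
  \<open>L2\<close>.\<close>

definition definable_fm ::
  "('s, 'f, 'r) lang \<Rightarrow> ('s, 'f, 'r, 'a) struct \<Rightarrow> ('s, 'g, 'q) lang \<Rightarrow> ('s, 'g, 'q, 'a) struct \<Rightarrow>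
   's list \<Rightarrow> ('s, 'f, 'r) fm \<Rightarrow> bool" where
  "definable_fm L1 A L2 B \<Gamma> \<phi> \<longleftrightarrow> wf_fm L1 \<Gamma> \<phi> \<and>
     (\<exists>\<psi>. wf_fm L2 \<Gamma> \<psi> \<and> (\<forall>as\<in>tuples (elems A) \<Gamma>. sat A as \<phi> = sat B as \<psi>))"

lemma fm_class_definable_fm:
  fixes L1 :: "('s, 'f, 'r) lang" and L2 :: "('s, 'g, 'q) lang"
  assumes car: "carrier B = carrier A"
  shows "fm_class L1 (definable_fm L1 A L2 B)"
proof
  fix \<Gamma> :: "'s list" and i j
  assume "i < length \<Gamma>" "j < length \<Gamma>" "\<Gamma> ! i = \<Gamma> ! j"
  then show "definable_fm L1 A L2 B \<Gamma> (Eq (Var i) (Var j))"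
    unfolding definable_fm_def
    by (auto intro!: exI[of _ "\<Gamma> ! j"] exI[of _ "Eq (Var i) (Var j)"] has_sort_Var)
next
  fix \<Gamma> \<phi> assume "definable_fm L1 A L2 B \<Gamma> \<phi>"
  then obtain \<psi> where "wf_fm L1 \<Gamma> \<phi>" "wf_fm L2 \<Gamma> \<psi>" "\<forall>as\<in>tuples (elems A) \<Gamma>. sat A as \<phi> = sat B as \<psi>"
    unfolding definable_fm_def by blast
  then show "definable_fm L1 A L2 B \<Gamma> (Neg \<phi>)"
    unfolding definable_fm_def by (intro conjI exI[of _ "Neg \<psi>"]) auto
next
  fix \<Gamma> \<phi> \<phi>' assume "definable_fm L1 A L2 B \<Gamma> \<phi>" "definable_fm L1 A L2 B \<Gamma> \<phi>'"
  then obtain \<psi> \<psi>' where "wf_fm L1 \<Gamma> \<phi>" "wf_fm L2 \<Gamma> \<psi>" "\<forall>as\<in>tuples (elems A) \<Gamma>. sat A as \<phi> = sat B as \<psi>"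
    "wf_fm L1 \<Gamma> \<phi>'" "wf_fm L2 \<Gamma> \<psi>'" "\<forall>as\<in>tuples (elems A) \<Gamma>. sat A as \<phi>' = sat B as \<psi>'"
    unfolding definable_fm_def by blast
  then show "definable_fm L1 A L2 B \<Gamma> (Conj \<phi> \<phi>')"
    unfolding definable_fm_def by (intro conjI exI[of _ "Conj \<psi> \<psi>'"]) auto
next
  fix s \<Gamma> \<phi> assume "definable_fm L1 A L2 B (s # \<Gamma>) \<phi>"
  then obtain \<psi> where \<psi>: "wf_fm L1 (s # \<Gamma>) \<phi>" "wf_fm L2 (s # \<Gamma>) \<psi>"
    "\<forall>as\<in>tuples (elems A) (s # \<Gamma>). sat A as \<phi> = sat B as \<psi>"
    unfolding definable_fm_def by blast
  have "a # as \<in> tuples (elems A) (s # \<Gamma>)" if "as \<in> tuples (elems A) \<Gamma>" "a \<in> carrier A s" for as a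
    using that by (simp add: tuples_def elems_def)
  then have "sat A as (Ex s \<phi>) = sat B as (Ex s \<psi>)" if "as \<in> tuples (elems A) \<Gamma>" for as
    using \<psi>(3) that by (simp add: car)
  then show "definable_fm L1 A L2 B \<Gamma> (Ex s \<phi>)"
    unfolding definable_fm_def using \<psi>(1,2) by (intro conjI exI[of _ "Ex s \<psi>"]) auto
next
  fix \<Gamma> \<Gamma>' \<phi> \<rho>
  assume "definable_fm L1 A L2 B \<Gamma> \<phi>" and \<rho>: "\<And>i. i < length \<Gamma> \<Longrightarrow> \<rho> i < length \<Gamma>' \<and> \<Gamma>' ! \<rho> i = \<Gamma> ! i"
  then obtain \<psi> where \<psi>: "wf_fm L1 \<Gamma> \<phi>" "wf_fm L2 \<Gamma> \<psi>" "\<forall>as\<in>tuples (elems A) \<Gamma>. sat A as \<phi> = sat B as \<psi>"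
    unfolding definable_fm_def by blast
  have "sat A as (rename \<phi> \<rho>) = sat B as (rename \<psi> \<rho>)" if as: "as \<in> tuples (elems A) \<Gamma>'" for as
  proof -
    let ?bs = "map (\<lambda>i. as ! \<rho> i) [0..<length \<Gamma>]"
    have "as ! \<rho> i \<in> carrier A (\<Gamma> ! i)" if "i < length \<Gamma>" for i
      using as \<rho>[OF that] by (metis (mono_tags, lifting) SigmaD2 elems_def list_all2_nthD2 mem_Collect_eq
          tuples_def tuples_length)
    then have "?bs \<in> tuples (elems A) \<Gamma>" by (auto simp: tuples_def elems_def list_all2_conv_all_nth)
    then have "sat A ?bs \<phi> = sat B ?bs \<psi>" using \<psi>(3) by blast
    moreover have "sat A as (rename \<phi> \<rho>) = sat A ?bs \<phi>" by (rule sat_rename[OF \<psi>(1)]) simp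
    moreover have "sat B as (rename \<psi> \<rho>) = sat B ?bs \<psi>" by (rule sat_rename[OF \<psi>(2)]) simp
    ultimately show ?thesis by simp
  qed
  then show "definable_fm L1 A L2 B \<Gamma>' (rename \<phi> \<rho>)"
    unfolding definable_fm_def using wf_rename[OF \<psi>(1) \<rho>] wf_rename[OF \<psi>(2) \<rho>] by blast
qed (simp add: definable_fm_def)

lemma definable_fm_dfn:
  assumes "carrier B = carrier A" "codef (definable_fm L1 A L2 B) A U \<sigma> W P Q"
  shows "dfn (wf_fm L2) B \<sigma> W P"
proof -
  obtain vs \<phi> where vs: "set vs \<subseteq> W" "definable_fm L1 A L2 B (map \<sigma> vs) \<phi>"
    "\<And>e. typed A \<sigma> W e \<Longrightarrow> P e = sat A (map e vs) \<phi>"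
    using assms(2) unfolding codef_def by blast
  then obtain \<psi> where "wf_fm L2 (map \<sigma> vs) \<psi>" "\<forall>as\<in>tuples (elems A) (map \<sigma> vs). sat A as \<phi> = sat B as \<psi>"
    unfolding definable_fm_def by blast
  then show ?thesis
    using vs typed_tuples[OF _ vs(1)] typed_carrier[OF assms(1)] unfolding codef_def by metis
qed

lemma dfn_definable_fm:
  assumes ex: "expansion L2 B L1 A" and P: "dfn (wf_fm L2) B \<sigma> W P"
  shows "\<exists>Q. codef (definable_fm L1 A L2 B) A U \<sigma> W P Q"
proof -
  have car: "carrier A = carrier B" and sub: "definable_sets L2 B \<subseteq> definable_sets L1 A"
    using ex by (auto simp: expansion_def)
  obtain vs \<psi> where vs: "set vs \<subseteq> W" "wf_fm L2 (map \<sigma> vs) \<psi>"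
    "\<And>e. typed B \<sigma> W e \<Longrightarrow> P e = sat B (map e vs) \<psi>"
    using P unfolding codef_def by blast
  have "(map \<sigma> vs, {as \<in> tuples (elems B) (map \<sigma> vs). sat B as \<psi>}) \<in> definable_sets L2 B"
    using vs(2) by (auto simp: definable_sets_def)
  then obtain \<phi> where \<phi>: "wf_fm L1 (map \<sigma> vs) \<phi>"
    "{as \<in> tuples (elems B) (map \<sigma> vs). sat B as \<psi>} = {as \<in> tuples (elems A) (map \<sigma> vs). sat A as \<phi>}"
    by (rule definable_setsE[OF subsetD[OF sub]])
  have eq: "sat A as \<phi> = sat B as \<psi>" if "as \<in> tuples (elems A) (map \<sigma> vs)" for as
    using Collect_conj_eqD[OF \<phi>(2)[folded elems_carrier[OF car]] that] by simp
  have "definable_fm L1 A L2 B (map \<sigma> vs) \<phi>" unfolding definable_fm_def using \<phi>(1) vs(2) eq by blast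
  moreover have "P e = sat A (map e vs) \<phi>" if "typed A \<sigma> W e" for e
    using vs(3)[of e, folded typed_carrier[OF car]] that eq[OF typed_tuples[OF that vs(1)]] by simp
  ultimately have "codef (definable_fm L1 A L2 B) A U \<sigma> W P (\<lambda>e. sat U (map e vs) \<phi>)"
    using vs(1) unfolding codef_def by blast
  then show ?thesis by blast
qed

section \<open>Transfer through sentences\<close>

lemma codef_sentence:
  assumes "codef (wf_fm L) A B \<sigma> {} P Q" "\<And>\<phi>. wf_fm L [] \<phi> \<Longrightarrow> sat A [] \<phi> = sat B [] \<phi>"
  shows "P e = Q e'"
  using assms unfolding codef_def typed_def by auto

text \<open>The witnesses cannot be transported, since the structures are only elementarily
  equivalent; their existence is a sentence and can.\<close>

lemma (in fm_class) codef_ex_transfer: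
  assumes P: "codef K A B \<sigma> V P Q" and V: "finite V"
    and sent: "\<And>\<phi>. wf_fm L [] \<phi> \<Longrightarrow> sat A [] \<phi> = sat B [] \<phi>"
    and f: "typed A \<sigma> V f" "P f"
  shows "\<exists>f. typed B \<sigma> V f \<and> Q f"
proof -
  have "codef K A B \<sigma> {} (\<lambda>e. \<exists>f. typed A \<sigma> V f \<and> P (override_on e f V))
      (\<lambda>e. \<exists>f. typed B \<sigma> V f \<and> Q (override_on e f V))"
    by (rule codef_exs[OF V]) (simp add: P)
  then have c: "codef (wf_fm L) A B \<sigma> {} (\<lambda>e. \<exists>f. typed A \<sigma> V f \<and> P (override_on e f V))
      (\<lambda>e. \<exists>f. typed B \<sigma> V f \<and> Q (override_on e f V))"
    by (rule codef_weaken) (rule K_wf)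
  have "P (override_on f f V)" using f(2) by (simp add: override_on_def)
  then have "\<exists>f'. typed B \<sigma> V f' \<and> Q (override_on undefined f' V)"
    using codef_sentence[OF c sent, of f undefined] f(1) by blast
  then obtain f' where f': "typed B \<sigma> V f'" "Q (override_on undefined f' V)" by blast
  have "Q f' = Q (override_on undefined f' V)"
    by (rule codef_dep[OF codef_flip[OF P] f'(1)]) auto
  then show ?thesis using f' by blast
qed

text \<open>Together with \<open>|sentences L| <o \<kappa>\<close> this makes the cardinal of a
  monster model uncountable.\<close>

lemma infinite_sentences: "infinite (sentences L)"
proof -
  let ?\<phi> = "Ex undefined (Eq (Var 0) (Var 0)) :: ('a, 'b, 'c) fm"
  let ?f = "\<lambda>n. (Neg ^^ n) ?\<phi>"
  have wf: "wf_fm L [] (?f n)" for n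
    by (induction n) (auto intro!: exI[of _ undefined] has_sort_Var)
  have "inj ?f"
  proof (rule injI)
    fix m n assume "?f m = ?f n"
    then show "m = n"
    proof (induction m arbitrary: n)
      case 0
      then show ?case by (cases n) auto
    next
      case (Suc m)
      then show ?case by (cases n) auto
    qed
  qed
  then have "infinite (range ?f)" by (rule range_inj_infinite)
  moreover have "range ?f \<subseteq> sentences L" using wf by (auto simp: sentences_def)
  ultimately show ?thesis using finite_subset by blast
qed

lemma monster_saturated_struct:
  assumes "monster \<kappa> L T U"
  shows "saturated_struct L U \<kappa>"
proof
  show "carrier U s \<noteq> {}" for s
    using assms by (simp add: monster_def model_def is_struct_def)
  show "saturated \<kappa> L U" using assms by (simp add: monster_def)
  show "natLeq <o \<kappa>"
    using assms infinite_sentences[of L] infinite_iff_natLeq_ordLeq ordLeq_ordLess_trans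
    unfolding monster_def by blast
qed

lemma monster_Th_sentence:
  assumes "model L (Th L M) U" "wf_fm L [] \<phi>"
  shows "sat M [] \<phi> = sat U [] \<phi>"
proof -
  have imp: "sat M [] \<psi> \<Longrightarrow> sat U [] \<psi>" if "wf_fm L [] \<psi>" for \<psi>
    using assms(1) that by (auto simp: model_def Th_def sentences_def)
  show ?thesis using imp[of \<phi>] imp[of "Neg \<phi>"] assms(2) by auto
qed

lemma codef_elementary:
  assumes "elementary_extension L M M'" "codef (wf_fm L) M M' \<sigma> W P Q" "typed M \<sigma> W e"
  shows "P e = Q e"
proof -
  obtain vs \<phi> where vs: "set vs \<subseteq> W" "wf_fm L (map \<sigma> vs) \<phi>"
    "\<And>e. typed M \<sigma> W e \<Longrightarrow> P e = sat M (map e vs) \<phi>" "\<And>e. typed M' \<sigma> W e \<Longrightarrow> Q e = sat M' (map e vs) \<phi>"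
    using assms(2) unfolding codef_def by blast
  have "typed M' \<sigma> W e" using assms(1,3) by (auto simp: typed_def elementary_extension_def)
  moreover have "sat M (map e vs) \<phi> = sat M' (map e vs) \<phi>"
    using assms(1) vs(2) typed_tuples[OF assms(3) vs(1)] by (simp add: elementary_extension_def)
  ultimately show ?thesis using vs(3,4) assms(3) by simp
qed

lemma codef_Rel:
  fixes L :: "('s, 'f, 'r) lang" and A :: "('s, 'f, 'r, 'a) struct" and B :: "('s, 'f, 'r, 'b) struct"
  assumes "R \<in> Rels L" "map \<sigma> vs = rdom L R" "set vs \<subseteq> W"
  shows "codef (wf_fm L) A B \<sigma> W (\<lambda>e. map e vs \<in> rint A R) (\<lambda>e. map e vs \<in> rint B R)"
proof -
  let ?\<phi> = "Rel R (map Var [0..<length vs])"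
  have var: "map (eval A (map e vs)) (map Var [0..<length vs]) = map e vs" for A :: "('s, 'f, 'r, 'z) struct" and e
    by (rule nth_equalityI) auto
  have "sat A (map e vs) ?\<phi> = (map e vs \<in> rint A R)" for A :: "('s, 'f, 'r, 'z) struct" and e
    unfolding sat.simps var ..
  moreover have "wf_fm L (map \<sigma> vs) ?\<phi>"
    using assms(1) by (auto simp: assms(2)[symmetric] list_all2_conv_all_nth intro!: has_sort_Var)
  ultimately show ?thesis using assms(3) unfolding codef_def by metis
qed

text \<open>
  A trace \<open>\<psi>(-; e) \<inter> M\<close> may have parameters \<open>e\<close> outside \<open>M\<close>, but its patterns on finite subsets of \<open>M\<close>
  are patterns of \<open>\<psi>(-; z)\<close>, hence, as \<open>M\<close> is an elementary substructure, are also realised in \<open>M\<close>.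
\<close>

lemma (in small_class) tame_external:
  fixes A :: "('s, 'f, 'r, 'c) struct" and L0 :: "('s, 'f0, 'r0) lang" and M M' :: "('s, 'f0, 'r0, 'c) struct"
    and \<sigma> :: "nat \<Rightarrow> 's"
  assumes car: "carrier A = carrier M" and el: "elementary_extension L0 M M'"
    and trans: "\<And>(\<sigma> :: nat + nat \<Rightarrow> 's) W P. dfn (wf_fm L0) M \<sigma> W P \<Longrightarrow> \<exists>Q. codef K A U \<sigma> W P Q"
    and sent: "\<And>\<phi>. wf_fm L [] \<phi> \<Longrightarrow> sat A [] \<phi> = sat U [] \<phi>"
    and R: "R \<in> Rels L" "rdom L R = ss"
      "rint A R = {as \<in> tuples (elems M') ss. sat M' (as @ ds) \<phi>} \<inter> tuples (elems M) ss"
    and \<phi>: "wf_fm L0 (ss @ ts) \<phi>" "ds \<in> tuples (elems M') ts"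
    and vs: "map \<sigma> vs = ss" "set vs \<subseteq> C \<union> D" and fin: "finite C" "finite D" and disj: "C \<inter> D = {}"
  shows "tame \<sigma> C D (\<lambda>e. map e vs \<in> rint U R)"
proof -
  interpret L0: fm_class L0 "wf_fm L0" by (rule fm_class_wf)
  define \<tau> where "\<tau> = case_sum \<sigma> ((!) ts)"
  \<comment> \<open>The labels \<open>Inr d\<close> stand for the external parameters
    \<open>ds\<close>; in the pattern formulas they are quantified together with the parameter
    variables from \<open>D\<close>.\<close>
  define C' D' :: "(nat + nat) set" where "C' = Inl ` C" and "D' = Inl ` D \<union> Inr ` {..<length ts}"
  have fin': "finite C'" "finite D'" "C' \<inter> D' = {}" using fin disj by (auto simp: C'_def D'_def)
  define us where "us = map Inl vs @ map Inr [0..<length ts]"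
  have tA: "typed A = typed M" by (rule typed_carrier[OF car])
  have MM': "carrier M s \<subseteq> carrier M' s" for s using el by (simp add: elementary_extension_def)
  have neM: "carrier M s \<noteq> {}" and neM': "carrier M' s \<noteq> {}" for s
    using el by (auto simp: elementary_extension_def is_struct_def)
  define \<Psi> where "\<Psi> = (\<lambda>e. sat M (map e us) \<phi>)"
  define \<Psi>' where "\<Psi>' = (\<lambda>e. sat M' (map e us) \<phi>)"
  have us: "set us \<subseteq> C' \<union> D'" using vs(2) by (auto simp: us_def C'_def D'_def)
  have "map \<tau> us = ss @ ts"
    using vs(1) by (auto simp: us_def \<tau>_def comp_def map_nth)
  then have \<Psi>\<Psi>': "codef (wf_fm L0) M M' \<tau> (C' \<union> D') \<Psi> \<Psi>'"
    using us \<phi>(1) unfolding codef_def \<Psi>_def \<Psi>'_def by metis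
  obtain \<Psi>U where \<Psi>U: "codef K A U \<tau> (C' \<union> D') \<Psi> \<Psi>U" using trans[OF codef_left[OF \<Psi>\<Psi>']] by blast
  \<comment> \<open>The same pattern in three structures: \<open>M\<close> and \<open>M'\<close> are
    compared by elementarity, and \<open>A\<close> (on the universe of \<open>M\<close>) and
    \<open>U\<close> by sentences.\<close>
  define pU where "pU = (\<lambda>(n::nat) S e. \<exists>f. typed U \<tau> D' f \<and> (\<forall>k<n. \<Psi>U (override_on (\<lambda>c. e (k, c)) f D') = (k \<in> S)))"
  define pM where "pM = (\<lambda>(n::nat) S e. \<exists>f. typed M \<tau> D' f \<and> (\<forall>k<n. \<Psi> (override_on (\<lambda>c. e (k, c)) f D') = (k \<in> S)))"
  define pM' where "pM' = (\<lambda>(n::nat) S e. \<exists>f. typed M' \<tau> D' f \<and> (\<forall>k<n. \<Psi>' (override_on (\<lambda>c. e (k, c)) f D') = (k \<in> S)))"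
  have neA: "carrier A s \<noteq> {}" for s using neM car by simp
  have pMU: "codef K A U (\<lambda>(k, c). \<tau> c) ({..<n} \<times> C') (pM n S) (pU n S)" for n S
    unfolding pM_def pU_def tA[symmetric]
    by (rule small.codef_pattern[OF fin'(2,3) \<Psi>U neA nonempty])
  have pMM': "codef (wf_fm L0) M M' (\<lambda>(k, c). \<tau> c) ({..<n} \<times> C') (pM n S) (pM' n S)" for n S
    unfolding pM_def pM'_def by (rule L0.codef_pattern[OF fin'(2,3) \<Psi>\<Psi>' neM neM'])
  define \<chi> where "\<chi> n S e = pU n S (\<lambda>v. e (apsnd projl v))" for n S e
  have \<chi>: "codef K A U (\<lambda>(k, c). \<sigma> c) ({..<n} \<times> C) (\<lambda>e. pM n S (\<lambda>v. e (apsnd projl v))) (\<chi> n S)" for n S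
    unfolding \<chi>_def by (rule codef_rename[OF pMU]) (auto simp: C'_def \<tau>_def)
  have 1: "(n, \<chi> n S) \<in> smalls \<sigma> C" for n S
    using codef_left[OF codef_flip[OF \<chi>]] by (simp add: smalls_def)
  have 3: "\<exists>n. \<forall>z. ftyped \<sigma> C z \<longrightarrow> (\<exists>S. \<not> \<chi> n S (\<lambda>(k, c). z k c))"
  proof -
    obtain n :: nat where n: "\<forall>z. ftyped \<tau> C' z \<longrightarrow>
        (\<exists>S. \<not> (\<exists>f. typed U \<tau> D' f \<and> (\<forall>k<n. \<Psi>U (override_on (z k) f D') = (k \<in> S))))"
      using nip_bound[OF nip fin' SDef_Def[OF codef_left[OF codef_flip[OF \<Psi>U]]]] by blast
    have "\<exists>S. \<not> \<chi> n S (\<lambda>(k, c). z k c)" if "ftyped \<sigma> C z" for z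
    proof -
      have "ftyped \<tau> C' (\<lambda>k w. z k (projl w))" using that by (auto simp: typed_def C'_def \<tau>_def)
      from n[THEN spec, THEN mp, OF this] show ?thesis by (simp add: \<chi>_def pU_def apsnd_def)
    qed
    then show ?thesis by blast
  qed
  have 2: "\<chi> n S (\<lambda>(k, c). z k c)"
    if z: "ftyped \<sigma> C z" and f: "typed U \<sigma> D f"
      and pat: "\<forall>k<n. (map (override_on (z k) f D) vs \<in> rint U R) = (k \<in> S)" for n S z f
  proof -
    let ?V = "{..<n} \<times> C" and ?\<sigma> = "\<lambda>(k::nat, c). \<sigma> c"
    define rA where "rA = (\<lambda>e. \<exists>f. typed A \<sigma> D f \<and> (\<forall>k<n. (map (override_on (\<lambda>c. e (k, c)) f D) vs \<in> rint A R) = (k \<in> S)))"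
    define rU where "rU = (\<lambda>e. \<exists>f. typed U \<sigma> D f \<and> (\<forall>k<n. (map (override_on (\<lambda>c. e (k, c)) f D) vs \<in> rint U R) = (k \<in> S)))"
    let ?pA = "\<lambda>e. pM n S (\<lambda>v. e (apsnd projl v))"
    have Rc: "codef (wf_fm L) A U \<sigma> (C \<union> D) (\<lambda>e. map e vs \<in> rint A R) (\<lambda>e. map e vs \<in> rint U R)"
      by (rule codef_Rel[OF R(1) _ vs(2)]) (simp add: vs(1) R(2))
    have r: "codef (wf_fm L) A U ?\<sigma> ?V rA rU"
      unfolding rA_def rU_def by (rule codef_pattern[OF fin(2) disj Rc neA nonempty])
    have "codef (wf_fm L) A U ?\<sigma> ?V ?pA (\<chi> n S)" by (rule codef_weaken[OF \<chi> small.K_wf])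
    from codef_imp[OF r this]
    \<comment> \<open>Patterns of \<open>R\<close> imply patterns of the formula behind it.
      Quantified over all tuples this is a sentence, so it suffices to verify it in
      \<open>A\<close>, where \<open>R\<close> is known to be a trace.\<close>
    have "codef (wf_fm L) A U ?\<sigma> {} (\<lambda>e. \<forall>h. typed A ?\<sigma> ?V h \<longrightarrow>
          (rA (override_on e h ?V) \<longrightarrow> ?pA (override_on e h ?V)))
        (\<lambda>e. \<forall>h. typed U ?\<sigma> ?V h \<longrightarrow> (rU (override_on e h ?V) \<longrightarrow> \<chi> n S (override_on e h ?V)))"
      by (intro codef_alls) (use fin(1) in simp_all)
    from codef_sentence[OF this sent]
    have tr: "(\<forall>h. typed A ?\<sigma> ?V h \<longrightarrow> (rA (override_on undefined h ?V) \<longrightarrow> ?pA (override_on undefined h ?V)))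
        = (\<forall>h. typed U ?\<sigma> ?V h \<longrightarrow> (rU (override_on undefined h ?V) \<longrightarrow> \<chi> n S (override_on undefined h ?V)))" .
    have "?pA (override_on undefined h ?V)"
      if h: "typed A ?\<sigma> ?V h" and rA: "rA (override_on undefined h ?V)" for h
    proof -
      let ?h = "override_on undefined h ?V"
      let ?e = "\<lambda>v. ?h (apsnd projl v)"
      obtain f where f: "typed A \<sigma> D f"
        "\<forall>k<n. (map (override_on (\<lambda>c. ?h (k, c)) f D) vs \<in> rint A R) = (k \<in> S)"
        using rA unfolding rA_def by blast
      define f' where "f' = case_sum f ((!) ds)"
      have lends: "length ds = length ts" by (rule tuples_length[OF \<phi>(2)])
      have "pM' n S ?e"
        unfolding pM'_def
      proof (intro exI[of _ f'] conjI allI impI)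
        have "ds ! d \<in> carrier M' (ts ! d)" if "d < length ts" for d
          using \<phi>(2) that by (auto simp: tuples_def elems_def list_all2_conv_all_nth)
        then show "typed M' \<tau> D' f'"
          using f(1) subsetD[OF MM'] unfolding tA by (auto simp: typed_def D'_def \<tau>_def f'_def)
        fix k assume k: "k < n"
        let ?t = "map (override_on (\<lambda>c. ?h (k, c)) f D) vs"
        have "typed M \<sigma> (C \<union> D) (override_on (\<lambda>c. ?h (k, c)) f D)"
          using h f(1) k unfolding tA by (auto simp: typed_def override_on_def)
        then have tM: "?t \<in> tuples (elems M) ss" using typed_tuples vs by metis
        moreover have "elems M \<subseteq> elems M'" using MM' by (auto simp: elems_def)
        ultimately have "?t \<in> tuples (elems M') ss" using tuples_mono by blast
        then have "(?t \<in> rint A R) = sat M' (?t @ ds) \<phi>" using tM by (simp add: R(3))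
        moreover have "map (override_on (\<lambda>c. ?e (k, c)) f' D') us = ?t @ ds"
        proof -
          have "map (override_on (\<lambda>c. ?e (k, c)) f' D') (map Inl vs) = ?t"
            by (auto simp: override_on_def D'_def f'_def)
          moreover have "map (override_on (\<lambda>c. ?e (k, c)) f' D') (map Inr [0..<length ts]) = ds"
            by (rule nth_equalityI) (auto simp: lends override_on_def D'_def f'_def)
          ultimately show ?thesis unfolding us_def map_append by simp
        qed
        ultimately show "\<Psi>' (override_on (\<lambda>c. ?e (k, c)) f' D') = (k \<in> S)"
          using f(2) k unfolding \<Psi>'_def by simp
      qed
      moreover have "typed M (\<lambda>(k, c). \<tau> c) ({..<n} \<times> C') ?e"
        using h unfolding tA by (auto simp: typed_def C'_def \<tau>_def)
      ultimately show ?thesis using codef_elementary[OF el pMM'] by blast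
    qed
    then have tr: "\<chi> n S (override_on undefined h ?V)"
      if "typed U ?\<sigma> ?V h" "rU (override_on undefined h ?V)" for h using tr that by blast
    let ?z = "\<lambda>(k, c). z k c"
    have zt: "typed U ?\<sigma> ?V ?z" using z by (auto simp: typed_def)
    have "rU (override_on undefined ?z ?V)"
      unfolding rU_def
    proof (intro exI[of _ f] conjI f allI impI)
      fix k assume k: "k < n"
      have eq: "map (override_on (\<lambda>c. override_on undefined ?z ?V (k, c)) f D) vs = map (override_on (z k) f D) vs"
        using k vs(2) by (auto simp: override_on_def)
      show "(map (override_on (\<lambda>c. override_on undefined ?z ?V (k, c)) f D) vs \<in> rint U R) = (k \<in> S)"
        unfolding eq using pat k by blast
    qed
    from tr[OF zt this] have "\<chi> n S (override_on undefined ?z ?V)" .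
    moreover have "\<chi> n S ?z = \<chi> n S (override_on undefined ?z ?V)"
      by (rule codef_dep[OF codef_flip[OF \<chi>] zt]) auto
    ultimately show ?thesis by simp
  qed
  show ?thesis
    unfolding tame_def by (rule exI[of _ \<chi>]) (use 1 2 3 in blast)
qed

text \<open>\<open>A\<close> and \<open>A0\<close> are the Shelah expansion and the intermediate
  structure on one universe, \<open>U\<close> and \<open>U0\<close> models of their theories. Since
  \<open>U0\<close> is not a reduct of \<open>U\<close>, every transfer takes the route through
  \<open>A0\<close> and \<open>A\<close>.\<close>

locale reduct = small_class L U \<kappa> "definable_fm L A L0 A0"
  for L :: "('s, 'f, 'r) lang" and U :: "('s, 'f, 'r, 'a) struct" and \<kappa> :: "'k rel"
    and A :: "('s, 'f, 'r, 'b) struct" and L0 :: "('s, 'g, 'q) lang" and A0 :: "('s, 'g, 'q, 'b) struct" +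
  fixes U0 :: "('s, 'g, 'q, 'c) struct"
  assumes reduct: "expansion L0 A0 L A"
    and nonempty0: "carrier U0 s \<noteq> {}"
    and equivalent: "wf_fm L [] \<phi> \<Longrightarrow> sat A [] \<phi> = sat U [] \<phi>"
    and equivalent0: "wf_fm L0 [] \<psi> \<Longrightarrow> sat A0 [] \<psi> = sat U0 [] \<psi>"
begin

lemma carriers: "carrier A = carrier A0" "carrier A s \<noteq> {}" "carrier A0 s \<noteq> {}"
  using reduct by (auto simp: expansion_def is_struct_def)

lemma codef_to_expansion:
  assumes "dfn (wf_fm L0) U0 \<sigma> W P"
  shows "\<exists>PA PU. codef (wf_fm L0) U0 A0 \<sigma> W P PA \<and> codef (definable_fm L A L0 A0) A U \<sigma> W PA PU"
proof -
  obtain PA where PA: "codef (wf_fm L0) U0 A0 \<sigma> W P PA" using codef_other[OF assms] by blast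
  have "dfn (wf_fm L0) A0 \<sigma> W PA" by (rule codef_left[OF codef_flip[OF PA]])
  from dfn_definable_fm[OF reduct this] PA show ?thesis by blast
qed

lemma codef_to_reduct:
  assumes "SDef \<sigma> W Q"
  shows "\<exists>Q0 QA. codef (wf_fm L0) U0 A0 \<sigma> W Q0 QA \<and> codef (definable_fm L A L0 A0) A U \<sigma> W QA Q"
proof -
  obtain QA where "codef (definable_fm L A L0 A0) U A \<sigma> W Q QA" using codef_other[OF assms] by blast
  then have QA: "codef (definable_fm L A L0 A0) A U \<sigma> W QA Q" by (rule codef_flip)
  have "dfn (wf_fm L0) A0 \<sigma> W QA" by (rule definable_fm_dfn[OF carriers(1)[symmetric] QA])
  then obtain Q0 where "codef (wf_fm L0) A0 U0 \<sigma> W QA Q0" using codef_other by blast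
  then show ?thesis using QA codef_flip by blast
qed

lemma transfer_witness:
  assumes P: "codef (wf_fm L0) U0 A0 \<sigma> V P PA" "codef (definable_fm L A L0 A0) A U \<sigma> V PA PU"
    and V: "finite V" and f: "typed U0 \<sigma> V f" "P f"
  shows "\<exists>f. typed U \<sigma> V f \<and> PU f"
proof -
  interpret r: fm_class L0 "wf_fm L0" by (rule fm_class_wf)
  obtain f where "typed A0 \<sigma> V f" "PA f"
    using r.codef_ex_transfer[OF P(1) V equivalent0[symmetric] f] by blast
  then show ?thesis
    using small.codef_ex_transfer[OF P(2) V equivalent] typed_carrier[OF carriers(1)] by metis
qed

text \<open>Shattering an infinite family is not expressible, but shattering \<open>n\<close> tuples
  is. The uniform bound for the translated formula in \<open>U\<close> therefore gives NIP in
  \<open>U0\<close>.\<close>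

lemma nip_reduct: "nip L0 U0"
  unfolding nip_def
proof (intro notI, elim exE conjE)
  interpret r: fm_class L0 "wf_fm L0" by (rule fm_class_wf)
  fix ss ts \<phi> and a :: "nat \<Rightarrow> 'c list" and b :: "nat set \<Rightarrow> 'c list"
  assume \<phi>: "wf_fm L0 (ss @ ts) \<phi>" and a: "\<forall>i. a i \<in> tuples (elems U0) ss"
    and b: "\<forall>S. b S \<in> tuples (elems U0) ts" and ab: "\<forall>i S. sat U0 (a i @ b S) \<phi> = (i \<in> S)"
  let ?l = "length (ss @ ts)"
  define C D where "C = {..<length ss}" and "D = {length ss..<?l}"
  have fin: "finite C" "finite D" "C \<inter> D = {}" by (auto simp: C_def D_def)
  let ?\<sigma> = "(!) (ss @ ts)" and ?\<tau> = "\<lambda>(k::nat, c). (ss @ ts) ! c"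
  let ?P = "\<lambda>e. sat U0 (map e [0..<?l]) \<phi>"
  have "wf_fm L0 (map ?\<sigma> [0..<?l]) \<phi>" using \<phi> by (simp only: map_nth)
  moreover have "set [0..<?l] \<subseteq> C \<union> D" by (auto simp: C_def D_def)
  ultimately have "dfn (wf_fm L0) U0 ?\<sigma> (C \<union> D) ?P" unfolding codef_def by blast
  then obtain PA PU where P: "codef (wf_fm L0) U0 A0 ?\<sigma> (C \<union> D) ?P PA"
    "codef (definable_fm L A L0 A0) A U ?\<sigma> (C \<union> D) PA PU"
    using codef_to_expansion by blast
  obtain n :: nat where n: "\<forall>z. ftyped ?\<sigma> C z \<longrightarrow>
      (\<exists>S. \<not> (\<exists>f. typed U ?\<sigma> D f \<and> (\<forall>k<n. PU (override_on (z k) f D) = (k \<in> S))))"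
    using nip_bound[OF nip fin SDef_Def[OF codef_left[OF codef_flip[OF P(2)]]]] by blast
  \<comment> \<open>The finitely many subsets of \<open>{..<n}\<close> suffice, so this is one
    formula in the tuples.\<close>
  let ?pat = "\<lambda>ty P e. \<forall>S\<in>Pow {..<n}. \<exists>f. ty f \<and> (\<forall>k<n. P (override_on (\<lambda>c. e (k, c)) f D) = (k \<in> S))"
  let ?W = "{..<n} \<times> C"
  have t1: "codef (wf_fm L0) U0 A0 ?\<tau> ?W (?pat (typed U0 ?\<sigma> D) ?P) (?pat (typed A0 ?\<sigma> D) PA)"
    by (intro r.codef_ball r.codef_pattern fin P nonempty0 carriers) simp
  have t2: "codef (definable_fm L A L0 A0) A U ?\<tau> ?W (?pat (typed A0 ?\<sigma> D) PA) (?pat (typed U ?\<sigma> D) PU)"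
    unfolding typed_carrier[OF carriers(1), symmetric]
    by (intro small.codef_ball small.codef_pattern fin P nonempty carriers) simp
  have len: "length (a k) = length ss" "length (b S) = length ts" for k S
    using a b tuples_length by metis+
  have tya: "a k ! c \<in> carrier U0 (ss ! c)" if "c < length ss" for k c
    using a that by (auto simp: tuples_def elems_def list_all2_conv_all_nth)
  have tyb: "b S ! c \<in> carrier U0 (ts ! c)" if "c < length ts" for S c
    using b that by (auto simp: tuples_def elems_def list_all2_conv_all_nth)
  let ?a = "\<lambda>(k, c). a k ! c"
  have "typed U0 ?\<tau> ?W ?a" by (auto simp: typed_def C_def nth_append tya)
  moreover have "?pat (typed U0 ?\<sigma> D) ?P ?a"
  proof
    fix S assume "S \<in> Pow {..<n}"
    let ?b = "\<lambda>d. b S ! (d - length ss)"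
    have "map (override_on (\<lambda>c. ?a (k, c)) ?b D) [0..<?l] = a k @ b S" for k
      by (rule nth_equalityI) (auto simp: len override_on_def D_def nth_append)
    then have "?P (override_on (\<lambda>c. ?a (k, c)) ?b D) = (k \<in> S)" for k using ab by simp
    moreover have "typed U0 ?\<sigma> D ?b" by (auto simp: typed_def D_def nth_append tyb)
    ultimately show "\<exists>f. typed U0 ?\<sigma> D f \<and> (\<forall>k<n. ?P (override_on (\<lambda>c. ?a (k, c)) f D) = (k \<in> S))"
      by blast
  qed
  ultimately obtain z where z: "typed U ?\<tau> ?W z" "?pat (typed U ?\<sigma> D) PU z"
    using transfer_witness[OF t1 t2] fin by blast
  \<comment> \<open>The bound speaks of sequences typed at every index; beyond \<open>n\<close>
    arbitrary elements are filled in.\<close>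
  define z' where "z' k c = (if k < n then z (k, c) else SOME x. x \<in> carrier U (?\<sigma> c))" for k c
  have "(SOME x. x \<in> carrier U s) \<in> carrier U s" for s
    using nonempty some_in_eq by blast
  then have "ftyped ?\<sigma> C z'"
    using z(1) by (auto simp: typed_def z'_def)
  with n obtain S where S: "\<not> (\<exists>f. typed U ?\<sigma> D f \<and> (\<forall>k<n. PU (override_on (z' k) f D) = (k \<in> S)))"
    by blast
  have "S \<inter> {..<n} \<in> Pow {..<n}" by simp
  then obtain f where "typed U ?\<sigma> D f" "\<forall>k<n. PU (override_on (\<lambda>c. z (k, c)) f D) = (k \<in> S \<inter> {..<n})"
    using z(2) by blast
  moreover have "z' k = (\<lambda>c. z (k, c))" if "k < n" for k using that by (intro ext) (simp add: z'_def)
  ultimately show False using S by auto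
qed

text \<open>For finite \<Delta> an approximation is described by one formula. The small formulas in
  \<Delta> are first translated back to \<open>U0\<close>; an approximation for the translations
  exists there, and so one for \<Delta> exists in \<open>U\<close>.\<close>

lemma transfer_approx:
  assumes fin: "finite C" "finite E" "C \<inter> E = {}" and \<Delta>: "finite \<Delta>" "\<Delta> \<subseteq> smalls \<sigma> C"
    and \<chi>: "codef (wf_fm L0) U0 A0 \<sigma> (C \<union> E) \<chi> \<chi>A" "codef (definable_fm L A L0 A0) A U \<sigma> (C \<union> E) \<chi>A \<chi>U"
    and approx: "\<And>Q. (\<And>q. q \<in> \<Delta> \<Longrightarrow> dfn (wf_fm L0) U0 (\<lambda>(k, c). \<sigma> c) ({..<fst q} \<times> C) (Q q)) \<Longrightarrow>
      \<exists>h. typed U0 (\<lambda>(k, \<epsilon>, c). \<sigma> c) ({..<n} \<times> (UNIV \<times> C \<union> {False} \<times> E)) h \<and> approx_pred C E \<chi> n \<Delta> Q h"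
  shows "\<exists>y. pair_approx single_mixes \<sigma> C E {} \<chi>U (\<lambda>e. \<not> \<chi>U e) n \<Delta> y"
proof -
  interpret r: fm_class L0 "wf_fm L0" by (rule fm_class_wf)
  let ?\<tau> = "\<lambda>(k::nat, \<epsilon>::bool, c). \<sigma> c" and ?W = "{..<n} \<times> (UNIV \<times> C \<union> {False} \<times> E)"
  have sm: "SDef (\<lambda>(k, c). \<sigma> c) ({..<fst q} \<times> C) (snd q)" if "q \<in> \<Delta>" for q
    using \<Delta>(2) that by (auto simp: smalls_def)
  have "\<exists>Q0 QA. codef (wf_fm L0) U0 A0 (\<lambda>(k, c). \<sigma> c) ({..<fst q} \<times> C) Q0 QA \<and>
      codef (definable_fm L A L0 A0) A U (\<lambda>(k, c). \<sigma> c) ({..<fst q} \<times> C) QA (snd q)" if "q \<in> \<Delta>" for q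
    by (rule codef_to_reduct[OF sm[OF that]])
  then obtain Q0 QA where Q0: "\<And>q. q \<in> \<Delta> \<Longrightarrow> codef (wf_fm L0) U0 A0 (\<lambda>(k, c). \<sigma> c) ({..<fst q} \<times> C) (Q0 q) (QA q)"
    and QA: "\<And>q. q \<in> \<Delta> \<Longrightarrow>
      codef (definable_fm L A L0 A0) A U (\<lambda>(k, c). \<sigma> c) ({..<fst q} \<times> C) (QA q) (snd q)"
    by metis
  obtain h0 where h0: "typed U0 ?\<tau> ?W h0" "approx_pred C E \<chi> n \<Delta> Q0 h0"
    using approx[of Q0, OF codef_left[OF Q0]] by blast
  have c1: "codef (wf_fm L0) U0 A0 ?\<tau> ?W (approx_pred C E \<chi> n \<Delta> Q0) (approx_pred C E \<chi>A n \<Delta> QA)"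
    by (rule r.codef_approx_pred[OF fin(1,2) \<Delta>(1) fin(3) nonempty0 carriers(3) \<chi>(1) Q0])
  have c2: "codef (definable_fm L A L0 A0) A U ?\<tau> ?W (approx_pred C E \<chi>A n \<Delta> QA) (approx_pred C E \<chi>U n \<Delta> snd)"
    by (rule small.codef_approx_pred[OF fin(1,2) \<Delta>(1) fin(3) carriers(2) nonempty \<chi>(2) QA])
  have finW: "finite ?W" using fin by simp
  obtain h where h: "typed U ?\<tau> ?W h" "approx_pred C E \<chi>U n \<Delta> snd h"
    using transfer_witness[OF c1 c2 finW h0] by (elim exE conjE)
  define y where "y i v = (if i < n then h (i, v) else SOME x. x \<in> carrier U (\<sigma> (snd v)))" for i v
  have y: "y i = (\<lambda>v. h (i, v))" if "i < n" for i using that by (intro ext) (simp add: y_def)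
  have "(SOME x. x \<in> carrier U s) \<in> carrier U s" for s
    using nonempty some_in_eq by blast
  then have ty: "ftyped (\<lambda>(\<epsilon>, c). \<sigma> c) (pairs C E) y"
    using h(1) by (auto simp: typed_def y_def)
  have tyv: "y i (\<epsilon>, c) \<in> carrier U (\<sigma> c)" if "c \<in> C" for i \<epsilon> c
  proof -
    have "(\<epsilon>, c) \<in> pairs C E" using that by simp
    then show ?thesis using bspec[OF ty[THEN spec, of i, unfolded typed_def], of "(\<epsilon>, c)"] by simp
  qed
  have step: "Q (\<lambda>(k, c). y (g' k) (\<epsilon>' k, c))"
    if q: "(m, Q) \<in> \<Delta>" and \<epsilon>: "single_mixes m \<epsilon>" "single_mixes m \<epsilon>'"
      and g: "strict_mono_on {..<m} g" "strict_mono_on {..<m} g'" "g ` {..<m} \<subseteq> {..<n}" "g' ` {..<m} \<subseteq> {..<n}"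
      and Qy: "Q (\<lambda>(k, c). y (g k) (\<epsilon> k, c))" for m Q g g' \<epsilon> \<epsilon>'
  proof -
    have eq: "Q (\<lambda>(k, c). y (g k) (\<epsilon> k, c)) = Q (\<lambda>(k, c). h (restrict g {..<m} k, restrict \<epsilon> {..<m} k, c))"
      if "g ` {..<m} \<subseteq> {..<n}" for g \<epsilon>
    proof (rule codef_dep[OF sm[OF q, simplified]])
      show "typed U (\<lambda>(k, c). \<sigma> c) ({..<m} \<times> C) (\<lambda>(k, c). y (g k) (\<epsilon> k, c))"
        using tyv by (auto simp: typed_def)
      fix v assume "v \<in> {..<m} \<times> C"
      then show "(case v of (k, c) \<Rightarrow> y (g k) (\<epsilon> k, c))
          = (case v of (k, c) \<Rightarrow> h (restrict g {..<m} k, restrict \<epsilon> {..<m} k, c))"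
        using that by (auto simp: y)
    qed
    have inc: "restrict g {..<m} \<in> increasing m n"
      if "strict_mono_on {..<m} g" "g ` {..<m} \<subseteq> {..<n}" for g
      using that by (auto simp: increasing_def strict_mono_on_def)
    have sel: "restrict \<epsilon> {..<m} \<in> selections m" if "single_mixes m \<epsilon>" for \<epsilon>
    proof -
      have eq: "{k. k < m \<and> restrict \<epsilon> {..<m} k} = {k. k < m \<and> \<epsilon> k}" by auto
      show ?thesis unfolding selections_def mem_Collect_eq eq by (intro conjI that) simp
    qed
    have "\<forall>q\<in>\<Delta>. \<forall>g\<in>increasing (fst q) n. \<forall>g'\<in>increasing (fst q) n.
        \<forall>\<epsilon>\<in>selections (fst q). \<forall>\<epsilon>'\<in>selections (fst q).
          snd q (\<lambda>(k, c). h (g k, \<epsilon> k, c)) \<longrightarrow> snd q (\<lambda>(k, c). h (g' k, \<epsilon>' k, c))"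
      using h(2) unfolding approx_pred_def by (elim conjE)
    from this[THEN bspec, OF q, unfolded fst_conv snd_conv, THEN bspec, OF inc[OF g(1,3)], THEN bspec,
        OF inc[OF g(2,4)], THEN bspec, OF sel[OF \<epsilon>(1)], THEN bspec, OF sel[OF \<epsilon>(2)]]
    show ?thesis using Qy unfolding eq[OF g(3)] eq[OF g(4)] by (rule mp)
  qed
  have const: "\<forall>d\<in>E. \<forall>i\<in>{..<n}. \<forall>j\<in>{..<n}. h (i, False, d) = h (j, False, d)"
    using h(2) unfolding approx_pred_def by (elim conjE)
  have base: "\<forall>i\<in>{..<n}. \<chi>U (\<lambda>v. h (i, False, v)) \<and> \<not> \<chi>U (\<lambda>v. h (i, v \<in> C, v))"
    using h(2) unfolding approx_pred_def by (elim conjE)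
  have "pair_approx single_mixes \<sigma> C E {} \<chi>U (\<lambda>e. \<not> \<chi>U e) n \<Delta> y"
    unfolding pair_approx_def
  proof (intro conjI allI impI ballI)
    show "typed U (\<lambda>(\<epsilon>, c). \<sigma> c) (pairs C (E \<union> {})) (y i)" for i using ty by simp
    fix i assume i: "i < n"
    then show "\<chi>U (\<lambda>v. y i (False, v))" "\<not> \<chi>U (\<lambda>v. y i (v \<in> C, v))"
      using base by (simp_all add: y)
    fix j d assume j: "j < n" and d: "d \<in> E"
    show "y i (False, d) = y j (False, d)"
      unfolding y[OF i] y[OF j] using const i j d by blast
  qed (rule step)
  then show ?thesis by blast
qed

end

theorem corollary1p2:
  fixes L :: "('s, 'f, 'r) lang"
    and T :: "('s, 'f, 'r) fm set"
    and M M' :: "('s, 'f, 'r, 'a) struct"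
    and Lh :: "('s, 'g, 'q) lang"
    and Mh :: "('s, 'g, 'q, 'a) struct"
    and \<kappa> :: "'k rel"
    and U :: "('s, unit, 's list \<times> 'a list set, 'b) struct"
    and \<kappa>h :: "'l rel"
    and Uh :: "('s, 'g, 'q, 'c) struct"
  assumes "complete_theory L T"
    and "model L T M"
    and "elementary_extension L M M'"
    and "saturated (cardSuc ( |elems M| +c |sentences L| )) L M'"
    and "expansion L M Lh Mh"
    and "expansion Lh Mh (shelah_lang L M M') (shelah_expansion M)"
    and "monster \<kappa> (shelah_lang L M M') (Th (shelah_lang L M M') (shelah_expansion M)) U"
    and "distal \<kappa> (shelah_lang L M M') U"
    and "monster \<kappa>h Lh (Th Lh Mh) Uh"
  shows "distal \<kappa>h Lh Uh"
proof -
  let ?L = "shelah_lang L M M'" and ?M = "shelah_expansion M"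
  let ?K = "definable_fm ?L ?M Lh Mh"
  have modelU: "model ?L (Th ?L ?M) U" and modelUh: "model Lh (Th Lh Mh) Uh"
    using assms(7,9) by (simp_all add: monster_def)
  have car: "carrier ?M = carrier M" by (simp add: shelah_expansion_def)
  have ne: "carrier Uh s \<noteq> {}" for s using modelUh by (simp add: model_def is_struct_def)
  interpret saturated_struct ?L U \<kappa> by (rule monster_saturated_struct[OF assms(7)])
  have "carrier Mh = carrier ?M" using assms(6) by (simp add: expansion_def)
  then interpret K: fm_class ?L ?K by (rule fm_class_definable_fm)
  have nipU: "nip ?L U" using assms(8) by (simp add: distal_def)
  interpret reduct ?L U \<kappa> ?M Lh Mh Uh
    by unfold_locales (rule nipU assms(6) ne monster_Th_sentence[OF modelU] monster_Th_sentence[OF modelUh]; assumption?)+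
  \<comment> \<open>Sets definable in \<open>M\<close> are definable in the intermediate structure,
    hence are defined in the Shelah expansion by small formulas. Thus the pattern conditions for
    traces are small.\<close>
  have trans: "\<exists>Q. codef ?K ?M U \<sigma> W P Q" if "dfn (wf_fm L) M \<sigma> W P" for \<sigma> :: "nat + nat \<Rightarrow> 's" and W P
  proof (rule dfn_definable_fm[OF assms(6)])
    show "dfn (wf_fm Lh) Mh \<sigma> W P"
      by (rule dfn_expansion[OF _ _ that]) (use assms(5) in \<open>simp_all add: expansion_def\<close>)
  qed
  interpret tame_class ?L U \<kappa> ?K
  proof unfold_locales
    show "Funs ?L = {}" by (simp add: shelah_lang_def)
    fix \<sigma> :: "nat \<Rightarrow> 's" and vs R C D
    assume R: "R \<in> Rels ?L" "map \<sigma> vs = rdom ?L R" and fin: "finite C" "finite D" "C \<inter> D = {}" "set vs \<subseteq> C \<union> D"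
    obtain ss X where R_eq: "R = (ss, X)" by fastforce
    then obtain \<phi> ts ds where \<phi>: "wf_fm L (ss @ ts) \<phi>" "ds \<in> tuples (elems M') ts"
      "X = {as \<in> tuples (elems M') ss. sat M' (as @ ds) \<phi>} \<inter> tuples (elems M) ss"
      using R(1) by (auto simp: shelah_lang_def externally_definable_def)
    have dom: "rdom ?L R = ss" and int: "rint ?M R = X" by (simp_all add: R_eq shelah_lang_def shelah_expansion_def)
    show "tame \<sigma> C D (\<lambda>e. map e vs \<in> rint U R)"
      using R(2) unfolding dom
      by (intro tame_external[OF car assms(3) trans equivalent R(1) dom int[unfolded \<phi>(3)] \<phi>(1,2) _ fin(4,1,2,3)])
  qed
  show ?thesis
    unfolding distal_def
  proof (intro conjI allI impI nip_reduct)
    fix ss I b J and D :: "('s \<times> 'c) set"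
    assume I: "ordered_set I" "no_endpoints I" "infinite (fst I)"
      and J: "ordered_set J" "no_endpoints J" "infinite (fst J)"
      and disj: "fst I \<inter> fst J = {}" "b \<notin> fst I \<union> fst J"
      and ind0: "indiscernible Lh Uh {} ss (I \<oplus> singleton b \<oplus> J)"
      and D: "D \<subseteq> elems Uh" and indD: "indiscernible Lh Uh D ss (I \<oplus> J)"
    show "indiscernible Lh Uh D ss (I \<oplus> singleton b \<oplus> J)"
    proof (rule ccontr)
      assume not_ind: "\<not> ?thesis"
      show False
      \<comment> \<open>The names in \<Delta> are taken to be predicates over \<open>U\<close>,
        whereas the failure lies in \<open>Uh\<close>; \<open>transfer_approx\<close> provides their
        interpretations there.\<close>
      proof (rule nondistal_approx[OF ne I J disj ind0 D indD not_ind])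
        fix \<sigma> :: "nat + (nat \<times> nat) + nat \<Rightarrow> 's" and C E \<chi>
        assume fin: "finite C" "finite E" "C \<inter> E = {}" and \<chi>: "dfn (wf_fm Lh) Uh \<sigma> (C \<union> E) \<chi>"
          and approx: "\<And>n (\<Delta> :: (nat \<times> ((nat \<times> (nat + (nat \<times> nat) + nat) \<Rightarrow> 'b) \<Rightarrow> bool)) set) Q. finite \<Delta> \<Longrightarrow>
            (\<And>q. q \<in> \<Delta> \<Longrightarrow> dfn (wf_fm Lh) Uh (\<lambda>(k, c). \<sigma> c) ({..<fst q} \<times> C) (Q q)) \<Longrightarrow>
            \<exists>h. typed Uh (\<lambda>(k, \<epsilon>, c). \<sigma> c) ({..<n} \<times> (UNIV \<times> C \<union> {False} \<times> E)) h \<and> approx_pred C E \<chi> n \<Delta> Q h"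
        obtain \<chi>M \<chi>U where \<chi>MU: "codef (wf_fm Lh) Uh Mh \<sigma> (C \<union> E) \<chi> \<chi>M" "codef ?K ?M U \<sigma> (C \<union> E) \<chi>M \<chi>U"
          using codef_to_expansion[OF \<chi>] by blast
        show False
        proof (rule no_nondistal_approximation[OF assms(8) fin])
          show "Def \<sigma> (C \<union> E) \<chi>U" by (rule SDef_Def[OF codef_left[OF codef_flip[OF \<chi>MU(2)]]])
          fix n and \<Delta> :: "(nat \<times> ((nat \<times> (nat + (nat \<times> nat) + nat) \<Rightarrow> 'b) \<Rightarrow> bool)) set"
          assume \<Delta>: "finite \<Delta>" "\<Delta> \<subseteq> smalls \<sigma> C"
          show "\<exists>y. pair_approx single_mixes \<sigma> C E {} \<chi>U (\<lambda>e. \<not> \<chi>U e) n \<Delta> y"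
            by (rule transfer_approx[OF fin \<Delta> \<chi>MU approx[OF \<Delta>(1)]])
        qed
      qed
    qed
  qed
qed

end
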